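(* Let $t>0$. For each $N\ge1$ let $(U_t^{(N)})$ be a Brownian motion on $U(N)$ and $(G_t^{(N)})$ a Brownian motion on $GL_N(\mathbb C)$. Then: (1) for every Laurent polynomial $P\in\mathbb C[X,X^{-1}]$, as $N\to\infty$, $$\Big\|B_t^{(N)}\big(P(U_t^{(N)})\big)-\mathcal G_t(P)(G_t^{(N)})\Big\|^2=O(1/N^2);$$ (2) for every $P\in\mathbb{C}\{X,X^{-1}\}$, as $N\to\infty$, $$\Big\|B_t^{(N)}\big(P(U_t^{(N)})\big)-\big(e^{\frac t2\Delta_U}P\big)(G_t^{(N)})\Big\|^2=O(1/N^2),$$ where the norm is that of $L^2_{\mathrm{hol}}(G_t^{(N)})\otimes M_N(\mathbb C)$, i.e. $\|F(G_t^{(N)})\|^2=\mathbb E\big[\operatorname{tr}(F(G_t^{(N)})^*F(G_t^{(N)}))\big]$.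
   Context: On $M_N(\mathbb C)$: $\operatorname{tr}=\frac1N\operatorname{Tr}$. $\mathbb{C}\{X,X^{-1}\}$: the vector space with basis the formal symbols $M_0\operatorname{tr}(M_1)\cdots\operatorname{tr}(M_n)$, $M_j$ words in two independent non-commuting letters $X,X^{-1}$ ($M_0$ possibly empty, $\{M_1,\dots,M_n\}$ an unordered multiset of non-empty words), product by concatenating $M_0N_0$ and merging trace factors, $\operatorname{tr}(1)=1$; for invertible $A\in M_N(\mathbb C)$, $(M_0\operatorname{tr}(M_1)\cdots\operatorname{tr}(M_n))(A)=\operatorname{tr}(M_1(A))\cdots\operatorname{tr}(M_n(A))M_0(A)$ with $X\mapsto A,X^{-1}\mapsto A^{-1}$. Laurent polynomials are the elements with $n=0$ modulo the identification $XX^{-1}=X^{-1}X=1$ (evaluations are unaffected). $\Delta_{U(N)}=\sum_a\tilde X_a^2$ for an orthonormal basis $(X_a)$ of $\mathfrak u(N)$ with inner product $N\operatorname{Tr}(X^*Y)$ and right-invariant fields $\tilde X_af(U)=\frac d{ds}|_0f(e^{sX_a}U)$; $\Delta_{GL_N(\mathbb C)}=\sum_a\tilde Z_a^2$ likewise for an orthonormal basis $(Z_a)_{a=1}^{2N^2}$ of $M_N(\mathbb C)$ with real inner product $N\operatorname{Re}\operatorname{Tr}(X^*Y)$. The Brownian motions start at $I_N$ with generators $\frac12\Delta_{U(N)}$ and $\frac14\Delta_{GL_N(\mathbb C)}$. Hall transform: $L^2(U_t^{(N)})$ = random variables $f(U_t^{(N)})$, $f$ Borel with finite second moment; $L^2_{\mathrm{hol}}(G_t^{(N)})$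 = random variables $F(G_t^{(N)})$, $F$ holomorphic on $GL_N(\mathbb C)$ with finite second moment. By Hall's theorem $e^{\frac t2\Delta_{U(N)}}f$ extends holomorphically to $GL_N(\mathbb C)$ and $B_t:f(U_t^{(N)})\mapsto(e^{\frac t2\Delta_{U(N)}}f)(G_t^{(N)})$ is a Hilbert space isomorphism; $B_t^{(N)}=B_t\otimes\mathrm{Id}_{M_N(\mathbb C)}$ acts entrywise on matrix-valued random variables. $\mathcal G_t$: define polynomials $P_n^t$ by $\sum_{n\ge0}z^nP_n^t(x)=\big(1-ze^{\frac t2\frac{1+z}{1-z}}x\big)^{-1}$; $\mathcal G_t$ is the linear operator on $\mathbb C[X,X^{-1}]$ with $\mathcal G_t(P_n^t(X))=X^n$ and $\mathcal G_t(P_n^t(X^{-1}))=X^{-n}$. $\Delta_U$: for a word $X_1\cdots X_k$ in $\{X,X^{-1}\}$, $l(i)=0,r(i)=1,\epsilon(i)=1$ if $X_i=X$; $l(i)=1,r(i)=0,\epsilon(i)=-1$ if $X_i=X^{-1}$; $X_i^0=1$; $\Delta_U(X_1\cdots X_k)=-kX_1\cdots X_k-2\sum_{i<j}\epsilon(i)\epsilon(j)X_1\cdots X_{i-1}X_i^{l(i)}X_j^{r(j)}X_{j+1}\cdots X_k\operatorname{tr}(X_i^{r(i)}X_{i+1}\cdots X_{j-1}X_j^{l(j)})$, extended linearly by $\Delta_U(M_0\operatorname{tr}(M_1)\cdots\operatorname{tr}(M_n))=\Delta_U(M_0)\operatorname{tr}(M_1)\cdots\operatorname{tr}(M_n)+\sum_jM_0\cdots\operatorname{tr}(\Delta_UM_j)\cdots\operatorname{tr}(M_n)$;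 $e^{\frac t2\Delta_U}$ is the exponential series on each finite-dimensional space of elements of degree $\le m$. *)

theory Defs
  imports "HOL-Probability.Probability" "HOL-Library.Poly_Mapping"
    "HOL-Library.Multiset" "HOL-Computational_Algebra.Polynomial"
begin

text \<open>An N x N complex matrix is an extensional function on index pairs
  (i,j) with i,j < N (value undefined outside), i.e. an element of mats N.\<close>

type_synonym cmat = "nat \<times> nat \<Rightarrow> complex"

definition sq :: "nat \<Rightarrow> (nat \<times> nat) set" where
  "sq N = {..<N} \<times> {..<N}"

definition mats :: "nat \<Rightarrow> cmat set" where
  "mats N = PiE (sq N) (\<lambda>_. UNIV)"

definition mat_space :: "nat \<Rightarrow> cmat measure" where
  "mat_space N = PiM (sq N) (\<lambda>_. borel)"

definition mmul :: "nat \<Rightarrow> cmat \<Rightarrow> cmat \<Rightarrow> cmat" where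
  "mmul N A B = restrict (\<lambda>(i,j). \<Sum>k<N. A (i,k) * B (k,j)) (sq N)"

definition mid :: "nat \<Rightarrow> cmat" where
  "mid N = restrict (\<lambda>(i,j). if i = j then 1 else 0) (sq N)"

definition madd :: "nat \<Rightarrow> cmat \<Rightarrow> cmat \<Rightarrow> cmat" where
  "madd N A B = restrict (\<lambda>ij. A ij + B ij) (sq N)"

definition mscale :: "nat \<Rightarrow> complex \<Rightarrow> cmat \<Rightarrow> cmat" where
  "mscale N c A = restrict (\<lambda>ij. c * A ij) (sq N)"

definition madj :: "nat \<Rightarrow> cmat \<Rightarrow> cmat" where
  "madj N A = restrict (\<lambda>(i,j). cnj (A (j,i))) (sq N)"

definition mpow :: "nat \<Rightarrow> cmat \<Rightarrow> nat \<Rightarrow> cmat" where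
  "mpow N A k = (mmul N A ^^ k) (mid N)"

definition mtr :: "nat \<Rightarrow> cmat \<Rightarrow> complex" where
  "mtr N A = (\<Sum>i<N. A (i,i)) / of_nat N"

definition minv :: "nat \<Rightarrow> cmat \<Rightarrow> cmat" where
  "minv N A = (SOME B. B \<in> mats N \<and> mmul N A B = mid N)"

definition mzpow :: "nat \<Rightarrow> cmat \<Rightarrow> int \<Rightarrow> cmat" where
  "mzpow N A k = (if 0 \<le> k then mpow N A (nat k) else mpow N (minv N A) (nat (- k)))"

definition GLm :: "nat \<Rightarrow> cmat set" where
  "GLm N = {A \<in> mats N. \<exists>B \<in> mats N. mmul N A B = mid N}"

definition Um :: "nat \<Rightarrow> cmat set" where
  "Um N = {U \<in> mats N. mmul N (madj N U) U = mid N}"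

definition mexp :: "nat \<Rightarrow> cmat \<Rightarrow> cmat" where
  "mexp N X = restrict (\<lambda>ij. suminf (\<lambda>m. mpow N X m ij / of_nat (fact m))) (sq N)"

definition matunit :: "nat \<Rightarrow> nat \<Rightarrow> nat \<Rightarrow> cmat" where
  "matunit N i j = restrict (\<lambda>ab. if ab = (i,j) then 1 else 0) (sq N)"

definition vf :: "nat \<Rightarrow> cmat \<Rightarrow> (cmat \<Rightarrow> 'b::real_normed_vector) \<Rightarrow> cmat \<Rightarrow> 'b" where
  "vf N X f U = vector_derivative (\<lambda>s::real. f (mmul N (mexp N (mscale N (complex_of_real s) X)) U)) (at 0)"

definition lap :: "nat \<Rightarrow> cmat list \<Rightarrow> (cmat \<Rightarrow> 'b::real_normed_vector) \<Rightarrow> cmat \<Rightarrow> 'b" where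
  "lap N basis f U = (\<Sum>X\<leftarrow>basis. vf N X (vf N X f) U)"

text \<open>An orthonormal basis of u(N) for the inner product N Tr(X^* Y):
  i E_jj / sqrt N, (E_jk - E_kj)/sqrt(2N), i(E_jk + E_kj)/sqrt(2N) (j<k).\<close>
definition u_basis :: "nat \<Rightarrow> cmat list" where
  "u_basis N =
     map (\<lambda>j. mscale N (\<i> / complex_of_real (sqrt N)) (matunit N j j)) [0..<N] @
     concat (map (\<lambda>j. concat (map (\<lambda>k.
        [mscale N (1 / complex_of_real (sqrt (2 * N)))
           (madd N (matunit N j k) (mscale N (-1) (matunit N k j))),
         mscale N (\<i> / complex_of_real (sqrt (2 * N)))
           (madd N (matunit N j k) (matunit N k j))]) [Suc j..<N])) [0..<N])"

text \<open>An orthonormal basis of M_N(C) for the real inner product N Re Tr(X^* Y):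
  E_jk / sqrt N, i E_jk / sqrt N.\<close>
definition gl_basis :: "nat \<Rightarrow> cmat list" where
  "gl_basis N = concat (map (\<lambda>j. concat (map (\<lambda>k.
     [mscale N (1 / complex_of_real (sqrt N)) (matunit N j k),
      mscale N (\<i> / complex_of_real (sqrt N)) (matunit N j k)]) [0..<N])) [0..<N])"

definition lapU :: "nat \<Rightarrow> (cmat \<Rightarrow> 'b::real_normed_vector) \<Rightarrow> cmat \<Rightarrow> 'b" where
  "lapU N = lap N (u_basis N)"

definition lapGL :: "nat \<Rightarrow> (cmat \<Rightarrow> 'b::real_normed_vector) \<Rightarrow> cmat \<Rightarrow> 'b" where
  "lapGL N = lap N (gl_basis N)"

definition dirder :: "nat \<Rightarrow> cmat \<Rightarrow> (cmat \<Rightarrow> real) \<Rightarrow> cmat \<Rightarrow> real" where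
  "dirder N E f A = vector_derivative (\<lambda>s::real. f (madd N A (mscale N (complex_of_real s) E))) (at 0)"

fun iter_dd :: "nat \<Rightarrow> cmat list \<Rightarrow> (cmat \<Rightarrow> real) \<Rightarrow> cmat \<Rightarrow> real" where
  "iter_dd N [] f = f"
| "iter_dd N (E # Es) f = dirder N E (iter_dd N Es f)"

definition smooth_mats :: "nat \<Rightarrow> (cmat \<Rightarrow> real) \<Rightarrow> bool" where
  "smooth_mats N f \<longleftrightarrow> (\<forall>Es. set Es \<subseteq> mats N \<longrightarrow>
      continuous_on (mats N) (iter_dd N Es f) \<and>
      (\<forall>E\<in>mats N. \<forall>A\<in>mats N.
         (\<lambda>s::real. iter_dd N Es f (madd N A (mscale N (complex_of_real s) E))) differentiable (at 0)))"

definition testGL :: "nat \<Rightarrow> (cmat \<Rightarrow> real) \<Rightarrow> bool" where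
  "testGL N f \<longleftrightarrow> smooth_mats N f \<and>
     (\<exists>K. compact K \<and> K \<subseteq> GLm N \<and> (\<forall>A\<in>mats N - K. f A = 0))"

text \<open>nu is the law of G_t, where (G_s) is the Brownian motion on GL_N(C) started at I_N
  with generator (1/4) Delta_GL: the one-dimensional marginals (mu s) start at the point mass
  at I_N and solve the (weak) Kolmogorov forward equation for the generator (1/4) Delta_GL.\<close>
definition GL_BM_law :: "nat \<Rightarrow> real \<Rightarrow> cmat measure \<Rightarrow> bool" where
  "GL_BM_law N t \<nu> \<longleftrightarrow> (\<exists>\<mu> :: real \<Rightarrow> cmat measure.
     (\<forall>s\<ge>0. prob_space (\<mu> s) \<and> sets (\<mu> s) = sets (mat_space N) \<and> emeasure (\<mu> s) (GLm N) = 1) \<and>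
     \<mu> 0 = return (mat_space N) (mid N) \<and> \<mu> t = \<nu> \<and>
     (\<forall>f. testGL N f \<longrightarrow>
        continuous_on {0..} (\<lambda>s. \<integral>A. f A \<partial>\<mu> s) \<and>
        (\<forall>s>0. ((\<lambda>r. \<integral>A. f A \<partial>\<mu> r) has_real_derivative (\<integral>A. lapGL N f A / 4 \<partial>\<mu> s)) (at s))))"

text \<open>e^{t/2 Delta_U(N)} f as exponential series (applied below only to polynomial functions
  in the entries of U and U^{-1}, which form finite-dimensional invariant subspaces).\<close>
definition heatU :: "nat \<Rightarrow> real \<Rightarrow> (cmat \<Rightarrow> complex) \<Rightarrow> cmat \<Rightarrow> complex" where
  "heatU N t f U = suminf (\<lambda>m. complex_of_real ((t/2)^m / fact m) * (lapU N ^^ m) f U)"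

text \<open>holomorphic on GL_N(C) (separately holomorphic in each entry; equivalent by Hartogs)\<close>
definition holoGL :: "nat \<Rightarrow> (cmat \<Rightarrow> complex) \<Rightarrow> bool" where
  "holoGL N F \<longleftrightarrow> (\<forall>A\<in>GLm N. \<forall>i<N. \<forall>j<N.
      (\<lambda>z. F (madd N A (mscale N z (matunit N i j)))) field_differentiable (at 0))"

definition hallU :: "nat \<Rightarrow> real \<Rightarrow> (cmat \<Rightarrow> complex) \<Rightarrow> cmat \<Rightarrow> complex" where
  "hallU N t f = (THE F. holoGL N F \<and> (\<forall>A. A \<notin> GLm N \<longrightarrow> F A = 0) \<and>
                       (\<forall>U\<in>Um N. F U = heatU N t f U))"

text \<open>B_t^(N) = B_t tensor Id, acting entrywise on a matrix-valued function of U\<close>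
definition hallM :: "nat \<Rightarrow> real \<Rightarrow> (cmat \<Rightarrow> cmat) \<Rightarrow> cmat \<Rightarrow> cmat" where
  "hallM N t f G = restrict (\<lambda>ij. hallU N t (\<lambda>U. f U ij) G) (sq N)"

text \<open>squared norm of (F - H)(G_t) in L^2_hol(G_t) tensor M_N(C): E[tr((F-H)^*(F-H))]\<close>
definition l2dist :: "nat \<Rightarrow> cmat measure \<Rightarrow> (cmat \<Rightarrow> cmat) \<Rightarrow> (cmat \<Rightarrow> cmat) \<Rightarrow> ennreal" where
  "l2dist N \<nu> F H = (\<integral>\<^sup>+G. ennreal ((\<Sum>i<N. \<Sum>j<N. (cmod (F G (i,j) - H G (i,j)))^2) / real N) \<partial>\<nu>)"

type_synonym lpoly = "int \<Rightarrow>\<^sub>0 complex"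

definition leval :: "nat \<Rightarrow> lpoly \<Rightarrow> cmat \<Rightarrow> cmat" where
  "leval N P A = restrict (\<lambda>ij. \<Sum>k\<in>Poly_Mapping.keys P. Poly_Mapping.lookup P k * mzpow N A k ij) (sq N)"

definition lsmult :: "complex \<Rightarrow> lpoly \<Rightarrow> lpoly" where
  "lsmult c P = Poly_Mapping.map (\<lambda>x. c * x) P"

definition Pfun :: "real \<Rightarrow> nat \<Rightarrow> complex \<Rightarrow> complex" where
  "Pfun t n x = (deriv ^^ n) (\<lambda>z. 1 / (1 - z * exp (complex_of_real (t/2) * (1 + z) / (1 - z)) * x)) 0
                 / of_nat (fact n)"

definition Pt :: "real \<Rightarrow> nat \<Rightarrow> complex poly" where
  "Pt t n = (THE p. \<forall>x. poly p x = Pfun t n x)"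

definition lp_X :: "complex poly \<Rightarrow> lpoly" where
  "lp_X p = Abs_poly_mapping (\<lambda>k. if 0 \<le> k then coeff p (nat k) else 0)"

definition lp_Xinv :: "complex poly \<Rightarrow> lpoly" where
  "lp_Xinv p = Abs_poly_mapping (\<lambda>k. if k \<le> 0 then coeff p (nat (- k)) else 0)"

definition Gt :: "real \<Rightarrow> lpoly \<Rightarrow> lpoly" where
  "Gt t = (THE L. (\<forall>p q. L (p + q) = L p + L q) \<and> (\<forall>c p. L (lsmult c p) = lsmult c (L p)) \<and>
              (\<forall>n. L (lp_X (Pt t n)) = Poly_Mapping.single (int n) 1) \<and>
              (\<forall>n. L (lp_Xinv (Pt t n)) = Poly_Mapping.single (- int n) 1))"

text \<open>Words in X (True) and X^{-1} (False). A basis symbol M_0 tr(M_1)...tr(M_n) is the pair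
  (M_0, {#M_1,...,M_n#}); valid symbols have all M_j (j \<ge> 1) non-empty.\<close>
type_synonym word = "bool list"
type_synonym tsym = "word \<times> word multiset"
type_synonym tpoly = "tsym \<Rightarrow>\<^sub>0 complex"

definition valid_tpoly :: "tpoly \<Rightarrow> bool" where
  "valid_tpoly P \<longleftrightarrow> (\<forall>b\<in>Poly_Mapping.keys P. [] \<notin># snd b)"

definition tsmult :: "complex \<Rightarrow> tpoly \<Rightarrow> tpoly" where
  "tsmult c P = Poly_Mapping.map (\<lambda>x. c * x) P"

definition tmapkeys :: "(tsym \<Rightarrow> tsym) \<Rightarrow> tpoly \<Rightarrow> tpoly" where
  "tmapkeys g P = (\<Sum>b\<in>Poly_Mapping.keys P. Poly_Mapping.single (g b) (Poly_Mapping.lookup P b))"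

text \<open>tr(w) as a trace factor multiset, with tr(1) = 1\<close>
definition trm :: "word \<Rightarrow> word multiset" where
  "trm w = (if w = [] then {#} else {#w#})"

definition lft :: "bool \<Rightarrow> word" where "lft x = (if x then [] else [x])"
definition rgt :: "bool \<Rightarrow> word" where "rgt x = (if x then [x] else [])"
definition eps :: "bool \<Rightarrow> complex" where "eps x = (if x then 1 else -1)"

definition DeltaU_word :: "word \<Rightarrow> tpoly" where
  "DeltaU_word w =
     Poly_Mapping.single (w, {#}) (- of_nat (length w)) +
     (\<Sum>(i,j)\<in>{(i,j). i < j \<and> j < length w}.
        Poly_Mapping.single
          (take i w @ lft (w ! i) @ rgt (w ! j) @ drop (Suc j) w,
           trm (rgt (w ! i) @ take (j - Suc i) (drop (Suc i) w) @ lft (w ! j)))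
          (- 2 * eps (w ! i) * eps (w ! j)))"

definition DeltaU_sym :: "tsym \<Rightarrow> tpoly" where
  "DeltaU_sym b = (case b of (M0, S) \<Rightarrow>
     tmapkeys (\<lambda>(w, T). (w, T + S)) (DeltaU_word M0) +
     sum_mset (image_mset (\<lambda>Mj. tmapkeys (\<lambda>(w, T). (M0, (S - {#Mj#}) + T + trm w)) (DeltaU_word Mj)) S))"

definition DeltaU :: "tpoly \<Rightarrow> tpoly" where
  "DeltaU P = (\<Sum>b\<in>Poly_Mapping.keys P. tsmult (Poly_Mapping.lookup P b) (DeltaU_sym b))"

text \<open>e^{t/2 Delta_U} P, coefficientwise exponential series (Delta_U preserves the
  finite-dimensional spaces of elements of bounded degree)\<close>
definition expDeltaU :: "real \<Rightarrow> tpoly \<Rightarrow> tpoly" where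
  "expDeltaU t P = Abs_poly_mapping (\<lambda>b. suminf (\<lambda>m. complex_of_real ((t/2)^m / fact m) * Poly_Mapping.lookup ((DeltaU ^^ m) P) b))"

definition weval :: "nat \<Rightarrow> word \<Rightarrow> cmat \<Rightarrow> cmat" where
  "weval N w A = foldr (\<lambda>x M. mmul N (if x then A else minv N A) M) w (mid N)"

definition symeval :: "nat \<Rightarrow> tsym \<Rightarrow> cmat \<Rightarrow> cmat" where
  "symeval N b A = (case b of (M0, S) \<Rightarrow>
     mscale N (prod_mset (image_mset (\<lambda>Mj. mtr N (weval N Mj A)) S)) (weval N M0 A))"

definition teval :: "nat \<Rightarrow> tpoly \<Rightarrow> cmat \<Rightarrow> cmat" where
  "teval N P A = restrict (\<lambda>ij. \<Sum>b\<in>Poly_Mapping.keys P. Poly_Mapping.lookup P b * symeval N b A ij) (sq N)"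

end

(*
  The Casimir element of u(N) turns the Laplacian on word functions A -> M_0(A) tr(M_1(A)) ... into the
  derivation Delta_U plus 1/N^2 times an operator on symbols with coefficients independent of N.  By uniqueness
  of holomorphic extensions from U(N), the Hall transform of P is therefore the exponential of this perturbed
  operator applied to P, and it differs from exp(t/2 Delta_U) P by O(1/N^2) times finitely many word functions.

  Their second moments under the law of G_t are bounded uniformly in N by a Lyapunov argument: the sums T_n of
  tr(w w^* ) over all words w of length n in A, A^{-1} and their adjoints are log-convex up to constants, and the
  Laplacian maps T_n to at most a constant times T_n.  Since only the weak Kolmogorov equation for compactly
  supported test functions is given, it is applied to truncations exp(-1/y) with y = 1/2 - b V and b -> 0.

  For the first part it remains to replace the traces of powers by their limit 1.  The same argument, applied to
  T_D / N^2 + |tr(A^k) - 1|^2 T_d, gives the rate, because tr(A^k) is annihilated by the Laplacian and its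
  gradient has square O(1/N^2).  Finally exp(t/2 Delta_U) X^n with all traces set to 1 is the transform G_t(X^n):
  the coefficients of the powers of the compositional inverse of z exp(s(1+z)/(1-z)) satisfy the differential
  equations encoded by Delta_U.
*)
theory Submission imports Defs "HOL-Complex_Analysis.Complex_Analysis" "Jordan_Normal_Form.Determinant"
begin

section \<open>Power series along lines and the diagonal of a separately holomorphic function\<close>

text \<open>The Hall transform is a definite description over functions that are holomorphic in each
  matrix entry separately and vanish off \<open>GLm\<close>. Identifying it needs uniqueness for
  separately holomorphic functions, which forces a Hartogs argument, cut down to one consequence:
  the diagonal of a separately holomorphic function of two variables is differentiable. Holomorphy
  along complex lines then suffices, because GL_N is generated by unitaries and by elements 1 + (z -
  1) P with P an orthogonal projection, and the latter form holomorphic curves that are unitary on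
  the circle. On the probabilistic side there are no paths, only integrals of test functions, and a
  bound L V <= c V has to survive truncation. A profile that is nondecreasing and convex on (-oo,
  1/2], evaluated at 1/2 - b V, gives the second-order term the favourable sign. Adjoints enter the
  words only for these moments, since squared norms are traces containing a matrix and its adjoint.
  One contraction formula over an orthonormal basis yields both the trace splitting in
  \<open>DeltaU\<close> and, when two factors are differentiated once each, the 1/N^2.\<close>

lemma integral_periodic_shift:
  fixes f :: "real \<Rightarrow> real"
  assumes cont: "continuous_on UNIV f" and per: "\<And>x. f (x + p) = f x" and p: "p \<ge> 0"
  shows "integral {a..a+p} f = integral {0..p} f"
proof -
  \<comment> \<open>The window from b to c contains 0, p, a and a + p, so that one antiderivative
    serves both integrals.\<close>
  define b where "b = - \<bar>a\<bar> - 1"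
  define c where "c = \<bar>a\<bar> + p + 1"
  define F where "F x = integral {b..x} f" for x
  have ci: "continuous_on A f" for A using cont continuous_on_subset by blast
  have dF: "(F has_real_derivative f x) (at x)" if "x \<in> {b<..<c}" for x
  proof -
    have "(F has_real_derivative f x) (at x within {b..c})"
      unfolding F_def by (rule integral_has_real_derivative) (use ci that in auto)
    moreover have "at x within {b..c} = at x" using that by (intro at_within_interior) auto
    ultimately show ?thesis by simp
  qed
  have int: "integral {x..x+p} f = F (x + p) - F x" if "x \<ge> b" for x
    unfolding F_def
    using Henstock_Kurzweil_Integration.integral_combine[of b x "x+p" f] that p integrable_continuous_interval[OF ci] by auto
  have "\<exists>k. \<forall>x\<in>{-\<bar>a\<bar>-1<..<\<bar>a\<bar>+1}. F (x + p) - F x = k"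
  proof (rule has_field_derivative_zero_constant)
    show "convex {-\<bar>a\<bar>-1<..<\<bar>a\<bar>+1}" by auto
    fix x assume x: "x \<in> {-\<bar>a\<bar>-1<..<\<bar>a\<bar>+1}"
    have "((\<lambda>x. F (x + p)) has_real_derivative f (x + p)) (at x)"
      using dF[of "x+p"] x p by (subst DERIV_shift[symmetric]) (auto simp: b_def c_def)
    moreover have "(F has_real_derivative f x) (at x)" using dF[of x] x p by (auto simp: b_def c_def)
    ultimately have "((\<lambda>x. F (x + p) - F x) has_real_derivative 0) (at x)"
      using DERIV_diff[of "\<lambda>x. F (x+p)" "f (x+p)" x UNIV F "f x"] per by simp
    then show "((\<lambda>x. F (x + p) - F x) has_real_derivative 0) (at x within {-\<bar>a\<bar>-1<..<\<bar>a\<bar>+1})"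
      by (rule has_field_derivative_at_within)
  qed
  then obtain k where k: "\<And>x. x \<in> {-\<bar>a\<bar>-1<..<\<bar>a\<bar>+1} \<Longrightarrow> F (x + p) - F x = k" by blast
  have "a \<in> {-\<bar>a\<bar>-1<..<\<bar>a\<bar>+1}" "0 \<in> {-\<bar>a\<bar>-1<..<\<bar>a\<bar>+1}" by auto
  from k[OF this(1)] k[OF this(2)] have "F (a + p) - F a = F (0 + p) - F 0" by simp
  with int[of a] int[of 0] show ?thesis by (simp add: b_def)
qed

text \<open>Sub-mean value property of the positive part of ln |u|, from the maximum modulus
  principle alone: for the product \<open>v\<close> of n rotated copies of u, |v 0| = |u 0|^n, while
  on the circle ln |v| is at most n/(2 pi) times a Riemann sum of the integral. The cut-off at 1
  keeps the logarithm continuous across zeros of u.\<close>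

lemma circle_submean:
  assumes hol: "u holomorphic_on ball 0 R" and R: "R > 1"
  shows "2*pi * ln (max 1 (cmod (u 0))) \<le> integral {0..2*pi} (\<lambda>\<theta>. ln (max 1 (cmod (u (cis \<theta>)))))"
proof -
  define L where "L \<theta> = ln (max 1 (cmod (u (cis \<theta>))))" for \<theta>
  have cu: "continuous_on (ball 0 R) u" using hol by (rule holomorphic_on_imp_continuous_on)
  have contL: "continuous_on UNIV L" unfolding L_def
    by (intro continuous_intros continuous_on_compose2[OF cu]) (use R in \<open>auto simp: max_def\<close>)
  have contL': "continuous_on A L" for A using contL continuous_on_subset by blast
  have perL: "L (x + 2*pi) = L x" for x by (simp add: L_def cis.ctr)
  have L0: "L x \<ge> 0" for x by (simp add: L_def)
  define I where "I = integral {0..2*pi} L"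
  have I0: "I \<ge> 0" unfolding I_def by (intro integral_nonneg integrable_continuous_interval contL') (auto simp: L0)
  have key: "2*pi * ln (max 1 (cmod (u 0))) \<le> I + 2*pi*e" if e: "e > 0" for e
  proof -
    \<comment> \<open>The starting angle, the offset and one more mesh width are each at most 2*pi,
      so [0, 6*pi] contains all points compared below.\<close>
    have "uniformly_continuous_on {0..6*pi} L" by (rule compact_uniformly_continuous[OF contL']) auto
    then obtain d where d: "d > 0" "\<And>x y. x \<in> {0..6*pi} \<Longrightarrow> y \<in> {0..6*pi} \<Longrightarrow> dist y x < d \<Longrightarrow> dist (L y) (L x) < e"
      unfolding uniformly_continuous_on_def using e by metis
    obtain n :: nat where n: "2*pi / d < real n" using reals_Archimedean2 by blast
    then have n0: "n > 0" using d by (metis divide_pos_pos gr0I less_asym' mult_pos_pos of_nat_0 pi_gt_zero zero_less_numeral)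
    define h where "h = 2*pi / real n"
    have h: "h > 0" "h < d" "real n * h = 2*pi" using n n0 d by (auto simp: h_def field_simps)
    have step: "(\<Sum>j<k. h * L (\<theta> + real j * h)) \<le> integral {\<theta>..\<theta> + real k * h} L + real k * h * e"
      if "\<theta> \<in> {0..2*pi}" "k \<le> n" for \<theta> k
      using that(2)
    proof (induction k)
      case 0 show ?case by simp
    next
      case (Suc k)
      let ?a = "\<theta> + real k * h"
      have kh: "real k * h + h \<le> 2*pi"
      proof -
        have "real (Suc k) * h \<le> real n * h" using Suc.prems h by (intro mult_right_mono) auto
        then show ?thesis using h by (simp add: algebra_simps)
      qed
      have b: "L ?a - e \<le> L y" if "y \<in> {?a..?a+h}" for y
      proof -
        have "0 \<le> real k * h" using h by simp
        moreover have "\<theta> \<le> 2*pi" "\<theta> \<ge> 0" using \<open>\<theta> \<in> {0..2*pi}\<close> by auto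
        moreover have "?a \<le> y" "y \<le> ?a + h" using that by auto
        ultimately have "?a \<in> {0..6*pi}" "y \<in> {0..6*pi}" "dist y ?a < d"
          unfolding atLeastAtMost_iff dist_real_def using kh pi_gt_zero h by linarith+
        from d(2)[OF this] show ?thesis by (simp add: dist_real_def)
      qed
      have "integral {?a..?a+h} (\<lambda>y. L ?a - e) \<le> integral {?a..?a+h} L"
        by (intro integral_le integrable_continuous_interval contL') (use b in auto)
      then have 1: "h * (L ?a - e) \<le> integral {?a..?a+h} L" using h by (simp add: content_real)
      have 2: "integral {\<theta>..\<theta> + real (Suc k) * h} L = integral {\<theta>..?a} L + integral {?a..?a+h} L"
        using Henstock_Kurzweil_Integration.integral_combine[of \<theta> ?a "?a+h" L] h integrable_continuous_interval[OF contL'] by (auto simp: algebra_simps)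
      show ?case using Suc 1 2 by (simp add: algebra_simps)
    qed
    have S: "(\<Sum>j<n. L (\<theta> + real j * h)) \<le> real n / (2*pi) * (I + 2*pi*e)" if "\<theta> \<in> {0..2*pi}" for \<theta>
    proof -
      have "h * (\<Sum>j<n. L (\<theta> + real j * h)) \<le> I + 2*pi*e"
        using step[OF that order.refl] integral_periodic_shift[OF contL, of "2*pi" \<theta>] perL h by (simp add: sum_distrib_left I_def)
      then show ?thesis using n0 h by (simp add: h_def field_simps)
    qed
    define v where "v z = (\<Prod>j<n. u (z * cis (real j * h)))" for z
    have inb: "z * cis x \<in> ball 0 R" if "z \<in> ball 0 R" for z x using that by (simp add: norm_mult)
    have holv: "v holomorphic_on ball 0 R" unfolding v_def
      by (intro holomorphic_intros holomorphic_on_compose_gen[OF _ hol, unfolded o_def]) (use inb in auto)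
    have "cmod (v 0) \<le> exp (real n / (2*pi) * (I + 2*pi*e))"
    proof (rule maximum_modulus_frontier[of v "cball 0 1"])
      show "v holomorphic_on interior (cball 0 1)" by (rule holomorphic_on_subset[OF holv]) (use R in auto)
      show "continuous_on (closure (cball 0 1)) v" by (rule continuous_on_subset[OF holomorphic_on_imp_continuous_on[OF holv]]) (use R in auto)
      fix z :: complex assume "z \<in> frontier (cball 0 1)"
      then have "cmod z = 1" by simp
      then obtain \<theta> where th: "0 \<le> \<theta>" "\<theta> < 2*pi" "z = cis \<theta>"
        by (metis complex_unimodular_polar cis.code complex_eq Re_complex_of_real cis_conv_exp cis.ctr complex_surj)
      have "cmod (v z) = (\<Prod>j<n. cmod (u (cis (\<theta> + real j * h))))" by (simp add: v_def prod_norm th cis_mult)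
      also have "\<dots> \<le> (\<Prod>j<n. exp (L (\<theta> + real j * h)))"
        proof (intro prod_mono conjI)
        fix j
        have "x \<le> exp (ln (max 1 x))" for x :: real by (subst exp_ln) auto
        then show "cmod (u (cis (\<theta> + real j * h))) \<le> exp (L (\<theta> + real j * h))" unfolding L_def .
      qed auto
      also have "\<dots> = exp (\<Sum>j<n. L (\<theta> + real j * h))" by (simp add: exp_sum)
      also have "\<dots> \<le> exp (real n / (2*pi) * (I + 2*pi*e))" using S[of \<theta>] th by simp
      finally show "cmod (v z) \<le> exp (real n / (2*pi) * (I + 2*pi*e))" .
    qed auto
    then have le: "cmod (u 0) ^ n \<le> exp (real n / (2*pi) * (I + 2*pi*e))" by (simp add: v_def norm_power)
    show ?thesis
    proof (cases "cmod (u 0) \<le> 1")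
      case True then show ?thesis using I0 e by (simp add: max_def)
    next
      case False
      then have "0 < cmod (u 0)" by linarith
      then have "real n * ln (cmod (u 0)) \<le> real n / (2*pi) * (I + 2*pi*e)"
        using ln_mono[OF le] by (simp add: ln_realpow zero_less_power)
      then have "real n * (2 * pi * ln (cmod (u 0))) \<le> real n * (I + 2*pi*e)" by (simp add: field_simps)
      then have "2 * pi * ln (cmod (u 0)) \<le> I + 2*pi*e" using n0 by (simp only: mult_le_cancel_left_pos of_nat_0_less_iff)
      then show ?thesis using False by (simp add: max_def)
    qed
  qed
  show ?thesis unfolding L_def[symmetric] I_def[symmetric]
  proof (rule field_le_epsilon)
    fix e :: real assume "e > 0"
    then show "2*pi * ln (max 1 (cmod (u 0))) \<le> I + e" using key[of "e / (2*pi)"] by simp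
  qed
qed


text \<open>A Harnack-type bound. The Moebius map \<phi> sends 0 to z and the circle to itself, so
  the sub-mean value property applies to u after \<phi>. Substituting along the boundary angle
  \<alpha> costs the factor 2 that turns 2*pi into pi, because \<alpha>' >= 1/2 when |z| <=
  1/5.\<close>

lemma disc_poisson_bound:
  assumes hol: "u holomorphic_on ball 0 R" and R: "R > 1" and z: "cmod z \<le> 1/5"
  shows "pi * ln (max 1 (cmod (u z))) \<le> integral {0..2*pi} (\<lambda>\<theta>. ln (max 1 (cmod (u (cis \<theta>)))))"
proof -
  define L where "L \<theta> = ln (max 1 (cmod (u (cis \<theta>))))" for \<theta>
  have cu: "continuous_on (ball 0 R) u" using hol by (rule holomorphic_on_imp_continuous_on)
  have contL: "continuous_on UNIV L" unfolding L_def
    by (intro continuous_intros continuous_on_compose2[OF cu]) (use R in \<open>auto simp: max_def\<close>)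
  have contL': "continuous_on A L" for A using contL continuous_on_subset by blast
  have perL: "L (x + 2*pi) = L x" for x by (simp add: L_def cis.ctr)
  have L0: "L x \<ge> 0" for x by (simp add: L_def)
  define \<phi> where "\<phi> \<zeta> = (\<zeta> + z) / (1 + cnj z * \<zeta>)" for \<zeta>
  have den: "cmod (1 + cnj z * \<zeta>) \<ge> 3/5" if "cmod \<zeta> < 2" for \<zeta>
  proof -
    have "cmod (cnj z * \<zeta>) \<le> 1/5 * 2" unfolding norm_mult using z that by (intro mult_mono) auto
    then show ?thesis using norm_diff_ineq[of 1 "cnj z * \<zeta>"] by simp
  qed
  \<comment> \<open>For |\<zeta>|^2 < 1 + \<eta> the identity below bounds |\<zeta> + z|^2 - |1 +
    cnj z * \<zeta>|^2 by \<eta>, while |1 + cnj z * \<zeta>| >= 3/5; hence \<phi> maps the enlarged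
    disc into the disc of radius R. The bound 3 keeps the enlarged disc within |\<zeta>| <
    2.\<close>
  define \<eta> where "\<eta> = min 3 ((R^2 - 1) * (9/25))"
  have R2: "R^2 > 1" using R by (simp add: one_less_power)
  have eta: "\<eta> > 0" using R2 by (simp add: \<eta>_def)
  define R' where "R' = sqrt (1 + \<eta>)"
  have R': "R' > 1" "R' \<le> 2" unfolding R'_def using eta by (auto simp: real_le_lsqrt \<eta>_def)
  have ident: "(cmod (\<zeta> + z))^2 - (cmod (1 + cnj z * \<zeta>))^2 = ((cmod \<zeta>)^2 - 1) * (1 - (cmod z)^2)" for \<zeta>
    unfolding cmod_power2 by (simp add: algebra_simps power2_eq_square)
  have inb: "\<phi> \<zeta> \<in> ball 0 R" if "\<zeta> \<in> ball 0 R'" for \<zeta>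
  proof -
    have l2: "cmod \<zeta> < 2" and lR: "cmod \<zeta> < R'" using that R' by auto
    let ?D = "cmod (1 + cnj z * \<zeta>)"
    have D: "?D \<ge> 3/5" by (rule den[OF l2])
    have zz: "0 \<le> 1 - (cmod z)^2" "1 - (cmod z)^2 \<le> 1" using z by (auto simp: power2_le_iff_abs_le power_le_one)
    have "(cmod \<zeta>)^2 < R'^2" using lR by (intro power_strict_mono) auto
    then have m: "(cmod \<zeta>)^2 - 1 < \<eta>" using eta by (simp add: R'_def)
    have "((cmod \<zeta>)^2 - 1) * (1 - (cmod z)^2) \<le> \<eta> * 1"
    proof (cases "(cmod \<zeta>)^2 - 1 \<ge> 0")
      case True then show ?thesis using m zz eta by (intro mult_mono) auto
    next
      case False
      then have "((cmod \<zeta>)^2 - 1) * (1 - (cmod z)^2) \<le> 0" using zz by (intro mult_nonpos_nonneg) auto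
      then show ?thesis using eta by simp
    qed
    also have "\<eta> * 1 \<le> (R^2 - 1) * (3/5)^2" using min.cobounded2[of 3 "(R^2 - 1) * (9/25)"] by (simp add: \<eta>_def power_divide)
    also have "\<dots> \<le> (R^2 - 1) * ?D^2" using R2 D by (intro mult_left_mono power_mono) auto
    finally have "(cmod (\<zeta> + z))^2 \<le> R^2 * ?D^2" using ident[of \<zeta>] by (simp add: algebra_simps)
    then have le: "cmod (\<zeta> + z) \<le> R * ?D" using R by (simp add: power_mult_distrib[symmetric] abs_le_square_iff[symmetric])
    have "cmod (\<zeta> + z) \<noteq> R * ?D"
    proof
      assume eq: "cmod (\<zeta> + z) = R * ?D"
      then have e: "(R^2 - 1) * ?D^2 = ((cmod \<zeta>)^2 - 1) * (1 - (cmod z)^2)" using ident[of \<zeta>] by (simp add: power_mult_distrib algebra_simps)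
      have "(R^2 - 1) * ?D^2 \<ge> (R^2 - 1) * (3/5)^2" using R2 D by (intro mult_left_mono power_mono) auto
      then have "(R^2 - 1) * ?D^2 \<ge> \<eta>" using min.cobounded2[of 3 "(R^2 - 1) * (9/25)"] by (simp add: \<eta>_def power_divide)
      moreover have "((cmod \<zeta>)^2 - 1) * (1 - (cmod z)^2) < \<eta>"
      proof (cases "(cmod \<zeta>)^2 - 1 \<ge> 0")
        case True
        then have "((cmod \<zeta>)^2 - 1) * (1 - (cmod z)^2) \<le> ((cmod \<zeta>)^2 - 1) * 1" using zz by (intro mult_left_mono) auto
        then show ?thesis using m by simp
      next
        case False
        then have "((cmod \<zeta>)^2 - 1) * (1 - (cmod z)^2) \<le> 0" using zz by (intro mult_nonpos_nonneg) auto
        then show ?thesis using eta by simp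
      qed
      ultimately show False using e by simp
    qed
    then have "cmod (\<zeta> + z) < R * ?D" using le by simp
    then show ?thesis using D R by (simp add: \<phi>_def norm_divide divide_less_eq)
  qed
  have nz: "1 + cnj z * \<zeta> \<noteq> 0" if "cmod \<zeta> < 2" for \<zeta> using den[OF that] by auto
  have hol\<phi>: "\<phi> holomorphic_on ball 0 R'" unfolding \<phi>_def
    by (intro holomorphic_intros) (use nz R' in auto)
  have "(\<lambda>\<zeta>. u (\<phi> \<zeta>)) holomorphic_on ball 0 R'"
    by (rule holomorphic_on_compose_gen[OF hol\<phi> hol, unfolded o_def]) (use inb in auto)
  from circle_submean[OF this R'(1)]
  have 1: "2*pi * ln (max 1 (cmod (u z))) \<le> integral {0..2*pi} (\<lambda>\<theta>. ln (max 1 (cmod (u (\<phi> (cis \<theta>))))))"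
    by (simp add: \<phi>_def)
  \<comment> \<open>A smooth lift of the argument of \<phi> on the circle: \<phi> (cis \<theta>) =
    cis \<theta> * cnj w / w with w = 1 + cnj z * cis \<theta>, and the principal logarithm is
    smooth there since Re w > 0.\<close>
  define \<alpha> where "\<alpha> \<theta> = \<theta> - 2 * Im (Ln (1 + cnj z * cis \<theta>))" for \<theta>
  have Rew: "Re (1 + cnj z * cis \<theta>) > 0" for \<theta>
  proof -
    have "\<bar>Re (cnj z * cis \<theta>)\<bar> \<le> 1/5" using abs_Re_le_cmod[of "cnj z * cis \<theta>"] z by (simp add: norm_mult del: cis.sel)
    then have "Re (cnj z * cis \<theta>) > - 1" by linarith
    then show ?thesis by simp
  qed
  have cis\<alpha>: "\<phi> (cis \<theta>) = cis (\<alpha> \<theta>)" for \<theta>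
  proof -
    define w where "w = 1 + cnj z * cis \<theta>"
    have w: "w \<noteq> 0" using Rew[of \<theta>] unfolding w_def by (metis less_irrefl zero_complex.sel(1))
    have c: "cis \<theta> * cnj w = cis \<theta> + z" by (simp add: w_def algebra_simps cis_cnj cis_mult)
    have "cis (- 2 * Im (Ln w)) = exp (cnj (Ln w) - Ln w)"
    proof -
      have "cnj x - x = - (\<i> * (2 * of_real (Im x)))" for x by (simp add: complex_eq_iff)
      then show ?thesis by (simp add: cis_conv_exp)
    qed
    also have "\<dots> = cnj w / w" using w by (simp add: exp_diff exp_cnj[symmetric])
    finally have d: "cis (- 2 * Im (Ln w)) = cnj w / w" .
    have "cis (\<alpha> \<theta>) = cis \<theta> * cis (- 2 * Im (Ln w))" by (simp add: \<alpha>_def w_def cis_mult)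
    then show ?thesis unfolding d using c by (simp add: \<phi>_def w_def)
  qed
  define \<alpha>' where "\<alpha>' \<theta> = 1 - 2 * Im (cnj z * (\<i> * cis \<theta>) / (1 + cnj z * cis \<theta>))" for \<theta>
  have d\<alpha>: "(\<alpha> has_real_derivative \<alpha>' \<theta>) (at \<theta>)" for \<theta>
  proof -
    have nn: "1 + cnj z * cis \<theta> \<notin> \<real>\<^sub>\<le>\<^sub>0" using Rew[of \<theta>] by (auto simp: complex_nonpos_Reals_iff)
    have "((\<lambda>\<theta>. 1 + cnj z * cis \<theta>) has_vector_derivative cnj z * (\<i> * cis \<theta>)) (at \<theta>)"
      unfolding cis_conv_exp
      by (auto intro!: derivative_eq_intros has_vector_derivative_real_field)
    from field_vector_diff_chain_at[OF this has_field_derivative_Ln[OF nn]]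
    have "((\<lambda>\<theta>. Ln (1 + cnj z * cis \<theta>)) has_vector_derivative (cnj z * (\<i> * cis \<theta>) / (1 + cnj z * cis \<theta>))) (at \<theta>)"
      by (simp add: o_def field_simps)
    from bounded_linear.has_vector_derivative[OF bounded_linear_Im this]
    have "((\<lambda>\<theta>. Im (Ln (1 + cnj z * cis \<theta>))) has_real_derivative Im (cnj z * (\<i> * cis \<theta>) / (1 + cnj z * cis \<theta>))) (at \<theta>)"
      unfolding has_real_derivative_iff_has_vector_derivative .
    then show ?thesis unfolding \<alpha>_def \<alpha>'_def by (intro DERIV_diff DERIV_cmult DERIV_ident)
  qed
  have \<alpha>'ge: "\<alpha>' \<theta> \<ge> 1/2" for \<theta>
  proof -
    have "cmod (cnj z * (\<i> * cis \<theta>) / (1 + cnj z * cis \<theta>)) \<le> 1/4"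
    proof -
      have "cmod (cnj z * cis \<theta>) \<le> 1/5" using z by (simp add: norm_mult)
      then have "cmod (1 + cnj z * cis \<theta>) \<ge> 4/5" using norm_diff_ineq[of 1 "cnj z * cis \<theta>"] by simp
      then show ?thesis using z by (simp add: norm_divide norm_mult divide_le_eq)
    qed
    then have "Im (cnj z * (\<i> * cis \<theta>) / (1 + cnj z * cis \<theta>)) \<le> 1/4"
      using abs_Im_le_cmod[of "cnj z * (\<i> * cis \<theta>) / (1 + cnj z * cis \<theta>)"] by linarith
    then show ?thesis by (simp add: \<alpha>'_def)
  qed
  have cont\<alpha>: "continuous_on UNIV \<alpha>" using d\<alpha> by (meson DERIV_isCont continuous_at_imp_continuous_on)
  have cont\<alpha>': "continuous_on UNIV \<alpha>'" unfolding \<alpha>'_def using Rew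
    by (intro continuous_intros) (metis less_irrefl zero_complex.sel(1))
  have \<alpha>2: "\<alpha> (2*pi) = \<alpha> 0 + 2*pi" by (simp add: \<alpha>_def cis.ctr)
  have mono: "\<alpha> x \<le> \<alpha> y" if "x \<le> y" for x y
  proof (rule DERIV_nonneg_imp_nondecreasing[OF that])
    fix x show "\<exists>y. (\<alpha> has_real_derivative y) (at x) \<and> 0 \<le> y"
      using d\<alpha>[of x] \<alpha>'ge[of x] by (intro exI[of _ "\<alpha>' x"]) auto
  qed
  have sub: "((\<lambda>x. \<alpha>' x *\<^sub>R L (\<alpha> x)) has_integral (integral {\<alpha> 0..\<alpha> (2*pi)} L)) {0..2*pi}"
    by (rule has_integral_substitution[where c = "\<alpha> 0" and d = "\<alpha> (2*pi)"])
      (use mono contL' d\<alpha> in \<open>auto intro: has_field_derivative_at_within\<close>)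
  have 2: "integral {\<alpha> 0..\<alpha> (2*pi)} L = integral {0..2*pi} L"
    unfolding \<alpha>2 by (rule integral_periodic_shift[OF contL]) (use perL in auto)
  have "integral {0..2*pi} (\<lambda>\<theta>. L (\<alpha> \<theta>)) \<le> integral {0..2*pi} (\<lambda>x. 2 * (\<alpha>' x *\<^sub>R L (\<alpha> x)))"
  proof (rule integral_le)
    show "(\<lambda>\<theta>. L (\<alpha> \<theta>)) integrable_on {0..2*pi}"
      by (intro integrable_continuous_interval continuous_on_compose2[OF contL' continuous_on_subset[OF cont\<alpha>]]) auto
    show "(\<lambda>x. 2 * (\<alpha>' x *\<^sub>R L (\<alpha> x))) integrable_on {0..2*pi}"
      using sub by (intro integrable_on_mult_right) (auto simp: integrable_on_def)
    fix x show "L (\<alpha> x) \<le> 2 * (\<alpha>' x *\<^sub>R L (\<alpha> x))"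
      using mult_right_mono[OF \<alpha>'ge[of x] L0[of "\<alpha> x"]] by simp
  qed
  also have "\<dots> = 2 * integral {0..2*pi} L" using sub 2 by (simp add: integral_unique)
  finally have "integral {0..2*pi} (\<lambda>\<theta>. L (\<alpha> \<theta>)) \<le> 2 * integral {0..2*pi} L" .
  then show ?thesis using 1 unfolding cis\<alpha> L_def by simp
qed

text \<open>Pointwise smallness of a sequence with exponential growth becomes uniform on a smaller
  disc. The functions ln max(1, |u k|) / k on the unit circle are dominated by ln C + ln B and
  vanish eventually at each point, so their integrals tend to 0, and
  \<open>disc_poisson_bound\<close> carries this inside.\<close>

lemma hartogs_lemma:
  fixes u :: "nat \<Rightarrow> complex \<Rightarrow> complex"
  assumes hol: "\<And>k. u k holomorphic_on ball 0 R" and R: "R > 1"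
    and C: "C \<ge> 1" and B: "B \<ge> 1"
    and bd: "\<And>k z. z \<in> ball 0 R \<Longrightarrow> cmod (u k z) \<le> C * B ^ k"
    and ev: "\<And>z. z \<in> ball 0 R \<Longrightarrow> \<forall>\<^sub>F k in sequentially. cmod (u k z) \<le> 1"
    and e: "e > 0"
  shows "\<exists>K. \<forall>k\<ge>K. \<forall>z\<in>cball 0 (1/5). cmod (u k z) \<le> exp (e * real k)"
proof -
  define L where "L k \<theta> = ln (max 1 (cmod (u k (cis \<theta>)))) / real k" for k \<theta>
  have cL: "continuous_on A (\<lambda>\<theta>. ln (max 1 (cmod (u k (cis \<theta>)))))" for A k
    by (intro continuous_intros continuous_on_compose2[OF holomorphic_on_imp_continuous_on[OF hol[of k]]]) (use R in \<open>auto simp: max_def\<close>)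
  have iL: "L k integrable_on {0..2*pi}" for k unfolding L_def divide_inverse
    by (intro integrable_on_mult_left integrable_continuous_interval cL)
  have cis: "cis \<theta> \<in> ball 0 R" for \<theta> using R by simp
  have "(\<lambda>k. integral {0..2*pi} (L k)) \<longlonglongrightarrow> integral {0..2*pi} (\<lambda>\<theta>. 0)"
  proof (rule dominated_convergence(2)[where h = "\<lambda>_. ln C + ln B"])
    show "(\<lambda>_. ln C + ln B) integrable_on {0..2*pi}" by (rule integrable_const_ivl)
    show "norm (L k x) \<le> ln C + ln B" for k x
    proof (cases "k = 0")
      case True then show ?thesis using C B by (simp add: L_def)
    next
      case False
      have CB: "C * B ^ k \<ge> 1" using C B mult_mono[of 1 C 1 "B^k"] by (simp add: one_le_power)
      have "ln (max 1 (cmod (u k (cis x)))) \<le> ln (C * B ^ k)"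
        by (rule ln_mono) (use bd[OF cis] CB in auto)
      also have "\<dots> = ln C + real k * ln B" using C B by (simp add: ln_mult ln_realpow)
      also have "\<dots> \<le> real k * (ln C + ln B)" using C B False mult_right_mono[of 1 "real k" "ln C"] by (simp add: algebra_simps)
      finally show ?thesis using False by (simp add: L_def divide_le_eq mult.commute)
    qed
    fix x
    have "\<forall>\<^sub>F k in sequentially. L k x = 0"
      using ev[OF cis[of x]] by eventually_elim (simp add: L_def max_def)
    then show "(\<lambda>k. L k x) \<longlonglongrightarrow> 0" by (rule tendsto_eventually)
  qed (rule iL)
  then have "(\<lambda>k. integral {0..2*pi} (L k)) \<longlonglongrightarrow> 0" by simp
  then have "\<forall>\<^sub>F k in sequentially. integral {0..2*pi} (L k) < pi * e"
    by (rule order_tendstoD) (use e in simp)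
  then obtain K where K: "\<And>k. k \<ge> K \<Longrightarrow> integral {0..2*pi} (L k) < pi * e"
    by (auto simp: eventually_sequentially)
  show ?thesis
  proof (intro exI[of _ "max 1 K"] allI impI ballI)
    fix k :: nat and z :: complex assume k: "max 1 K \<le> k" and z: "z \<in> cball 0 (1/5)"
    have "pi * ln (max 1 (cmod (u k z))) \<le> integral {0..2*pi} (\<lambda>\<theta>. ln (max 1 (cmod (u k (cis \<theta>)))))"
      using disc_poisson_bound[OF hol[of k] R, of z] z by simp
    also have "\<dots> = integral {0..2*pi} (\<lambda>\<theta>. real k * L k \<theta>)" using k by (simp add: L_def)
    also have "\<dots> = real k * integral {0..2*pi} (L k)" by simp
    also have "\<dots> \<le> real k * (pi * e)" using K[of k] k by (intro mult_left_mono) auto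
    finally have "ln (max 1 (cmod (u k z))) \<le> e * real k" by (simp add: mult.commute mult.left_commute)
    then have "exp (ln (max 1 (cmod (u k z)))) \<le> exp (e * real k)" by (simp only: exp_le_cancel_iff)
    moreover have "exp (ln y) = y" if "y \<ge> 1" for y :: real using that by simp
    ultimately have "max 1 (cmod (u k z)) \<le> exp (e * real k)" by (metis max.cobounded1)
    then show "cmod (u k z) \<le> exp (e * real k)" by simp
  qed
qed

text \<open>Each coefficient is the limit, uniform in z, of difference quotients that involve only g
  and the earlier coefficients; the Cauchy-type bound \<open>bd\<close> controls the tail of the
  Taylor series.\<close>

lemma taylor_coeff_holomorphic:
  fixes g :: "complex \<Rightarrow> complex \<Rightarrow> complex"
  assumes r: "r > 0" and hz: "\<And>w. w \<in> ball w0 r \<Longrightarrow> (\<lambda>z. g z w) holomorphic_on ball 0 \<rho>"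
    and sums: "\<And>z w. z \<in> ball 0 \<rho> \<Longrightarrow> w \<in> ball w0 r \<Longrightarrow> (\<lambda>k. c k z * (w - w0) ^ k) sums g z w"
    and bd: "\<And>z k. z \<in> ball 0 \<rho> \<Longrightarrow> cmod (c k z) \<le> M / r ^ k"
  shows "c k holomorphic_on ball 0 \<rho>"
proof (induction k rule: less_induct)
  case (less k)
  \<comment> \<open>t n tends to 0 with t n / r <= 1/2, so the remainder after order k is dominated
    by a geometric series of size proportional to t n.\<close>
  define t where "t n = r / (real n + 2)" for n :: nat
  have t: "t n > 0" "t n < r" for n using r by (auto simp: t_def field_simps add_pos_nonneg)
  have t2: "t n / r \<le> 1/2" for n
  proof -
    have "t n / r = 1 / (real n + 2)" using r by (simp add: t_def)
    then show ?thesis by (simp add: divide_le_eq)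
  qed
  define F where "F n z = (g z (w0 + of_real (t n)) - (\<Sum>i<k. c i z * of_real (t n) ^ i)) / of_real (t n) ^ k" for n z
  have inb: "w0 + of_real (t n) \<in> ball w0 r" for n using t[of n] by (simp add: dist_norm)
  have M0: "M \<ge> 0" if "z \<in> ball 0 \<rho>" for z :: complex using order_trans[OF norm_ge_zero bd[OF that, of 0]] by simp
  have bound: "cmod (F n z - c k z) \<le> (M / r ^ k) * (2 / (real n + 2))" if z: "z \<in> ball 0 \<rho>" for n z
  proof -
    let ?t = "of_real (t n) :: complex"
    have s: "(\<lambda>i. c i z * ?t ^ i) sums g z (w0 + ?t)" using sums[OF z inb[of n]] by simp
    then have "(\<lambda>j. c (j + Suc k) z * ?t ^ (j + Suc k)) sums (g z (w0 + ?t) - (\<Sum>i<Suc k. c i z * ?t ^ i))"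
      by (rule sums_split_initial_segment)
    from sums_divide[OF this, of "?t ^ k"]
    have s2: "(\<lambda>j. c (j + Suc k) z * ?t ^ (j + Suc k) / ?t ^ k) sums (F n z - c k z)"
      using t[of n] by (simp add: F_def field_simps)
    have nb: "norm (c (j + Suc k) z * ?t ^ (j + Suc k) / ?t ^ k) \<le> (M / r ^ k) * (t n / r) * (1/2) ^ j" for j
    proof -
      have "norm (c (j + Suc k) z * ?t ^ (j + Suc k) / ?t ^ k) = cmod (c (j + Suc k) z) * t n ^ (j + 1)"
        using t[of n] by (simp add: norm_mult norm_divide norm_power power_add)
      also have "\<dots> \<le> M / r ^ (j + Suc k) * t n ^ (j + 1)" using t[of n] by (intro mult_right_mono bd[OF z]) auto
      also have "\<dots> = (M / r ^ k) * (t n / r) * (t n / r) ^ j" using r by (simp add: power_add power_divide mult_ac)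
      also have "\<dots> \<le> (M / r ^ k) * (t n / r) * (1/2) ^ j" using t[of n] t2[of n] r M0[OF z] by (intro mult_left_mono power_mono) auto
      finally show ?thesis .
    qed
    have g: "(\<lambda>j. (M / r ^ k) * (t n / r) * (1/2) ^ j) sums ((M / r ^ k) * (t n / r) * (1 / (1 - 1/2)))"
      by (intro sums_mult geometric_sums) auto
    have "cmod (F n z - c k z) \<le> (M / r ^ k) * (t n / r) * (1 / (1 - 1/2))"
      unfolding sums_unique[OF s2] sums_unique[OF g]
      by (rule norm_suminf_le) (use nb sums_summable[OF g] in auto)
    then show ?thesis using r by (simp add: t_def)
  qed
  show ?case
  proof (rule holomorphic_uniform_sequence[of _ F])
    show "F n holomorphic_on ball 0 \<rho>" for n
    proof -
      have "(\<lambda>z. \<Sum>i<k. c i z * of_real (t n) ^ i) holomorphic_on ball 0 \<rho>"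
        using less.IH by (intro holomorphic_intros) auto
      then show ?thesis unfolding F_def using t[of n]
        by (intro holomorphic_on_divide holomorphic_on_diff holomorphic_on_const hz inb) auto
    qed
    fix z :: complex assume z: "z \<in> ball 0 \<rho>"
    obtain d where d: "d > 0" "cball z d \<subseteq> ball 0 \<rho>" using z open_contains_cball open_ball by blast
    have "uniform_limit (cball z d) F (c k) sequentially"
    proof (rule uniform_limitI)
      fix e :: real assume e: "e > 0"
      have "(\<lambda>n. (M / r ^ k) * (2 / (real n + 2))) \<longlonglongrightarrow> 0" by real_asymp
      then have "\<forall>\<^sub>F n in sequentially. (M / r ^ k) * (2 / (real n + 2)) < e" by (rule order_tendstoD) (use e in simp)
      then show "\<forall>\<^sub>F n in sequentially. \<forall>x\<in>cball z d. dist (F n x) (c k x) < e"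
      proof eventually_elim
        case (elim n)
        show ?case
        proof
          fix x assume "x \<in> cball z d"
          then show "dist (F n x) (c k x) < e" using bound[of x n] d elim by (auto simp: dist_norm)
        qed
      qed
    qed
    then show "\<exists>d>0. cball z d \<subseteq> ball 0 \<rho> \<and> uniform_limit (cball z d) F (c k) sequentially" using d by blast
  qed auto
qed

text \<open>Osgood's argument: the closed sets \<open>E m\<close> of parameters w for which g is
  bounded by m over all z in the half disc cover the disc of radius R/4, so by Baire one of them has
  interior.\<close>

lemma separately_holomorphic_bounded_somewhere:
  fixes g :: "complex \<Rightarrow> complex \<Rightarrow> complex"
  assumes R: "R > 0"
    and hz: "\<And>w. w \<in> ball 0 R \<Longrightarrow> (\<lambda>z. g z w) holomorphic_on ball 0 R"
    and hw: "\<And>z. z \<in> ball 0 R \<Longrightarrow> g z holomorphic_on ball 0 R"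
  obtains w0 r m where "r > 0" "ball w0 r \<subseteq> ball 0 (R/4)"
    "\<And>z w. z \<in> ball 0 (R/2) \<Longrightarrow> w \<in> ball w0 r \<Longrightarrow> cmod (g z w) \<le> real m"
proof -
  define S where "S = cball (0::complex) (R/4)"
  define E where "E m = {w\<in>S. \<forall>z\<in>cball 0 (R/2). cmod (g z w) \<le> real m}" for m :: nat
  have SR: "S \<subseteq> ball 0 R" using R by (auto simp: S_def)
  have zR: "z \<in> ball 0 R" if "z \<in> cball 0 (R/2)" for z :: complex using that R by auto
  have clE: "closed (E m)" for m
  proof -
    have "E m = S \<inter> (\<Inter>z\<in>cball 0 (R/2). {w\<in>S. cmod (g z w) \<le> real m})" by (auto simp: E_def)
    moreover have "closed {w\<in>S. cmod (g z w) \<le> real m}" if z: "z \<in> cball 0 (R/2)" for z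
    proof -
      have "continuous_on S (\<lambda>w. cmod (g z w))"
        by (intro continuous_on_norm continuous_on_subset[OF holomorphic_on_imp_continuous_on[OF hw[OF zR[OF z]]] SR])
      then have "closed (S \<inter> (\<lambda>w. cmod (g z w)) -` {..real m})"
        by (intro continuous_closed_preimage) (auto simp: S_def)
      moreover have "{w\<in>S. cmod (g z w) \<le> real m} = S \<inter> (\<lambda>w. cmod (g z w)) -` {..real m}" by auto
      ultimately show ?thesis by simp
    qed
    ultimately show ?thesis by (auto simp: S_def intro!: closed_Int closed_INT)
  qed
  have cover: "\<exists>m. w \<in> E m" if w: "w \<in> S" for w
  proof -
    have "compact ((\<lambda>z. g z w) ` cball 0 (R/2))"
      by (intro compact_continuous_image continuous_on_subset[OF holomorphic_on_imp_continuous_on[OF hz]]) (use w SR zR in auto)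
    then have "bounded ((\<lambda>z. g z w) ` cball 0 (R/2))" by (rule compact_imp_bounded)
    then obtain B where B: "\<And>z. z \<in> cball 0 (R/2) \<Longrightarrow> cmod (g z w) \<le> B"
      unfolding bounded_iff by (metis (no_types, lifting) imageI)
    obtain m :: nat where "B \<le> real m" using real_arch_simple by blast
    then have "w \<in> E m" unfolding E_def using w by (auto intro!: order_trans[OF B])
    then show ?thesis ..
  qed
  have "\<exists>m. \<not> S \<subseteq> closure (S - E m)"
  proof (rule ccontr)
    assume "\<nexists>m. \<not> S \<subseteq> closure (S - E m)"
    then have d: "\<And>m. S \<subseteq> closure (S - E m)" by blast
    have "S \<subseteq> closure (\<Inter> (range (\<lambda>m. S - E m)))"
    proof (rule Baire)
      show "closed S" by (simp add: S_def)
      show "countable (range (\<lambda>m. S - E m))" by simp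
      fix T assume "T \<in> range (\<lambda>m. S - E m)"
      then obtain m where T: "T = S - E m" by auto
      have "openin (top_of_set S) (S - E m)" using clE[of m]
        unfolding openin_open by (intro exI[of _ "- E m"]) auto
      then show "openin (top_of_set S) T \<and> S \<subseteq> closure T" using d T by blast
    qed
    moreover have "\<Inter> (range (\<lambda>m. S - E m)) = {}" using cover by blast
    moreover have "0 \<in> S" using R by (simp add: S_def)
    ultimately show False by (metis closure_empty empty_iff subset_empty)
  qed
  then obtain m w1 where w1: "w1 \<in> S" "w1 \<notin> closure (S - E m)" by blast
  let ?O = "ball 0 (R/4) \<inter> - closure (S - E m)"
  have "w1 \<in> closure (ball 0 (R/4))" using w1 R by (simp add: S_def)
  then have "?O \<noteq> {}" using w1(2) open_Int_closure_eq_empty[of "- closure (S - E m)" "ball 0 (R/4)"] by blast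
  then obtain w0 where "w0 \<in> ?O" by blast
  moreover have "open ?O" by (intro open_Int) auto
  ultimately obtain r where r: "r > 0" "ball w0 r \<subseteq> ?O" by (meson open_contains_ball)
  show ?thesis
  proof (rule that[OF r(1), of w0 m])
    show "ball w0 r \<subseteq> ball 0 (R/4)" using r by blast
    fix z w :: complex assume z: "z \<in> ball 0 (R/2)" and w: "w \<in> ball w0 r"
    have "w \<notin> S - E m" "w \<in> S" using r(2) w closure_subset[of "S - E m"] by (auto simp: S_def subset_iff)
    then show "cmod (g z w) \<le> real m" using z by (auto simp: E_def)
  qed
qed

text \<open>Expand in w around a point w0 near which g is bounded. Convergence of the series at w0 +
  s with s = R/2 gives c k z * s^k -> 0 for each z separately; Hartogs' lemma makes this uniform, |c
  k| <= (3/R)^k for large k and |z| <= R/24. On the diagonal |\<zeta> - w0| <= R/24 + R/4 = 7R/24,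
  so the series is dominated by powers of 7/8.\<close>

theorem hartogs_diagonal:
  fixes g :: "complex \<Rightarrow> complex \<Rightarrow> complex"
  assumes R: "R > 0"
    and hz: "\<And>w. w \<in> ball 0 R \<Longrightarrow> (\<lambda>z. g z w) holomorphic_on ball 0 R"
    and hw: "\<And>z. z \<in> ball 0 R \<Longrightarrow> g z holomorphic_on ball 0 R"
  shows "(\<lambda>z. g z z) field_differentiable (at 0)"
proof -
  obtain w0 r1 m where r1: "r1 > 0" "ball w0 r1 \<subseteq> ball 0 (R/4)"
    and bd: "\<And>z w. z \<in> ball 0 (R/2) \<Longrightarrow> w \<in> ball w0 r1 \<Longrightarrow> cmod (g z w) \<le> real m"
    using separately_holomorphic_bounded_somewhere[OF R hz hw] by metis
  have w0: "cmod w0 < R/4" using r1 subsetD[OF r1(2), of w0] by simp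
  define r where "r = min (r1/2) (R/4)"
  have r: "r > 0" "r < r1" "r \<le> R/4" using r1 R by (auto simp: r_def)
  define c where "c k z = (deriv ^^ k) (g z) w0 / fact k" for k z
  define s where "s = R/2"
  have sub: "ball w0 (3*R/4) \<subseteq> ball 0 R"
  proof
    fix w assume "w \<in> ball w0 (3*R/4)"
    then have "cmod (w - w0) < 3*R/4" by (simp add: dist_norm norm_minus_commute)
    then show "w \<in> ball 0 R" using w0 norm_triangle_ineq[of "w - w0" w0] by simp
  qed
  have sums: "(\<lambda>k. c k z * (w - w0) ^ k) sums g z w" if "z \<in> ball 0 R" "w \<in> ball w0 (3*R/4)" for z w
    unfolding c_def by (rule holomorphic_power_series[OF holomorphic_on_subset[OF hw[OF that(1)] sub] that(2)])
  have ballr: "ball w0 r \<subseteq> ball w0 (3*R/4)" "cball w0 r \<subseteq> ball w0 r1" "cball w0 r \<subseteq> ball w0 (3*R/4)" using r R by auto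
  have cbd: "cmod (c k z) \<le> (real m + 1) / r ^ k" if z: "z \<in> ball 0 (R/2)" for k z
  proof (cases "k = 0")
    case True then show ?thesis using bd[OF z, of w0] r1 by (simp add: c_def)
  next
    case False
    have zR: "z \<in> ball 0 R" using z R by auto
    have h: "g z holomorphic_on ball w0 (3*R/4)" using holomorphic_on_subset[OF hw[OF zR] sub] .
    have "cmod ((deriv ^^ k) (g z) w0) \<le> fact k * (real m + 1) / r ^ k"
    proof (rule Cauchy_higher_deriv_bound[where y = 0])
      show "g z holomorphic_on ball w0 r" by (rule holomorphic_on_subset[OF h ballr(1)])
      show "continuous_on (cball w0 r) (g z)" by (rule continuous_on_subset[OF holomorphic_on_imp_continuous_on[OF h] ballr(3)])
      fix w assume "w \<in> ball w0 r"
      then have "w \<in> ball w0 r1" using r by auto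
      then show "g z w \<in> ball 0 (real m + 1)" using bd[OF z, of w] by simp
    qed (use r False in auto)
    then show ?thesis by (simp add: c_def norm_divide divide_le_eq mult.commute mult.left_commute)
  qed
  have holc: "c k holomorphic_on ball 0 (R/2)" for k
  proof (rule taylor_coeff_holomorphic[OF r(1), of w0 g])
    show "(\<lambda>z. g z w) holomorphic_on ball 0 (R/2)" if "w \<in> ball w0 r" for w
    proof (rule holomorphic_on_subset[OF hz])
      show "w \<in> ball 0 R" using that ballr sub by blast
    qed (use R in auto)
    show "(\<lambda>k. c k z * (w - w0) ^ k) sums g z w" if "z \<in> ball 0 (R/2)" "w \<in> ball w0 r" for z w
    proof (rule sums)
      show "w \<in> ball w0 (3*R/4)" using that ballr by blast
    qed (use that R in auto)
  qed (rule cbd)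
  \<comment> \<open>Rescaling z by R/4 carries the disc of radius 2 onto that of radius R/2, and the
    disc of radius 1/5 onto one containing the disc of radius R/24.\<close>
  define u where "u k z = c k (of_real (R/4) * z) * of_real s ^ k" for k z
  have scale: "of_real (R/4) * z \<in> ball 0 (R/2)" if "z \<in> ball 0 2" for z :: complex
    using that R by (simp add: norm_mult)
  \<comment> \<open>The rate ln (3/2) is chosen so that (3/2)^k / s^k = (3/R)^k, and 3/R times 7R/24
    is 7/8 < 1.\<close>
  have "\<exists>K. \<forall>k\<ge>K. \<forall>z\<in>cball 0 (1/5). cmod (u k z) \<le> exp (ln (3/2) * real k)"
  proof (rule hartogs_lemma[where R = 2 and C = "real m + 1" and B = "s / r"])
    show "u k holomorphic_on ball 0 2" for k unfolding u_def
      by (intro holomorphic_intros holomorphic_on_compose_gen[OF _ holc, unfolded o_def]) (use scale in auto)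
    show "1 \<le> s / r" using r R by (simp add: s_def field_simps)
    fix z :: complex assume z: "z \<in> ball 0 2"
    show "cmod (u k z) \<le> (real m + 1) * (s / r) ^ k" for k
    proof -
      have s0: "s > 0" using R by (simp add: s_def)
      have "cmod (u k z) = cmod (c k (of_real (R/4) * z)) * s ^ k"
        unfolding u_def norm_mult norm_power norm_of_real using s0 by simp
      also have "\<dots> \<le> (real m + 1) / r ^ k * s ^ k"
        using s0 by (intro mult_right_mono cbd[OF scale[OF z]]) auto
      finally show ?thesis by (simp add: power_divide)
    qed
    have "w0 + of_real s \<in> ball w0 (3*R/4)" using R by (simp add: s_def dist_norm)
    moreover have "of_real (R/4) * z \<in> ball 0 R" using scale[OF z] R by auto
    ultimately have "(\<lambda>k. u k z) sums g (of_real (R/4) * z) (w0 + of_real s)"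
      using sums[of "of_real (R/4) * z" "w0 + of_real s"] by (simp add: u_def)
    then have "(\<lambda>k. u k z) \<longlonglongrightarrow> 0" using sums_summable summable_LIMSEQ_zero by blast
    then have "(\<lambda>k. cmod (u k z)) \<longlonglongrightarrow> 0" by (rule tendsto_norm_zero)
    then have "\<forall>\<^sub>F k in sequentially. cmod (u k z) < 1" by (rule order_tendstoD) simp
    then show "\<forall>\<^sub>F k in sequentially. cmod (u k z) \<le> 1" by eventually_elim simp
  qed auto
  then obtain K where K: "\<And>k z. k \<ge> K \<Longrightarrow> z \<in> cball 0 (1/5) \<Longrightarrow> cmod (u k z) \<le> exp (ln (3/2) * real k)" by blast
  have cK: "cmod (c k \<zeta>) \<le> (3/R) ^ k" if "k \<ge> K" "\<zeta> \<in> cball 0 (R/24)" for k \<zeta>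
  proof -
    have "cmod (of_real (4/R) * \<zeta>) = 4/R * cmod \<zeta>" using R by (simp add: norm_mult norm_divide)
    also have "\<dots> \<le> 4/R * (R/24)" using that R by (intro mult_left_mono) auto
    finally have "of_real (4/R) * \<zeta> \<in> cball 0 (1/5::real)" using R by simp
    from K[OF that(1) this] have "cmod (c k \<zeta>) * s ^ k \<le> (3/2) ^ k"
      using R by (simp add: u_def norm_mult norm_power s_def exp_of_nat_mult mult.commute[of "ln (3/2)"])
    then have "cmod (c k \<zeta>) \<le> (3/2) ^ k / s ^ k" using R by (simp add: s_def pos_le_divide_eq)
    also have "\<dots> = (3/R) ^ k" using R by (simp add: s_def power_divide[symmetric])
    finally show ?thesis .
  qed
  let ?B = "cball (0::complex) (R/24)"
  have "uniform_limit ?B (\<lambda>n \<zeta>. \<Sum>k<n. c k \<zeta> * (\<zeta> - w0) ^ k) (\<lambda>\<zeta>. suminf (\<lambda>k. c k \<zeta> * (\<zeta> - w0) ^ k)) sequentially"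
  proof (rule Weierstrass_m_test_ev[where M = "\<lambda>k. (7/8) ^ k"])
    show "\<forall>\<^sub>F k in sequentially. \<forall>\<zeta>\<in>?B. norm (c k \<zeta> * (\<zeta> - w0) ^ k) \<le> (7/8) ^ k"
      unfolding eventually_sequentially
    proof (intro exI allI impI ballI)
      fix k \<zeta> assume k: "K \<le> k" and z: "\<zeta> \<in> ?B"
      have "cmod (\<zeta> - w0) \<le> 7*R/24" using z w0 norm_triangle_ineq4[of \<zeta> w0] by simp
      then have "cmod (c k \<zeta>) * cmod (\<zeta> - w0) ^ k \<le> (3/R) ^ k * (7*R/24) ^ k"
        using cK[OF k z] R by (intro mult_mono power_mono) auto
      also have "\<dots> = (7/8) ^ k" using R by (simp add: power_mult_distrib[symmetric])
      finally show "norm (c k \<zeta> * (\<zeta> - w0) ^ k) \<le> (7/8) ^ k" by (simp add: norm_mult norm_power)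
    qed
  qed auto
  moreover have "suminf (\<lambda>k. c k \<zeta> * (\<zeta> - w0) ^ k) = g \<zeta> \<zeta>" if "\<zeta> \<in> ?B" for \<zeta>
  proof -
    have "cmod (\<zeta> - w0) \<le> 7*R/24" using that w0 norm_triangle_ineq4[of \<zeta> w0] by simp
    then have "\<zeta> \<in> ball w0 (3*R/4)" using R by (simp add: dist_norm norm_minus_commute)
    moreover have "\<zeta> \<in> ball 0 R" using that R by auto
    ultimately show ?thesis using sums by (simp add: sums_iff)
  qed
  ultimately have ul: "uniform_limit ?B (\<lambda>n \<zeta>. \<Sum>k<n. c k \<zeta> * (\<zeta> - w0) ^ k) (\<lambda>\<zeta>. g \<zeta> \<zeta>) sequentially"
    by (subst uniform_limit_cong'[of ?B _ "\<lambda>n \<zeta>. \<Sum>k<n. c k \<zeta> * (\<zeta> - w0) ^ k" _ "\<lambda>\<zeta>. suminf (\<lambda>k. c k \<zeta> * (\<zeta> - w0) ^ k)"]) auto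
  have "(\<lambda>\<zeta>. g \<zeta> \<zeta>) holomorphic_on ball 0 (R/24)"
  proof (rule holomorphic_uniform_limit[OF _ ul])
    have h: "(\<lambda>\<zeta>. \<Sum>k<n. c k \<zeta> * (\<zeta> - w0) ^ k) holomorphic_on ball 0 (R/2)" for n
      by (intro holomorphic_intros holc)
    show "\<forall>\<^sub>F n in sequentially. continuous_on ?B (\<lambda>\<zeta>. \<Sum>k<n. c k \<zeta> * (\<zeta> - w0) ^ k) \<and>
        (\<lambda>\<zeta>. \<Sum>k<n. c k \<zeta> * (\<zeta> - w0) ^ k) holomorphic_on ball 0 (R/24)"
      by (intro always_eventually allI conjI continuous_on_subset[OF holomorphic_on_imp_continuous_on[OF h]] holomorphic_on_subset[OF h])
        (use R in auto)
  qed auto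
  then show ?thesis using R by (intro holomorphic_on_imp_differentiable_at[of _ "ball 0 (R/24)"]) auto
qed

section \<open>Matrix algebra\<close>

lemma mats_ext: "A \<in> mats N \<Longrightarrow> B \<in> mats N \<Longrightarrow> (\<And>i j. i < N \<Longrightarrow> j < N \<Longrightarrow> A (i,j) = B (i,j)) \<Longrightarrow> A = B"
  unfolding mats_def sq_def by (rule PiE_ext) auto

lemma in_sq [simp]: "(i,j) \<in> sq N \<longleftrightarrow> i < N \<and> j < N"
  by (simp add: sq_def)

lemma finite_sq [simp]: "finite (sq N)" by (simp add: sq_def)

lemma mats_closed [simp]:
  "mmul N A B \<in> mats N" "mid N \<in> mats N" "madd N A B \<in> mats N" "mscale N c A \<in> mats N"
  "madj N A \<in> mats N" "matunit N i j \<in> mats N" "mexp N A \<in> mats N"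
  by (simp_all add: mmul_def mid_def madd_def mscale_def madj_def matunit_def mexp_def mats_def restrict_def PiE_def Pi_def extensional_def)

lemma mat_nth [simp]:
  assumes "i < N" "j < N"
  shows "mmul N A B (i,j) = (\<Sum>k<N. A (i,k) * B (k,j))"
    "mid N (i,j) = (if i = j then 1 else 0)"
    "madd N A B (i,j) = A (i,j) + B (i,j)"
    "mscale N c A (i,j) = c * A (i,j)"
    "madj N A (i,j) = cnj (A (j,i))"
    "matunit N k l (i,j) = (if i = k \<and> j = l then 1 else 0)"
  using assms by (auto simp: mmul_def mid_def madd_def mscale_def madj_def matunit_def)

lemma mmul_assoc: "mmul N (mmul N A B) C = mmul N A (mmul N B C)"
  by (rule mats_ext[where N = N]) (auto simp: sum_distrib_left sum_distrib_right mult.assoc intro: sum.swap)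

lemma mmul_mid_left [simp]: "A \<in> mats N \<Longrightarrow> mmul N (mid N) A = A"
  by (rule mats_ext[where N = N]) (auto simp: if_distrib[where f = "\<lambda>x. x * _"] cong: if_cong)

lemma mmul_mid_right [simp]: "A \<in> mats N \<Longrightarrow> mmul N A (mid N) = A"
  by (rule mats_ext[where N = N]) (auto simp: if_distrib[where f = "\<lambda>x. _ * x"] cong: if_cong)

lemma madj_mmul: "madj N (mmul N A B) = mmul N (madj N B) (madj N A)"
  by (rule mats_ext[where N = N]) (auto simp: mult.commute)

lemma madj_madj [simp]: "A \<in> mats N \<Longrightarrow> madj N (madj N A) = A"
  by (rule mats_ext[where N = N]) auto

lemma madj_mid [simp]: "madj N (mid N) = mid N"
  by (rule mats_ext[where N = N]) auto

lemma mmul_madd_right: "mmul N A (madd N B C) = madd N (mmul N A B) (mmul N A C)"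
  by (rule mats_ext[where N = N]) (auto simp: algebra_simps sum.distrib)

lemma mmul_madd_left: "mmul N (madd N B C) A = madd N (mmul N B A) (mmul N C A)"
  by (rule mats_ext[where N = N]) (auto simp: algebra_simps sum.distrib)

lemma mmul_mscale_right [simp]: "mmul N A (mscale N c B) = mscale N c (mmul N A B)"
  by (rule mats_ext[where N = N]) (auto simp: algebra_simps sum_distrib_left)

lemma mmul_mscale_left [simp]: "mmul N (mscale N c A) B = mscale N c (mmul N A B)"
  by (rule mats_ext[where N = N]) (auto simp: algebra_simps sum_distrib_left)

lemma mscale_mscale [simp]: "mscale N c (mscale N d A) = mscale N (c * d) A"
  by (rule mats_ext[where N = N]) auto

lemma mscale_1 [simp]: "A \<in> mats N \<Longrightarrow> mscale N 1 A = A"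
  by (rule mats_ext[where N = N]) auto

lemma mtr_mmul_commute: "mtr N (mmul N A B) = mtr N (mmul N B A)"
proof -
  have "(\<Sum>i<N. \<Sum>k<N. A (i,k) * B (k,i)) = (\<Sum>i<N. \<Sum>k<N. B (i,k) * A (k,i))"
    by (subst sum.swap) (simp add: mult.commute)
  then show ?thesis by (simp add: mtr_def)
qed

section \<open>Determinants, invertibility and continuity of the inverse\<close>

lemma Mat_mmul: "Matrix.mat N N (mmul N A B) = Matrix.mat N N A * Matrix.mat N N B"
  by (rule eq_matI) (auto simp: scalar_prod_def atLeast0LessThan)

lemma Mat_mid: "Matrix.mat N N (mid N) = 1\<^sub>m N"
  by (rule eq_matI) auto

lemma Mat_inj: "A \<in> mats N \<Longrightarrow> B \<in> mats N \<Longrightarrow> Matrix.mat N N A = Matrix.mat N N B \<Longrightarrow> A = B"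
  by (rule mats_ext[where N = N]) (auto, metis index_mat(1))

lemma mmul_inverse_commute:
  assumes "A \<in> mats N" "B \<in> mats N" "mmul N A B = mid N"
  shows "mmul N B A = mid N"
proof -
  have "Matrix.mat N N A * Matrix.mat N N B = 1\<^sub>m N" using arg_cong[OF assms(3), of "Matrix.mat N N"] by (simp only: Mat_mmul Mat_mid)
  then have "Matrix.mat N N B * Matrix.mat N N A = 1\<^sub>m N" by (rule mat_mult_left_right_inverse[rotated 2]) auto
  then show ?thesis by (intro Mat_inj[where N = N]) (auto simp: Mat_mmul Mat_mid)
qed

text \<open>\<open>minv\<close> picks some right inverse; the choice is determined because a right
  inverse of a square matrix is two-sided.\<close>

lemma minv_unique:
  assumes "A \<in> mats N" "B \<in> mats N" "mmul N A B = mid N"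
  shows "A \<in> GLm N" "minv N A = B"
proof -
  show "A \<in> GLm N" using assms by (auto simp: GLm_def)
  have "C = B" if "C \<in> mats N" "mmul N A C = mid N" for C
  proof -
    have "C = mmul N (mmul N B A) C" using mmul_inverse_commute[OF assms] that by simp
    also have "\<dots> = B" using that assms by (simp add: mmul_assoc)
    finally show ?thesis .
  qed
  then show "minv N A = B" unfolding minv_def using assms by (intro some_equality) blast+
qed

lemma minv_GL:
  assumes "A \<in> GLm N"
  shows "A \<in> mats N" "minv N A \<in> mats N" "mmul N A (minv N A) = mid N" "mmul N (minv N A) A = mid N" "minv N A \<in> GLm N"
    "minv N (minv N A) = A"
proof -
  obtain B where B: "A \<in> mats N" "B \<in> mats N" "mmul N A B = mid N" using assms by (auto simp: GLm_def)
  with minv_unique[OF B] mmul_inverse_commute[OF B] minv_unique[of B N A]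
  show "A \<in> mats N" "minv N A \<in> mats N" "mmul N A (minv N A) = mid N" "mmul N (minv N A) A = mid N" "minv N A \<in> GLm N"
    "minv N (minv N A) = A"
    by auto
qed

lemma GLm_mmul:
  assumes "A \<in> GLm N" "B \<in> GLm N"
  shows "mmul N A B \<in> GLm N" "minv N (mmul N A B) = mmul N (minv N B) (minv N A)"
proof -
  have "mmul N (mmul N A B) (mmul N (minv N B) (minv N A)) = mmul N A (mmul N (mmul N B (minv N B)) (minv N A))"
    by (simp add: mmul_assoc)
  also have "\<dots> = mid N" using assms minv_GL by simp
  finally show "mmul N A B \<in> GLm N" "minv N (mmul N A B) = mmul N (minv N B) (minv N A)"
    using minv_unique[of "mmul N A B" N "mmul N (minv N B) (minv N A)"] by auto
qed

lemma mid_GLm [simp]: "mid N \<in> GLm N" "minv N (mid N) = mid N"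
  using minv_unique[of "mid N" N "mid N"] by auto

lemma Um_GLm:
  assumes "U \<in> Um N"
  shows "U \<in> GLm N" "minv N U = madj N U"
proof -
  have U: "U \<in> mats N" "mmul N (madj N U) U = mid N" using assms by (auto simp: Um_def)
  from mmul_inverse_commute[OF _ this] have "mmul N U (madj N U) = mid N" by simp
  with U show "U \<in> GLm N" "minv N U = madj N U" using minv_unique[of U N "madj N U"] by auto
qed

lemma GLm_iff_det: "A \<in> mats N \<Longrightarrow> A \<in> GLm N \<longleftrightarrow> Determinant.det (Matrix.mat N N A) \<noteq> 0"
proof
  assume "A \<in> mats N" "A \<in> GLm N"
  then have "Matrix.mat N N A * Matrix.mat N N (minv N A) = 1\<^sub>m N"
    using arg_cong[OF minv_GL(3), of A N "Matrix.mat N N"] by (simp only: Mat_mmul Mat_mid)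
  then have "Determinant.det (Matrix.mat N N A) * Determinant.det (Matrix.mat N N (minv N A)) = 1"
    using det_mult[of "Matrix.mat N N A" N "Matrix.mat N N (minv N A)"] by simp
  then show "Determinant.det (Matrix.mat N N A) \<noteq> 0" by auto
next
  let ?M = "Matrix.mat N N A" let ?d = "Determinant.det ?M"
  assume A: "A \<in> mats N" and d: "?d \<noteq> 0"
  define B where "B = restrict (\<lambda>ij. adj_mat ?M $$ ij / ?d) (sq N)"
  have B: "B \<in> mats N" by (auto simp: B_def mats_def)
  have adj: "adj_mat ?M \<in> carrier_mat N N" "?M * adj_mat ?M = ?d \<cdot>\<^sub>m 1\<^sub>m N"
    using adj_mat[of ?M N] by auto
  have "mmul N A B = mid N"
  proof (rule mats_ext[where N = N])
    fix i j assume ij: "i < N" "j < N"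
    have "mmul N A B (i,j) = (\<Sum>k<N. A (i,k) * adj_mat ?M $$ (k,j)) / ?d"
      using ij by (simp add: B_def sum_divide_distrib)
    also have "(\<Sum>k<N. A (i,k) * adj_mat ?M $$ (k,j)) = (?M * adj_mat ?M) $$ (i,j)"
      using ij adj(1) by (simp add: scalar_prod_def atLeast0LessThan)
    also have "\<dots> = (if i = j then ?d else 0)" unfolding adj(2) using ij by simp
    finally show "mmul N A B (i,j) = mid N (i,j)" using ij d by simp
  qed auto
  then show "A \<in> GLm N" using A B minv_unique[of A N B] by auto
qed

text \<open>Cramer's rule makes the inverse a quotient of polynomials in the entries, from which its
  continuity is read off.\<close>

lemma minv_adj_mat:
  assumes A: "A \<in> GLm N" and ij: "i < N" "j < N"
  shows "minv N A (i,j) = adj_mat (Matrix.mat N N A) $$ (i,j) / Determinant.det (Matrix.mat N N A)"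
proof -
  let ?M = "Matrix.mat N N A" let ?d = "Determinant.det ?M" let ?B = "Matrix.mat N N (minv N A)"
  have d: "?d \<noteq> 0" using A GLm_iff_det minv_GL by blast
  have adj: "adj_mat ?M \<in> carrier_mat N N" "?M * adj_mat ?M = ?d \<cdot>\<^sub>m 1\<^sub>m N"
    using adj_mat[of ?M N] by auto
  have B: "?B * ?M = 1\<^sub>m N"
    using arg_cong[OF minv_GL(4)[OF A], of "Matrix.mat N N"] by (simp only: Mat_mmul Mat_mid)
  have "adj_mat ?M = (?B * ?M) * adj_mat ?M" using adj B by simp
  also have "\<dots> = ?B * (?M * adj_mat ?M)" using adj by (intro assoc_mult_mat) auto
  also have "\<dots> = ?d \<cdot>\<^sub>m ?B" unfolding adj(2) by (metis mat_carrier mult_smult_distrib one_carrier_mat right_mult_one_mat)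
  finally show ?thesis using ij d by simp
qed

lemma tendsto_det:
  fixes M :: "'s \<Rightarrow> complex Matrix.mat"
  assumes c: "\<And>s. M s \<in> carrier_mat n n" "M0 \<in> carrier_mat n n"
    and e: "\<And>i j. i < n \<Longrightarrow> j < n \<Longrightarrow> ((\<lambda>s. M s $$ (i,j)) \<longlongrightarrow> M0 $$ (i,j)) F"
  shows "((\<lambda>s. Determinant.det (M s)) \<longlongrightarrow> Determinant.det M0) F"
  unfolding det_def'[OF c(1)] det_def'[OF c(2)]
proof (intro tendsto_sum tendsto_mult tendsto_prod tendsto_const e)
  fix p i assume "p \<in> {p. p permutes {0..<n}}" "i \<in> {0..<n}"
  then show "i < n" "p i < n" using permutes_in_image[of p "{0..<n}" i] by auto
qed

text \<open>An arbitrary filter and entrywise limits, because the same fact serves lines, planes,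
  exponential curves, sequences and the topology of the function space.\<close>

lemma tendsto_GL:
  assumes e: "\<And>i j. i < N \<Longrightarrow> j < N \<Longrightarrow> ((\<lambda>s. \<gamma> s (i,j)) \<longlongrightarrow> A (i,j)) F"
    and A: "A \<in> GLm N" and m: "\<And>s. \<gamma> s \<in> mats N"
  shows "\<forall>\<^sub>F s in F. \<gamma> s \<in> GLm N"
    "\<And>i j. i < N \<Longrightarrow> j < N \<Longrightarrow> ((\<lambda>s. minv N (\<gamma> s) (i,j)) \<longlongrightarrow> minv N A (i,j)) F"
proof -
  have d0: "Determinant.det (Matrix.mat N N A) \<noteq> 0" using A GLm_iff_det minv_GL by blast
  have td: "((\<lambda>s. Determinant.det (Matrix.mat N N (\<gamma> s))) \<longlongrightarrow> Determinant.det (Matrix.mat N N A)) F"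
    by (rule tendsto_det) (use e in auto)
  then show ev: "\<forall>\<^sub>F s in F. \<gamma> s \<in> GLm N"
    using tendsto_imp_eventually_ne[OF td d0] m GLm_iff_det by (auto elim: eventually_mono)
  fix i j assume ij: "i < N" "j < N"
  have "((\<lambda>s. adj_mat (Matrix.mat N N (\<gamma> s)) $$ (i,j)) \<longlongrightarrow> adj_mat (Matrix.mat N N A) $$ (i,j)) F"
  proof -
    have "((\<lambda>s. Determinant.det (mat_delete (Matrix.mat N N (\<gamma> s)) j i)) \<longlongrightarrow> Determinant.det (mat_delete (Matrix.mat N N A) j i)) F"
      by (rule tendsto_det[where n = "N - 1"]) (use ij in \<open>auto simp: mat_delete_def intro!: e\<close>)
    then show ?thesis using ij by (simp add: adj_mat_def cofactor_def tendsto_mult_left)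
  qed
  then have "((\<lambda>s. adj_mat (Matrix.mat N N (\<gamma> s)) $$ (i,j) / Determinant.det (Matrix.mat N N (\<gamma> s)))
      \<longlongrightarrow> minv N A (i,j)) F"
    unfolding minv_adj_mat[OF A ij] by (intro tendsto_divide td d0)
  then show "((\<lambda>s. minv N (\<gamma> s) (i,j)) \<longlongrightarrow> minv N A (i,j)) F"
    by (rule Lim_transform_eventually) (use ev ij in \<open>auto simp: minv_adj_mat elim!: eventually_mono\<close>)
qed

text \<open>Where g vanishes, continuity of f is enough for the product rule. This avoids a circle
  in differentiating the inverse, where one factor is the inverse itself.\<close>

lemma has_derivative_mult_vanishing:
  fixes f g :: "'k::real_normed_vector \<Rightarrow> complex"
  assumes f: "(f \<longlongrightarrow> f x) (at x)" and g: "(g has_derivative D) (at x)" and 0: "g x = 0"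
  shows "((\<lambda>s. f s * g s) has_derivative (\<lambda>h. f x * D h)) (at x)"
proof -
  have bl: "bounded_linear D" using g by (rule has_derivative_bounded_linear)
  obtain K where K: "\<And>h. norm (D h) \<le> norm h * K" using bounded_linear.bounded[OF bl] by blast
  have lim: "((\<lambda>y. norm (g y - g x - D (y - x)) / norm (y - x)) \<longlongrightarrow> 0) (at x)"
    using g by (simp add: has_derivative_iff_norm)
  have 1: "((\<lambda>y. norm (f y) * (norm (g y - D (y - x)) / norm (y - x)) + norm (f y - f x) * K) \<longlongrightarrow> norm (f x) * 0 + 0 * K) (at x)"
    using lim f 0 by (intro tendsto_add tendsto_mult tendsto_norm tendsto_const) (auto intro!: tendsto_norm_zero LIM_zero)
  have "((\<lambda>y. norm (f y * g y - f x * g x - f x * D (y - x)) / norm (y - x)) \<longlongrightarrow> 0) (at x)"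
  proof (rule tendsto_sandwich[of "\<lambda>_. 0"])
    show "\<forall>\<^sub>F y in at x. norm (f y * g y - f x * g x - f x * D (y - x)) / norm (y - x)
      \<le> norm (f y) * (norm (g y - D (y - x)) / norm (y - x)) + norm (f y - f x) * K"
      unfolding eventually_at_filter
    proof (rule always_eventually, intro allI impI)
      fix y assume y: "y \<noteq> x"
      have "f y * g y - f x * g x - f x * D (y - x) = f y * (g y - D (y - x)) + (f y - f x) * D (y - x)"
        using 0 by (simp add: algebra_simps)
      then have "norm (f y * g y - f x * g x - f x * D (y - x)) \<le> norm (f y) * norm (g y - D (y - x)) + norm (f y - f x) * (norm (y - x) * K)"
        using norm_triangle_ineq[of "f y * (g y - D (y - x))" "(f y - f x) * D (y - x)"] mult_left_mono[OF K[of "y - x"], of "norm (f y - f x)"]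
        by (simp add: norm_mult)
      then show "norm (f y * g y - f x * g x - f x * D (y - x)) / norm (y - x)
        \<le> norm (f y) * (norm (g y - D (y - x)) / norm (y - x)) + norm (f y - f x) * K"
        using y divide_right_mono[of _ _ "norm (y - x)"] by (fastforce simp: add_divide_distrib)
    qed
  qed (use 1 in auto)
  then show ?thesis unfolding has_derivative_iff_norm
    using bounded_linear_compose[OF bounded_linear_mult_right bl] by (auto simp: o_def)
qed

text \<open>The resolvent identity writes the increment of the inverse as inverse at s times
  increment of \<gamma> times inverse at x, and the middle factor vanishes at x. The parameter space
  is a general normed space: real for exponential curves, complex for holomorphic lines.\<close>

lemma minv_has_derivative:
  fixes \<gamma> :: "'k::real_normed_vector \<Rightarrow> cmat"
  assumes d: "\<And>i j. i < N \<Longrightarrow> j < N \<Longrightarrow> ((\<lambda>s. \<gamma> s (i,j)) has_derivative (\<lambda>h. D h (i,j))) (at x)"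
    and A: "\<gamma> x = A" "A \<in> GLm N" and m: "\<And>s. \<gamma> s \<in> mats N" and ij: "i < N" "j < N"
  shows "((\<lambda>s. minv N (\<gamma> s) (i,j)) has_derivative (\<lambda>h. - mmul N (mmul N (minv N A) (D h)) (minv N A) (i,j))) (at x)"
proof -
  have lim: "((\<lambda>s. \<gamma> s (i,j)) \<longlongrightarrow> A (i,j)) (at x)" if "i < N" "j < N" for i j
    using has_derivative_continuous[OF d[OF that]] A by (simp add: continuous_within)
  have ev: "\<forall>\<^sub>F s in at x. \<gamma> s \<in> GLm N" by (rule tendsto_GL(1)[OF lim A(2) m])
  have tg: "((\<lambda>s. minv N (\<gamma> s) (i,j)) \<longlongrightarrow> minv N A (i,j)) (at x)" if "i < N" "j < N" for i j
    by (rule tendsto_GL(2)[OF lim A(2) m that])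
  let ?B = "minv N A"
  have res: "minv N (\<gamma> s) (i,j) = ?B (i,j) - (\<Sum>k<N. (\<Sum>l<N. minv N (\<gamma> s) (i,l) * (\<gamma> s (l,k) - A (l,k))) * ?B (k,j))"
    if g: "\<gamma> s \<in> GLm N" for s
  proof -
    define E where "E = madd N (\<gamma> s) (mscale N (-1) A)"
    have "mmul N (mmul N (minv N (\<gamma> s)) E) ?B = madd N (mmul N (mmul N (minv N (\<gamma> s)) (\<gamma> s)) ?B)
        (mscale N (-1) (mmul N (minv N (\<gamma> s)) (mmul N A ?B)))"
      by (simp add: E_def mmul_madd_right mmul_madd_left mmul_assoc)
    also have "\<dots> = madd N ?B (mscale N (-1) (minv N (\<gamma> s)))" using minv_GL[OF g] minv_GL[OF A(2)] by simp
    finally have "mmul N (mmul N (minv N (\<gamma> s)) E) ?B (i,j) = ?B (i,j) - minv N (\<gamma> s) (i,j)" using ij by simp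
    then show ?thesis using ij by (simp add: E_def)
  qed
  have "((\<lambda>s. minv N (\<gamma> s) (i,l) * (\<gamma> s (l,k) - A (l,k))) has_derivative (\<lambda>h. ?B (i,l) * D h (l,k))) (at x)"
    if "l < N" "k < N" for l k
  proof -
    have "((\<lambda>s. \<gamma> s (l,k) - A (l,k)) has_derivative (\<lambda>h. D h (l,k))) (at x)"
      using has_derivative_diff[OF d[OF that] has_derivative_const[of "A (l,k)"]] by simp
    from has_derivative_mult_vanishing[OF _ this, of "\<lambda>s. minv N (\<gamma> s) (i,l)"] tg[of i l]
    show ?thesis using that ij A by simp
  qed
  then have "((\<lambda>s. ?B (i,j) - (\<Sum>k<N. (\<Sum>l<N. minv N (\<gamma> s) (i,l) * (\<gamma> s (l,k) - A (l,k))) * ?B (k,j)))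
     has_derivative (\<lambda>h. 0 - (\<Sum>k<N. (\<Sum>l<N. ?B (i,l) * D h (l,k)) * ?B (k,j)))) (at x)"
    by (intro has_derivative_diff has_derivative_const has_derivative_sum has_derivative_mult_left) auto
  then have "((\<lambda>s. minv N (\<gamma> s) (i,j)) has_derivative (\<lambda>h. 0 - (\<Sum>k<N. (\<Sum>l<N. ?B (i,l) * D h (l,k)) * ?B (k,j)))) (at x)"
  proof (rule has_derivative_transform_eventually)
    show "\<forall>\<^sub>F s in at x. ?B (i,j) - (\<Sum>k<N. (\<Sum>l<N. minv N (\<gamma> s) (i,l) * (\<gamma> s (l,k) - A (l,k))) * ?B (k,j)) = minv N (\<gamma> s) (i,j)"
      using ev by eventually_elim (rule res[symmetric])
    show "?B (i,j) - (\<Sum>k<N. (\<Sum>l<N. minv N (\<gamma> x) (i,l) * (\<gamma> x (l,k) - A (l,k))) * ?B (k,j)) = minv N (\<gamma> x) (i,j)"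
      using A by (intro res[symmetric]) simp
  qed simp
  then show ?thesis using ij by simp
qed

section \<open>The exponential curves exp(s X) A\<close>

lemma mpow_Suc: "mpow N A (Suc m) = mmul N A (mpow N A m)" "mpow N A 0 = mid N"
  by (simp_all add: mpow_def)

lemma mpow_mats [simp]: "mpow N A m \<in> mats N"
  by (cases m) (simp_all add: mpow_Suc)

lemma mpow_mscale: "mpow N (mscale N c X) m = mscale N (c ^ m) (mpow N X m)"
  by (induction m) (simp_all add: mpow_Suc mult.commute)

lemma mpow_bound:
  assumes "\<And>i j. i < N \<Longrightarrow> j < N \<Longrightarrow> cmod (X (i,j)) \<le> c" "i < N" "j < N"
  shows "cmod (mpow N X m (i,j)) \<le> (real N * c) ^ m"
  using assms(2,3)
proof (induction m arbitrary: i j)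
  case (Suc m)
  have "0 \<le> c" using order_trans[OF norm_ge_zero assms(1)[OF assms(2,3)]] .
  then have "cmod (\<Sum>k<N. X (i,k) * mpow N X m (k,j)) \<le> (\<Sum>k<N. c * (real N * c) ^ m)"
    using Suc assms(1) by (intro sum_norm_le) (auto simp: norm_mult intro!: mult_mono)
  then show ?case using Suc.prems by (simp add: mpow_Suc)
qed (simp add: mpow_Suc)

lemma mexp_has_derivative:
  assumes X: "X \<in> mats N" and ij: "i < N" "j < N"
  shows "((\<lambda>z. mexp N (mscale N z X) (i,j)) has_field_derivative X (i,j)) (at 0)"
    "mexp N (mscale N 0 X) (i,j) = mid N (i,j)"
proof -
  define a where "a m = mpow N X m (i,j) / fact m" for m
  have eq: "mexp N (mscale N z X) (i,j) = suminf (\<lambda>m. a m * z ^ m)" for z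
    using ij by (simp add: mexp_def mpow_mscale a_def mult.commute)
  define c where "c = (\<Sum>p\<in>sq N. cmod (X p))"
  have c: "cmod (X (i,j)) \<le> c" if "i < N" "j < N" for i j
    unfolding c_def by (rule member_le_sum) (use that in auto)
  have "summable (\<lambda>m. a m * of_real 1 ^ m)"
  proof (rule summable_comparison_test')
    show "summable (\<lambda>m. (real N * c) ^ m / fact m)" using summable_exp[of "real N * c"] by (simp add: field_simps)
    show "norm (a m * of_real 1 ^ m) \<le> (real N * c) ^ m / fact m" for m
      using mpow_bound[of N X c, OF c ij(1,2), where m = m] by (simp add: a_def norm_divide divide_right_mono)
  qed
  then have "((\<lambda>z. suminf (\<lambda>m. a m * z ^ m)) has_field_derivative suminf (\<lambda>m. diffs a m * 0 ^ m)) (at 0)"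
    by (rule termdiffs_strong) auto
  then show "((\<lambda>z. mexp N (mscale N z X) (i,j)) has_field_derivative X (i,j)) (at 0)"
    unfolding eq powser_zero using X by (simp add: diffs_def a_def mpow_Suc)
  show "mexp N (mscale N 0 X) (i,j) = mid N (i,j)"
    unfolding eq powser_zero by (simp add: a_def mpow_Suc)
qed

abbreviation mexpc :: "nat \<Rightarrow> cmat \<Rightarrow> cmat \<Rightarrow> real \<Rightarrow> cmat" where
  "mexpc N X A s \<equiv> mmul N (mexp N (mscale N (complex_of_real s) X)) A"

lemma mexpc_vector_derivative:
  assumes X: "X \<in> mats N" and ij: "i < N" "j < N"
  shows "((\<lambda>s. mexpc N X A s (i,j)) has_vector_derivative mmul N X A (i,j)) (at 0)"
proof -
  have "((\<lambda>s. mexp N (mscale N (complex_of_real s) X) (i,k)) has_vector_derivative X (i,k)) (at 0)" if "k < N" for k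
    by (rule has_vector_derivative_real_field) (use mexp_has_derivative(1)[OF X ij(1) that] in simp)
  then show ?thesis using ij
    by (auto intro!: has_vector_derivative_sum has_vector_derivative_mult_left)
qed

lemma mexpc_0:
  assumes "X \<in> mats N" "A \<in> mats N"
  shows "mexpc N X A 0 = A"
proof -
  have "mexp N (mscale N 0 X) = mid N"
    by (rule mats_ext[where N = N]) (use mexp_has_derivative(2)[OF assms(1)] in auto)
  then show ?thesis using assms by simp
qed

section \<open>Uniqueness of holomorphic extension from the unitary group\<close>

definition line_holo :: "nat \<Rightarrow> (cmat \<Rightarrow> complex) \<Rightarrow> bool" where
  "line_holo N H \<longleftrightarrow> (\<forall>A\<in>GLm N. \<forall>E\<in>mats N. (\<lambda>z. H (madd N A (mscale N z E))) field_differentiable (at 0))"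

lemma field_differentiable_shift:
  fixes f :: "complex \<Rightarrow> complex"
  assumes "(\<lambda>h. f (h + x)) field_differentiable (at 0)"
  shows "f field_differentiable (at x)"
  using assms DERIV_shift[of f _ 0 x] by (auto simp: field_differentiable_def)

lemma GLm_open_plane:
  assumes A: "A \<in> GLm N"
  shows "\<exists>R>0. \<forall>z w. cmod z < R \<longrightarrow> cmod w < R \<longrightarrow> madd N (madd N A (mscale N z E1)) (mscale N w E2) \<in> GLm N"
proof -
  define \<gamma> where "\<gamma> p = madd N (madd N A (mscale N (fst p) E1)) (mscale N (snd p) E2)" for p
  have "\<forall>\<^sub>F p in nhds (0,0). \<gamma> p \<in> GLm N"
  proof (rule tendsto_GL(1)[OF _ A])
    fix i j assume "i < N" "j < N"
    moreover have "((\<lambda>p::complex\<times>complex. A (i,j) + fst p * E1 (i,j) + snd p * E2 (i,j)) \<longlongrightarrow> A (i,j)) (nhds (0,0))"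
      by (rule tendsto_eq_intros tendsto_fst tendsto_snd filterlim_ident refl | simp)+
    ultimately show "((\<lambda>p. \<gamma> p (i,j)) \<longlongrightarrow> A (i,j)) (nhds (0,0))" by (simp add: \<gamma>_def)
  qed (simp add: \<gamma>_def)
  then obtain d where d: "d > 0" "\<And>p. dist p (0,0) < d \<Longrightarrow> \<gamma> p \<in> GLm N" unfolding eventually_nhds_metric by blast
  show ?thesis
  proof (intro exI[of _ "d/2"] conjI allI impI)
    fix z w :: complex assume "cmod z < d/2" "cmod w < d/2"
    then have "norm (z,w) < d" using norm_Pair_le[of z w] by simp
    then show "madd N (madd N A (mscale N z E1)) (mscale N w E2) \<in> GLm N" using d(2)[of "(z,w)"] by (simp add: \<gamma>_def dist_norm zero_prod_def[symmetric])
  qed (use d in simp)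
qed

text \<open>Induction on the set of entries where the direction E may be nonzero. A new entry adds
  one matrix unit, and the line in question is the diagonal of the plane spanned by the old
  direction and this unit; \<open>hartogs_diagonal\<close> asks for holomorphy in these two
  directions separately.\<close>

theorem holoGL_line_holo:
  assumes H: "holoGL N H"
  shows "line_holo N H"
proof -
  have "\<forall>A\<in>GLm N. \<forall>E\<in>mats N. (\<forall>p\<in>sq N - S. E p = 0) \<longrightarrow> (\<lambda>z. H (madd N A (mscale N z E))) field_differentiable (at 0)"
    if "finite S" "S \<subseteq> sq N" for S
    using that
  proof (induction S rule: finite_induct)
    case empty
    have "(\<lambda>z. H (madd N A (mscale N z E))) = (\<lambda>z. H A)" if "A \<in> GLm N" "\<forall>p\<in>sq N - {}. E p = 0" for A E
    proof
      fix z have "madd N A (mscale N z E) = A"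
        by (rule mats_ext[where N = N]) (use that minv_GL in auto)
      then show "H (madd N A (mscale N z E)) = H A" by simp
    qed
    then show ?case by auto
  next
    case (insert p S)
    show ?case
    proof (intro ballI impI)
      fix A E assume A: "A \<in> GLm N" and E: "E \<in> mats N" "\<forall>q\<in>sq N - insert p S. E q = 0"
      obtain i j where p: "p = (i,j)" by fastforce
      have ij: "i < N" "j < N" using insert.prems p by auto
      define E' where "E' = E(p := 0)"
      have E': "E' \<in> mats N" using E p ij by (auto simp: E'_def mats_def PiE_def extensional_def)
      have E'0: "\<forall>q\<in>sq N - S. E' q = 0" using E by (auto simp: E'_def)
      define F where "F = mscale N (E p) (matunit N i j)"
      have F: "F \<in> mats N" by (simp add: F_def)
      define \<gamma> where "\<gamma> z w = madd N (madd N A (mscale N z E')) (mscale N w F)" for z w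
      obtain R where R: "R > 0" "\<And>z w. cmod z < R \<Longrightarrow> cmod w < R \<Longrightarrow> \<gamma> z w \<in> GLm N"
        using GLm_open_plane[OF A, of E' F] unfolding \<gamma>_def by blast
      have 1: "madd N (\<gamma> z w) (mscale N h E') = \<gamma> (h + z) w" for z w h
        by (rule mats_ext[where N = N]) (auto simp: \<gamma>_def algebra_simps)
      have 2: "madd N (\<gamma> z w) (mscale N (E p * h) (matunit N i j)) = \<gamma> z (h + w)" for z w h
        by (rule mats_ext[where N = N]) (auto simp: \<gamma>_def F_def algebra_simps)
      have "(\<lambda>z. H (\<gamma> z z)) field_differentiable (at 0)"
      proof (rule hartogs_diagonal[OF R(1), where g = "\<lambda>z w. H (\<gamma> z w)"])
        fix w :: complex assume w: "w \<in> ball 0 R"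
        have "(\<lambda>z. H (\<gamma> z w)) field_differentiable (at z)" if "z \<in> ball 0 R" for z
        proof (rule field_differentiable_shift)
          have "\<gamma> z w \<in> GLm N" using R w that by simp
          then have "(\<lambda>h. H (madd N (\<gamma> z w) (mscale N h E'))) field_differentiable (at 0)"
            using insert.IH insert.prems E' E'0 by blast
          then show "(\<lambda>h. H (\<gamma> (h + z) w)) field_differentiable (at 0)" unfolding 1 .
        qed
        then show "(\<lambda>z. H (\<gamma> z w)) holomorphic_on ball 0 R"
          by (simp add: holomorphic_on_def field_differentiable_at_within)
        have "(\<lambda>z. H (\<gamma> w z)) field_differentiable (at z)" if "z \<in> ball 0 R" for z
        proof (rule field_differentiable_shift)
          have "\<gamma> w z \<in> GLm N" using R w that by simp
          then have "(\<lambda>h. H (madd N (\<gamma> w z) (mscale N h (matunit N i j)))) field_differentiable (at (E p * 0))"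
            using H ij by (simp add: holoGL_def)
          from field_differentiable_compose[where f = "\<lambda>h. E p * h" and z = 0, OF _ this]
          show "(\<lambda>h. H (\<gamma> w (h + z))) field_differentiable (at 0)" by (simp add: o_def 2 field_differentiable_linear)
        qed
        then show "(\<lambda>z. H (\<gamma> w z)) holomorphic_on ball 0 R"
          by (simp add: holomorphic_on_def field_differentiable_at_within)
      qed
      moreover have "\<gamma> z z = madd N A (mscale N z E)" for z
        by (rule mats_ext[where N = N]) (auto simp: \<gamma>_def F_def E'_def p algebra_simps)
      ultimately show "(\<lambda>z. H (madd N A (mscale N z E))) field_differentiable (at 0)" by simp
    qed
  qed
  from this[of "sq N"] show ?thesis unfolding line_holo_def by auto
qed

lemma line_holo_at:
  assumes "line_holo N H" "E \<in> mats N" "madd N A (mscale N z E) \<in> GLm N"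
  shows "(\<lambda>z. H (madd N A (mscale N z E))) field_differentiable (at z)"
proof (rule field_differentiable_shift)
  have "madd N (madd N A (mscale N z E)) (mscale N h E) = madd N A (mscale N (h + z) E)" for h
    by (rule mats_ext[where N = N]) (auto simp: algebra_simps)
  moreover have "(\<lambda>h. H (madd N (madd N A (mscale N z E)) (mscale N h E))) field_differentiable (at 0)"
    using assms by (auto simp: line_holo_def)
  ultimately show "(\<lambda>h. H (madd N A (mscale N (h + z) E))) field_differentiable (at 0)" by simp
qed

text \<open>Not density in a topology: these are the g for which vanishing on the unitary group
  implies vanishing on its left translate by g. Since H ranges over a class stable under left
  translation, the set is closed under products and generators of GL_N suffice.\<close>

definition unitary_dense :: "nat \<Rightarrow> cmat set" where
  "unitary_dense N = {g\<in>GLm N. \<forall>H. line_holo N H \<longrightarrow> (\<forall>U\<in>Um N. H U = 0) \<longrightarrow> (\<forall>U\<in>Um N. H (mmul N g U) = 0)}"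

lemma line_holo_translate:
  assumes "line_holo N H" "g \<in> GLm N"
  shows "line_holo N (\<lambda>A. H (mmul N g A))"
proof -
  have "mmul N g (madd N A (mscale N z E)) = madd N (mmul N g A) (mscale N z (mmul N g E))" for A z E
    by (simp add: mmul_madd_right)
  then show ?thesis using assms GLm_mmul(1) by (simp add: line_holo_def)
qed

lemma unitary_dense_mmul:
  assumes "g \<in> unitary_dense N" "h \<in> unitary_dense N"
  shows "mmul N g h \<in> unitary_dense N"
  unfolding unitary_dense_def
proof (intro CollectI conjI allI impI ballI)
  have gh: "g \<in> GLm N" "h \<in> GLm N" using assms by (auto simp: unitary_dense_def)
  then show "mmul N g h \<in> GLm N" by (rule GLm_mmul)
  fix H U assume H: "line_holo N H" "\<forall>U\<in>Um N. H U = 0" and U: "U \<in> Um N"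
  have "H (mmul N g (mmul N h U)) = 0"
    using assms(2) line_holo_translate[OF H(1) gh(1)] assms(1) H U unfolding unitary_dense_def by blast
  then show "H (mmul N (mmul N g h) U) = 0" by (simp add: mmul_assoc)
qed

lemma Um_mmul: "U \<in> Um N \<Longrightarrow> V \<in> Um N \<Longrightarrow> mmul N U V \<in> Um N"
proof -
  assume a: "U \<in> Um N" "V \<in> Um N"
  have "mmul N (madj N (mmul N U V)) (mmul N U V) = mmul N (madj N V) (mmul N (mmul N (madj N U) U) V)"
    by (simp add: madj_mmul mmul_assoc)
  then show ?thesis using a by (simp add: Um_def)
qed

lemma Um_unitary_dense: "U \<in> Um N \<Longrightarrow> U \<in> unitary_dense N"
  using Um_mmul Um_GLm unfolding unitary_dense_def by blast

text \<open>z -> 1 + (z - 1) P is multiplicative from the nonzero complex numbers to GL_N and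
  unitary on the unit circle. Along it a line-holomorphic function is holomorphic in the punctured
  plane and vanishes on the circle, hence everywhere.\<close>

lemma projection_unitary_dense:
  assumes P: "P \<in> mats N" "madj N P = P" "mmul N P P = P" and z: "z \<noteq> 0"
  shows "madd N (mid N) (mscale N (z - 1) P) \<in> unitary_dense N"
proof -
  define g where "g z = madd N (mid N) (mscale N (z - 1) P)" for z
  have gm: "mmul N (g z) (g w) = g (z * w)" for z w
  proof -
    have "mmul N (g z) (g w) = madd N (madd N (mid N) (mscale N (z - 1) P)) (mscale N (w - 1) (madd N P (mscale N (z - 1) P)))"
      using P by (simp add: g_def mmul_madd_left mmul_madd_right)
    also have "\<dots> = g (z * w)" by (rule mats_ext[where N = N]) (auto simp: g_def algebra_simps)
    finally show ?thesis .
  qed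
  have g1: "g 1 = mid N" by (rule mats_ext[where N = N]) (auto simp: g_def)
  have gm': "g z \<in> mats N" for z by (simp add: g_def)
  have gGL: "g z \<in> GLm N" if "z \<noteq> 0" for z
    using minv_unique(1)[OF gm' gm', of z "1/z"] gm[of z "1/z"] g1 that by simp
  have "madj N (g z) = madd N (mid N) (mscale N (cnj z - 1) (madj N P))" for z
    by (rule mats_ext[where N = N]) (auto simp: g_def)
  then have adj: "madj N (g z) = g (cnj z)" for z using P(2) by (simp add: g_def)
  have gU: "g z \<in> Um N" if "cmod z = 1" for z
  proof -
    have "cnj z * z = 1" using that by (metis complex_norm_square mult.commute of_real_1 one_power2)
    then show ?thesis using gm' adj gm g1 by (simp add: Um_def)
  qed
  have "g z \<in> unitary_dense N"
    unfolding unitary_dense_def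
  proof (intro CollectI conjI allI impI ballI)
    show "g z \<in> GLm N" by (rule gGL[OF z])
    fix H U assume H: "line_holo N H" "\<forall>U\<in>Um N. H U = 0" and U: "U \<in> Um N"
    define A where "A = madd N U (mscale N (-1) (mmul N P U))"
    have eq: "mmul N (g z) U = madd N A (mscale N z (mmul N P U))" for z
      using U by (intro mats_ext[where N = N]) (auto simp: g_def mmul_madd_left A_def Um_def algebra_simps)
    have hol: "(\<lambda>z. H (mmul N (g z) U)) holomorphic_on (- {0})"
      unfolding holomorphic_on_def
    proof
      fix z :: complex assume "z \<in> - {0}"
      then have "mmul N (g z) U \<in> GLm N" using gGL U Um_GLm GLm_mmul by auto
      then show "(\<lambda>z. H (mmul N (g z) U)) field_differentiable (at z within - {0})"
        unfolding eq by (rule field_differentiable_at_within[OF line_holo_at[OF H(1) mats_closed(1)]])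
    qed
    have conn: "connected (- {0::complex})" by (rule connected_punctured_universe) simp
    have lim: "1 islimpt sphere (0::complex) 1"
    proof (rule connected_imp_perfect)
      show "connected (sphere (0::complex) 1)" by (rule connected_sphere) simp
      show "sphere (0::complex) 1 \<noteq> {a}" for a
      proof
        assume a: "sphere (0::complex) 1 = {a}"
        have "1 \<in> sphere (0::complex) 1" "-1 \<in> sphere (0::complex) 1" by auto
        then show False unfolding a by auto
      qed
    qed simp
    show "H (mmul N (g z) U) = 0"
    proof (rule analytic_continuation[OF hol _ conn _ _ lim])
      show "H (mmul N (g z) U) = 0" if "z \<in> sphere 0 1" for z
        using H(2) Um_mmul[OF gU U] that by simp
    qed (use z in auto)
  qed
  then show ?thesis by (simp add: g_def)
qed

text \<open>A 2 x 2 block in rows and columns i, j and the scalar e on the rest of the diagonal: e =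
  1 for group elements, e = 0 for projections supported in the block.\<close>

definition blk :: "nat \<Rightarrow> nat \<Rightarrow> nat \<Rightarrow> complex \<Rightarrow> complex \<Rightarrow> complex \<Rightarrow> complex \<Rightarrow> complex \<Rightarrow> cmat" where
  "blk N i j e a b c d = restrict (\<lambda>(k,l). if k = i \<and> l = i then a else if k = i \<and> l = j then b
     else if k = j \<and> l = i then c else if k = j \<and> l = j then d else if k = l then e else 0) (sq N)"

lemma blk_mats [simp]: "blk N i j e a b c d \<in> mats N"
  by (simp add: blk_def mats_def restrict_def PiE_def Pi_def extensional_def)

lemma blk_nth: "k < N \<Longrightarrow> l < N \<Longrightarrow> blk N i j e a b c d (k,l) = (if k = i \<and> l = i then a else if k = i \<and> l = j then b
     else if k = j \<and> l = i then c else if k = j \<and> l = j then d else if k = l then e else 0)"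
  by (simp add: blk_def)

lemma blk_mmul_nth:
  assumes ij: "i < N" "j < N" "i \<noteq> j" and kl: "k < N" "l < N"
  shows "mmul N (blk N i j e a b c d) A (k,l) =
    (if k = i then a * A (i,l) + b * A (j,l) else if k = j then c * A (i,l) + d * A (j,l) else e * A (k,l))"
proof -
  have "(\<Sum>m<N. blk N i j e a b c d (k,m) * A (m,l)) = (\<Sum>m\<in>(if k = i \<or> k = j then {i,j} else {k}). blk N i j e a b c d (k,m) * A (m,l))"
    by (rule sum.mono_neutral_right) (use ij kl in \<open>auto simp: blk_nth split: if_splits\<close>)
  then show ?thesis using ij kl by (auto simp: blk_nth)
qed

lemma blk_mmul:
  assumes "i < N" "j < N" "i \<noteq> j"
  shows "mmul N (blk N i j e a b c d) (blk N i j e' a' b' c' d') =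
    blk N i j (e*e') (a*a' + b*c') (a*b' + b*d') (c*a' + d*c') (c*b' + d*d')"
  by (rule mats_ext[where N = N]) (use assms in \<open>auto simp: blk_mmul_nth blk_nth simp del: mat_nth(1)\<close>)

lemma blk_adj: "i \<noteq> j \<Longrightarrow> madj N (blk N i j e a b c d) = blk N i j (cnj e) (cnj a) (cnj c) (cnj b) (cnj d)"
  by (rule mats_ext[where N = N]) (auto simp: blk_nth)

lemma blk_mid: "mid N = blk N i j 1 1 0 0 1"
  by (rule mats_ext[where N = N]) (auto simp: blk_nth)

text \<open>The scalar equations say that the block with rows (a, b) and (c, d) is self-adjoint and
  idempotent.\<close>

lemma blk_projection_unitary_dense:
  assumes ij: "i < N" "j < N" "i \<noteq> j" and "cnj a = a" "cnj d = d" "c = cnj b"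
    "a*a + b*c = a" "a*b + b*d = b" "c*a + d*c = c" "c*b + d*d = d" "z \<noteq> 0"
  shows "blk N i j 1 (1 + (z-1)*a) ((z-1)*b) ((z-1)*c) (1 + (z-1)*d) \<in> unitary_dense N"
proof -
  have "madd N (mid N) (mscale N (z - 1) (blk N i j 0 a b c d)) \<in> unitary_dense N"
  proof (rule projection_unitary_dense)
    show "madj N (blk N i j 0 a b c d) = blk N i j 0 a b c d" using assms(4-6) by (simp add: blk_adj[OF ij(3)])
    show "mmul N (blk N i j 0 a b c d) (blk N i j 0 a b c d) = blk N i j 0 a b c d"
      by (simp only: blk_mmul[OF ij] assms(7-10) mult_zero_left)
  qed (use assms(11) in simp_all)
  moreover have "madd N (mid N) (mscale N (z - 1) (blk N i j 0 a b c d)) = blk N i j 1 (1 + (z-1)*a) ((z-1)*b) ((z-1)*c) (1 + (z-1)*d)"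
  proof (rule mats_ext[where N = N])
    fix k l assume "k < N" "l < N"
    then show "madd N (mid N) (mscale N (z - 1) (blk N i j 0 a b c d)) (k,l) = blk N i j 1 (1 + (z-1)*a) ((z-1)*b) ((z-1)*c) (1 + (z-1)*d) (k,l)"
      using ij(3) by (cases "k = i"; cases "k = j"; cases "l = i"; cases "l = j") (simp_all add: blk_nth)
  qed auto
  ultimately show ?thesis by (simp only:)
qed

lemma diag_unitary_dense:
  assumes "i < N" "j < N" "i \<noteq> j" "a \<noteq> 0"
  shows "blk N i j 1 a 0 0 1 \<in> unitary_dense N"
  using blk_projection_unitary_dense[of i N j 1 0 0 0 a] assms by simp

text \<open>The transvection with entry 3/2 has singular values 2 and 1/2, with rational singular projections.\<close>
lemma transvection_unitary_dense:
  assumes ij: "i < N" "j < N" "i \<noteq> j"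
  shows "blk N i j 1 1 a 0 1 \<in> unitary_dense N"
proof (cases "a = 0")
  case True
  have "mid N \<in> unitary_dense N" by (rule Um_unitary_dense) (simp add: Um_def)
  then show ?thesis using True blk_mid[of N i j] by simp
next
  case False
  \<comment> \<open>Polar decomposition: the unitary factor is the rotation with cosine 4/5, and the
    positive factor is 2 Q + (1/2) (1 - Q) on the block, where Q has entries 1/5, 2/5, 2/5,
    4/5.\<close>
  let ?W = "blk N i j 1 (4/5) (3/5) (-3/5) (4/5)"
  have W: "?W \<in> unitary_dense N"
    by (rule Um_unitary_dense) (use ij in \<open>simp add: Um_def blk_adj blk_mmul blk_mid[of N i j]\<close>)
  have P1: "blk N i j 1 (6/5) (2/5) (2/5) (9/5) \<in> unitary_dense N"
    using blk_projection_unitary_dense[OF ij, of "1/5" "4/5" "2/5" "2/5" 2] by simp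
  have P2: "blk N i j 1 (3/5) (1/5) (1/5) (9/10) \<in> unitary_dense N"
    using blk_projection_unitary_dense[OF ij, of "4/5" "1/5" "-2/5" "-2/5" "1/2"] by simp
  have "mmul N ?W (mmul N (blk N i j 1 (6/5) (2/5) (2/5) (9/5)) (blk N i j 1 (3/5) (1/5) (1/5) (9/10))) = blk N i j 1 1 (3/2) 0 1"
    using ij by (simp add: blk_mmul)
  then have T: "blk N i j 1 1 (3/2) 0 1 \<in> unitary_dense N"
    using unitary_dense_mmul[OF W unitary_dense_mmul[OF P1 P2]] by simp
  \<comment> \<open>Conjugation by diag(c, 1) multiplies the corner entry by c, so c = 2 a / 3 turns
    3/2 into a.\<close>
  have "mmul N (blk N i j 1 (2*a/3) 0 0 1) (mmul N (blk N i j 1 1 (3/2) 0 1) (blk N i j 1 (3/(2*a)) 0 0 1)) = blk N i j 1 1 a 0 1"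
    using ij False by (simp add: blk_mmul)
  then show ?thesis
    using unitary_dense_mmul[OF diag_unitary_dense[OF ij, of "2*a/3"] unitary_dense_mmul[OF T diag_unitary_dense[OF ij, of "3/(2*a)"]]] False by simp
qed

text \<open>Row operations can be undone inside \<open>unitary_dense\<close>: the inverse of the
  matrix with block rows (a, b) and (0, 1) is diag(1/a, 1) times a transvection. Gaussian
  elimination thus proves membership backwards, from the reduced matrix.\<close>

lemma unitary_dense_cancel:
  assumes ij: "i < N" "j < N" "i \<noteq> j" and a: "a \<noteq> 0" and A: "A \<in> mats N"
    and "mmul N (blk N i j 1 a b 0 1) A \<in> unitary_dense N"
  shows "A \<in> unitary_dense N"
proof -
  have "mmul N (blk N i j 1 1 (- b) 0 1) (mmul N (blk N i j 1 a b 0 1) A) \<in> unitary_dense N"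
    by (rule unitary_dense_mmul[OF transvection_unitary_dense[OF ij] assms(6)])
  from unitary_dense_mmul[OF diag_unitary_dense[OF ij, of "1/a"] this] a
  have "mmul N (mmul N (blk N i j 1 (1/a) 0 0 1) (mmul N (blk N i j 1 1 (- b) 0 1) (blk N i j 1 a b 0 1))) A \<in> unitary_dense N"
    by (simp add: mmul_assoc)
  moreover have "mmul N (blk N i j 1 (1/a) 0 0 1) (mmul N (blk N i j 1 1 (- b) 0 1) (blk N i j 1 a b 0 1)) = mid N"
    using ij a by (simp add: blk_mmul blk_mid[of N i j])
  ultimately show ?thesis using A by simp
qed


definition first_cols_unit :: "nat \<Rightarrow> nat \<Rightarrow> cmat \<Rightarrow> bool" where
  "first_cols_unit N k A \<longleftrightarrow> (\<forall>j<k. \<forall>i<N. A (i,j) = (if i = j then 1 else 0))"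

lemma blk_GLm: "i < N \<Longrightarrow> j < N \<Longrightarrow> i \<noteq> j \<Longrightarrow> a \<noteq> 0 \<Longrightarrow> blk N i j 1 a b 0 1 \<in> GLm N"
  using minv_unique(1)[of "blk N i j 1 a b 0 1" N "blk N i j 1 (1/a) (-b/a) 0 1"] by (simp add: blk_mmul blk_mid[of N i j])

lemma eliminate_column:
  assumes IH: "\<And>A. A \<in> GLm N \<Longrightarrow> first_cols_unit N (Suc k) A \<Longrightarrow> A \<in> unitary_dense N"
    and k: "k < N" and F: "finite F" "F \<subseteq> {..<N} - {k}"
    and A: "A \<in> GLm N" "first_cols_unit N k A" "A (k,k) = 1" "\<forall>i<N. i \<noteq> k \<longrightarrow> i \<notin> F \<longrightarrow> A (i,k) = 0"
  shows "A \<in> unitary_dense N"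
  using F A
proof (induction F arbitrary: A rule: finite_induct)
  case empty
  then have "first_cols_unit N (Suc k) A" unfolding first_cols_unit_def by (auto simp: less_Suc_eq)
  then show ?case using IH empty by blast
next
  case (insert i F)
  have ik: "i < N" "i \<noteq> k" using insert.prems by auto
  let ?T = "blk N i k 1 1 (- A (i,k)) 0 1"
  let ?B = "mmul N ?T A"
  have e: "?B (r,l) = (if r = i then A (i,l) - A (i,k) * A (k,l) else A (r,l))" if "r < N" "l < N" for r l
    using that ik k by (simp add: blk_mmul_nth del: mat_nth(1))
  have "?B \<in> unitary_dense N"
  proof (rule insert.IH)
    show "?B \<in> GLm N" using GLm_mmul blk_GLm ik k insert.prems by simp
    show "first_cols_unit N k ?B" using insert.prems(3) k by (auto simp: first_cols_unit_def e simp del: mat_nth(1))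
    show "?B (k,k) = 1" using insert.prems(4) k ik by (simp add: e del: mat_nth(1))
    show "\<forall>r<N. r \<noteq> k \<longrightarrow> r \<notin> F \<longrightarrow> ?B (r,k) = 0" using insert.prems k by (simp add: e del: mat_nth(1))
  qed (use insert.prems in auto)
  then show ?case using unitary_dense_cancel[of i N k 1 A "- A (i,k)"] ik k insert.prems minv_GL by simp
qed

lemma GLm_unitary_dense_aux:
  assumes "A \<in> GLm N" "first_cols_unit N (N - n) A" "n \<le> N"
  shows "A \<in> unitary_dense N"
  using assms
proof (induction n arbitrary: A)
  case 0
  then have "A = mid N" by (intro mats_ext[where N = N]) (use minv_GL in \<open>auto simp: first_cols_unit_def\<close>)
  moreover have "mid N \<in> unitary_dense N" by (rule Um_unitary_dense) (simp add: Um_def)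
  ultimately show ?case by simp
next
  case (Suc n)
  define k where "k = N - Suc n"
  have k: "k < N" "N - n = Suc k" using Suc.prems by (auto simp: k_def)
  note fc = Suc.prems(2)[folded k_def]
  have IH: "A \<in> unitary_dense N" if "A \<in> GLm N" "first_cols_unit N (Suc k) A" for A
    using Suc.IH[of A] that k Suc.prems by simp
  have unit: "A \<in> unitary_dense N" if "A \<in> GLm N" "first_cols_unit N k A" "A (k,k) = 1" for A
    by (rule eliminate_column[OF IH k(1), of "{..<N} - {k}"]) (use that in auto)
  have pivot: "A \<in> unitary_dense N" if A: "A \<in> GLm N" "first_cols_unit N k A" "A (k,k) \<noteq> 0" for A
  \<comment> \<open>A single index admits no \<open>blk\<close>; the scalar is then 1 + (z - 1) P
    with P the identity.\<close>
  proof (cases "N = 1")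
    case True
    have "A = madd N (mid N) (mscale N (A (0,0) - 1) (mid N))"
      by (rule mats_ext[where N = N]) (use A minv_GL True in auto)
    moreover have "madd N (mid N) (mscale N (A (0,0) - 1) (mid N)) \<in> unitary_dense N"
      by (rule projection_unitary_dense) (use A True k in auto)
    ultimately show ?thesis by simp
  next
    case False
    then obtain j where j: "j < N" "j \<noteq> k" using k by (metis One_nat_def Suc_lessI less_one nat_neq_iff not_less_zero zero_less_Suc)
    let ?T = "blk N k j 1 (1 / A (k,k)) 0 0 1"
    have e: "mmul N ?T A (r,l) = (if r = k then A (k,l) / A (k,k) else A (r,l))" if "r < N" "l < N" for r l
      using that j k by (simp add: blk_mmul_nth del: mat_nth(1))
    have "mmul N ?T A \<in> unitary_dense N"
    proof (rule unit)
      show "mmul N ?T A \<in> GLm N" using GLm_mmul blk_GLm j k A by simp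
      show "first_cols_unit N k (mmul N ?T A)" using A(2) k by (auto simp: first_cols_unit_def e simp del: mat_nth(1))
      show "mmul N ?T A (k,k) = 1" using A(3) k by (simp add: e del: mat_nth(1))
    qed
    then show ?thesis using unitary_dense_cancel[of k N j "1 / A (k,k)" A 0] j k A minv_GL by simp
  qed
  \<comment> \<open>Otherwise column k would be a combination of the first k columns, which are unit
    vectors, and applying the inverse would give 0 = 1 in position (k,k).\<close>
  have "\<exists>p<N. p \<ge> k \<and> A (p,k) \<noteq> 0"
  proof (rule ccontr)
    assume "\<not> (\<exists>p<N. p \<ge> k \<and> A (p,k) \<noteq> 0)"
    then have z: "\<And>p. p < N \<Longrightarrow> p \<ge> k \<Longrightarrow> A (p,k) = 0" by blast
    have col: "A (m,k) = (\<Sum>i<k. A (i,k) * A (m,i))" if "m < N" for m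
    proof -
      have "(\<Sum>i<k. A (i,k) * A (m,i)) = (\<Sum>i<k. if m = i then A (i,k) else 0)"
        using fc that by (intro sum.cong) (auto simp: first_cols_unit_def)
      then show ?thesis using z[of m] that by (simp add: not_less)
    qed
    let ?B = "minv N A"
    have inv: "(\<Sum>m<N. ?B (i,m) * A (m,j)) = (if i = j then 1 else 0)" if "i < N" "j < N" for i j
      using minv_GL(4)[OF Suc.prems(1)] mat_nth(1,2)[OF that] by metis
    have "1 = (\<Sum>m<N. ?B (k,m) * A (m,k))" using inv[of k k] k by simp
    also have "\<dots> = (\<Sum>m<N. \<Sum>i<k. A (i,k) * (?B (k,m) * A (m,i)))"
      by (intro sum.cong refl) (subst col, auto simp: sum_distrib_left mult_ac)
    also have "\<dots> = (\<Sum>i<k. A (i,k) * (\<Sum>m<N. ?B (k,m) * A (m,i)))"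
      by (subst sum.swap) (simp add: sum_distrib_left)
    also have "\<dots> = 0" using inv k by (intro sum.neutral) auto
    finally show False by simp
  qed
  then obtain p where p: "p < N" "p \<ge> k" "A (p,k) \<noteq> 0" by blast
  show ?case
  proof (cases "A (k,k) = 0")
    case False
    then show ?thesis using pivot Suc.prems fc by blast
  next
    case True
    then have pk: "p > k" using p by (metis le_neq_implies_less)
    let ?T = "blk N k p 1 1 1 0 1"
    have e: "mmul N ?T A (r,l) = (if r = k then A (k,l) + A (p,l) else A (r,l))" if "r < N" "l < N" for r l
      using that p pk k by (simp add: blk_mmul_nth del: mat_nth(1))
    have "mmul N ?T A \<in> unitary_dense N"
    proof (rule pivot)
      show "mmul N ?T A \<in> GLm N" using GLm_mmul blk_GLm p pk k Suc.prems by simp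
      show "first_cols_unit N k (mmul N ?T A)" using fc k p pk by (auto simp: first_cols_unit_def e simp del: mat_nth(1))
      show "mmul N ?T A (k,k) \<noteq> 0" using True p k by (simp add: e del: mat_nth(1))
    qed
    then show ?thesis using unitary_dense_cancel[of k N p 1 A 1] p pk k Suc.prems minv_GL by simp
  qed
qed

theorem holoGL_zero_on_Um:
  assumes "holoGL N H" "\<And>U. U \<in> Um N \<Longrightarrow> H U = 0" "A \<in> GLm N"
  shows "H A = 0"
proof -
  have "A \<in> unitary_dense N" by (rule GLm_unitary_dense_aux[of A N N]) (use assms in \<open>auto simp: first_cols_unit_def\<close>)
  then have "H (mmul N A (mid N)) = 0"
    using assms holoGL_line_holo[OF assms(1)] unfolding unitary_dense_def by (auto simp: Um_def)
  then show ?thesis using assms minv_GL by simp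
qed

lemma holoGL_unique:
  assumes F: "holoGL N F" "\<And>A. A \<notin> GLm N \<Longrightarrow> F A = 0" "\<And>U. U \<in> Um N \<Longrightarrow> F U = h U"
    and G: "holoGL N G" "\<And>A. A \<notin> GLm N \<Longrightarrow> G A = 0" "\<And>U. U \<in> Um N \<Longrightarrow> G U = h U"
  shows "F = G"
proof
  fix A
  have "holoGL N (\<lambda>A. F A - G A)" using F(1) G(1) by (auto simp: holoGL_def intro!: field_differentiable_diff)
  from holoGL_zero_on_Um[OF this] F G show "F A = G A" by (cases "A \<in> GLm N") auto
qed

section \<open>Derivatives along one-parameter groups\<close>

text \<open>A relation between functions on all of GL_N, so that a second derivative is simply a
  second instance of it.\<close>

definition vdiff :: "nat \<Rightarrow> cmat \<Rightarrow> (cmat \<Rightarrow> 'b::real_normed_vector) \<Rightarrow> (cmat \<Rightarrow> 'b) \<Rightarrow> bool" where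
  "vdiff N X f f' \<longleftrightarrow> (\<forall>A\<in>GLm N. ((\<lambda>s. f (mexpc N X A s)) has_vector_derivative f' A) (at 0))"

lemma vdiffD: "vdiff N X f f' \<Longrightarrow> A \<in> GLm N \<Longrightarrow> ((\<lambda>s. f (mexpc N X A s)) has_vector_derivative f' A) (at 0)"
  by (simp add: vdiff_def)

lemma mexpc_eventually_GLm:
  assumes X: "X \<in> mats N" and A: "A \<in> GLm N"
  shows "\<forall>\<^sub>F s in nhds 0. mexpc N X A s \<in> GLm N"
proof (rule tendsto_GL(1)[OF _ A])
  fix i j assume ij: "i < N" "j < N"
  have "isCont (\<lambda>s. mexpc N X A s (i,j)) 0"
    using has_vector_derivative_continuous[OF mexpc_vector_derivative[OF X ij]] by simp
  then have "((\<lambda>s. mexpc N X A s (i,j)) \<longlongrightarrow> mexpc N X A 0 (i,j)) (nhds 0)"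
    unfolding isCont_def by (rule tendsto_at_iff_tendsto_nhds[THEN iffD1])
  then show "((\<lambda>s. mexpc N X A s (i,j)) \<longlongrightarrow> A (i,j)) (nhds 0)"
    by (simp only: mexpc_0[OF X minv_GL(1)[OF A]])
qed simp

text \<open>Agreement on GL_N suffices: it is open, so exp(s X) A stays in it for small s.\<close>

lemma vdiff_cong:
  assumes X: "X \<in> mats N" and "vdiff N X f f'"
    and e: "\<And>A. A \<in> GLm N \<Longrightarrow> f A = g A" "\<And>A. A \<in> GLm N \<Longrightarrow> f' A = g' A"
  shows "vdiff N X g g'"
  unfolding vdiff_def
proof
  fix A assume A: "A \<in> GLm N"
  have d: "((\<lambda>s. f (mexpc N X A s)) has_vector_derivative g' A) (at 0)" using vdiffD[OF assms(2) A] e(2)[OF A] by simp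
  have ev: "\<forall>\<^sub>F s in nhds 0. f (mexpc N X A s) = g (mexpc N X A s)"
    using mexpc_eventually_GLm[OF X A] by eventually_elim (rule e)
  show "((\<lambda>s. g (mexpc N X A s)) has_vector_derivative g' A) (at 0)"
    unfolding has_vector_derivative_def
  proof (rule has_derivative_transform_eventually[OF d[unfolded has_vector_derivative_def]])
    show "\<forall>\<^sub>F s in at 0. f (mexpc N X A s) = g (mexpc N X A s)" using ev unfolding eventually_nhds_conv_at by (rule conjunct1)
    show "f (mexpc N X A 0) = g (mexpc N X A 0)" using ev by (rule eventually_nhds_x_imp_x)
  qed (rule UNIV_I)
qed

lemma vf_vdiff: "vdiff N X f f' \<Longrightarrow> A \<in> GLm N \<Longrightarrow> vf N X f A = f' A"
  unfolding vf_def by (rule vector_derivative_at) (rule vdiffD)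

lemma vf_vf_vdiff:
  assumes X: "X \<in> mats N" and "vdiff N X f f1" "vdiff N X f1 f2" "A \<in> GLm N"
  shows "vf N X (vf N X f) A = f2 A"
proof (rule vf_vdiff[OF _ assms(4)])
  show "vdiff N X (vf N X f) f2"
    by (rule vdiff_cong[OF X assms(3)]) (simp_all add: vf_vdiff[OF assms(2)])
qed

lemma vdiff_const: "vdiff N X (\<lambda>A. c) (\<lambda>A. 0)"
  by (simp add: vdiff_def)

lemma vdiff_add: "vdiff N X f f' \<Longrightarrow> vdiff N X g g' \<Longrightarrow> vdiff N X (\<lambda>A. f A + g A) (\<lambda>A. f' A + g' A)"
  by (simp add: vdiff_def has_vector_derivative_add)

lemma vdiff_sum: "(\<And>i. i \<in> I \<Longrightarrow> vdiff N X (f i) (f' i)) \<Longrightarrow> vdiff N X (\<lambda>A. \<Sum>i\<in>I. f i A) (\<lambda>A. \<Sum>i\<in>I. f' i A)"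
  by (simp add: vdiff_def has_vector_derivative_sum)

lemma vdiff_mult:
  fixes f g :: "cmat \<Rightarrow> 'b::real_normed_algebra"
  assumes X: "X \<in> mats N" and "vdiff N X f f'" "vdiff N X g g'"
  shows "vdiff N X (\<lambda>A. f A * g A) (\<lambda>A. f' A * g A + f A * g' A)"
  unfolding vdiff_def
proof
  fix A assume A: "A \<in> GLm N"
  then have "mexpc N X A 0 = A" using mexpc_0[OF X] minv_GL by simp
  with has_vector_derivative_mult[OF vdiffD[OF assms(2) A] vdiffD[OF assms(3) A]]
  show "((\<lambda>s. f (mexpc N X A s) * g (mexpc N X A s)) has_vector_derivative f' A * g A + f A * g' A) (at 0)"
    by (simp only: add.commute)
qed

lemma vdiff_bounded_linear: "bounded_linear h \<Longrightarrow> vdiff N X f f' \<Longrightarrow> vdiff N X (\<lambda>A. h (f A)) (\<lambda>A. h (f' A))"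
  by (auto simp: vdiff_def intro: bounded_linear.has_vector_derivative)

lemma vdiff_cmult: "vdiff N X f f' \<Longrightarrow> vdiff N X (\<lambda>A. c * f A) (\<lambda>A. c * f' A)" for c :: "'b::real_normed_algebra"
  by (rule vdiff_bounded_linear[OF bounded_linear_mult_right])

section \<open>Derivatives of matrix-valued functions, entry by entry\<close>

definition mdiff :: "nat \<Rightarrow> cmat \<Rightarrow> (cmat \<Rightarrow> cmat) \<Rightarrow> (cmat \<Rightarrow> cmat) \<Rightarrow> bool" where
  "mdiff N X F F' \<longleftrightarrow> (\<forall>i<N. \<forall>j<N. vdiff N X (\<lambda>A. F A (i,j)) (\<lambda>A. F' A (i,j)))"

lemma mdiff_cong:
  assumes X: "X \<in> mats N" and "mdiff N X F F'" "\<And>A. A \<in> GLm N \<Longrightarrow> F A = G A" "\<And>A. A \<in> GLm N \<Longrightarrow> F' A = G' A"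
  shows "mdiff N X G G'"
  unfolding mdiff_def
proof (intro allI impI)
  fix i j assume "i < N" "j < N"
  then have "vdiff N X (\<lambda>A. F A (i,j)) (\<lambda>A. F' A (i,j))" using assms(2) by (simp add: mdiff_def)
  then show "vdiff N X (\<lambda>A. G A (i,j)) (\<lambda>A. G' A (i,j))"
    by (rule vdiff_cong[OF X]) (simp_all add: assms(3,4))
qed

lemma mdiff_mid: "X \<in> mats N \<Longrightarrow> mdiff N X (\<lambda>A. B) (\<lambda>A. mscale N 0 B)"
  unfolding mdiff_def by (auto simp: vdiff_const)

lemma mdiff_madd: "mdiff N X F F' \<Longrightarrow> mdiff N X G G' \<Longrightarrow> mdiff N X (\<lambda>A. madd N (F A) (G A)) (\<lambda>A. madd N (F' A) (G' A))"
  unfolding mdiff_def by (auto simp: vdiff_add)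

lemma mdiff_mscale: "mdiff N X F F' \<Longrightarrow> mdiff N X (\<lambda>A. mscale N c (F A)) (\<lambda>A. mscale N c (F' A))"
  unfolding mdiff_def by (auto simp: vdiff_cmult)

lemma mdiff_mmul:
  assumes X: "X \<in> mats N" and "mdiff N X F F'" "mdiff N X G G'"
  shows "mdiff N X (\<lambda>A. mmul N (F A) (G A)) (\<lambda>A. madd N (mmul N (F' A) (G A)) (mmul N (F A) (G' A)))"
  unfolding mdiff_def
proof (intro allI impI)
  fix i j assume ij: "i < N" "j < N"
  have "vdiff N X (\<lambda>A. \<Sum>k<N. F A (i,k) * G A (k,j)) (\<lambda>A. \<Sum>k<N. F' A (i,k) * G A (k,j) + F A (i,k) * G' A (k,j))"
    by (intro vdiff_sum vdiff_mult X) (use assms ij in \<open>auto simp: mdiff_def\<close>)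
  then show "vdiff N X (\<lambda>A. mmul N (F A) (G A) (i,j)) (\<lambda>A. madd N (mmul N (F' A) (G A)) (mmul N (F A) (G' A)) (i,j))"
    using ij by (simp add: sum.distrib)
qed

lemma mdiff_mmul_const: "mdiff N X G G' \<Longrightarrow> mdiff N X (\<lambda>A. mmul N B (G A)) (\<lambda>A. mmul N B (G' A))"
  unfolding mdiff_def by (auto intro!: vdiff_sum vdiff_cmult)

lemma mdiff_madj: "mdiff N X F F' \<Longrightarrow> mdiff N X (\<lambda>A. madj N (F A)) (\<lambda>A. madj N (F' A))"
  unfolding mdiff_def by (auto intro!: vdiff_bounded_linear[OF bounded_linear_cnj])

lemma mdiff_id: "X \<in> mats N \<Longrightarrow> mdiff N X (\<lambda>A. A) (\<lambda>A. mmul N X A)"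
  using mexpc_vector_derivative by (auto simp: mdiff_def vdiff_def simp del: mat_nth(1))

lemma mdiff_minv:
  assumes X: "X \<in> mats N"
  shows "mdiff N X (minv N) (\<lambda>A. mscale N (-1) (mmul N (minv N A) X))"
  unfolding mdiff_def vdiff_def
proof (intro allI impI ballI)
  fix i j A assume ij: "i < N" "j < N" and A: "A \<in> GLm N"
  have "((\<lambda>s. minv N (mexpc N X A s) (i,j)) has_derivative
     (\<lambda>h. - mmul N (mmul N (minv N A) (mscale N (complex_of_real h) (mmul N X A))) (minv N A) (i,j))) (at 0)"
  proof (rule minv_has_derivative)
    fix i j assume ij: "i < N" "j < N"
    then have "(\<lambda>h. mscale N (complex_of_real h) (mmul N X A) (i,j)) = (\<lambda>h. h *\<^sub>R mmul N X A (i,j))"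
      by (simp add: scaleR_conv_of_real)
    then show "((\<lambda>s. mexpc N X A s (i,j)) has_derivative (\<lambda>h. mscale N (complex_of_real h) (mmul N X A) (i,j))) (at 0)"
      using mexpc_vector_derivative[OF X ij, of A] unfolding has_vector_derivative_def by (simp only:)
  qed (use A ij mexpc_0[OF X] minv_GL in auto)
  moreover have "mmul N (mmul N (minv N A) (mmul N X A)) (minv N A) = mmul N (minv N A) X"
    using minv_GL[OF A] X by (simp add: mmul_assoc)
  ultimately show "((\<lambda>s. minv N (mexpc N X A s) (i,j)) has_vector_derivative mscale N (-1) (mmul N (minv N A) X) (i,j)) (at 0)"
    using ij unfolding has_vector_derivative_def by (simp add: scaleR_conv_of_real del: mat_nth(1))
qed

text \<open>Letters are pairs \<open>(b, st)\<close>: \<open>b\<close> selects the matrix or its inverse, \<open>st\<close> the adjoint.\<close>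

type_synonym letter = "bool \<times> bool"

definition lev :: "nat \<Rightarrow> cmat \<Rightarrow> letter \<Rightarrow> cmat" where
  "lev N A x = (let M = (if fst x then A else minv N A) in if snd x then madj N M else M)"

definition wev :: "nat \<Rightarrow> cmat \<Rightarrow> letter list \<Rightarrow> cmat" where
  "wev N A w = foldr (\<lambda>x. mmul N (lev N A x)) w (mid N)"

text \<open>Differentiating a letter along exp(s X) A inserts X, or its adjoint for a starred
  letter: A becomes X A, the inverse becomes minus the inverse times X, and adjoints reverse the
  order. \<open>lpart\<close> and \<open>rpart\<close> tell on which side of the insertion the
  letter remains, \<open>lsgn\<close> the sign.\<close>

definition lpart :: "letter \<Rightarrow> letter list" where "lpart x = (if fst x \<noteq> snd x then [] else [x])"
definition rpart :: "letter \<Rightarrow> letter list" where "rpart x = (if fst x \<noteq> snd x then [x] else [])"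
definition lsgn :: "letter \<Rightarrow> complex" where "lsgn x = (if fst x then 1 else -1)"
definition lins :: "nat \<Rightarrow> cmat \<Rightarrow> letter \<Rightarrow> cmat" where "lins N X x = (if snd x then madj N X else X)"

lemma wev_simps [simp]: "wev N A [] = mid N" "wev N A (x # w) = mmul N (lev N A x) (wev N A w)"
  by (simp_all add: wev_def)

lemma wev_mats [simp]: "wev N A w \<in> mats N"
  by (cases w) auto

lemma wev_append: "wev N A (v @ w) = mmul N (wev N A v) (wev N A w)"
  by (induction v) (auto simp: mmul_assoc)

lemma lev_mats [simp]: "A \<in> GLm N \<Longrightarrow> lev N A x \<in> mats N"
  using minv_GL by (simp add: lev_def Let_def)

lemma lins_mats [simp]: "X \<in> mats N \<Longrightarrow> lins N X x \<in> mats N"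
  by (simp add: lins_def)

lemma lsgn_sq [simp]: "lsgn x * lsgn x = 1" by (simp add: lsgn_def)

definition lev1 :: "nat \<Rightarrow> cmat \<Rightarrow> cmat \<Rightarrow> letter \<Rightarrow> cmat" where
  "lev1 N X A x = mscale N (lsgn x) (mmul N (wev N A (lpart x)) (mmul N (lins N X x) (wev N A (rpart x))))"

definition lev2 :: "nat \<Rightarrow> cmat \<Rightarrow> cmat \<Rightarrow> letter \<Rightarrow> cmat" where
  "lev2 N X A x = mmul N (wev N A (lpart x)) (mmul N (lins N X x) (mmul N (lins N X x) (wev N A (rpart x))))"

lemma madj_mscale: "madj N (mscale N c A) = mscale N (cnj c) (madj N A)"
  by (rule mats_ext[where N = N]) auto

lemma mdiff_lev:
  assumes X: "X \<in> mats N"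
  shows "mdiff N X (\<lambda>A. lev N A x) (\<lambda>A. lev1 N X A x)"
proof -
  obtain b st where x: "x = (b, st)" by fastforce
  show ?thesis
  proof (cases b; cases st)
    assume b: "b" "\<not> st"
    show ?thesis
      by (rule mdiff_cong[OF X mdiff_id[OF X]]) (use b x X minv_GL in \<open>auto simp: lev_def lev1_def lsgn_def lins_def lpart_def rpart_def\<close>)
  next
    assume b: "b" "st"
    show ?thesis
      by (rule mdiff_cong[OF X mdiff_madj[OF mdiff_id[OF X]]]) (use b x X minv_GL in \<open>auto simp: lev_def lev1_def lsgn_def lins_def lpart_def rpart_def madj_mmul\<close>)
  next
    assume b: "\<not> b" "\<not> st"
    show ?thesis
      by (rule mdiff_cong[OF X mdiff_minv[OF X]]) (use b x X minv_GL in \<open>auto simp: lev_def lev1_def lsgn_def lins_def lpart_def rpart_def\<close>)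
  next
    assume b: "\<not> b" "st"
    show ?thesis
      by (rule mdiff_cong[OF X mdiff_madj[OF mdiff_minv[OF X]]]) (use b x X minv_GL in \<open>auto simp: lev_def lev1_def lsgn_def lins_def lpart_def rpart_def madj_mmul madj_mscale\<close>)
  qed
qed

lemma mdiff_lev1:
  assumes X: "X \<in> mats N"
  shows "mdiff N X (\<lambda>A. lev1 N X A x) (\<lambda>A. lev2 N X A x)"
proof (cases "fst x \<noteq> snd x")
  case True
  show ?thesis
    by (rule mdiff_cong[OF X mdiff_mscale[OF mdiff_mmul_const[OF mdiff_lev[OF X, of x], of "lins N X x"], where c = "lsgn x"]])
      (use True X in \<open>auto simp: lev1_def lev2_def lpart_def rpart_def\<close>)
next
  case False
  show ?thesis
    by (rule mdiff_cong[OF X mdiff_mscale[OF mdiff_mmul[OF X mdiff_lev[OF X, of x] mdiff_mid[OF X, of "lins N X x"]], where c = "lsgn x"]])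
      (use False X in \<open>auto simp: lev1_def lev2_def lpart_def rpart_def mmul_assoc intro!: mats_ext[where N = N]\<close>)
qed

text \<open>All single insertions of X: an entry (c,P,y,Q) stands for c P X Q, with y the letter
  that was differentiated. \<open>pairs\<close> lists insertions at two different letters, each
  unordered pair once, whence the factor 2 in \<open>D2\<close>; a letter differentiated twice
  receives both copies of X at the same place, and its sign squares to 1.\<close>

fun ins :: "letter list \<Rightarrow> (complex \<times> letter list \<times> letter \<times> letter list) list" where
  "ins [] = []"
| "ins (x # w) = (lsgn x, lpart x, x, rpart x @ w) # map (\<lambda>(c,P,y,Q). (c, x # P, y, Q)) (ins w)"

fun pairs :: "letter list \<Rightarrow> (complex \<times> letter list \<times> letter \<times> letter list \<times> letter \<times> letter list) list" where
  "pairs [] = []"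
| "pairs (x # w) = map (\<lambda>(c,P,y,Q). (lsgn x * c, lpart x, x, rpart x @ P, y, Q)) (ins w)
     @ map (\<lambda>(c,P,x',M,y,Q). (c, x # P, x', M, y, Q)) (pairs w)"

definition msum :: "nat \<Rightarrow> ('a \<Rightarrow> cmat) \<Rightarrow> 'a list \<Rightarrow> cmat" where
  "msum N f xs = restrict (\<lambda>p. \<Sum>x\<leftarrow>xs. f x p) (sq N)"

lemma msum_mats [simp]: "msum N f xs \<in> mats N"
  by (simp add: msum_def mats_def restrict_def PiE_def Pi_def extensional_def)

lemma msum_nth: "i < N \<Longrightarrow> j < N \<Longrightarrow> msum N f xs (i,j) = (\<Sum>x\<leftarrow>xs. f x (i,j))"
  by (simp add: msum_def)

lemma msum_Cons: "msum N f (x # xs) = madd N (f x) (msum N f xs)"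
  by (rule mats_ext[where N = N]) (auto simp: msum_nth)

lemma msum_append: "msum N f (xs @ ys) = madd N (msum N f xs) (msum N f ys)"
  by (rule mats_ext[where N = N]) (auto simp: msum_nth)

lemma msum_map: "msum N f (map g xs) = msum N (\<lambda>x. f (g x)) xs"
  by (simp add: msum_def o_def)

lemma mmul_msum: "mmul N B (msum N f xs) = msum N (\<lambda>x. mmul N B (f x)) xs"
  by (rule mats_ext[where N = N])
    (auto simp: msum_nth sum_list_const_mult[symmetric] sum_list_sum_nth sum_distrib_left intro: sum.swap)

lemma mscale_msum: "mscale N c (msum N f xs) = msum N (\<lambda>x. mscale N c (f x)) xs"
  by (rule mats_ext[where N = N]) (auto simp: msum_nth sum_list_const_mult[symmetric] intro!: arg_cong[where f = sum_list])

lemma msum_cong: "(\<And>x. x \<in> set xs \<Longrightarrow> f x = g x) \<Longrightarrow> msum N f xs = msum N g xs"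
  by (rule mats_ext[where N = N]) (auto simp: msum_nth cong: map_cong)

definition D1 :: "nat \<Rightarrow> cmat \<Rightarrow> cmat \<Rightarrow> letter list \<Rightarrow> cmat" where
  "D1 N X A w = msum N (\<lambda>(c,P,y,Q). mscale N c (mmul N (wev N A P) (mmul N (lins N X y) (wev N A Q)))) (ins w)"

definition D2 :: "nat \<Rightarrow> cmat \<Rightarrow> cmat \<Rightarrow> letter list \<Rightarrow> cmat" where
  "D2 N X A w = madd N
    (msum N (\<lambda>(c,P,y,Q). mmul N (wev N A P) (mmul N (lins N X y) (mmul N (lins N X y) (wev N A Q)))) (ins w))
    (msum N (\<lambda>(c,P,x,M,y,Q). mscale N (2 * c) (mmul N (wev N A P) (mmul N (lins N X x) (mmul N (wev N A M) (mmul N (lins N X y) (wev N A Q)))))) (pairs w))"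

lemma D1_Cons: "D1 N X A (x # w) = madd N (mmul N (lev1 N X A x) (wev N A w)) (mmul N (lev N A x) (D1 N X A w))"
  unfolding D1_def ins.simps msum_Cons msum_map mmul_msum
  by (intro arg_cong2[where f = "madd N"] msum_cong) (auto simp: lev1_def wev_append mmul_assoc split: prod.splits)

lemma D2_Cons: "D2 N X A (x # w) = madd N (mmul N (lev2 N X A x) (wev N A w))
   (madd N (mscale N 2 (mmul N (lev1 N X A x) (D1 N X A w))) (mmul N (lev N A x) (D2 N X A w)))"
proof -
  let ?I = "\<lambda>w. msum N (\<lambda>(c,P,y,Q). mmul N (wev N A P) (mmul N (lins N X y) (mmul N (lins N X y) (wev N A Q)))) (ins w)"
  let ?P = "\<lambda>w. msum N (\<lambda>(c,P,x,M,y,Q). mscale N (2 * c) (mmul N (wev N A P) (mmul N (lins N X x) (mmul N (wev N A M) (mmul N (lins N X y) (wev N A Q)))))) (pairs w)"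
  have 1: "?I (x # w) = madd N (mmul N (lev2 N X A x) (wev N A w)) (mmul N (lev N A x) (?I w))"
    unfolding ins.simps msum_Cons msum_map mmul_msum
    by (intro arg_cong2[where f = "madd N"] msum_cong) (auto simp: lev2_def wev_append mmul_assoc split: prod.splits)
  have 2: "?P (x # w) = madd N (mscale N 2 (mmul N (lev1 N X A x) (D1 N X A w))) (mmul N (lev N A x) (?P w))"
    unfolding pairs.simps msum_append msum_map mmul_msum D1_def mscale_msum
    by (intro arg_cong2[where f = "madd N"] msum_cong) (auto simp: lev1_def wev_append mmul_assoc mult_ac split: prod.splits)
  show ?thesis unfolding D2_def 1 2 by (rule mats_ext[where N = N]) (auto simp: mmul_madd_right algebra_simps sum.distrib)
qed

lemma mdiff_wev:
  assumes X: "X \<in> mats N"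
  shows "mdiff N X (\<lambda>A. wev N A w) (\<lambda>A. D1 N X A w)"
proof (induction w)
  case Nil
  show ?case by (rule mdiff_cong[OF X mdiff_mid[OF X, of "mid N"]]) (auto simp: D1_def msum_nth intro!: mats_ext[where N = N])
next
  case (Cons x w)
  show ?case by (rule mdiff_cong[OF X mdiff_mmul[OF X mdiff_lev[OF X, of x] Cons]]) (auto simp: D1_Cons)
qed

lemma mdiff_D1:
  assumes X: "X \<in> mats N"
  shows "mdiff N X (\<lambda>A. D1 N X A w) (\<lambda>A. D2 N X A w)"
proof (induction w)
  case Nil
  show ?case by (rule mdiff_cong[OF X mdiff_mid[OF X, of "msum N (\<lambda>x. mid N) []"]])
    (auto simp: D1_def D2_def msum_nth intro!: mats_ext[where N = N])
next
  case (Cons x w)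
  show ?case
    by (rule mdiff_cong[OF X mdiff_madd[OF mdiff_mmul[OF X mdiff_lev1[OF X, of x] mdiff_wev[OF X, of w]]
        mdiff_mmul[OF X mdiff_lev[OF X, of x] Cons]]])
      (auto simp: D1_Cons D2_Cons intro!: mats_ext[where N = N])
qed

definition vdiff2 :: "nat \<Rightarrow> cmat \<Rightarrow> (cmat \<Rightarrow> 'b::real_normed_vector) \<Rightarrow> (cmat \<Rightarrow> 'b) \<Rightarrow> (cmat \<Rightarrow> 'b) \<Rightarrow> bool" where
  "vdiff2 N X f f1 f2 \<longleftrightarrow> vdiff N X f f1 \<and> vdiff N X f1 f2"

lemma vdiff2_mult:
  fixes f g :: "cmat \<Rightarrow> 'b::{real_normed_algebra,comm_ring_1}"
  assumes X: "X \<in> mats N" and "vdiff2 N X f f1 f2" "vdiff2 N X g g1 g2"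
  shows "vdiff2 N X (\<lambda>A. f A * g A) (\<lambda>A. f1 A * g A + f A * g1 A) (\<lambda>A. f2 A * g A + 2 * (f1 A * g1 A) + f A * g2 A)"
  unfolding vdiff2_def
proof
  show "vdiff N X (\<lambda>A. f A * g A) (\<lambda>A. f1 A * g A + f A * g1 A)" using assms by (auto simp: vdiff2_def intro!: vdiff_mult)
  have "vdiff N X (\<lambda>A. f1 A * g A + f A * g1 A) (\<lambda>A. (f2 A * g A + f1 A * g1 A) + (f1 A * g1 A + f A * g2 A))"
    using assms by (intro vdiff_add[OF vdiff_mult[OF X] vdiff_mult[OF X]]) (simp_all add: vdiff2_def)
  then show "vdiff N X (\<lambda>A. f1 A * g A + f A * g1 A) (\<lambda>A. f2 A * g A + 2 * (f1 A * g1 A) + f A * g2 A)"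
    by (rule vdiff_cong[OF X]) (auto simp: algebra_simps)
qed

lemma vdiff2_bounded_linear: "bounded_linear h \<Longrightarrow> vdiff2 N X f f1 f2 \<Longrightarrow> vdiff2 N X (\<lambda>A. h (f A)) (\<lambda>A. h (f1 A)) (\<lambda>A. h (f2 A))"
  by (simp add: vdiff2_def vdiff_bounded_linear)

lemma vdiff2_add: "vdiff2 N X f f1 f2 \<Longrightarrow> vdiff2 N X g g1 g2 \<Longrightarrow>
   vdiff2 N X (\<lambda>A. f A + g A) (\<lambda>A. f1 A + g1 A) (\<lambda>A. f2 A + g2 A)"
  by (simp add: vdiff2_def vdiff_add)

lemma vdiff2_sum: "(\<And>i. i \<in> I \<Longrightarrow> vdiff2 N X (f i) (f1 i) (f2 i)) \<Longrightarrow>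
   vdiff2 N X (\<lambda>A. \<Sum>i\<in>I. f i A) (\<lambda>A. \<Sum>i\<in>I. f1 i A) (\<lambda>A. \<Sum>i\<in>I. f2 i A)"
  by (simp add: vdiff2_def vdiff_sum)

lemma vdiff2_const: "vdiff2 N X (\<lambda>A. c) (\<lambda>A. 0) (\<lambda>A. 0)"
  by (simp add: vdiff2_def vdiff_const)

lemma vdiff2_wev: "X \<in> mats N \<Longrightarrow> i < N \<Longrightarrow> j < N \<Longrightarrow>
   vdiff2 N X (\<lambda>A. wev N A w (i,j)) (\<lambda>A. D1 N X A w (i,j)) (\<lambda>A. D2 N X A w (i,j))"
  using mdiff_wev mdiff_D1 by (simp add: vdiff2_def mdiff_def)

lemma vdiff2_mtr:
  assumes "X \<in> mats N"
  shows "vdiff2 N X (\<lambda>A. mtr N (wev N A w)) (\<lambda>A. mtr N (D1 N X A w)) (\<lambda>A. mtr N (D2 N X A w))"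
  unfolding mtr_def
  by (rule vdiff2_bounded_linear[OF bounded_linear_divide vdiff2_sum]) (use vdiff2_wev[OF assms] in auto)

lemma lap_vdiff2:
  assumes "\<And>X. X \<in> set basis \<Longrightarrow> X \<in> mats N" "\<And>X. X \<in> set basis \<Longrightarrow> vdiff2 N X f (f1 X) (f2 X)" "A \<in> GLm N"
  shows "lap N basis f A = (\<Sum>X\<leftarrow>basis. f2 X A)"
  unfolding lap_def using assms by (intro arg_cong[where f = sum_list] map_cong) (auto simp: vdiff2_def intro!: vf_vf_vdiff)

section \<open>Casimir sums\<close>

lemma sum_list_concat_map: "(\<Sum>x\<leftarrow>concat (map g xs). F x) = (\<Sum>y\<leftarrow>xs. \<Sum>x\<leftarrow>g y. F x)" for F :: "'a \<Rightarrow> 'b::comm_monoid_add"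
  by (induction xs) auto

lemma sum_u_basis: "(\<Sum>X\<leftarrow>u_basis N. F X) =
  (\<Sum>j<N. F (mscale N (\<i> / complex_of_real (sqrt N)) (matunit N j j))) +
  (\<Sum>j<N. \<Sum>k\<in>{Suc j..<N}.
     F (mscale N (1 / complex_of_real (sqrt (2 * N))) (madd N (matunit N j k) (mscale N (-1) (matunit N k j)))) +
     F (mscale N (\<i> / complex_of_real (sqrt (2 * N))) (madd N (matunit N j k) (matunit N k j))))"
  for F :: "cmat \<Rightarrow> 'b::comm_monoid_add"
  unfolding u_basis_def by (simp add: sum_list_concat_map o_def interv_sum_list_conv_sum_set_nat atLeast0LessThan)

lemma sum_gl_basis: "(\<Sum>X\<leftarrow>gl_basis N. F X) =
  (\<Sum>j<N. \<Sum>k<N. F (mscale N (1 / complex_of_real (sqrt N)) (matunit N j k)) + F (mscale N (\<i> / complex_of_real (sqrt N)) (matunit N j k)))"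
  for F :: "cmat \<Rightarrow> 'b::comm_monoid_add"
  unfolding gl_basis_def by (simp add: sum_list_concat_map o_def interv_sum_list_conv_sum_set_nat atLeast0LessThan)

lemma u_basis_mats: "X \<in> set (u_basis N) \<Longrightarrow> X \<in> mats N"
  by (auto simp: u_basis_def)

lemma gl_basis_mats: "X \<in> set (gl_basis N) \<Longrightarrow> X \<in> mats N"
  by (auto simp: gl_basis_def)

lemma sqrt_of_real_sq: "complex_of_real (sqrt (real n)) * complex_of_real (sqrt (real n)) = of_nat n"
  by (metis of_real_mult of_real_of_nat_eq of_nat_0_le_iff real_sqrt_mult_self abs_of_nat)

lemma imaginary_mult: "\<i> * x * (\<i> * y) = - (x * y)"
  by (simp add: complex_eq_iff algebra_simps)

lemma cnj_sum_list: "cnj (sum_list (map f xs)) = sum_list (map (\<lambda>x. cnj (f x)) xs)"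
  by (induction xs) auto

text \<open>For each pair j < k the products E_jk E_jk and E_kj E_kj from the two basis elements
  cancel, and only E_jk E_kj and E_kj E_jk survive; the diagonal basis elements supply the case a =
  b.\<close>

lemma u_basis_magic:
  assumes "a < N" "b < N" "c < N" "d < N"
  shows "(\<Sum>X\<leftarrow>u_basis N. X (a,b) * X (c,d)) = (if a = d \<and> b = c then - 1 / of_nat N else 0)"
proof -
  define \<delta> where "\<delta> j k a b = (if a = j \<and> b = k then 1 else 0 :: complex)" for j k a b :: nat
  have s1: "(\<i> / complex_of_real (sqrt N) * x) * (\<i> / complex_of_real (sqrt N) * y) = - (x * y) / of_nat N" for x y
  proof -
    have "(\<i> / complex_of_real (sqrt N) * x) * (\<i> / complex_of_real (sqrt N) * y) = - (x * y) / (complex_of_real (sqrt N) * complex_of_real (sqrt N))"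
      by (simp add: imaginary_mult)
    then show ?thesis unfolding sqrt_of_real_sq .
  qed
  define r where "r = complex_of_real (sqrt (2 * real N))"
  have r: "r * r = 2 * of_nat N" using sqrt_of_real_sq[of "2 * N"] by (simp add: r_def)
  have s2: "(1 / r * x) * (1 / r * y) + (\<i> / r * x') * (\<i> / r * y') = (x * y - x' * y') / (2 * of_nat N)" for x y x' y'
    unfolding r[symmetric] by (simp add: diff_divide_distrib imaginary_mult)
  have "(\<Sum>X\<leftarrow>u_basis N. X (a,b) * X (c,d)) =
    (\<Sum>j<N. - (\<delta> j j a b * \<delta> j j c d) / of_nat N) +
    (\<Sum>j<N. \<Sum>k\<in>{Suc j..<N}. ((\<delta> j k a b - \<delta> k j a b) * (\<delta> j k c d - \<delta> k j c d) - (\<delta> j k a b + \<delta> k j a b) * (\<delta> j k c d + \<delta> k j c d)) / (2 * of_nat N))"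
    unfolding sum_u_basis using assms
    by (simp add: \<delta>_def[symmetric] r_def[symmetric] s1 s2 del: of_real_mult times_divide_eq_left times_divide_eq_right)
  also have "(\<Sum>j<N. - (\<delta> j j a b * \<delta> j j c d) / of_nat N) = (if a = b \<and> b = c \<and> c = d then - 1 / of_nat N else 0)"
  proof -
    have "(\<Sum>j<N. - (\<delta> j j a b * \<delta> j j c d) / of_nat N) = (\<Sum>j<N. if j = a then (if a = b \<and> b = c \<and> c = d then - 1 / of_nat N else 0) else 0)"
      by (intro sum.cong) (auto simp: \<delta>_def)
    then show ?thesis using assms by simp
  qed
  also have "(\<Sum>j<N. \<Sum>k\<in>{Suc j..<N}. ((\<delta> j k a b - \<delta> k j a b) * (\<delta> j k c d - \<delta> k j c d) - (\<delta> j k a b + \<delta> k j a b) * (\<delta> j k c d + \<delta> k j c d)) / (2 * of_nat N))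
     = (if a \<noteq> b \<and> b = c \<and> a = d then - 1 / of_nat N else 0)"
  proof -
    have e: "((\<delta> j k a b - \<delta> k j a b) * (\<delta> j k c d - \<delta> k j c d) - (\<delta> j k a b + \<delta> k j a b) * (\<delta> j k c d + \<delta> k j c d)) / (2 * of_nat N)
      = - (\<delta> j k a b * \<delta> k j c d + \<delta> k j a b * \<delta> j k c d) / of_nat N" for j k
    proof -
      have "(x - y) * (u - v) - (x + y) * (u + v) = 2 * (- (x * v + y * u))" for x y u v :: complex
        by (simp add: algebra_simps)
      then show ?thesis by (simp only: mult_divide_mult_cancel_left_if) simp
    qed
    \<comment> \<open>At most one pair j < k contributes, namely (min a b, max a b), and it exists
      only when a and b differ.\<close>
    have "(\<Sum>j<N. \<Sum>k\<in>{Suc j..<N}. - (\<delta> j k a b * \<delta> k j c d + \<delta> k j a b * \<delta> j k c d) / of_nat N)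
      = (\<Sum>j<N. \<Sum>k\<in>{Suc j..<N}. if j = min a b \<and> k = max a b then (if b = c \<and> a = d then - 1 / of_nat N else 0) else 0)"
    proof (intro sum.cong refl)
      fix j k assume "k \<in> {Suc j..<N}"
      then have jk: "j < k" by simp
      define v where "v = (if b = c \<and> a = d then 1 else 0 :: complex)"
      have p1: "\<delta> j k a b * \<delta> k j c d = (if j = a \<and> k = b then v else 0)" by (auto simp: \<delta>_def v_def)
      have p2: "\<delta> k j a b * \<delta> j k c d = (if j = b \<and> k = a then v else 0)" by (auto simp: \<delta>_def v_def)
      have "(if j = a \<and> k = b then v else 0) + (if j = b \<and> k = a then v else 0) = (if j = min a b \<and> k = max a b then v else 0)"
        using jk unfolding min_def max_def by (cases "a \<le> b") (simp, linarith, simp, linarith)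
      then show "- (\<delta> j k a b * \<delta> k j c d + \<delta> k j a b * \<delta> j k c d) / of_nat N =
        (if j = min a b \<and> k = max a b then (if b = c \<and> a = d then - 1 / of_nat N else 0) else 0)"
        unfolding p1 p2 by (simp only:) (simp add: v_def)
    qed
    also have "\<dots> = (\<Sum>j<N. if j = min a b then (if a \<noteq> b \<and> b = c \<and> a = d then - 1 / of_nat N else 0) else 0)"
    proof (intro sum.cong refl)
      fix j
      have "(\<Sum>k\<in>{Suc j..<N}. if j = min a b \<and> k = max a b then (if b = c \<and> a = d then - 1 / of_nat N else 0) else (0::complex))
        = (\<Sum>k\<in>{Suc j..<N}. if k = max a b then (if j = min a b \<and> b = c \<and> a = d then - 1 / of_nat N else 0) else 0)"
        by (intro sum.cong) auto
      also have "\<dots> = (if j = min a b then (if a \<noteq> b \<and> b = c \<and> a = d then - 1 / of_nat N else 0) else 0)"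
        using assms by (auto simp: min_def max_def)
      finally show "(\<Sum>k\<in>{Suc j..<N}. if j = min a b \<and> k = max a b then (if b = c \<and> a = d then - 1 / of_nat N else 0) else (0::complex)) = (if j = min a b then (if a \<noteq> b \<and> b = c \<and> a = d then - 1 / of_nat N else 0) else 0)" .
    qed
    also have "\<dots> = (if a \<noteq> b \<and> b = c \<and> a = d then - 1 / of_nat N else 0)" using assms by (simp add: min_def)
    finally show ?thesis unfolding e .
  qed
  finally show ?thesis by auto
qed

text \<open>With each X the basis contains iX: their bilinear contributions cancel, their
  sesquilinear ones add up. Hence traces of words without adjoints will be harmonic on GL_N.\<close>

lemma gl_basis_magic:
  assumes "a < N" "b < N" "c < N" "d < N"
  shows "(\<Sum>X\<leftarrow>gl_basis N. X (a,b) * X (c,d)) = 0"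
    "(\<Sum>X\<leftarrow>gl_basis N. X (a,b) * cnj (X (c,d))) = (if a = c \<and> b = d then 2 / of_nat N else 0)"
proof -
  define \<delta> where "\<delta> j k a b = (if a = j \<and> b = k then 1 else 0 :: complex)" for j k a b :: nat
  have c: "cnj (\<delta> j k a b) = \<delta> j k a b" for j k a b by (simp add: \<delta>_def)
  have s1: "(1 / complex_of_real (sqrt N) * x) * (1 / complex_of_real (sqrt N) * y) + (\<i> / complex_of_real (sqrt N) * x) * (\<i> / complex_of_real (sqrt N) * y) = 0" for x y
    by (simp add: imaginary_mult)
  have s2: "(1 / complex_of_real (sqrt N) * x) * cnj (1 / complex_of_real (sqrt N) * y) + (\<i> / complex_of_real (sqrt N) * x) * cnj (\<i> / complex_of_real (sqrt N) * y) = 2 * (x * cnj y) / of_nat N" for x y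
  proof -
    have "(1 / complex_of_real (sqrt N) * x) * cnj (1 / complex_of_real (sqrt N) * y) + (\<i> / complex_of_real (sqrt N) * x) * cnj (\<i> / complex_of_real (sqrt N) * y)
       = 2 * (x * cnj y) / (complex_of_real (sqrt N) * complex_of_real (sqrt N))" by (simp add: imaginary_mult)
    then show ?thesis unfolding sqrt_of_real_sq .
  qed
  show "(\<Sum>X\<leftarrow>gl_basis N. X (a,b) * X (c,d)) = 0"
    unfolding sum_gl_basis using assms by (simp add: \<delta>_def[symmetric] s1 del: times_divide_eq_left times_divide_eq_right)
  have "(\<Sum>X\<leftarrow>gl_basis N. X (a,b) * cnj (X (c,d))) = (\<Sum>j<N. \<Sum>k<N. 2 * (\<delta> j k a b * cnj (\<delta> j k c d)) / of_nat N)"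
    unfolding sum_gl_basis using assms
    by (simp only: mat_nth s2 \<delta>_def[symmetric])
  also have "\<dots> = (\<Sum>j<N. \<Sum>k<N. if k = b then (if j = a then (if a = c \<and> b = d then 2 / of_nat N else 0) else 0) else 0)"
    unfolding c by (intro sum.cong refl) (auto simp: \<delta>_def)
  also have "\<dots> = (if a = c \<and> b = d then 2 / of_nat N else 0)" using assms by simp
  finally show "(\<Sum>X\<leftarrow>gl_basis N. X (a,b) * cnj (X (c,d))) = (if a = c \<and> b = d then 2 / of_nat N else 0)" .
qed

lemma sum_list_swap: "(\<Sum>x\<leftarrow>xs. \<Sum>i\<in>I. f x i) = (\<Sum>i\<in>I. \<Sum>x\<leftarrow>xs. f x i)" for f :: "'a \<Rightarrow> 'b \<Rightarrow> 'c::comm_monoid_add"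
  by (induction xs) (auto simp: sum.distrib)

lemma sum_list_swap2: "(\<Sum>x\<leftarrow>xs. \<Sum>y\<leftarrow>ys. f x y) = (\<Sum>y\<leftarrow>ys. \<Sum>x\<leftarrow>xs. f x y)" for f :: "'a \<Rightarrow> 'b \<Rightarrow> 'c::comm_monoid_add"
  by (induction xs) (auto simp: sum_list_addf)

text \<open>The common shape of the contraction formulas, with Y and Z allowed to insert adjoints:
  \<kappa> is -1 for u(N), and for M_N(C) it is 0 or 2 according to whether the two insertions are
  of the same kind.\<close>

definition casimir :: "nat \<Rightarrow> 'a list \<Rightarrow> ('a \<Rightarrow> cmat) \<Rightarrow> ('a \<Rightarrow> cmat) \<Rightarrow> complex \<Rightarrow> bool" where
  "casimir N bs Y Z \<kappa> \<longleftrightarrow> (\<forall>a<N. \<forall>b<N. \<forall>c<N. \<forall>d<N. (\<Sum>X\<leftarrow>bs. Y X (a,b) * Z X (c,d)) = (if a = d \<and> b = c then \<kappa> / of_nat N else 0))"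

text \<open>Two insertions into one word split off the segment between them as a normalized trace,
  with no power of N left over. This is the origin of the trace factors in
  \<open>DeltaU\<close>.\<close>

lemma casimir_sandwich:
  assumes c: "casimir N bs Y Z \<kappa>" and ij: "i < N" "j < N"
  shows "(\<Sum>X\<leftarrow>bs. mmul N P (mmul N (Y X) (mmul N M (mmul N (Z X) Q))) (i,j)) = \<kappa> * mtr N M * mmul N P Q (i,j)"
proof -
  have "(\<Sum>X\<leftarrow>bs. mmul N P (mmul N (Y X) (mmul N M (mmul N (Z X) Q))) (i,j)) =
     (\<Sum>X\<leftarrow>bs. \<Sum>a<N. \<Sum>b<N. \<Sum>c<N. \<Sum>d<N. (P (i,a) * M (b,c) * Q (d,j)) * (Y X (a,b) * Z X (c,d)))"
    using ij by (intro arg_cong[where f = sum_list] map_cong refl) (simp add: sum_distrib_left mult_ac)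
  also have "\<dots> = (\<Sum>a<N. \<Sum>b<N. \<Sum>c<N. \<Sum>d<N. (P (i,a) * M (b,c) * Q (d,j)) * (\<Sum>X\<leftarrow>bs. Y X (a,b) * Z X (c,d)))"
    unfolding sum_list_swap sum_list_const_mult by (rule refl)
  also have "\<dots> = (\<Sum>a<N. \<Sum>b<N. \<Sum>c<N. \<Sum>d<N. if d = a then (if c = b then P (i,a) * M (b,b) * Q (a,j) * (\<kappa> / of_nat N) else 0) else 0)"
    using c by (intro sum.cong refl) (auto simp: casimir_def)
  also have "\<dots> = (\<Sum>a<N. \<Sum>b<N. P (i,a) * M (b,b) * Q (a,j) * (\<kappa> / of_nat N))" by simp
  also have "\<dots> = (\<Sum>b<N. \<Sum>a<N. P (i,a) * M (b,b) * Q (a,j) * (\<kappa> / of_nat N))" by (rule sum.swap)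
  also have "\<dots> = \<kappa> * mtr N M * mmul N P Q (i,j)"
    using ij by (simp add: mtr_def sum_distrib_left sum_distrib_right mult_ac sum_divide_distrib)
  finally show ?thesis .
qed

text \<open>An insertion into a word and one into a separate trace merge the two into a single word
  at the price 1/N^2: one 1/N comes from the contraction, the other from the normalization of the
  trace.\<close>

lemma casimir_cross:
  assumes c: "casimir N bs Y Z \<kappa>" and ij: "i < N" "j < N"
  shows "(\<Sum>X\<leftarrow>bs. mmul N P (mmul N (Y X) Q) (i,j) * mtr N (mmul N P' (mmul N (Z X) Q')))
    = \<kappa> / (of_nat N)^2 * mmul N P (mmul N Q' (mmul N P' Q)) (i,j)"
proof -
  have "(\<Sum>X\<leftarrow>bs. mmul N P (mmul N (Y X) Q) (i,j) * mtr N (mmul N P' (mmul N (Z X) Q'))) =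
     (\<Sum>X\<leftarrow>bs. \<Sum>a<N. \<Sum>b<N. \<Sum>k<N. \<Sum>c<N. \<Sum>d<N. (P (i,a) * Q (b,j) * P' (k,c) * Q' (d,k) / of_nat N) * (Y X (a,b) * Z X (c,d)))"
  proof (intro arg_cong[where f = sum_list] map_cong refl)
    fix X
    have "mmul N P (mmul N (Y X) Q) (i,j) = (\<Sum>a<N. \<Sum>b<N. P (i,a) * (Y X (a,b) * Q (b,j)))"
      using ij by (simp add: sum_distrib_left)
    moreover have "mtr N (mmul N P' (mmul N (Z X) Q')) = (\<Sum>k<N. \<Sum>c<N. \<Sum>d<N. P' (k,c) * (Z X (c,d) * Q' (d,k)) / of_nat N)"
      by (simp add: mtr_def sum_distrib_left sum_divide_distrib)
    ultimately have "mmul N P (mmul N (Y X) Q) (i,j) * mtr N (mmul N P' (mmul N (Z X) Q')) =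
      (\<Sum>a<N. \<Sum>b<N. \<Sum>k<N. \<Sum>c<N. \<Sum>d<N. P (i,a) * (Y X (a,b) * Q (b,j)) * (P' (k,c) * (Z X (c,d) * Q' (d,k)) / of_nat N))"
      by (simp only: sum_distrib_right) (simp only: sum_distrib_left)
    then show "mmul N P (mmul N (Y X) Q) (i,j) * mtr N (mmul N P' (mmul N (Z X) Q')) =
      (\<Sum>a<N. \<Sum>b<N. \<Sum>k<N. \<Sum>c<N. \<Sum>d<N. (P (i,a) * Q (b,j) * P' (k,c) * Q' (d,k) / of_nat N) * (Y X (a,b) * Z X (c,d)))"
      by (simp add: mult_ac)
  qed
  also have "\<dots> = (\<Sum>a<N. \<Sum>b<N. \<Sum>k<N. \<Sum>c<N. \<Sum>d<N. (P (i,a) * Q (b,j) * P' (k,c) * Q' (d,k) / of_nat N) * (\<Sum>X\<leftarrow>bs. Y X (a,b) * Z X (c,d)))"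
    unfolding sum_list_swap sum_list_const_mult by (rule refl)
  also have "\<dots> = (\<Sum>a<N. \<Sum>b<N. \<Sum>k<N. \<Sum>c<N. \<Sum>d<N. if d = a then (if c = b then P (i,a) * Q (b,j) * P' (k,b) * Q' (a,k) / of_nat N * (\<kappa> / of_nat N) else 0) else 0)"
    using c by (intro sum.cong refl) (auto simp: casimir_def)
  also have "\<dots> = (\<Sum>a<N. \<Sum>b<N. \<Sum>k<N. P (i,a) * Q (b,j) * P' (k,b) * Q' (a,k) / of_nat N * (\<kappa> / of_nat N))" by simp
  also have "\<dots> = (\<Sum>a<N. \<Sum>k<N. \<Sum>b<N. P (i,a) * Q (b,j) * P' (k,b) * Q' (a,k) / of_nat N * (\<kappa> / of_nat N))"
    by (intro sum.cong refl sum.swap)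
  also have "\<dots> = \<kappa> / (of_nat N)^2 * mmul N P (mmul N Q' (mmul N P' Q)) (i,j)"
    using ij by (simp add: sum_distrib_left mult_ac power2_eq_square)
  finally show ?thesis .
qed

lemma casimir_cross_mtr:
  assumes c: "casimir N bs Y Z \<kappa>"
  shows "(\<Sum>X\<leftarrow>bs. mtr N (mmul N P (mmul N (Y X) Q)) * mtr N (mmul N P' (mmul N (Z X) Q')))
    = \<kappa> / (of_nat N)^2 * mtr N (mmul N P (mmul N Q' (mmul N P' Q)))"
proof -
  have "(\<Sum>X\<leftarrow>bs. mtr N (mmul N P (mmul N (Y X) Q)) * mtr N (mmul N P' (mmul N (Z X) Q'))) =
    (\<Sum>X\<leftarrow>bs. \<Sum>i<N. (1 / of_nat N) * (mmul N P (mmul N (Y X) Q) (i,i) * mtr N (mmul N P' (mmul N (Z X) Q'))))"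
    by (intro arg_cong[where f = sum_list] map_cong refl)
      (simp add: mtr_def[of N "mmul N P (mmul N _ Q)"] sum_distrib_right sum_divide_distrib del: mat_nth(1))
  also have "\<dots> = (\<Sum>i<N. (1 / of_nat N) * (\<kappa> / (of_nat N)^2 * mmul N P (mmul N Q' (mmul N P' Q)) (i,i)))"
    unfolding sum_list_swap sum_list_const_mult using casimir_cross[OF c] by (intro sum.cong refl) (simp del: mat_nth(1))
  also have "\<dots> = \<kappa> / (of_nat N)^2 * mtr N (mmul N P (mmul N Q' (mmul N P' Q)))"
    by (simp add: mtr_def sum_distrib_left sum_divide_distrib mult_ac del: mat_nth(1))
  finally show ?thesis .
qed

lemma casimir_u_basis: "\<not> snd x \<Longrightarrow> \<not> snd y \<Longrightarrow> casimir N (u_basis N) (\<lambda>X. lins N X x) (\<lambda>X. lins N X y) (-1)"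
  using u_basis_magic by (auto simp: casimir_def lins_def)

lemma casimir_gl_basis: "casimir N (gl_basis N) (\<lambda>X. lins N X x) (\<lambda>X. lins N X y) (if snd x = snd y then 0 else 2)"
proof -
  have star: "(\<Sum>X\<leftarrow>gl_basis N. cnj (X (b,a)) * cnj (X (d,c))) = 0" if "a < N" "b < N" "c < N" "d < N" for a b c d
    using arg_cong[OF gl_basis_magic(1)[of b N a d c], of cnj] that by (simp add: cnj_sum_list)
  show ?thesis
    unfolding casimir_def
  proof (intro allI impI)
    fix a b c d assume l: "a < N" "b < N" "c < N" "d < N"
    note m = gl_basis_magic(2)[OF l(1,2,4,3)] gl_basis_magic(2)[OF l(3,4,2,1)]
    have "(\<Sum>X\<leftarrow>gl_basis N. cnj (X (b,a)) * X (c,d)) = (if c = b \<and> d = a then 2 / of_nat N else 0)"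
      unfolding m(2)[symmetric] by (intro arg_cong[where f = sum_list] map_cong refl mult.commute)
    also have "\<dots> = (if a = d \<and> b = c then 2 / of_nat N else 0)" by auto
    finally have m2: "(\<Sum>X\<leftarrow>gl_basis N. cnj (X (b,a)) * X (c,d)) = (if a = d \<and> b = c then 2 / of_nat N else 0)" .
    show "(\<Sum>X\<leftarrow>gl_basis N. lins N X x (a,b) * lins N X y (c,d)) = (if a = d \<and> b = c then (if snd x = snd y then 0 else 2) / of_nat N else 0)"
    proof (cases "snd x"; cases "snd y")
      assume "snd x" "snd y" then show ?thesis using star[OF l] l by (simp add: lins_def)
    next
      assume "snd x" "\<not> snd y" then show ?thesis using m2 l by (simp add: lins_def)
    next
      assume "\<not> snd x" "snd y" then show ?thesis using m(1) l by (simp add: lins_def)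
    next
      assume "\<not> snd x" "\<not> snd y" then show ?thesis using gl_basis_magic(1)[OF l] by (simp add: lins_def)
    qed
  qed
qed

lemma ins_length: "(c,P,y,Q) \<in> set (ins w) \<Longrightarrow> length P + length Q = length w \<and> set P \<subseteq> set w \<and> set Q \<subseteq> set w \<and> y \<in> set w \<and> cmod c = 1"
proof (induction w arbitrary: c P y Q)
  case (Cons x w)
  show ?case using Cons.prems
    by (auto dest!: Cons.IH simp: lpart_def rpart_def lsgn_def split: if_splits)
qed simp

lemma pairs_length: "(c,P,x,M,y,Q) \<in> set (pairs w) \<Longrightarrow> length P + length M + length Q = length w \<and>
    set P \<subseteq> set w \<and> set M \<subseteq> set w \<and> set Q \<subseteq> set w \<and> x \<in> set w \<and> y \<in> set w \<and> cmod c = 1"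
proof (induction w arbitrary: c P x M y Q)
  case (Cons z w)
  show ?case using Cons.prems
    by (auto dest!: Cons.IH ins_length simp: lpart_def rpart_def lsgn_def norm_mult split: if_splits)
qed simp

lemma length_ins: "length (ins w) = length w"
  by (induction w) auto

lemma length_pairs: "length (pairs w) \<le> length w ^ 2"
  by (induction w) (auto simp: length_ins power2_eq_square)

section \<open>Words, traces and the operator on symbols\<close>

abbreviation lkp :: "('a \<Rightarrow>\<^sub>0 'b::zero) \<Rightarrow> 'a \<Rightarrow> 'b" where "lkp \<equiv> Poly_Mapping.lookup"
abbreviation kys :: "('a \<Rightarrow>\<^sub>0 'b::zero) \<Rightarrow> 'a set" where "kys \<equiv> Poly_Mapping.keys"

text \<open>Linear extension of a function on symbols; evaluations, coefficients and traces of a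
  \<open>tpoly\<close> are all instances.\<close>

definition lin :: "(tsym \<Rightarrow> complex) \<Rightarrow> tpoly \<Rightarrow> complex" where
  "lin \<phi> P = (\<Sum>b\<in>kys P. lkp P b * \<phi> b)"

lemma lin_superset: "finite B \<Longrightarrow> kys P \<subseteq> B \<Longrightarrow> lin \<phi> P = (\<Sum>b\<in>B. lkp P b * \<phi> b)"
  unfolding lin_def by (rule sum.mono_neutral_left) (auto simp: in_keys_iff)

lemma lin_zero [simp]: "lin \<phi> 0 = 0" by (simp add: lin_def)

lemma lin_single [simp]: "lin \<phi> (Poly_Mapping.single b c) = c * \<phi> b"
  by (simp add: lin_def)

lemma lin_add: "lin \<phi> (P + Q) = lin \<phi> P + lin \<phi> Q"
proof -
  let ?B = "kys P \<union> kys Q"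
  have "lin \<phi> (P + Q) = (\<Sum>b\<in>?B. lkp (P + Q) b * \<phi> b)"
    by (rule lin_superset) (use Poly_Mapping.keys_add[of P Q] in auto)
  also have "\<dots> = (\<Sum>b\<in>?B. lkp P b * \<phi> b) + (\<Sum>b\<in>?B. lkp Q b * \<phi> b)"
    by (simp add: lookup_add distrib_right sum.distrib)
  also have "\<dots> = lin \<phi> P + lin \<phi> Q"
    using lin_superset[of ?B P \<phi>] lin_superset[of ?B Q \<phi>] by simp
  finally show ?thesis .
qed

lemma lin_sum: "lin \<phi> (\<Sum>i\<in>I. f i) = (\<Sum>i\<in>I. lin \<phi> (f i))"
  by (induction I rule: infinite_finite_induct) (auto simp: lin_add)

lemma lin_sum_mset: "lin \<phi> (sum_mset (image_mset f S)) = sum_mset (image_mset (\<lambda>x. lin \<phi> (f x)) S)"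
  by (induction S) (auto simp: lin_add)

lemma lookup_tsmult: "lkp (tsmult c P) b = c * lkp P b"
  by (simp add: tsmult_def map.rep_eq when_def)

lemma lin_tsmult: "lin \<phi> (tsmult c P) = c * lin \<phi> P"
proof -
  have "lin \<phi> (tsmult c P) = (\<Sum>b\<in>kys P. lkp (tsmult c P) b * \<phi> b)"
    by (rule lin_superset) (auto simp: in_keys_iff lookup_tsmult)
  then show ?thesis by (simp add: lookup_tsmult lin_def sum_distrib_left mult.assoc)
qed

lemma lin_tmapkeys: "lin \<phi> (tmapkeys g P) = lin (\<lambda>b. \<phi> (g b)) P"
  by (simp add: tmapkeys_def lin_sum) (simp add: lin_def)

lemma lookup_lin: "lkp P b = lin (\<lambda>b'. if b' = b then 1 else 0) P"
  by (auto simp: lin_def in_keys_iff if_distrib[where f = "\<lambda>x. _ * x"] cong: if_cong)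

lemma teval_lin: "i < N \<Longrightarrow> j < N \<Longrightarrow> teval N P A (i,j) = lin (\<lambda>b. symeval N b A (i,j)) P"
  by (simp add: teval_def lin_def)

section \<open>The second derivative of a word and \<open>DeltaU_word\<close>\<close>

definition em :: "word \<Rightarrow> letter list" where "em w = map (\<lambda>b. (b, False)) w"

lemma em_simps [simp]: "em [] = []" "em (x # w) = (x, False) # em w" "em (v @ w) = em v @ em w" "length (em w) = length w"
  by (simp_all add: em_def)

lemma wev_em: "wev N A (em w) = weval N w A"
  by (induction w) (auto simp: weval_def lev_def)

lemma em_fst: "set P \<subseteq> set (em w) \<Longrightarrow> em (map fst P) = P"
  by (induction P) (auto simp: em_def)

lemma weval_mats [simp]: "weval N w A \<in> mats N"
  unfolding wev_em[symmetric] by simp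

lemma lft_rgt_em: "map fst (lpart (x, False)) = lft x" "map fst (rpart (x, False)) = rgt x" "lsgn (x, False) = eps x"
  by (auto simp: lpart_def rpart_def lft_def rgt_def lsgn_def eps_def)

text \<open>Links sums over positions, the form of \<open>DeltaU_word\<close>, with the recursive
  lists of insertions. The function h is arbitrary in the induction because prefixing a letter
  changes its first argument.\<close>

lemma sum_ins_em:
  fixes h :: "word \<Rightarrow> word \<Rightarrow> complex \<Rightarrow> complex"
  shows "(\<Sum>j<length w. h (take j w @ lft (w ! j)) (rgt (w ! j) @ drop (Suc j) w) (eps (w ! j)))
    = (\<Sum>(c,P,y,Q)\<leftarrow>ins (em w). h (map fst P) (map fst Q) c)"
proof (induction w arbitrary: h)
  case (Cons x w)
  have "map fst (em w) = w" by (simp add: em_def o_def)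
  then show ?case using Cons.IH[of "\<lambda>P. h (x # P)"]
    by (simp add: sum.lessThan_Suc_shift lft_rgt_em o_def case_prod_unfold del: sum.lessThan_Suc)
qed simp

lemma sum_pairs_em:
  fixes h :: "word \<Rightarrow> word \<Rightarrow> complex \<Rightarrow> complex"
  shows "(\<Sum>(i,j)\<in>{(i,j). i < j \<and> j < length w}. h (take i w @ lft (w ! i) @ rgt (w ! j) @ drop (Suc j) w)
      (rgt (w ! i) @ take (j - Suc i) (drop (Suc i) w) @ lft (w ! j)) (eps (w ! i) * eps (w ! j)))
    = (\<Sum>(c,P,x,M,y,Q)\<leftarrow>pairs (em w). h (map fst (P @ Q)) (map fst M) c)"
proof (induction w arbitrary: h)
  case (Cons x w)
  define S where "S n = {(i::nat,j). i < j \<and> j < n}" for n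
  have fin: "finite (S n)" for n by (rule finite_subset[of _ "{..<n} \<times> {..<n}"]) (auto simp: S_def)
  have S: "S (Suc n) = (\<lambda>j. (0, Suc j)) ` {..<n} \<union> (\<lambda>(i,j). (Suc i, Suc j)) ` S n" for n
  unfolding set_eq_iff
  proof (intro allI iffI)
    fix p assume "p \<in> S (Suc n)"
    then obtain i j where p: "p = (i,j)" "i < j" "j < Suc n" by (auto simp: S_def)
    then obtain j' where j': "j = Suc j'" by (cases j) auto
    show "p \<in> (\<lambda>j. (0, Suc j)) ` {..<n} \<union> (\<lambda>(i,j). (Suc i, Suc j)) ` S n"
    proof (cases i)
      case 0 then show ?thesis using p j' by auto
    next
      case (Suc i')
      then have "(i', j') \<in> S n" using p j' by (auto simp: S_def)
      then show ?thesis using p j' Suc by force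
    qed
  qed (auto simp: S_def)
  let ?g = "\<lambda>w h (i,j). h (take i w @ lft (w ! i) @ rgt (w ! j) @ drop (Suc j) w)
      (rgt (w ! i) @ take (j - Suc i) (drop (Suc i) w) @ lft (w ! j)) (eps (w ! i) * eps (w ! j)) :: complex"
  have "(\<Sum>p\<in>S (length (x # w)). ?g (x # w) h p) =
    (\<Sum>p\<in>(\<lambda>j. (0, Suc j)) ` {..<length w}. ?g (x # w) h p) + (\<Sum>p\<in>(\<lambda>(i,j). (Suc i, Suc j)) ` S (length w). ?g (x # w) h p)"
    unfolding length_Cons S by (intro sum.union_disjoint) (auto simp: fin)
  also have "(\<Sum>p\<in>(\<lambda>j. (0, Suc j)) ` {..<length w}. ?g (x # w) h p) =
     (\<Sum>j<length w. h (lft x @ (rgt (w ! j) @ drop (Suc j) w)) (rgt x @ (take j w @ lft (w ! j))) (eps x * eps (w ! j)))"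
    by (subst sum.reindex) (auto simp: inj_on_def)
  also have "\<dots> = (\<Sum>(c,P,y,Q)\<leftarrow>ins (em w). h (lft x @ map fst Q) (rgt x @ map fst P) (eps x * c))"
    by (rule sum_ins_em[of "\<lambda>P Q c. h (lft x @ Q) (rgt x @ P) (eps x * c)" w])
  also have "(\<Sum>p\<in>(\<lambda>(i,j). (Suc i, Suc j)) ` S (length w). ?g (x # w) h p) = (\<Sum>p\<in>S (length w). ?g w (\<lambda>P. h (x # P)) p)"
    by (subst sum.reindex) (auto simp: inj_on_def o_def case_prod_unfold)
  also have "\<dots> = (\<Sum>(c,P,x',M,y,Q)\<leftarrow>pairs (em w). h (x # map fst (P @ Q)) (map fst M) c)"
    using Cons.IH[of "\<lambda>P. h (x # P)"] by (simp add: S_def case_prod_unfold)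
  finally show ?case
    by (simp add: S_def lft_rgt_em o_def case_prod_unfold)
qed simp

lemma ins_append: "(c,P,y,Q) \<in> set (ins w) \<Longrightarrow> P @ Q = w"
  by (induction w arbitrary: c P y Q) (auto simp: lpart_def rpart_def split: if_splits)

lemma mtr_mid [simp]: "N \<ge> 1 \<Longrightarrow> mtr N (mid N) = 1"
  by (simp add: mtr_def)

definition pS :: "nat \<Rightarrow> word multiset \<Rightarrow> cmat \<Rightarrow> complex" where
  "pS N S A = prod_mset (image_mset (\<lambda>M. mtr N (weval N M A)) S)"

lemma pS_simps [simp]: "pS N {#} A = 1" "pS N (add_mset M S) A = mtr N (weval N M A) * pS N S A"
  "pS N (S + T) A = pS N S A * pS N T A"
  by (simp_all add: pS_def)

lemma pS_trm: "N \<ge> 1 \<Longrightarrow> pS N (trm w) A = mtr N (weval N w A)"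
  by (auto simp: trm_def pS_def weval_def)

lemma symeval_nth: "i < N \<Longrightarrow> j < N \<Longrightarrow> symeval N (w,S) A (i,j) = pS N S A * weval N w A (i,j)"
  by (simp add: symeval_def pS_def)

lemma symeval_nth': "i < N \<Longrightarrow> j < N \<Longrightarrow> symeval N b A (i,j) = pS N (snd b) A * weval N (fst b) A (i,j)"
  by (cases b) (simp add: symeval_nth)

lemma symeval_mats [simp]: "symeval N b A \<in> mats N"
  by (cases b) (simp add: symeval_def)

lemma mtr_mscale: "mtr N (mscale N c A) = c * mtr N A"
  by (simp add: mtr_def sum_distrib_left)

lemma mtr_symeval: "mtr N (symeval N (w,S) A) = pS N S A * mtr N (weval N w A)"
  by (simp add: symeval_def pS_def mtr_mscale)

lemma mtr_symeval': "mtr N (symeval N b A) = pS N (snd b) A * mtr N (weval N (fst b) A)"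
  by (cases b) (simp add: mtr_symeval)

text \<open>For a single word the agreement with \<open>DeltaU_word\<close> is exact for every N >=
  1. Two insertions at one letter enclose the empty segment, of trace 1, and give -1 each; two
  insertions at different letters split off a trace. Error terms appear only between different
  factors of a symbol.\<close>

lemma sum_D2_em:
  assumes N: "N \<ge> 1" and A: "A \<in> GLm N" and ij: "i < N" "j < N"
  shows "(\<Sum>X\<leftarrow>u_basis N. D2 N X A (em w) (i,j)) = lin (\<lambda>b. symeval N b A (i,j)) (DeltaU_word w)"
proof -
  have unst: "\<not> snd x" if "x \<in> set (em w)" for x using that by (auto simp: em_def)
  have 1: "(\<Sum>X\<leftarrow>u_basis N. \<Sum>(c,P,y,Q)\<leftarrow>ins (em w). mmul N (wev N A P) (mmul N (lins N X y) (mmul N (lins N X y) (wev N A Q))) (i,j))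
    = - of_nat (length w) * weval N w A (i,j)"
  proof -
    have "(\<Sum>X\<leftarrow>u_basis N. \<Sum>(c,P,y,Q)\<leftarrow>ins (em w). mmul N (wev N A P) (mmul N (lins N X y) (mmul N (lins N X y) (wev N A Q))) (i,j))
      = (\<Sum>(c,P,y,Q)\<leftarrow>ins (em w). \<Sum>X\<leftarrow>u_basis N. mmul N (wev N A P) (mmul N (lins N X y) (mmul N (lins N X y) (wev N A Q))) (i,j))"
      by (simp only: case_prod_unfold) (rule sum_list_swap2)
    also have "\<dots> = (\<Sum>(c,P,y,Q)\<leftarrow>ins (em w). - weval N w A (i,j))"
    proof (intro arg_cong[where f = sum_list] map_cong refl, clarify)
      fix c P y st Q assume m: "(c, P, (y,st), Q) \<in> set (ins (em w))"
      then have y: "\<not> snd (y,st)" using ins_length[OF m] unst by blast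
      have "(\<Sum>X\<leftarrow>u_basis N. mmul N (wev N A P) (mmul N (lins N X (y,st)) (mmul N (mid N) (mmul N (lins N X (y,st)) (wev N A Q)))) (i,j))
        = -1 * mtr N (mid N) * mmul N (wev N A P) (wev N A Q) (i,j)"
        by (rule casimir_sandwich[OF casimir_u_basis[OF y y] ij])
      also have "mmul N (wev N A P) (wev N A Q) = weval N w A" using ins_append[OF m] wev_append[of N A P Q] wev_em by metis
      finally show "(\<Sum>X\<leftarrow>u_basis N. mmul N (wev N A P) (mmul N (lins N X (y,st)) (mmul N (lins N X (y,st)) (wev N A Q))) (i,j)) = - weval N w A (i,j)"
        using N by (simp only: mmul_mid_left[OF mats_closed(1)] mtr_mid)  simp
    qed
    also have "\<dots> = - of_nat (length w) * weval N w A (i,j)"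
      by (simp add: case_prod_unfold length_ins sum_list_triv)
    finally show ?thesis .
  qed
  have 2: "(\<Sum>X\<leftarrow>u_basis N. \<Sum>(c,P,x,M,y,Q)\<leftarrow>pairs (em w). mscale N (2 * c) (mmul N (wev N A P) (mmul N (lins N X x) (mmul N (wev N A M) (mmul N (lins N X y) (wev N A Q))))) (i,j))
    = (\<Sum>(c,P,x,M,y,Q)\<leftarrow>pairs (em w). - 2 * c * (mtr N (weval N (map fst M) A) * weval N (map fst (P @ Q)) A (i,j)))"
  proof -
    have "(\<Sum>X\<leftarrow>u_basis N. \<Sum>(c,P,x,M,y,Q)\<leftarrow>pairs (em w). mscale N (2 * c) (mmul N (wev N A P) (mmul N (lins N X x) (mmul N (wev N A M) (mmul N (lins N X y) (wev N A Q))))) (i,j))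
      = (\<Sum>(c,P,x,M,y,Q)\<leftarrow>pairs (em w). \<Sum>X\<leftarrow>u_basis N. mscale N (2 * c) (mmul N (wev N A P) (mmul N (lins N X x) (mmul N (wev N A M) (mmul N (lins N X y) (wev N A Q))))) (i,j))"
      by (simp only: case_prod_unfold) (rule sum_list_swap2)
    also have "\<dots> = (\<Sum>(c,P,x,M,y,Q)\<leftarrow>pairs (em w). - 2 * c * (mtr N (weval N (map fst M) A) * weval N (map fst (P @ Q)) A (i,j)))"
    proof (intro arg_cong[where f = sum_list] map_cong refl, clarify)
      fix c P x sx M y sy Q assume m: "(c, P, (x,sx), M, (y,sy), Q) \<in> set (pairs (em w))"
      note l = pairs_length[OF m]
      have xy: "\<not> snd (x,sx)" "\<not> snd (y,sy)" using l unst by blast+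
      have MPQ: "wev N A M = weval N (map fst M) A" "wev N A (P @ Q) = weval N (map fst (P @ Q)) A"
        unfolding wev_em[symmetric] using em_fst[of M w] em_fst[of "P @ Q" w] l by simp_all
      have "(\<Sum>X\<leftarrow>u_basis N. mscale N (2 * c) (mmul N (wev N A P) (mmul N (lins N X (x,sx)) (mmul N (wev N A M) (mmul N (lins N X (y,sy)) (wev N A Q))))) (i,j))
        = (\<Sum>X\<leftarrow>u_basis N. (2 * c) * mmul N (wev N A P) (mmul N (lins N X (x,sx)) (mmul N (wev N A M) (mmul N (lins N X (y,sy)) (wev N A Q)))) (i,j))"
        using ij by (simp del: mat_nth(1))
      also have "\<dots> = 2 * c * (-1 * mtr N (wev N A M) * mmul N (wev N A P) (wev N A Q) (i,j))"
        unfolding sum_list_const_mult casimir_sandwich[OF casimir_u_basis[OF xy] ij] ..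
      finally show "(\<Sum>X\<leftarrow>u_basis N. mscale N (2 * c) (mmul N (wev N A P) (mmul N (lins N X (x,sx)) (mmul N (wev N A M) (mmul N (lins N X (y,sy)) (wev N A Q))))) (i,j))
        = - 2 * c * (mtr N (weval N (map fst M) A) * weval N (map fst (P @ Q)) A (i,j))"
        unfolding wev_append[symmetric] MPQ by simp
    qed
    finally show ?thesis .
  qed
  have "lin (\<lambda>b. symeval N b A (i,j)) (DeltaU_word w) = - of_nat (length w) * weval N w A (i,j) +
    (\<Sum>(i',j')\<in>{(i,j). i < j \<and> j < length w}. - 2 * (eps (w ! i') * eps (w ! j')) *
        (mtr N (weval N (rgt (w ! i') @ take (j' - Suc i') (drop (Suc i') w) @ lft (w ! j')) A) *
         weval N (take i' w @ lft (w ! i') @ rgt (w ! j') @ drop (Suc j') w) A (i,j)))"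
    unfolding DeltaU_word_def lin_add lin_sum
    using ij by (simp add: symeval_nth pS_trm[OF N] case_prod_unfold mult.assoc)
  also have "\<dots> = - of_nat (length w) * weval N w A (i,j) +
     (\<Sum>(c,P,x,M,y,Q)\<leftarrow>pairs (em w). - 2 * c * (mtr N (weval N (map fst M) A) * weval N (map fst (P @ Q)) A (i,j)))"
    using sum_pairs_em[of "\<lambda>v u c. - 2 * c * (mtr N (weval N u A) * weval N v A (i,j))" w] by simp
  also have "\<dots> = (\<Sum>X\<leftarrow>u_basis N. D2 N X A (em w) (i,j))"
    unfolding 1[symmetric] 2[symmetric] sum_list_addf[symmetric]
    using ij by (simp add: D2_def msum_nth case_prod_unfold del: mat_nth(1,4))
  finally show ?thesis ..
qed


section \<open>Symbols of bounded degree, with coefficients free of N\<close>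

definition tdeg :: "tsym \<Rightarrow> nat" where
  "tdeg b = length (fst b) + sum_mset (image_mset length (snd b))"

text \<open>Empty trace factors are excluded: arbitrarily many of them would leave the degree
  unchanged, and the set would be infinite.\<close>

definition Bd :: "nat \<Rightarrow> tsym set" where
  "Bd d = {b. tdeg b \<le> d \<and> [] \<notin># snd b}"

lemma sum_mset_length_ge: "M \<in># S \<Longrightarrow> length M \<le> sum_mset (image_mset length S)"
  by (induction S) auto

lemma sum_mset_length_size: "[] \<notin># S \<Longrightarrow> size S \<le> sum_mset (image_mset length S)"
proof (induction S)
  case (add M S)
  then have "length M \<ge> 1" by (cases M) auto
  then show ?case using add by simp
qed simp

lemma finite_Bd [simp]: "finite (Bd d)"
proof (rule finite_subset)
  define W where "W = {w :: word. set w \<subseteq> UNIV \<and> length w \<le> d}"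
  have W: "finite W" unfolding W_def by (rule finite_lists_length_le) simp
  show "finite ((\<lambda>(w,xs). (w, mset xs)) ` (W \<times> {xs. set xs \<subseteq> W \<and> length xs \<le> d}))"
    using W finite_lists_length_le[OF W] by simp
  show "Bd d \<subseteq> (\<lambda>(w,xs). (w, mset xs)) ` (W \<times> {xs. set xs \<subseteq> W \<and> length xs \<le> d})"
  proof
    fix b assume b: "b \<in> Bd d"
    obtain w S where wS: "b = (w,S)" by fastforce
    obtain xs where xs: "mset xs = S" using ex_mset by blast
    have d: "length w + sum_mset (image_mset length S) \<le> d" "[] \<notin># S" using b by (auto simp: Bd_def wS tdeg_def)
    have "length xs \<le> d" using sum_mset_length_size[OF d(2)] d(1) size_mset[of xs] xs by simp
    moreover have "set xs \<subseteq> W"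
    proof
      fix M assume "M \<in> set xs"
      then have "M \<in># S" using xs by (metis set_mset_mset)
      then show "M \<in> W" using sum_mset_length_ge[of M S] d by (simp add: W_def)
    qed
    moreover have "w \<in> W" using d by (simp add: W_def)
    ultimately show "b \<in> (\<lambda>(w,xs). (w, mset xs)) ` (W \<times> {xs. set xs \<subseteq> W \<and> length xs \<le> d})"
      unfolding wS xs[symmetric] by force
  qed
qed

lemma Bd_mono: "d \<le> d' \<Longrightarrow> Bd d \<subseteq> Bd d'"
  by (auto simp: Bd_def)

lemma Bd_trm: "(w,S) \<in> Bd d \<Longrightarrow> (w, S + trm M) \<in> Bd (d + length M)"
  by (auto simp: Bd_def tdeg_def trm_def)

text \<open>The coefficients come before N: f is one combination of symbols of degree at most d for
  all matrix sizes at once. This uniformity is what turns a factor 1/N^2 into a rate.\<close>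

definition rep :: "nat \<Rightarrow> (nat \<Rightarrow> cmat \<Rightarrow> nat \<times> nat \<Rightarrow> complex) \<Rightarrow> bool" where
  "rep d f \<longleftrightarrow> (\<exists>c. \<forall>N\<ge>1. \<forall>A\<in>GLm N. \<forall>i<N. \<forall>j<N. f N A (i,j) = (\<Sum>b\<in>Bd d. c b * symeval N b A (i,j)))"

lemma rep_cong:
  assumes "rep d f" "\<And>N A i j. N \<ge> 1 \<Longrightarrow> A \<in> GLm N \<Longrightarrow> i < N \<Longrightarrow> j < N \<Longrightarrow> g N A (i,j) = f N A (i,j)"
  shows "rep d g"
proof -
  obtain c where "\<forall>N\<ge>1. \<forall>A\<in>GLm N. \<forall>i<N. \<forall>j<N. f N A (i,j) = (\<Sum>b\<in>Bd d. c b * symeval N b A (i,j))"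
    using assms(1) unfolding rep_def by (rule exE)
  then show ?thesis unfolding rep_def by (intro exI[of _ c]) (simp add: assms(2))
qed

lemma repE:
  assumes "rep d f"
  obtains c where "\<And>N A i j. N \<ge> 1 \<Longrightarrow> A \<in> GLm N \<Longrightarrow> i < N \<Longrightarrow> j < N \<Longrightarrow> f N A (i,j) = (\<Sum>b\<in>Bd d. c b * symeval N b A (i,j))"
proof -
  obtain c where "\<forall>N\<ge>1. \<forall>A\<in>GLm N. \<forall>i<N. \<forall>j<N. f N A (i,j) = (\<Sum>b\<in>Bd d. c b * symeval N b A (i,j))"
    using assms(1) unfolding rep_def by (rule exE)
  then show ?thesis by (intro that[of c]) simp
qed

lemma rep_symeval: "b \<in> Bd d \<Longrightarrow> rep d (\<lambda>N A. symeval N b A)"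
  unfolding rep_def
  by (intro exI[of _ "\<lambda>b'. if b' = b then 1 else 0"]) (simp add: if_distrib[where f = "\<lambda>x. x * _"] cong: if_cong)

lemma rep_zero: "rep d (\<lambda>N A p. 0)"
  unfolding rep_def by (intro exI[of _ "\<lambda>b. 0"]) simp

lemma rep_add: "rep d f \<Longrightarrow> rep d g \<Longrightarrow> rep d (\<lambda>N A p. f N A p + g N A p)"
  unfolding rep_def
proof (elim exE)
  fix c c' assume "\<forall>N\<ge>1. \<forall>A\<in>GLm N. \<forall>i<N. \<forall>j<N. f N A (i,j) = (\<Sum>b\<in>Bd d. c b * symeval N b A (i,j))"
    "\<forall>N\<ge>1. \<forall>A\<in>GLm N. \<forall>i<N. \<forall>j<N. g N A (i,j) = (\<Sum>b\<in>Bd d. c' b * symeval N b A (i,j))"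
  then show "\<exists>c. \<forall>N\<ge>1. \<forall>A\<in>GLm N. \<forall>i<N. \<forall>j<N. f N A (i,j) + g N A (i,j) = (\<Sum>b\<in>Bd d. c b * symeval N b A (i,j))"
    by (intro exI[of _ "\<lambda>b. c b + c' b"]) (simp add: distrib_right sum.distrib)
qed

lemma rep_cmult: "rep d f \<Longrightarrow> rep d (\<lambda>N A p. k * f N A p)"
  unfolding rep_def
proof (elim exE)
  fix c assume "\<forall>N\<ge>1. \<forall>A\<in>GLm N. \<forall>i<N. \<forall>j<N. f N A (i,j) = (\<Sum>b\<in>Bd d. c b * symeval N b A (i,j))"
  then show "\<exists>c. \<forall>N\<ge>1. \<forall>A\<in>GLm N. \<forall>i<N. \<forall>j<N. k * f N A (i,j) = (\<Sum>b\<in>Bd d. c b * symeval N b A (i,j))"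
    by (intro exI[of _ "\<lambda>b. k * c b"]) (simp add: sum_distrib_left mult.assoc)
qed

lemma rep_sum: "(\<And>x. x \<in> I \<Longrightarrow> rep d (f x)) \<Longrightarrow> rep d (\<lambda>N A p. \<Sum>x\<in>I. f x N A p)"
  by (induction I rule: infinite_finite_induct) (auto intro: rep_zero rep_add)

lemma rep_sum_list: "(\<And>x. x \<in> set xs \<Longrightarrow> rep d (f x)) \<Longrightarrow> rep d (\<lambda>N A p. \<Sum>x\<leftarrow>xs. f x N A p)"
  by (induction xs) (auto intro: rep_zero rep_add)

lemma rep_mult:
  assumes "rep d f"
  shows "rep (d + length M) (\<lambda>N A p. mtr N (weval N M A) * f N A p)"
proof -
  obtain c where c: "\<And>N A i j. N \<ge> 1 \<Longrightarrow> A \<in> GLm N \<Longrightarrow> i < N \<Longrightarrow> j < N \<Longrightarrow> f N A (i,j) = (\<Sum>b\<in>Bd d. c b * symeval N b A (i,j))"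
    by (rule repE[OF assms]) blast
  have "rep (d + length M) (\<lambda>N A p. \<Sum>b\<in>Bd d. c b * symeval N (fst b, snd b + trm M) A p)"
    by (rule rep_sum[OF rep_cmult[OF rep_symeval]]) (rule Bd_trm, simp)
  then show ?thesis
    by (rule rep_cong) (simp add: c sum_distrib_left symeval_nth' pS_trm mult_ac)
qed

lemma rep_mono: "rep d f \<Longrightarrow> d \<le> d' \<Longrightarrow> rep d' f"
proof -
  assume r: "rep d f" and "d \<le> d'"
  obtain c where c: "\<And>N A i j. N \<ge> 1 \<Longrightarrow> A \<in> GLm N \<Longrightarrow> i < N \<Longrightarrow> j < N \<Longrightarrow> f N A (i,j) = (\<Sum>b\<in>Bd d. c b * symeval N b A (i,j))"
    by (rule repE[OF r]) blast
  have "rep d' (\<lambda>N A p. \<Sum>b\<in>Bd d. c b * symeval N b A p)"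
    using Bd_mono[OF \<open>d \<le> d'\<close>] by (intro rep_sum[OF rep_cmult[OF rep_symeval]]) auto
  then show "rep d' f" by (rule rep_cong) (simp add: c)
qed

text \<open>The trace of F becomes a new trace factor; multiplication by the word v keeps the
  statement matrix-valued, as \<open>rep\<close> requires.\<close>

lemma rep_trace:
  assumes "rep d (\<lambda>N A. F N A)"
  shows "rep (d + length v) (\<lambda>N A p. mtr N (F N A) * weval N v A p)"
proof -
  obtain c where c: "\<And>N A i j. N \<ge> 1 \<Longrightarrow> A \<in> GLm N \<Longrightarrow> i < N \<Longrightarrow> j < N \<Longrightarrow> F N A (i,j) = (\<Sum>b\<in>Bd d. c b * symeval N b A (i,j))"
    by (rule repE[OF assms]) blast
  have B: "(v, snd b + trm (fst b)) \<in> Bd (d + length v)" if "b \<in> Bd d" for b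
    using that by (auto simp: Bd_def tdeg_def trm_def)
  have "rep (d + length v) (\<lambda>N A p. \<Sum>b\<in>Bd d. c b * symeval N (v, snd b + trm (fst b)) A p)"
    by (rule rep_sum[OF rep_cmult[OF rep_symeval]]) (rule B)
  then show ?thesis
  proof (rule rep_cong)
    fix N A i j assume *: "1 \<le> N" "A \<in> GLm N" "i < N" "j < N"
    have "mtr N (F N A) = (\<Sum>k<N. \<Sum>b\<in>Bd d. c b * symeval N b A (k,k)) / of_nat N"
      unfolding mtr_def using c[OF *(1,2)] by simp
    also have "\<dots> = (\<Sum>b\<in>Bd d. c b * mtr N (symeval N b A))"
      unfolding mtr_def by (subst sum.swap) (simp only: sum_divide_distrib sum_distrib_left times_divide_eq_right)
    finally have "mtr N (F N A) = (\<Sum>b\<in>Bd d. c b * (pS N (snd b) A * mtr N (weval N (fst b) A)))"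
      by (simp only: mtr_symeval')
    then show "mtr N (F N A) * weval N v A (i,j) = (\<Sum>b\<in>Bd d. c b * symeval N (v, snd b + trm (fst b)) A (i,j))"
      using * by (simp add: symeval_nth pS_trm sum_distrib_right sum_distrib_left mult_ac)
  qed
qed

section \<open>Derivatives of products of traces\<close>

fun T1 :: "nat \<Rightarrow> cmat \<Rightarrow> cmat \<Rightarrow> word list \<Rightarrow> complex" where
  "T1 N X A [] = 0"
| "T1 N X A (M # xs) = mtr N (D1 N X A (em M)) * pS N (mset xs) A + mtr N (weval N M A) * T1 N X A xs"

fun T2 :: "nat \<Rightarrow> cmat \<Rightarrow> cmat \<Rightarrow> word list \<Rightarrow> complex" where
  "T2 N X A [] = 0"
| "T2 N X A (M # xs) = mtr N (D2 N X A (em M)) * pS N (mset xs) A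
     + 2 * (mtr N (D1 N X A (em M)) * T1 N X A xs) + mtr N (weval N M A) * T2 N X A xs"

lemma vdiff2_pS: "X \<in> mats N \<Longrightarrow> vdiff2 N X (pS N (mset xs)) (\<lambda>A. T1 N X A xs) (\<lambda>A. T2 N X A xs)"
proof (induction xs)
  case Nil
  then show ?case using vdiff2_const[of N X 1] by (simp add: pS_def)
next
  case (Cons M xs)
  have "pS N (mset (M # xs)) = (\<lambda>A. mtr N (weval N M A) * pS N (mset xs) A)" by (rule ext) simp
  with vdiff2_mult[OF Cons.prems vdiff2_mtr[OF Cons.prems, of "em M"] Cons.IH[OF Cons.prems]]
  show ?case by (simp add: wev_em)
qed

text \<open>What a derivation would give for the Laplacian of a product of traces, one factor being
  differentiated at a time. The sum of \<open>T2\<close> over the basis exceeds it by the cross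
  terms between factors.\<close>

fun dpS :: "nat \<Rightarrow> cmat \<Rightarrow> word list \<Rightarrow> complex" where
  "dpS N A [] = 0"
| "dpS N A (M # xs) = (\<Sum>X\<leftarrow>u_basis N. mtr N (D2 N X A (em M))) * pS N (mset xs) A + mtr N (weval N M A) * dpS N A xs"

lemma rep_mult_pS: "rep d f \<Longrightarrow> rep (d + sum_list (map length xs)) (\<lambda>N A p. pS N (mset xs) A * f N A p)"
proof (induction xs)
  case Nil then show ?case by simp
next
  case (Cons M xs)
  show ?case
    by (rule rep_cong[OF rep_mono[OF rep_mult[OF Cons.IH[OF Cons.prems], of M]]]) simp_all
qed

text \<open>After multiplication by N^2 a combination of words remains that is free of N and whose
  words have the total length of w and M.\<close>

lemma cross_words:
  assumes N: "N \<ge> 1" and A: "A \<in> GLm N" and ij: "i < N" "j < N"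
  shows "(of_nat N)^2 * (\<Sum>X\<leftarrow>u_basis N. D1 N X A (em w) (i,j) * mtr N (D1 N X A (em M)))
    = (\<Sum>(c,P,y,Q)\<leftarrow>ins (em w). \<Sum>(c',P',y',Q')\<leftarrow>ins (em M). - (c * c') * weval N (map fst (P @ Q' @ P' @ Q)) A (i,j))"
proof -
  let ?t = "\<lambda>X P y Q. mmul N (wev N A P) (mmul N (lins N X y) (wev N A Q))"
  have tr: "mtr N (D1 N X A v) = (\<Sum>(c,P,y,Q)\<leftarrow>ins v. c * mtr N (?t X P y Q))" for X v
  proof -
    have "mtr N (D1 N X A v) = (\<Sum>(c,P,y,Q)\<leftarrow>ins v. mtr N (mscale N c (?t X P y Q)))"
      unfolding mtr_def D1_def by (simp add: msum_nth sum_list_swap[symmetric] case_prod_unfold divide_inverse sum_list_mult_const sum_distrib_right[symmetric] del: mat_nth(1,4))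
    then show ?thesis by (simp add: mtr_mscale)
  qed
  have "(\<Sum>X\<leftarrow>u_basis N. D1 N X A (em w) (i,j) * mtr N (D1 N X A (em M)))
    = (\<Sum>X\<leftarrow>u_basis N. \<Sum>p\<leftarrow>ins (em w). \<Sum>q\<leftarrow>ins (em M).
        (fst p * fst q) * (?t X (fst (snd p)) (fst (snd (snd p))) (snd (snd (snd p))) (i,j) * mtr N (?t X (fst (snd q)) (fst (snd (snd q))) (snd (snd (snd q))))))"
    unfolding tr using ij
    by (simp add: D1_def msum_nth case_prod_unfold sum_list_mult_const[symmetric] sum_list_const_mult[symmetric] mult_ac del: mat_nth(1))
  also have "\<dots> = (\<Sum>p\<leftarrow>ins (em w). \<Sum>q\<leftarrow>ins (em M). \<Sum>X\<leftarrow>u_basis N.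
        (fst p * fst q) * (?t X (fst (snd p)) (fst (snd (snd p))) (snd (snd (snd p))) (i,j) * mtr N (?t X (fst (snd q)) (fst (snd (snd q))) (snd (snd (snd q))))))"
    by (rule trans[OF sum_list_swap2]) (intro arg_cong[where f = sum_list] map_cong refl sum_list_swap2)
  also have "\<dots> = (\<Sum>p\<leftarrow>ins (em w). \<Sum>q\<leftarrow>ins (em M).
      (1 / (of_nat N)^2) * (- (fst p * fst q) * weval N (map fst (fst (snd p) @ snd (snd (snd q)) @ fst (snd q) @ snd (snd (snd p)))) A (i,j)))"
  proof (intro arg_cong[where f = sum_list] map_cong refl)
    fix p q assume pq: "p \<in> set (ins (em w))" "q \<in> set (ins (em M))"
    obtain c P y Q where p: "p = (c,P,y,Q)" by (metis prod.exhaust)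
    obtain c' P' y' Q' where q: "q = (c',P',y',Q')" by (metis prod.exhaust)
    have l: "set P \<subseteq> set (em w)" "set Q \<subseteq> set (em w)" "y \<in> set (em w)" "set P' \<subseteq> set (em M)" "set Q' \<subseteq> set (em M)" "y' \<in> set (em M)"
      using ins_length[of c P y Q] ins_length[of c' P' y' Q'] pq p q by blast+
    have y: "\<not> snd y" "\<not> snd y'" using l by (auto simp: em_def)
    have e: "em (map fst (P @ Q' @ P' @ Q)) = P @ Q' @ P' @ Q"
      using em_fst[OF l(1)] em_fst[OF l(2)] em_fst[OF l(4)] em_fst[OF l(5)] by simp
    have "(\<Sum>X\<leftarrow>u_basis N. ?t X P y Q (i,j) * mtr N (?t X P' y' Q')) = -1 / (of_nat N)^2 * mmul N (wev N A P) (mmul N (wev N A Q') (mmul N (wev N A P') (wev N A Q))) (i,j)"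
      by (rule casimir_cross[OF casimir_u_basis[OF y] ij])
    also have "mmul N (wev N A P) (mmul N (wev N A Q') (mmul N (wev N A P') (wev N A Q))) = weval N (map fst (P @ Q' @ P' @ Q)) A"
      unfolding wev_em[symmetric] e by (simp add: wev_append)
    finally show "(\<Sum>X\<leftarrow>u_basis N. (fst p * fst q) * (?t X (fst (snd p)) (fst (snd (snd p))) (snd (snd (snd p))) (i,j) * mtr N (?t X (fst (snd q)) (fst (snd (snd q))) (snd (snd (snd q))))))
      = (1 / (of_nat N)^2) * (- (fst p * fst q) * weval N (map fst (fst (snd p) @ snd (snd (snd q)) @ fst (snd q) @ snd (snd (snd p)))) A (i,j))"
      by (simp add: p q sum_list_const_mult del: mat_nth(1))
  qed
  finally have e: "(\<Sum>X\<leftarrow>u_basis N. D1 N X A (em w) (i,j) * mtr N (D1 N X A (em M))) =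
    (1 / (of_nat N)^2) * (\<Sum>p\<leftarrow>ins (em w). \<Sum>q\<leftarrow>ins (em M).
      - (fst p * fst q) * weval N (map fst (fst (snd p) @ snd (snd (snd q)) @ fst (snd q) @ snd (snd (snd p)))) A (i,j))"
    by (simp only: sum_list_const_mult)
  show ?thesis unfolding e using N by (simp add: case_prod_unfold)
qed

lemma rep_cross_words: "rep (length w + length M) (\<lambda>N A p. (of_nat N)^2 * (\<Sum>X\<leftarrow>u_basis N. D1 N X A (em w) p * mtr N (D1 N X A (em M))))"
proof (rule rep_cong)
  show "rep (length w + length M) (\<lambda>N A p. \<Sum>(c,P,y,Q)\<leftarrow>ins (em w). \<Sum>(c',P',y',Q')\<leftarrow>ins (em M). - (c * c') * weval N (map fst (P @ Q' @ P' @ Q)) A p)"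
    unfolding case_prod_unfold
  proof (rule rep_sum_list, rule rep_sum_list, rule rep_cmult)
    fix p q assume pq: "p \<in> set (ins (em w))" "q \<in> set (ins (em M))"
    obtain c P y Q where p: "p = (c,P,y,Q)" by (metis prod.exhaust)
    obtain c' P' y' Q' where q: "q = (c',P',y',Q')" by (metis prod.exhaust)
    have l: "length P + length Q = length w" "length P' + length Q' = length M"
      using ins_length[of c P y Q "em w"] ins_length[of c' P' y' Q' "em M"] pq p q by simp_all
    have "rep (length w + length M) (\<lambda>N A. symeval N (map fst (P @ Q' @ P' @ Q), {#}) A)"
      by (rule rep_symeval) (use l in \<open>simp add: Bd_def tdeg_def\<close>)
    then show "rep (length w + length M) (\<lambda>N A. weval N (map fst (fst (snd p) @ snd (snd (snd q)) @ fst (snd q) @ snd (snd (snd p)))) A)"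
      by (rule rep_cong) (simp add: p q symeval_nth)
  qed
qed (rule cross_words)

lemma rep_cross: "rep (length w + sum_list (map length xs)) (\<lambda>N A p. (of_nat N)^2 * (\<Sum>X\<leftarrow>u_basis N. D1 N X A (em w) p * T1 N X A xs))"
proof (induction xs)
  case Nil
  show ?case using rep_zero by simp
next
  case (Cons M xs)
  show ?case
  proof (rule rep_cong)
    show "rep (length w + sum_list (map length (M # xs)))
      (\<lambda>N A p. pS N (mset xs) A * ((of_nat N)^2 * (\<Sum>X\<leftarrow>u_basis N. D1 N X A (em w) p * mtr N (D1 N X A (em M))))
        + mtr N (weval N M A) * ((of_nat N)^2 * (\<Sum>X\<leftarrow>u_basis N. D1 N X A (em w) p * T1 N X A xs)))"
      by (rule rep_add[OF rep_mono[OF rep_mult_pS[OF rep_cross_words[of w M], of xs]] rep_mono[OF rep_mult[OF Cons.IH, of M]]]) simp_all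
  qed (simp add: sum_list_const_mult[symmetric] sum_list_addf[symmetric] algebra_simps)
qed

lemma mtr_sum_list_scalar: "mtr N (restrict (\<lambda>p. k * (\<Sum>X\<leftarrow>bs. F X p * s X)) (sq N)) = k * (\<Sum>X\<leftarrow>bs. mtr N (F X) * s X)"
proof -
  have "(\<Sum>i<N. \<Sum>X\<leftarrow>bs. F X (i,i) * s X) = (\<Sum>X\<leftarrow>bs. (\<Sum>i<N. F X (i,i)) * s X)"
    unfolding sum_list_swap[symmetric] by (simp add: sum_distrib_right)
  moreover have "(\<Sum>X\<leftarrow>bs. (\<Sum>i<N. F X (i,i)) * s X) / of_nat N = (\<Sum>X\<leftarrow>bs. (\<Sum>i<N. F X (i,i)) / of_nat N * s X)"
    by (induction bs) (simp_all add: add_divide_distrib)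
  moreover have "mtr N (restrict (\<lambda>p. k * (\<Sum>X\<leftarrow>bs. F X p * s X)) (sq N)) = k * ((\<Sum>i<N. \<Sum>X\<leftarrow>bs. F X (i,i) * s X) / of_nat N)"
    by (simp add: mtr_def sum_distrib_left)
  ultimately show ?thesis unfolding mtr_def by (simp only:)
qed

lemma rep_T2: "rep (length v + sum_list (map length xs)) (\<lambda>N A p. (of_nat N)^2 * ((\<Sum>X\<leftarrow>u_basis N. T2 N X A xs) - dpS N A xs) * weval N v A p)"
proof (induction xs)
  case Nil
  show ?case using rep_zero by simp
next
  case (Cons M xs)
  \<comment> \<open>A matrix whose trace is the cross term, so that \<open>rep_trace\<close> applies
    to it.\<close>
  define G where "G N A = restrict (\<lambda>p. (of_nat N)^2 * (\<Sum>X\<leftarrow>u_basis N. D1 N X A (em M) p * T1 N X A xs)) (sq N)" for N A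
  have "rep (length M + sum_list (map length xs)) (\<lambda>N A. G N A)"
    by (rule rep_cong[OF rep_cross[of M xs]]) (simp add: G_def)
  from rep_trace[OF this, of v]
  have 1: "rep (length v + sum_list (map length (M # xs))) (\<lambda>N A p. mtr N (G N A) * weval N v A p)"
    by (rule rep_mono) simp
  show ?case
  proof (rule rep_cong)
    show "rep (length v + sum_list (map length (M # xs)))
      (\<lambda>N A p. 2 * (mtr N (G N A) * weval N v A p) + mtr N (weval N M A) * ((of_nat N)^2 * ((\<Sum>X\<leftarrow>u_basis N. T2 N X A xs) - dpS N A xs) * weval N v A p))"
      by (rule rep_add[OF rep_cmult[OF 1] rep_mono[OF rep_mult[OF Cons.IH, of M]]]) simp
    fix N A i j
    have g: "mtr N (G N A) = (of_nat N)^2 * (\<Sum>X\<leftarrow>u_basis N. mtr N (D1 N X A (em M)) * T1 N X A xs)"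
      unfolding G_def by (rule mtr_sum_list_scalar)
    have s: "(\<Sum>X\<leftarrow>u_basis N. T2 N X A (M # xs)) - dpS N A (M # xs)
      = 2 * (\<Sum>X\<leftarrow>u_basis N. mtr N (D1 N X A (em M)) * T1 N X A xs) + mtr N (weval N M A) * ((\<Sum>X\<leftarrow>u_basis N. T2 N X A xs) - dpS N A xs)"
      by (simp add: sum_list_addf sum_list_const_mult sum_list_mult_const algebra_simps)
    show "(of_nat N)^2 * ((\<Sum>X\<leftarrow>u_basis N. T2 N X A (M # xs)) - dpS N A (M # xs)) * weval N v A (i,j)
     = 2 * (mtr N (G N A) * weval N v A (i,j)) + mtr N (weval N M A) * ((of_nat N)^2 * ((\<Sum>X\<leftarrow>u_basis N. T2 N X A xs) - dpS N A xs) * weval N v A (i,j))"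
      unfolding s g by (simp add: algebra_simps)
  qed
qed

lemma lin_mtr: "lin (\<lambda>b. mtr N (F b)) P = (\<Sum>i<N. lin (\<lambda>b. F b (i,i)) P) / of_nat N"
  unfolding lin_def mtr_def
  by (subst sum.swap) (simp only: sum_divide_distrib sum_distrib_left times_divide_eq_right)

lemma sum_mtr_D2_em:
  assumes "N \<ge> 1" "A \<in> GLm N"
  shows "(\<Sum>X\<leftarrow>u_basis N. mtr N (D2 N X A (em M))) = lin (\<lambda>b. mtr N (symeval N b A)) (DeltaU_word M)"
proof -
  have "(\<Sum>X\<leftarrow>u_basis N. mtr N (D2 N X A (em M))) = (\<Sum>i<N. \<Sum>X\<leftarrow>u_basis N. D2 N X A (em M) (i,i)) / of_nat N"
    unfolding sum_list_swap[symmetric] mtr_def by (simp add: divide_inverse sum_list_mult_const)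
  then show ?thesis using sum_D2_em[OF assms] unfolding lin_mtr by simp
qed

lemma dpS_mset:
  "dpS N A xs = sum_mset (image_mset (\<lambda>M. pS N (mset xs - {#M#}) A * (\<Sum>X\<leftarrow>u_basis N. mtr N (D2 N X A (em M)))) (mset xs))"
proof (induction xs)
  case (Cons M xs)
  let ?\<tau> = "\<lambda>M. \<Sum>X\<leftarrow>u_basis N. mtr N (D2 N X A (em M))"
  have "sum_mset (image_mset (\<lambda>M'. pS N (mset (M # xs) - {#M'#}) A * ?\<tau> M') (mset xs))
    = sum_mset (image_mset (\<lambda>M'. mtr N (weval N M A) * (pS N (mset xs - {#M'#}) A * ?\<tau> M')) (mset xs))"
  proof (intro arg_cong[where f = sum_mset] image_mset_cong)
    fix M' assume "M' \<in># mset xs"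
    then have "mset (M # xs) - {#M'#} = add_mset M (mset xs - {#M'#})" by (simp add: add_mset_diff_bothsides[symmetric] del: add_mset_diff_bothsides)
    then show "pS N (mset (M # xs) - {#M'#}) A * ?\<tau> M' = mtr N (weval N M A) * (pS N (mset xs - {#M'#}) A * ?\<tau> M')" by simp
  qed
  also have "\<dots> = mtr N (weval N M A) * dpS N A xs" unfolding Cons.IH by (simp add: sum_mset_distrib_left image_mset.compositionality o_def)
  finally show ?case by (simp add: mult.commute)
qed simp

lemma lin_DeltaU_sym:
  assumes N: "N \<ge> 1" and A: "A \<in> GLm N" and ij: "i < N" "j < N"
  shows "lin (\<lambda>b. symeval N b A (i,j)) (DeltaU_sym (w, mset xs)) =
    pS N (mset xs) A * (\<Sum>X\<leftarrow>u_basis N. D2 N X A (em w) (i,j)) + dpS N A xs * weval N w A (i,j)"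
proof -
  have c: "lin (\<lambda>b. k * \<phi> b) P = k * lin \<phi> P" for k \<phi> P by (simp add: lin_def sum_distrib_left mult_ac)
  have 1: "lin (\<lambda>b. symeval N b A (i,j)) (tmapkeys (\<lambda>(w, T). (w, T + mset xs)) (DeltaU_word w)) = pS N (mset xs) A * (\<Sum>X\<leftarrow>u_basis N. D2 N X A (em w) (i,j))"
    unfolding lin_tmapkeys sum_D2_em[OF assms] c[symmetric] using ij
    by (intro arg_cong[where f = "\<lambda>\<phi>. lin \<phi> _"] ext) (auto simp: symeval_nth)
  have 2: "lin (\<lambda>b. symeval N b A (i,j)) (tmapkeys (\<lambda>(v, T). (w, S + T + trm v)) (DeltaU_word M))
    = weval N w A (i,j) * (pS N S A * (\<Sum>X\<leftarrow>u_basis N. mtr N (D2 N X A (em M))))" for S M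
    unfolding lin_tmapkeys sum_mtr_D2_em[OF N A] c[symmetric] using ij
    by (intro arg_cong[where f = "\<lambda>\<phi>. lin \<phi> _"] ext) (auto simp: symeval_nth pS_trm[OF N] mtr_symeval)
  show ?thesis
    unfolding DeltaU_sym_def prod.case lin_add lin_sum_mset 1 2 dpS_mset
    by (simp add: sum_mset_distrib_right image_mset.compositionality o_def mult.commute[of "weval N w A (i,j)"])
qed

definition symD1 :: "nat \<Rightarrow> cmat \<Rightarrow> cmat \<Rightarrow> word \<Rightarrow> word list \<Rightarrow> nat \<times> nat \<Rightarrow> complex" where
  "symD1 N X A w xs p = T1 N X A xs * weval N w A p + pS N (mset xs) A * D1 N X A (em w) p"

definition symD2 :: "nat \<Rightarrow> cmat \<Rightarrow> cmat \<Rightarrow> word \<Rightarrow> word list \<Rightarrow> nat \<times> nat \<Rightarrow> complex" where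
  "symD2 N X A w xs p = T2 N X A xs * weval N w A p + 2 * (T1 N X A xs * D1 N X A (em w) p) + pS N (mset xs) A * D2 N X A (em w) p"

lemma vdiff2_symeval:
  assumes X: "X \<in> mats N" and ij: "i < N" "j < N"
  shows "vdiff2 N X (\<lambda>A. symeval N (w, mset xs) A (i,j)) (\<lambda>A. symD1 N X A w xs (i,j)) (\<lambda>A. symD2 N X A w xs (i,j))"
  using vdiff2_mult[OF X vdiff2_pS[OF X, of xs] vdiff2_wev[OF X ij, of "em w"]] ij
  by (simp add: symD1_def symD2_def symeval_nth wev_em)

text \<open>The Laplacian of a symbol minus \<open>DeltaU_sym\<close> consists of cross terms alone:
  between two traces (\<open>rep_T2\<close>) and between a trace and the word
  (\<open>rep_cross\<close>), each of order 1/N^2.\<close>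

theorem lapU_symeval_rep:
  "rep (tdeg (w, mset xs)) (\<lambda>N A p. (of_nat N)^2 * ((\<Sum>X\<leftarrow>u_basis N. symD2 N X A w xs p) - lin (\<lambda>b. symeval N b A p) (DeltaU_sym (w, mset xs))))"
proof (rule rep_cong)
  have d: "length w + sum_list (map length xs) = tdeg (w, mset xs)"
    by (induction xs) (simp_all add: tdeg_def)
  show "rep (tdeg (w, mset xs)) (\<lambda>N A p. (of_nat N)^2 * ((\<Sum>X\<leftarrow>u_basis N. T2 N X A xs) - dpS N A xs) * weval N w A p
      + 2 * ((of_nat N)^2 * (\<Sum>X\<leftarrow>u_basis N. D1 N X A (em w) p * T1 N X A xs)))"
    unfolding d[symmetric] by (rule rep_add[OF rep_T2 rep_cmult[OF rep_cross]])
  fix N A i j assume *: "1 \<le> N" "A \<in> GLm N" "i < N" "j < N"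
  show "(of_nat N)^2 * ((\<Sum>X\<leftarrow>u_basis N. symD2 N X A w xs (i,j)) - lin (\<lambda>b. symeval N b A (i,j)) (DeltaU_sym (w, mset xs)))
    = (of_nat N)^2 * ((\<Sum>X\<leftarrow>u_basis N. T2 N X A xs) - dpS N A xs) * weval N w A (i,j)
      + 2 * ((of_nat N)^2 * (\<Sum>X\<leftarrow>u_basis N. D1 N X A (em w) (i,j) * T1 N X A xs))"
    unfolding lin_DeltaU_sym[OF *] symD2_def
    by (simp add: sum_list_addf sum_list_const_mult sum_list_mult_const algebra_simps)
qed

section \<open>Exponentials of kernels\<close>

text \<open>A kernel acts on coefficient families from the right, \<open>a b b'\<close> being the
  coefficient of b' in the image of b; \<open>kexp\<close> is the exponential series applied to
  c.\<close>

definition kit :: "('a \<Rightarrow> 'a \<Rightarrow> complex) \<Rightarrow> 'a set \<Rightarrow> ('a \<Rightarrow> complex) \<Rightarrow> 'a \<Rightarrow> complex" where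
  "kit a B c = (\<lambda>b'. \<Sum>b\<in>B. c b * a b b')"

definition kexp :: "complex \<Rightarrow> ('a \<Rightarrow> 'a \<Rightarrow> complex) \<Rightarrow> 'a set \<Rightarrow> ('a \<Rightarrow> complex) \<Rightarrow> 'a \<Rightarrow> complex" where
  "kexp s a B c b = suminf (\<lambda>m. s ^ m / fact m * (kit a B ^^ m) c b)"

lemma kit_norm:
  assumes B: "finite B" and K: "\<And>b. b \<in> B \<Longrightarrow> (\<Sum>b'\<in>B. cmod (a b b')) \<le> K"
  shows "(\<Sum>b'\<in>B. cmod (kit a B c b')) \<le> K * (\<Sum>b\<in>B. cmod (c b))"
proof -
  have "(\<Sum>b'\<in>B. cmod (kit a B c b')) \<le> (\<Sum>b'\<in>B. \<Sum>b\<in>B. cmod (c b) * cmod (a b b'))"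
    unfolding kit_def by (intro sum_mono sum_norm_le) (simp add: norm_mult)
  also have "\<dots> = (\<Sum>b\<in>B. cmod (c b) * (\<Sum>b'\<in>B. cmod (a b b')))"
    by (subst sum.swap) (simp only: sum_distrib_left)
  also have "\<dots> \<le> (\<Sum>b\<in>B. cmod (c b) * K)" by (intro sum_mono mult_left_mono K) auto
  finally show ?thesis by (simp add: sum_distrib_left mult.commute)
qed

lemma kit_pow_norm:
  assumes B: "finite B" and K: "\<And>b. b \<in> B \<Longrightarrow> (\<Sum>b'\<in>B. cmod (a b b')) \<le> K" and K0: "K \<ge> 0"
  shows "(\<Sum>b'\<in>B. cmod ((kit a B ^^ m) c b')) \<le> K ^ m * (\<Sum>b\<in>B. cmod (c b))"
proof (induction m)
  case (Suc m)
  have "(\<Sum>b'\<in>B. cmod ((kit a B ^^ Suc m) c b')) \<le> K * (\<Sum>b'\<in>B. cmod ((kit a B ^^ m) c b'))"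
    using kit_norm[OF B K] by simp
  also have "\<dots> \<le> K * (K ^ m * (\<Sum>b\<in>B. cmod (c b)))" by (intro mult_left_mono Suc K0)
  finally show ?case by (simp add: mult.assoc)
qed simp

lemma exp_series_bound:
  fixes x :: "nat \<Rightarrow> complex"
  assumes "\<And>m. cmod (x m) \<le> C * K ^ m" "K \<ge> 0"
  shows "summable (\<lambda>m. s ^ m / fact m * x m)" "cmod (suminf (\<lambda>m. s ^ m / fact m * x m)) \<le> C * exp (cmod s * K)"
proof -
  have b: "norm (s ^ m / fact m * x m) \<le> C * ((cmod s * K) ^ m / fact m)" for m
  proof -
    have "norm (s ^ m / fact m * x m) = (cmod s ^ m / fact m) * cmod (x m)" by (simp add: norm_mult norm_divide norm_power)
    also have "\<dots> \<le> (cmod s ^ m / fact m) * (C * K ^ m)" by (intro mult_left_mono assms) auto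
    finally show ?thesis by (simp add: power_mult_distrib mult_ac)
  qed
  have e: "(\<lambda>m. C * ((cmod s * K) ^ m / fact m)) sums (C * exp (cmod s * K))"
    using sums_mult[OF exp_converges[of "cmod s * K"], of C] by (simp add: divide_inverse mult.commute scaleR_conv_of_real)
  show "summable (\<lambda>m. s ^ m / fact m * x m)" by (rule summable_comparison_test'[OF sums_summable[OF e]]) (rule b)
  show "cmod (suminf (\<lambda>m. s ^ m / fact m * x m)) \<le> C * exp (cmod s * K)"
    unfolding sums_unique[OF e] by (rule norm_suminf_le[OF b sums_summable[OF e]])
qed

lemma kexp_summable:
  assumes B: "finite B" and b: "b \<in> B"
  shows "summable (\<lambda>m. s ^ m / fact m * (kit a B ^^ m) c b)"
proof (rule exp_series_bound(1))
  define K where "K = (\<Sum>b\<in>B. \<Sum>b'\<in>B. cmod (a b b'))"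
  show K0: "K \<ge> 0" by (simp add: K_def sum_nonneg)
  have K: "(\<Sum>b'\<in>B. cmod (a b b')) \<le> K" if "b \<in> B" for b
    unfolding K_def by (rule member_le_sum[OF that]) (auto simp: B sum_nonneg)
  fix m
  have "cmod ((kit a B ^^ m) c b) \<le> (\<Sum>b'\<in>B. cmod ((kit a B ^^ m) c b'))" by (rule member_le_sum[OF b]) (auto simp: B)
  also have "\<dots> \<le> K ^ m * (\<Sum>b\<in>B. cmod (c b))" by (rule kit_pow_norm[OF B K K0])
  finally show "cmod ((kit a B ^^ m) c b) \<le> (\<Sum>b\<in>B. cmod (c b)) * K ^ m" by (simp add: mult.commute)
qed

text \<open>Lipschitz dependence on the perturbation, uniform for |\<epsilon>| <= 1: telescoping
  bounds the difference of the m-th iterates by |\<epsilon>| m K^m times the norm of c, with K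
  bounding both kernels together.\<close>

lemma kexp_perturb:
  fixes B :: "'a set"
  assumes B: "finite B"
  shows "\<exists>C\<ge>0. \<forall>\<epsilon> b. cmod \<epsilon> \<le> 1 \<longrightarrow> b \<in> B \<longrightarrow> cmod (kexp s (\<lambda>b b'. a b b' + \<epsilon> * l b b') B c b - kexp s a B c b) \<le> C * cmod \<epsilon>"
proof -
  define K where "K = (\<Sum>b\<in>B. \<Sum>b'\<in>B. cmod (a b b') + cmod (l b b'))"
  have K0: "K \<ge> 0" by (simp add: K_def sum_nonneg)
  have K: "(\<Sum>b'\<in>B. cmod (a b b') + cmod (l b b')) \<le> K" if "b \<in> B" for b
    unfolding K_def by (rule member_le_sum[OF that]) (auto simp: B sum_nonneg)
  define c0 where "c0 = (\<Sum>b\<in>B. cmod (c b))"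
  have c0: "c0 \<ge> 0" by (simp add: c0_def sum_nonneg)
  show ?thesis
  proof (intro exI[of _ "c0 * exp (cmod s * (2 * K))"] conjI allI impI)
    fix \<epsilon> b assume e: "cmod \<epsilon> \<le> 1" and b: "b \<in> B"
    let ?a = "\<lambda>b b'. a b b' + \<epsilon> * l b b'"
    have Ka: "(\<Sum>b'\<in>B. cmod (a b b')) \<le> K" if "b \<in> B" for b
      by (rule order_trans[OF sum_mono K[OF that]]) simp
    have Kl: "(\<Sum>b'\<in>B. cmod (l b b')) \<le> K" if "b \<in> B" for b
      by (rule order_trans[OF sum_mono K[OF that]]) simp
    have Ke: "(\<Sum>b'\<in>B. cmod (?a b b')) \<le> K" if "b \<in> B" for b
    proof (rule order_trans[OF sum_mono K[OF that]])
      fix b'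
      have "cmod (\<epsilon> * l b b') \<le> 1 * cmod (l b b')" unfolding norm_mult using e by (intro mult_right_mono) auto
      then show "cmod (?a b b') \<le> cmod (a b b') + cmod (l b b')" using norm_triangle_ineq[of "a b b'" "\<epsilon> * l b b'"] by simp
    qed
    have D: "(\<Sum>b'\<in>B. cmod ((kit ?a B ^^ m) c b' - (kit a B ^^ m) c b')) \<le> cmod \<epsilon> * real m * K ^ m * c0" for m
    proof (induction m)
      case (Suc m)
      let ?x = "(kit ?a B ^^ m) c" let ?y = "(kit a B ^^ m) c"
      have eq: "kit ?a B ?x b' - kit a B ?y b' = kit ?a B (\<lambda>b. ?x b - ?y b) b' + \<epsilon> * kit l B ?y b'" for b'
        unfolding kit_def by (simp add: sum_distrib_left sum_subtractf[symmetric] sum.distrib[symmetric] algebra_simps)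
      have "(\<Sum>b'\<in>B. cmod (kit ?a B ?x b' - kit a B ?y b')) \<le> (\<Sum>b'\<in>B. cmod (kit ?a B (\<lambda>b. ?x b - ?y b) b') + cmod \<epsilon> * cmod (kit l B ?y b'))"
        unfolding eq by (intro sum_mono order_trans[OF norm_triangle_ineq]) (simp add: norm_mult)
      also have "\<dots> = (\<Sum>b'\<in>B. cmod (kit ?a B (\<lambda>b. ?x b - ?y b) b')) + cmod \<epsilon> * (\<Sum>b'\<in>B. cmod (kit l B ?y b'))"
        by (simp only: sum.distrib sum_distrib_left)
      also have "\<dots> \<le> K * (\<Sum>b'\<in>B. cmod (?x b' - ?y b')) + cmod \<epsilon> * (K * (\<Sum>b'\<in>B. cmod (?y b')))"
        by (intro add_mono mult_left_mono kit_norm[OF B Ke] kit_norm[OF B Kl]) auto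
      also have "\<dots> \<le> K * (cmod \<epsilon> * real m * K ^ m * c0) + cmod \<epsilon> * (K * (K ^ m * c0))"
        unfolding c0_def
        by (intro add_mono mult_left_mono kit_pow_norm[OF B Ka K0] Suc[unfolded c0_def] K0) (use K0 in auto)
      also have "\<dots> = cmod \<epsilon> * real (Suc m) * K ^ Suc m * c0" by (simp add: algebra_simps)
      finally show ?case by simp
    qed simp
    have bd: "cmod ((kit ?a B ^^ m) c b - (kit a B ^^ m) c b) \<le> (cmod \<epsilon> * c0) * (2 * K) ^ m" for m
    proof -
      have "cmod ((kit ?a B ^^ m) c b - (kit a B ^^ m) c b) \<le> (\<Sum>b'\<in>B. cmod ((kit ?a B ^^ m) c b' - (kit a B ^^ m) c b'))"
        by (rule member_le_sum[OF b]) (auto simp: B)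
      also have "\<dots> \<le> cmod \<epsilon> * real m * K ^ m * c0" by (rule D)
      \<comment> \<open>m <= 2^m absorbs the factor m into the geometric growth, which becomes (2
        K)^m.\<close>
      also have "\<dots> \<le> cmod \<epsilon> * (2 ^ m) * K ^ m * c0"
        using of_nat_less_two_power[of m, where 'a = real] K0 c0 by (intro mult_right_mono mult_left_mono) auto
      finally show ?thesis by (simp add: power_mult_distrib mult_ac)
    qed
    have "kexp s ?a B c b - kexp s a B c b = suminf (\<lambda>m. s ^ m / fact m * ((kit ?a B ^^ m) c b - (kit a B ^^ m) c b))"
      unfolding kexp_def by (subst suminf_diff[OF kexp_summable[OF B b] kexp_summable[OF B b]]) (simp add: right_diff_distrib)
    also have "cmod \<dots> \<le> (cmod \<epsilon> * c0) * exp (cmod s * (2 * K))"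
      by (rule exp_series_bound(2)[OF bd]) (use K0 in simp)
    finally show "cmod (kexp s ?a B c b - kexp s a B c b) \<le> c0 * exp (cmod s * (2 * K)) * cmod \<epsilon>"
      by (simp add: mult_ac)
  qed (use c0 in simp)
qed

section \<open>\<open>DeltaU\<close> as a kernel on symbols of bounded degree\<close>

lemma trm_length: "sum_mset (image_mset length (trm u)) = length u"
  by (simp add: trm_def)

lemma DeltaU_word_keys:
  assumes "b \<in> kys (DeltaU_word w)"
  shows "tdeg b \<le> length w \<and> [] \<notin># snd b"
proof -
  let ?I = "{(i,j). i < j \<and> j < length w}"
  let ?f = "\<lambda>(i,j). Poly_Mapping.single
          (take i w @ lft (w ! i) @ rgt (w ! j) @ drop (Suc j) w,
           trm (rgt (w ! i) @ take (j - Suc i) (drop (Suc i) w) @ lft (w ! j)))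
          (- 2 * eps (w ! i) * eps (w ! j))"
  have "b \<in> kys (Poly_Mapping.single (w, {#} :: word multiset) (- of_nat (length w) :: complex)) \<or> b \<in> kys (sum ?f ?I)"
    using subsetD[OF Poly_Mapping.keys_add assms[unfolded DeltaU_word_def]] by (simp only: Un_iff)
  then show ?thesis
  proof
    assume "b \<in> kys (Poly_Mapping.single (w, {#} :: word multiset) (- of_nat (length w) :: complex))"
    then have "b = (w, {#})" by (simp split: if_splits)
    then show ?thesis by (simp add: tdeg_def)
  next
    assume "b \<in> kys (sum ?f ?I)"
    then obtain i j where ij: "i < j" "j < length w" and b: "b \<in> kys (?f (i,j))"
      using Poly_Mapping.keys_sum[of ?f ?I] by blast
    then have b': "b = (take i w @ lft (w ! i) @ rgt (w ! j) @ drop (Suc j) w,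
           trm (rgt (w ! i) @ take (j - Suc i) (drop (Suc i) w) @ lft (w ! j)))" by (simp split: if_splits)
    have lr: "length (lft x) + length (rgt x) = 1" for x by (simp add: lft_def rgt_def)
    have "tdeg b = length (take i w @ lft (w ! i) @ rgt (w ! j) @ drop (Suc j) w) + length (rgt (w ! i) @ take (j - Suc i) (drop (Suc i) w) @ lft (w ! j))"
      unfolding b' tdeg_def by (simp only: fst_conv snd_conv trm_length)
    also have "\<dots> = length w" using lr[of "w ! i"] lr[of "w ! j"] ij by simp
    finally show ?thesis by (simp add: b' trm_def)
  qed
qed

lemma tmapkeys_keys: "b \<in> kys (tmapkeys g P) \<Longrightarrow> \<exists>b'\<in>kys P. b = g b'"
  unfolding tmapkeys_def using Poly_Mapping.keys_sum by (fastforce split: if_splits)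

lemma keys_sum_mset: "b \<in> kys (sum_mset (image_mset f S)) \<Longrightarrow> \<exists>x\<in>#S. b \<in> kys (f x)"
proof (induction S)
  case (add x S)
  then have "b \<in> kys (f x) \<or> b \<in> kys (sum_mset (image_mset f S))"
    using Poly_Mapping.keys_add[of "f x"] by auto
  then show ?case using add.IH by auto
qed simp

text \<open>At a cut each letter is kept on exactly one side, so the degree does not increase and
  the finite sets \<open>Bd d\<close> are invariant.\<close>

lemma DeltaU_sym_keys:
  assumes b: "b \<in> Bd d" and b': "b' \<in> kys (DeltaU_sym b)"
  shows "b' \<in> Bd d"
proof -
  obtain w S where wS: "b = (w,S)" by fastforce
  have d: "length w + sum_mset (image_mset length S) \<le> d" "[] \<notin># S" using b by (auto simp: Bd_def wS tdeg_def)
  have "b' \<in> kys (tmapkeys (\<lambda>(w, T). (w, T + S)) (DeltaU_word w)) \<or>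
     b' \<in> kys (sum_mset (image_mset (\<lambda>Mj. tmapkeys (\<lambda>(v, T). (w, (S - {#Mj#}) + T + trm v)) (DeltaU_word Mj)) S))"
    using subsetD[OF Poly_Mapping.keys_add b'[unfolded DeltaU_sym_def wS prod.case]] by (simp only: Un_iff)
  then show ?thesis
  proof
    assume "b' \<in> kys (tmapkeys (\<lambda>(w, T). (w, T + S)) (DeltaU_word w))"
    from tmapkeys_keys[OF this] obtain v T where v: "(v,T) \<in> kys (DeltaU_word w)" "b' = (v, T + S)" by auto
    from DeltaU_word_keys[OF v(1)] show ?thesis using d v(2) by (auto simp: Bd_def tdeg_def)
  next
    assume "b' \<in> kys (sum_mset (image_mset (\<lambda>Mj. tmapkeys (\<lambda>(v, T). (w, (S - {#Mj#}) + T + trm v)) (DeltaU_word Mj)) S))"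
    from keys_sum_mset[OF this] obtain M where M: "M \<in># S" "b' \<in> kys (tmapkeys (\<lambda>(v, T). (w, (S - {#M#}) + T + trm v)) (DeltaU_word M))" by blast
    from tmapkeys_keys[OF this(2)] obtain v T where v: "(v,T) \<in> kys (DeltaU_word M)" "b' = (w, (S - {#M#}) + T + trm v)" by auto
    have "sum_mset (image_mset length S) = length M + sum_mset (image_mset length (S - {#M#}))"
      using M(1) by (metis insert_DiffM image_mset_add_mset sum_mset.insert)
    moreover have "[] \<notin># S - {#M#}" using d(2) by (meson in_diffD)
    ultimately show ?thesis using DeltaU_word_keys[OF v(1)] d v(2) by (auto simp: Bd_def tdeg_def trm_def)
  qed
qed

definition dker :: "tsym \<Rightarrow> tsym \<Rightarrow> complex" where
  "dker b b' = lkp (DeltaU_sym b) b'"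

lemma lookup_DeltaU:
  assumes "kys P \<subseteq> Bd d"
  shows "lkp (DeltaU P) b = kit dker (Bd d) (lkp P) b"
proof -
  have "lkp (DeltaU P) b = lin (\<lambda>b0. dker b0 b) P"
    by (simp add: DeltaU_def lookup_sum lookup_tsmult lin_def dker_def)
  then show ?thesis using lin_superset[OF finite_Bd assms] by (simp add: kit_def)
qed

lemma lookup_DeltaU_pow:
  assumes P: "kys P \<subseteq> Bd d"
  shows "kys ((DeltaU ^^ m) P) \<subseteq> Bd d \<and> lkp ((DeltaU ^^ m) P) = (kit dker (Bd d) ^^ m) (lkp P)"
proof (induction m)
  case 0 then show ?case using P by simp
next
  case (Suc m)
  let ?Q = "(DeltaU ^^ m) P"
  have l: "lkp (DeltaU ?Q) = kit dker (Bd d) (lkp ?Q)"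
    using lookup_DeltaU[of ?Q d] Suc by (intro ext) simp
  have "kys (DeltaU ?Q) \<subseteq> Bd d"
  proof
    fix b assume "b \<in> kys (DeltaU ?Q)"
    then have "kit dker (Bd d) (lkp ?Q) b \<noteq> 0" by (simp add: in_keys_iff l)
    then obtain b0 where "b0 \<in> Bd d" "dker b0 b \<noteq> 0" unfolding kit_def by (metis (no_types, lifting) mult_eq_0_iff sum.neutral)
    then show "b \<in> Bd d" using DeltaU_sym_keys[of b0 d b] by (simp add: dker_def in_keys_iff)
  qed
  then show ?case using l Suc by simp
qed

text \<open>Invariance of \<open>Bd d\<close> supplies the finite support on which the meaning of
  \<open>Abs_poly_mapping\<close> rests.\<close>

lemma lookup_expDeltaU:
  assumes P: "kys P \<subseteq> Bd d"
  shows "lkp (expDeltaU t P) b = (if b \<in> Bd d then kexp (of_real (t/2)) dker (Bd d) (lkp P) b else 0)"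
proof -
  let ?f = "\<lambda>b. suminf (\<lambda>m. complex_of_real ((t/2)^m / fact m) * lkp ((DeltaU ^^ m) P) b)"
  have f: "?f b = (if b \<in> Bd d then kexp (of_real (t/2)) dker (Bd d) (lkp P) b else 0)" for b
  proof (cases "b \<in> Bd d")
    case True
    then show ?thesis using lookup_DeltaU_pow[OF P] by (simp add: kexp_def)
  next
    case False
    then have "lkp ((DeltaU ^^ m) P) b = 0" for m using lookup_DeltaU_pow[OF P, of m] by (meson in_keys_iff subsetD)
    then show ?thesis using False by simp
  qed
  have "{b. ?f b \<noteq> 0} \<subseteq> Bd d" unfolding f by auto
  then have "finite {b. ?f b \<noteq> 0}" using finite_Bd finite_subset by blast
  then have "lkp (expDeltaU t P) = ?f" unfolding expDeltaU_def by (simp add: Abs_poly_mapping_inverse)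
  then show ?thesis using f by simp
qed

lemma tpoly_Bd: "valid_tpoly P \<Longrightarrow> \<exists>d. kys P \<subseteq> Bd d"
proof -
  assume v: "valid_tpoly P"
  have "kys P \<subseteq> Bd (\<Sum>b\<in>kys P. tdeg b)"
    using v by (auto simp: Bd_def valid_tpoly_def intro!: member_le_sum)
  then show ?thesis ..
qed

text \<open>The correction kernel is found before N is given. The enumeration \<open>SOME xs\<close>
  of the trace factors depends on the symbol alone, and one choice of coefficients for each b makes
  up the kernel.\<close>

lemma kernel_correction_exists:
  "\<exists>l. \<forall>b\<in>Bd d. \<forall>N\<ge>1. \<forall>A\<in>GLm N. \<forall>i<N. \<forall>j<N.
     (\<Sum>X\<leftarrow>u_basis N. symD2 N X A (fst b) (SOME xs. mset xs = snd b) (i,j)) =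
       (\<Sum>b'\<in>Bd d. (dker b b' + 1 / (of_nat N)^2 * l b b') * symeval N b' A (i,j))"
proof -
  have "\<exists>c. \<forall>N\<ge>1. \<forall>A\<in>GLm N. \<forall>i<N. \<forall>j<N.
     (\<Sum>X\<leftarrow>u_basis N. symD2 N X A (fst b) (SOME xs. mset xs = snd b) (i,j)) =
       (\<Sum>b'\<in>Bd d. (dker b b' + 1 / (of_nat N)^2 * c b') * symeval N b' A (i,j))" if b: "b \<in> Bd d" for b
  proof -
    define xs where "xs = (SOME xs. mset xs = snd b)"
    have xs: "mset xs = snd b" unfolding xs_def using ex_mset[of "snd b"] by (rule someI_ex)
    have bx: "(fst b, mset xs) = b" by (simp add: xs)
    have "tdeg b \<le> d" using b by (simp add: Bd_def)
    have r: "rep d (\<lambda>N A p. (of_nat N)^2 * ((\<Sum>X\<leftarrow>u_basis N. symD2 N X A (fst b) xs p) - lin (\<lambda>b. symeval N b A p) (DeltaU_sym b)))"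
      using rep_mono[OF lapU_symeval_rep[of "fst b" xs]] \<open>tdeg b \<le> d\<close> unfolding bx by blast
    obtain c where c: "\<And>N A i j. N \<ge> 1 \<Longrightarrow> A \<in> GLm N \<Longrightarrow> i < N \<Longrightarrow> j < N \<Longrightarrow>
      (of_nat N)^2 * ((\<Sum>X\<leftarrow>u_basis N. symD2 N X A (fst b) xs (i,j)) - lin (\<lambda>b. symeval N b A (i,j)) (DeltaU_sym b)) = (\<Sum>b\<in>Bd d. c b * symeval N b A (i,j))"
      by (rule repE[OF r]) blast
    show ?thesis unfolding xs_def[symmetric]
    proof (intro exI[of _ c] allI impI ballI)
      fix N A i j assume *: "1 \<le> N" "A \<in> GLm N" "i < N" "j < N"
      have "lin (\<lambda>b. symeval N b A (i,j)) (DeltaU_sym b) = (\<Sum>b'\<in>Bd d. dker b b' * symeval N b' A (i,j))"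
        unfolding dker_def by (rule lin_superset) (use DeltaU_sym_keys[OF b] in auto)
      moreover have "(\<Sum>X\<leftarrow>u_basis N. symD2 N X A (fst b) xs (i,j)) = lin (\<lambda>b. symeval N b A (i,j)) (DeltaU_sym b) +
         1 / (of_nat N)^2 * (\<Sum>b\<in>Bd d. c b * symeval N b A (i,j))"
        unfolding c[OF *, symmetric] using *(1) by simp
      ultimately show "(\<Sum>X\<leftarrow>u_basis N. symD2 N X A (fst b) xs (i,j)) =
         (\<Sum>b'\<in>Bd d. (dker b b' + 1 / (of_nat N)^2 * c b') * symeval N b' A (i,j))"
        by (simp only: distrib_right sum.distrib sum_distrib_left mult.assoc)
    qed
  qed
  then have "\<forall>b\<in>Bd d. \<exists>c. \<forall>N\<ge>1. \<forall>A\<in>GLm N. \<forall>i<N. \<forall>j<N.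
     (\<Sum>X\<leftarrow>u_basis N. symD2 N X A (fst b) (SOME xs. mset xs = snd b) (i,j)) =
       (\<Sum>b'\<in>Bd d. (dker b b' + 1 / (of_nat N)^2 * c b') * symeval N b' A (i,j))" by blast
  then show ?thesis by (rule bchoice)
qed

definition lker :: "nat \<Rightarrow> tsym \<Rightarrow> tsym \<Rightarrow> complex" where
  "lker d = (SOME l. \<forall>b\<in>Bd d. \<forall>N\<ge>1. \<forall>A\<in>GLm N. \<forall>i<N. \<forall>j<N.
     (\<Sum>X\<leftarrow>u_basis N. symD2 N X A (fst b) (SOME xs. mset xs = snd b) (i,j)) =
       (\<Sum>b'\<in>Bd d. (dker b b' + 1 / (of_nat N)^2 * l b b') * symeval N b' A (i,j)))"

lemma lker:
  "b \<in> Bd d \<Longrightarrow> N \<ge> 1 \<Longrightarrow> A \<in> GLm N \<Longrightarrow> i < N \<Longrightarrow> j < N \<Longrightarrow>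
     (\<Sum>X\<leftarrow>u_basis N. symD2 N X A (fst b) (SOME xs. mset xs = snd b) (i,j)) =
       (\<Sum>b'\<in>Bd d. (dker b b' + 1 / (of_nat N)^2 * lker d b b') * symeval N b' A (i,j))"
  using someI_ex[OF kernel_correction_exists[of d], folded lker_def] by blast

definition nker :: "nat \<Rightarrow> nat \<Rightarrow> tsym \<Rightarrow> tsym \<Rightarrow> complex" where
  "nker d N b b' = dker b b' + 1 / (of_nat N)^2 * lker d b b'"

lemma lapU_combination:
  assumes N: "N \<ge> 1" and ij: "i < N" "j < N" and A: "A \<in> GLm N"
    and f: "\<And>A. A \<in> GLm N \<Longrightarrow> f A = (\<Sum>b\<in>Bd d. c b * symeval N b A (i,j))"
  shows "lapU N f A = (\<Sum>b\<in>Bd d. kit (nker d N) (Bd d) c b * symeval N b A (i,j))"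
proof -
  let ?xs = "\<lambda>b :: tsym. SOME xs. mset xs = snd b"
  have xs: "(fst b, mset (?xs b)) = b" for b :: tsym
    using someI_ex[OF ex_mset[of "snd b"]] by simp
  have vd: "vdiff2 N X f (\<lambda>A. \<Sum>b\<in>Bd d. c b * symD1 N X A (fst b) (?xs b) (i,j)) (\<lambda>A. \<Sum>b\<in>Bd d. c b * symD2 N X A (fst b) (?xs b) (i,j))"
    if X: "X \<in> set (u_basis N)" for X
  proof -
    have Xm: "X \<in> mats N" using u_basis_mats[OF X] .
    have "vdiff2 N X (\<lambda>A. \<Sum>b\<in>Bd d. c b * symeval N b A (i,j)) (\<lambda>A. \<Sum>b\<in>Bd d. c b * symD1 N X A (fst b) (?xs b) (i,j)) (\<lambda>A. \<Sum>b\<in>Bd d. c b * symD2 N X A (fst b) (?xs b) (i,j))"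
    proof (rule vdiff2_sum)
      fix b
      from vdiff2_symeval[OF Xm ij, of "fst b" "?xs b"]
      have "vdiff2 N X (\<lambda>A. symeval N b A (i,j)) (\<lambda>A. symD1 N X A (fst b) (?xs b) (i,j)) (\<lambda>A. symD2 N X A (fst b) (?xs b) (i,j))"
        unfolding xs .
      from vdiff2_bounded_linear[OF bounded_linear_mult_right this]
      show "vdiff2 N X (\<lambda>A. c b * symeval N b A (i,j)) (\<lambda>A. c b * symD1 N X A (fst b) (?xs b) (i,j)) (\<lambda>A. c b * symD2 N X A (fst b) (?xs b) (i,j))" .
    qed
    then show ?thesis unfolding vdiff2_def using vdiff_cong[OF Xm] f by (metis (no_types, lifting))
  qed
  have "lapU N f A = (\<Sum>X\<leftarrow>u_basis N. \<Sum>b\<in>Bd d. c b * symD2 N X A (fst b) (?xs b) (i,j))"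
    unfolding lapU_def by (rule lap_vdiff2[OF u_basis_mats vd A])
  also have "\<dots> = (\<Sum>b\<in>Bd d. c b * (\<Sum>X\<leftarrow>u_basis N. symD2 N X A (fst b) (?xs b) (i,j)))"
    unfolding sum_list_swap sum_list_const_mult ..
  also have "\<dots> = (\<Sum>b\<in>Bd d. c b * (\<Sum>b'\<in>Bd d. nker d N b b' * symeval N b' A (i,j)))"
    unfolding nker_def by (intro sum.cong refl arg_cong2[where f = "(*)"] lker[OF _ N A ij])
  also have "\<dots> = (\<Sum>b'\<in>Bd d. \<Sum>b\<in>Bd d. c b * nker d N b b' * symeval N b' A (i,j))"
    by (subst sum.swap) (simp only: sum_distrib_left mult.assoc)
  also have "\<dots> = (\<Sum>b\<in>Bd d. kit (nker d N) (Bd d) c b * symeval N b A (i,j))"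
    by (simp only: kit_def sum_distrib_right)
  finally show ?thesis .
qed

lemma lapU_pow_combination:
  assumes N: "N \<ge> 1" and ij: "i < N" "j < N"
    and f: "\<And>A. A \<in> GLm N \<Longrightarrow> f A = (\<Sum>b\<in>Bd d. c b * symeval N b A (i,j))"
  shows "A \<in> GLm N \<Longrightarrow> (lapU N ^^ m) f A = (\<Sum>b\<in>Bd d. (kit (nker d N) (Bd d) ^^ m) c b * symeval N b A (i,j))"
proof (induction m arbitrary: A)
  case (Suc m)
  show ?case using lapU_combination[OF N ij Suc.prems Suc.IH] by simp
qed (simp add: f)

lemma heatU_combination:
  assumes N: "N \<ge> 1" and ij: "i < N" "j < N"
    and f: "\<And>A. A \<in> GLm N \<Longrightarrow> f A = (\<Sum>b\<in>Bd d. c b * symeval N b A (i,j))" and U: "U \<in> GLm N"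
  shows "heatU N t f U = (\<Sum>b\<in>Bd d. kexp (of_real (t/2)) (nker d N) (Bd d) c b * symeval N b U (i,j))"
proof -
  have "(\<lambda>m. complex_of_real ((t/2)^m / fact m) * (lapU N ^^ m) f U) =
    (\<lambda>m. \<Sum>b\<in>Bd d. (complex_of_real (t/2) ^ m / fact m * (kit (nker d N) (Bd d) ^^ m) c b) * symeval N b U (i,j))"
    using lapU_pow_combination[OF N ij f U] by (simp add: sum_distrib_left mult.assoc)
  moreover have "(\<lambda>m. \<Sum>b\<in>Bd d. (complex_of_real (t/2) ^ m / fact m * (kit (nker d N) (Bd d) ^^ m) c b) * symeval N b U (i,j))
     sums (\<Sum>b\<in>Bd d. kexp (of_real (t/2)) (nker d N) (Bd d) c b * symeval N b U (i,j))"
    unfolding kexp_def by (intro sums_sum sums_mult2 summable_sums kexp_summable finite_Bd)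
  ultimately show ?thesis unfolding heatU_def by (simp only: sums_iff)
qed

section \<open>Holomorphy of symbols and their Hall transform\<close>

lemma weval_line_differentiable:
  assumes A: "A \<in> GLm N" and E: "E \<in> mats N" and ij: "i < N" "j < N"
  shows "(\<lambda>z. weval N w (madd N A (mscale N z E)) (i,j)) field_differentiable (at 0)"
  using ij
proof (induction w arbitrary: i j)
  case Nil
  then show ?case by (simp add: weval_def field_differentiable_const)
next
  case (Cons x w)
  have l: "(\<lambda>z. (if x then madd N A (mscale N z E) else minv N (madd N A (mscale N z E))) (i,k)) field_differentiable (at 0)"
    if k: "k < N" for k
  proof (cases x)
    case True
    then show ?thesis using Cons.prems k by (auto intro!: derivative_intros)
  next
    case False
    have "((\<lambda>z. minv N (madd N A (mscale N z E)) (i,k)) has_derivative (\<lambda>h. - mmul N (mmul N (minv N A) (mscale N h E)) (minv N A) (i,k))) (at 0)"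
    proof (rule minv_has_derivative[OF _ _ A])
      show "((\<lambda>z. madd N A (mscale N z E) (i,j)) has_derivative (\<lambda>h. mscale N h E (i,j))) (at 0)" if "i < N" "j < N" for i j
        using that by (auto intro!: derivative_eq_intros)
      show "madd N A (mscale N 0 E) = A" by (rule mats_ext[where N = N]) (use A minv_GL in auto)
    qed (use Cons.prems k in auto)
    moreover have "(\<lambda>h. - mmul N (mmul N (minv N A) (mscale N h E)) (minv N A) (i,k)) = (*) (- mmul N (mmul N (minv N A) E) (minv N A) (i,k))"
      using Cons.prems k by (auto simp: mult.commute simp del: mat_nth(1))
    ultimately show ?thesis using False by (auto simp: field_differentiable_def has_field_derivative_def)
  qed
  have "(\<lambda>z. \<Sum>k<N. (if x then madd N A (mscale N z E) else minv N (madd N A (mscale N z E))) (i,k) * weval N w (madd N A (mscale N z E)) (k,j)) field_differentiable (at 0)"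
    using l Cons by (intro field_differentiable_sum field_differentiable_mult) auto
  then show ?case using Cons.prems by (simp add: weval_def)
qed

lemma symeval_line_differentiable:
  assumes A: "A \<in> GLm N" and E: "E \<in> mats N" and ij: "i < N" "j < N"
  shows "(\<lambda>z. symeval N b (madd N A (mscale N z E)) (i,j)) field_differentiable (at 0)"
proof -
  have "(\<lambda>z. pS N S (madd N A (mscale N z E))) field_differentiable (at 0)" for S
  proof (induction S)
    case (add M S)
    have "(\<lambda>z. mtr N (weval N M (madd N A (mscale N z E)))) field_differentiable (at 0)"
      unfolding mtr_def divide_inverse
      by (intro field_differentiable_mult field_differentiable_sum field_differentiable_const weval_line_differentiable A E) auto
    then show ?case using add by (auto intro!: field_differentiable_mult)
  qed (simp add: field_differentiable_const)
  then have "(\<lambda>z. pS N (snd b) (madd N A (mscale N z E)) * weval N (fst b) (madd N A (mscale N z E)) (i,j)) field_differentiable (at 0)"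
    by (intro field_differentiable_mult weval_line_differentiable A E ij)
  then show ?thesis using ij by (simp add: symeval_nth')
qed

text \<open>On U(N) the exponential series is a combination of symbols with constant coefficients.
  The same combination is holomorphic on GL_N, and uniqueness of the extension identifies it with
  the definite description.\<close>

lemma hallU_combination:
  assumes N: "N \<ge> 1" and ij: "i < N" "j < N"
    and f: "\<And>A. A \<in> GLm N \<Longrightarrow> f A = (\<Sum>b\<in>Bd d. c b * symeval N b A (i,j))" and G: "G \<in> GLm N"
  shows "hallU N t f G = (\<Sum>b\<in>Bd d. kexp (of_real (t/2)) (nker d N) (Bd d) c b * symeval N b G (i,j))"
proof -
  let ?E = "kexp (complex_of_real (t/2)) (nker d N) (Bd d) c"
  define F where "F A = (if A \<in> GLm N then \<Sum>b\<in>Bd d. ?E b * symeval N b A (i,j) else 0)" for A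
  have hol: "holoGL N F"
    unfolding holoGL_def
  proof (intro ballI allI impI)
    fix A k l assume A: "A \<in> GLm N" and kl: "k < N" "l < N"
    let ?\<gamma> = "\<lambda>z. madd N A (mscale N z (matunit N k l))"
    have "(\<lambda>z. \<Sum>b\<in>Bd d. ?E b * symeval N b (?\<gamma> z) (i,j)) field_differentiable (at 0)"
      by (intro field_differentiable_sum field_differentiable_mult field_differentiable_const symeval_line_differentiable A ij) simp
    then obtain D where D: "((\<lambda>z. \<Sum>b\<in>Bd d. ?E b * symeval N b (?\<gamma> z) (i,j)) has_field_derivative D) (at 0)"
      by (auto simp: field_differentiable_def)
    have "\<forall>\<^sub>F z in nhds 0. ?\<gamma> z \<in> GLm N"
    proof (rule tendsto_GL(1)[OF _ A])
      fix i j assume ij: "i < N" "j < N"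
      have "((\<lambda>z. A (i,j) + z * matunit N k l (i,j)) \<longlongrightarrow> A (i,j) + 0 * matunit N k l (i,j)) (nhds 0)"
        by (intro tendsto_intros filterlim_ident)
      then show "((\<lambda>z. ?\<gamma> z (i,j)) \<longlongrightarrow> A (i,j)) (nhds 0)" using ij by simp
    qed simp
    then have "\<forall>\<^sub>F z in nhds 0. F (?\<gamma> z) = (\<Sum>b\<in>Bd d. ?E b * symeval N b (?\<gamma> z) (i,j))"
      by eventually_elim (simp add: F_def)
    then show "(\<lambda>z. F (?\<gamma> z)) field_differentiable (at 0)"
      using D DERIV_cong_ev[OF refl _ refl, of "\<lambda>z. F (?\<gamma> z)" "\<lambda>z. \<Sum>b\<in>Bd d. ?E b * symeval N b (?\<gamma> z) (i,j)" 0 D]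
      by (auto simp: field_differentiable_def)
  qed
  have "hallU N t f = F"
    unfolding hallU_def
  proof (rule the_equality)
    have "\<forall>U\<in>Um N. F U = heatU N t f U" using Um_GLm heatU_combination[OF N ij f] by (simp add: F_def)
    then show "holoGL N F \<and> (\<forall>A. A \<notin> GLm N \<longrightarrow> F A = 0) \<and> (\<forall>U\<in>Um N. F U = heatU N t f U)" using hol by (simp add: F_def)
    then show "F' = F" if "holoGL N F' \<and> (\<forall>A. A \<notin> GLm N \<longrightarrow> F' A = 0) \<and> (\<forall>U\<in>Um N. F' U = heatU N t f U)" for F'
      using that holoGL_unique[of N F' "heatU N t f" F] by blast
  qed
  then show ?thesis using G by (simp add: F_def)
qed

text \<open>\<open>kexp_perturb\<close> with \<epsilon> = 1/N^2: the kernel \<open>nker d N\<close>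
  describes the true Laplacian, \<open>dker\<close> its limit.\<close>

theorem hallM_teval_diff:
  assumes P: "kys P \<subseteq> Bd d"
  shows "\<exists>C\<ge>0. \<forall>N\<ge>1. \<exists>\<delta>. (\<forall>b\<in>Bd d. cmod (\<delta> b) \<le> C / (real N)^2) \<and>
    (\<forall>A\<in>GLm N. \<forall>i<N. \<forall>j<N. hallM N t (teval N P) A (i,j) - teval N (expDeltaU t P) A (i,j) = (\<Sum>b\<in>Bd d. \<delta> b * symeval N b A (i,j)))"
proof -
  let ?c = "lkp P" and ?s = "complex_of_real (t/2)"
  obtain C where C: "C \<ge> 0" "\<And>\<epsilon> b. cmod \<epsilon> \<le> 1 \<Longrightarrow> b \<in> Bd d \<Longrightarrow>
      cmod (kexp ?s (\<lambda>b b'. dker b b' + \<epsilon> * lker d b b') (Bd d) ?c b - kexp ?s dker (Bd d) ?c b) \<le> C * cmod \<epsilon>"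
    using kexp_perturb[OF finite_Bd[of d], where s = ?s and a = dker and l = "lker d" and c = ?c] by blast
  have exp_keys: "kys (expDeltaU t P) \<subseteq> Bd d"
    using lookup_expDeltaU[OF P, of t] by (auto simp: in_keys_iff split: if_splits)
  show ?thesis
  proof (intro exI[of _ C] conjI allI impI C(1))
    fix N :: nat assume N: "N \<ge> 1"
    let ?\<delta> = "\<lambda>b. kexp ?s (nker d N) (Bd d) ?c b - kexp ?s dker (Bd d) ?c b"
    show "\<exists>\<delta>. (\<forall>b\<in>Bd d. cmod (\<delta> b) \<le> C / (real N)^2) \<and>
      (\<forall>A\<in>GLm N. \<forall>i<N. \<forall>j<N. hallM N t (teval N P) A (i,j) - teval N (expDeltaU t P) A (i,j) = (\<Sum>b\<in>Bd d. \<delta> b * symeval N b A (i,j)))"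
    proof (intro exI[of _ ?\<delta>] conjI ballI allI impI)
      fix b assume b: "b \<in> Bd d"
      have e: "cmod (1 / (of_nat N)^2) = 1 / (real N)^2" by (simp add: norm_divide norm_power)
      have "1 \<le> (real N)^2" using N by (simp add: one_le_power)
      then have "cmod (1 / (of_nat N)^2) \<le> 1" unfolding e using N by (simp add: divide_le_eq)
      from C(2)[OF this b] show "cmod (?\<delta> b) \<le> C / (real N)^2" unfolding e by (simp add: nker_def[abs_def])
    next
      fix A i j assume A: "A \<in> GLm N" and ij: "i < N" "j < N"
      have f: "teval N P A (i,j) = (\<Sum>b\<in>Bd d. ?c b * symeval N b A (i,j))" for A
        using lin_superset[OF finite_Bd P] ij by (simp add: teval_lin)
      have "hallM N t (teval N P) A (i,j) = (\<Sum>b\<in>Bd d. kexp ?s (nker d N) (Bd d) ?c b * symeval N b A (i,j))"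
        using hallU_combination[OF N ij f A, of t] ij by (simp add: hallM_def)
      moreover have "teval N (expDeltaU t P) A (i,j) = (\<Sum>b\<in>Bd d. kexp ?s dker (Bd d) ?c b * symeval N b A (i,j))"
        using lin_superset[OF finite_Bd exp_keys] ij by (simp add: teval_lin lookup_expDeltaU[OF P])
      ultimately show "hallM N t (teval N P) A (i,j) - teval N (expDeltaU t P) A (i,j) = (\<Sum>b\<in>Bd d. ?\<delta> b * symeval N b A (i,j))"
        by (simp add: sum_subtractf left_diff_distrib)
    qed
  qed
qed

section \<open>Moment inequalities\<close>

definition nrm2 :: "nat \<Rightarrow> cmat \<Rightarrow> real" where
  "nrm2 N M = (\<Sum>i<N. \<Sum>j<N. (cmod (M (i,j)))^2) / real N"

lemma nrm2_nonneg [simp]: "nrm2 N M \<ge> 0"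
  by (simp add: nrm2_def sum_nonneg)

lemma nrm2_sq: "nrm2 N M = (\<Sum>p\<in>sq N. (cmod (M p))^2) / real N"
  unfolding nrm2_def sq_def by (simp add: sum.cartesian_product)

lemma nrm2_madj: "nrm2 N (madj N M) = nrm2 N M"
proof -
  have "(\<Sum>i<N. \<Sum>j<N. (cmod (M (j,i)))^2) = (\<Sum>i<N. \<Sum>j<N. (cmod (M (i,j)))^2)" by (rule sum.swap)
  then show ?thesis by (simp add: nrm2_def)
qed

lemma mtr_mmul_madj: "mtr N (mmul N M (madj N M)) = complex_of_real (nrm2 N M)"
  by (simp add: mtr_def nrm2_def complex_norm_square[symmetric])

lemma mtr_cauchy_schwarz: "(cmod (mtr N (mmul N P Q)))^2 \<le> nrm2 N P * nrm2 N Q"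
proof -
  have e: "mtr N (mmul N P Q) = (\<Sum>p\<in>sq N. P p * Q (snd p, fst p)) / of_nat N"
    unfolding mtr_def sq_def by (simp add: sum.cartesian_product case_prod_unfold)
  have "cmod (\<Sum>p\<in>sq N. P p * Q (snd p, fst p)) \<le> (\<Sum>p\<in>sq N. cmod (P p) * cmod (Q (snd p, fst p)))"
    by (rule sum_norm_le) (simp add: norm_mult)
  then have "(cmod (\<Sum>p\<in>sq N. P p * Q (snd p, fst p)))^2 \<le> (\<Sum>p\<in>sq N. cmod (P p) * cmod (Q (snd p, fst p)))^2"
    by (intro power_mono) auto
  also have "\<dots> \<le> (\<Sum>p\<in>sq N. (cmod (P p))^2) * (\<Sum>p\<in>sq N. (cmod (Q (snd p, fst p)))^2)"
    by (rule Cauchy_Schwarz_ineq_sum)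
  also have "(\<Sum>p\<in>sq N. (cmod (Q (snd p, fst p)))^2) = (\<Sum>p\<in>sq N. (cmod (Q p))^2)"
    by (rule sum.reindex_bij_witness[of _ prod.swap prod.swap]) (auto simp: sq_def)
  finally have "(cmod (\<Sum>p\<in>sq N. P p * Q (snd p, fst p)))^2 \<le> (\<Sum>p\<in>sq N. (cmod (P p))^2) * (\<Sum>p\<in>sq N. (cmod (Q p))^2)" .
  then have "(cmod (\<Sum>p\<in>sq N. P p * Q (snd p, fst p)))^2 / (real N * real N) \<le> (\<Sum>p\<in>sq N. (cmod (P p))^2) * (\<Sum>p\<in>sq N. (cmod (Q p))^2) / (real N * real N)"
    by (rule divide_right_mono) simp
  then show ?thesis unfolding e nrm2_sq by (simp add: norm_divide power_divide power2_eq_square)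
qed

lemma cnj_mtr: "cnj (mtr N M) = mtr N (madj N M)"
  by (simp add: mtr_def)

definition sw :: "letter list \<Rightarrow> letter list" where "sw w = rev (map (\<lambda>x. (fst x, \<not> snd x)) w)"

lemma length_sw [simp]: "length (sw w) = length w" by (simp add: sw_def)

lemma wev_sw: "A \<in> GLm N \<Longrightarrow> wev N A (sw w) = madj N (wev N A w)"
proof (induction w)
  case (Cons x w)
  have "lev N A (fst x, \<not> snd x) = madj N (lev N A x)" using Cons.prems minv_GL by (simp add: lev_def Let_def)
  moreover have "sw (x # w) = sw w @ [(fst x, \<not> snd x)]" by (simp add: sw_def)
  ultimately show ?case using Cons by (simp add: wev_append madj_mmul)
qed (simp add: sw_def)

lemma madj_GLm: "A \<in> GLm N \<Longrightarrow> madj N A \<in> GLm N"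
proof -
  assume A: "A \<in> GLm N"
  have "mmul N (madj N A) (madj N (minv N A)) = mid N" using arg_cong[OF minv_GL(4)[OF A], of "madj N"] by (simp only: madj_mmul madj_mid)
  then show ?thesis using minv_unique(1)[of "madj N A" N "madj N (minv N A)"] by simp
qed

lemma wev_GLm: "A \<in> GLm N \<Longrightarrow> wev N A w \<in> GLm N"
proof (induction w)
  case (Cons x w)
  then have "lev N A x \<in> GLm N" using madj_GLm minv_GL by (simp add: lev_def Let_def)
  then show ?case using Cons GLm_mmul(1) by simp
qed simp

lemma nrm2_GLm_pos: "N \<ge> 1 \<Longrightarrow> M \<in> GLm N \<Longrightarrow> nrm2 N M > 0"
proof (rule ccontr)
  assume N: "N \<ge> 1" and M: "M \<in> GLm N" and "\<not> nrm2 N M > 0"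
  then have "(\<Sum>p\<in>sq N. (cmod (M p))^2) = 0" using nrm2_nonneg[of N M] unfolding nrm2_sq
    by (metis divide_eq_0_iff less_eq_real_def not_one_le_zero of_nat_eq_0_iff)
  then have z: "M p = 0" if "p \<in> sq N" for p using that by (simp add: sum_nonneg_eq_0_iff)
  have "mid N (0,0) = mmul N M (minv N M) (0,0)" using minv_GL(3)[OF M] by simp
  also have "\<dots> = 0" using N z by simp
  finally show False using N by simp
qed

definition Wn :: "nat \<Rightarrow> letter list set" where "Wn n = {w. length w = n}"

lemma finite_Wn [simp]: "finite (Wn n)"
  using finite_lists_length_eq[of "UNIV :: letter set" n] by (simp add: Wn_def)

text \<open>Summing over all words of length n, adjoints and inverses included, gives one quantity
  that bounds each of them and is stable under cutting words and rejoining the pieces.\<close>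

definition Tn :: "nat \<Rightarrow> cmat \<Rightarrow> nat \<Rightarrow> real" where "Tn N A n = (\<Sum>w\<in>Wn n. nrm2 N (wev N A w))"

lemma Tn_nonneg [simp]: "Tn N A n \<ge> 0" by (simp add: Tn_def sum_nonneg)

lemma nrm2_le_Tn: "nrm2 N (wev N A w) \<le> Tn N A (length w)"
  unfolding Tn_def by (rule member_le_sum) (use finite_Wn[of "length w"] in \<open>auto simp: Wn_def\<close>)

lemma nrm2_mid: "N \<ge> 1 \<Longrightarrow> nrm2 N (mid N) = 1"
proof -
  assume N: "N \<ge> 1"
  have "complex_of_real (nrm2 N (mid N)) = 1" unfolding mtr_mmul_madj[symmetric] using N by simp
  then show ?thesis by simp
qed

lemma Tn_0: "N \<ge> 1 \<Longrightarrow> Tn N A 0 = 1"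
  by (simp add: Tn_def Wn_def nrm2_mid)

lemma Tn_pos: "N \<ge> 1 \<Longrightarrow> A \<in> GLm N \<Longrightarrow> Tn N A n > 0"
  using nrm2_le_Tn[of N A "replicate n (True,False)"] nrm2_GLm_pos[OF _ wev_GLm, of N A "replicate n (True,False)"] by simp

lemma Wn_Suc: "Wn (Suc n) = (\<lambda>(x,w). x # w) ` (UNIV \<times> Wn n)"
  by (auto simp: Wn_def length_Suc_conv image_iff)

lemma Tn_Suc: "Tn N A (Suc n) = (\<Sum>p\<in>UNIV \<times> Wn n. nrm2 N (wev N A (fst p # snd p)))"
  unfolding Tn_def Wn_Suc by (subst sum.reindex) (auto simp: inj_on_def case_prod_unfold)

text \<open>With ' for the adjoint, tr((x W)(x W)') = tr((x' x W) W'), and Cauchy-Schwarz separates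
  a word of length n + 2 from one of length n. The 4 counts the letters, since each W occurs once
  for every x.\<close>

lemma Tn_log_convex:
  assumes A: "A \<in> GLm N"
  shows "(Tn N A (Suc n))^2 \<le> 4 * Tn N A n * Tn N A (Suc (Suc n))"
proof -
  let ?I = "(UNIV :: letter set) \<times> Wn n"
  let ?y = "\<lambda>p :: letter \<times> letter list. (fst (fst p), \<not> snd (fst p)) # fst p # snd p"
  have fin: "finite ?I" by simp
  have one: "nrm2 N (wev N A (fst p # snd p)) \<le> sqrt (nrm2 N (wev N A (?y p))) * sqrt (nrm2 N (wev N A (snd p)))" for p :: "letter \<times> letter list"
  proof -
    let ?x = "lev N A (fst p)" let ?W = "wev N A (snd p)"
    have xs: "lev N A (fst (fst p), \<not> snd (fst p)) = madj N ?x" using A minv_GL by (simp add: lev_def Let_def)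
    have "mtr N (mmul N (wev N A (?y p)) (madj N ?W)) = mtr N (mmul N (madj N ?x) (mmul N (mmul N ?x ?W) (madj N ?W)))"
      by (simp add: xs mmul_assoc)
    also have "\<dots> = mtr N (mmul N (mmul N (mmul N ?x ?W) (madj N ?W)) (madj N ?x))" by (rule mtr_mmul_commute)
    also have "\<dots> = mtr N (mmul N (mmul N ?x ?W) (madj N (mmul N ?x ?W)))" by (simp add: madj_mmul mmul_assoc)
    also have "\<dots> = complex_of_real (nrm2 N (wev N A (fst p # snd p)))" by (simp add: mtr_mmul_madj)
    finally have "(nrm2 N (wev N A (fst p # snd p)))^2 = (cmod (mtr N (mmul N (wev N A (?y p)) (madj N ?W))))^2" by simp
    also have "\<dots> \<le> nrm2 N (wev N A (?y p)) * nrm2 N ?W" using mtr_cauchy_schwarz[of N "wev N A (?y p)" "madj N ?W"] by (simp only: nrm2_madj)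
    finally show ?thesis by (simp add: real_le_rsqrt real_sqrt_mult[symmetric])
  qed
  have "(Tn N A (Suc n))^2 \<le> (\<Sum>p\<in>?I. sqrt (nrm2 N (wev N A (?y p))) * sqrt (nrm2 N (wev N A (snd p))))^2"
    unfolding Tn_Suc by (intro power_mono sum_mono one sum_nonneg) auto
  also have "\<dots> \<le> (\<Sum>p\<in>?I. (sqrt (nrm2 N (wev N A (?y p))))^2) * (\<Sum>p\<in>?I. (sqrt (nrm2 N (wev N A (snd p))))^2)"
    by (rule Cauchy_Schwarz_ineq_sum)
  also have "\<dots> = (\<Sum>p\<in>?I. nrm2 N (wev N A (?y p))) * (\<Sum>p\<in>?I. nrm2 N (wev N A (snd p)))" by simp
  also have "(\<Sum>p\<in>?I. nrm2 N (wev N A (snd p))) = 4 * Tn N A n"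
  proof -
    have "(\<Sum>p\<in>?I. nrm2 N (wev N A (snd p))) = (\<Sum>x\<in>(UNIV :: letter set). \<Sum>w\<in>Wn n. nrm2 N (wev N A w))"
      by (simp only: sum.cartesian_product case_prod_unfold)
    moreover have "card (UNIV :: letter set) = 4"
      by (simp add: UNIV_Times_UNIV[symmetric] card_cartesian_product del: UNIV_Times_UNIV)
    ultimately show ?thesis by (simp add: Tn_def)
  qed
  also have "(\<Sum>p\<in>?I. nrm2 N (wev N A (?y p))) = (\<Sum>w\<in>?y ` ?I. nrm2 N (wev N A w))"
    by (subst sum.reindex) (auto simp: inj_on_def)
  also have "\<dots> * (4 * Tn N A n) \<le> Tn N A (Suc (Suc n)) * (4 * Tn N A n)"
    unfolding Tn_def by (intro mult_right_mono sum_mono2 mult_nonneg_nonneg sum_nonneg) (use finite_Wn[of "Suc (Suc n)"] in \<open>auto simp: Wn_def\<close>)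
  finally show ?thesis by (simp add: mult_ac)
qed

text \<open>By log-convexity the ratios T_{n+1} / T_n increase up to a factor 4 per step. Comparing
  the ratio at i with the one at i + j costs 4^j, and i such comparisons give 4^(i j).\<close>

lemma Tn_mult_le:
  assumes N: "N \<ge> 1" and A: "A \<in> GLm N"
  shows "Tn N A i * Tn N A j \<le> 4 ^ (i * j) * Tn N A (i + j)"
proof -
  define r where "r n = Tn N A (Suc n) / Tn N A n" for n
  have pos: "Tn N A n > 0" for n by (rule Tn_pos[OF N A])
  have r1: "r n \<le> 4 * r (Suc n)" for n
    using Tn_log_convex[OF A, of n] pos[of n] pos[of "Suc n"] by (simp add: r_def divide_le_eq le_divide_eq power2_eq_square mult_ac)
  have r0: "r n \<ge> 0" for n using pos by (simp add: r_def less_imp_le)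
  have rk: "r n \<le> 4 ^ k * r (n + k)" for n k
  proof (induction k)
    case (Suc k)
    have "4 ^ k * r (n + k) \<le> 4 ^ k * (4 * r (Suc (n + k)))" by (intro mult_left_mono r1) simp
    then have "4 ^ k * r (n + k) \<le> 4 ^ Suc k * r (n + Suc k)" by (simp add: mult_ac)
    with Suc show ?case by linarith
  qed simp
  have S: "Tn N A (Suc n) = r n * Tn N A n" for n using pos[of n] by (simp add: r_def)
  show ?thesis
  proof (induction i)
    case 0 then show ?case using Tn_0[OF N] by simp
  next
    case (Suc i)
    have "Tn N A (Suc i) * Tn N A j = r i * (Tn N A i * Tn N A j)" by (simp add: S)
    also have "\<dots> \<le> r i * (4 ^ (i * j) * Tn N A (i + j))" by (intro mult_left_mono Suc r0)
    also have "\<dots> \<le> (4 ^ j * r (i + j)) * (4 ^ (i * j) * Tn N A (i + j))" by (intro mult_right_mono rk) simp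
    also have "\<dots> = 4 ^ (Suc i * j) * Tn N A (Suc i + j)" by (simp add: S power_add mult_ac)
    finally show ?case .
  qed
qed

lemma mtr_word_le: "(cmod (mtr N (wev N A (u1 @ u2))))^2 \<le> Tn N A (length u1) * Tn N A (length u2)"
  unfolding wev_append
  by (rule order_trans[OF mtr_cauchy_schwarz mult_mono[OF nrm2_le_Tn nrm2_le_Tn]]) simp_all

lemma mtr_word_le': "(cmod (mtr N (wev N A u)))^2 \<le> Tn N A i * Tn N A j" if "length u = i + j"
  using mtr_word_le[of N A "take i u" "drop i u"] that by simp

text \<open>Each word is cut in two, the first half rounded down for u and up for v, so that
  corresponding halves have total length d. Cauchy-Schwarz for each trace, followed by
  \<open>Tn_mult_le\<close> for the two pairs of halves, leaves the square of T_d.\<close>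

lemma mtr_pair_le:
  assumes N: "N \<ge> 1" and A: "A \<in> GLm N" and l: "length u + length v = 2 * d"
  shows "cmod (mtr N (wev N A u)) * cmod (mtr N (wev N A v)) \<le> 4 ^ (d * d) * Tn N A d"
proof -
  let ?a = "cmod (mtr N (wev N A u))" let ?b = "cmod (mtr N (wev N A v))"
  define i where "i = length u div 2"
  define i' where "i' = length u - i"
  define j' where "j' = length v div 2"
  define j where "j = length v - j'"
  have ij: "i + j = d" "i' + j' = d" using l by (auto simp: i_def i'_def j_def j'_def)
  have a: "?a^2 \<le> Tn N A i * Tn N A i'" by (rule mtr_word_le') (simp add: i_def i'_def)
  have b: "?b^2 \<le> Tn N A j * Tn N A j'" by (rule mtr_word_le') (simp add: j_def j'_def)
  have T: "Tn N A p * Tn N A q \<le> 4 ^ (d * d) * Tn N A d" if "p + q = d" for p q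
  proof -
    have "p * q \<le> d * d" using that by (intro mult_mono) auto
    then have "(4::real) ^ (p * q) \<le> 4 ^ (d * d)" by (intro power_increasing) auto
    then show ?thesis using Tn_mult_le[OF N A, of p q] that mult_right_mono[of "4 ^ (p * q)" "4 ^ (d * d)" "Tn N A d"] by simp
  qed
  have "(?a * ?b)^2 \<le> (Tn N A i * Tn N A i') * (Tn N A j * Tn N A j')"
    unfolding power_mult_distrib by (intro mult_mono a b) auto
  also have "\<dots> = (Tn N A i * Tn N A j) * (Tn N A i' * Tn N A j')" by (simp only: mult_ac)
  also have "\<dots> \<le> (4 ^ (d * d) * Tn N A d) * (4 ^ (d * d) * Tn N A d)" by (intro mult_mono T ij) auto
  finally have "(?a * ?b)^2 \<le> (4 ^ (d * d) * Tn N A d)^2" by (simp only: power2_eq_square)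
  then show ?thesis by (rule power2_le_imp_le) simp
qed

section \<open>The Laplacian and the gradient of GL_N on traces of words\<close>

lemma of_real_sum_list: "complex_of_real (\<Sum>x\<leftarrow>xs. f x) = (\<Sum>x\<leftarrow>xs. complex_of_real (f x))"
  by (induction xs) auto

lemma mtr_msum: "mtr N (msum N f xs) = (\<Sum>x\<leftarrow>xs. mtr N (f x))"
  unfolding mtr_def by (simp add: msum_nth sum_list_swap[symmetric] divide_inverse sum_list_mult_const sum_distrib_right[symmetric])

text \<open>Two insertions at one letter are of the same kind and contribute 0. Among the pairs only
  those of a starred and an unstarred letter carry a nonzero factor.\<close>

lemma sum_gl_D2:
  "(\<Sum>X\<leftarrow>gl_basis N. mtr N (D2 N X A v)) =
    (\<Sum>(c,P,x,M,y,Q)\<leftarrow>pairs v. 2 * c * ((if snd x = snd y then 0 else 2) * mtr N (wev N A M) * mtr N (wev N A (P @ Q))))"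
proof -
  have tra: "mtr N (madd N P Q) = mtr N P + mtr N Q" for P Q by (simp add: mtr_def sum.distrib add_divide_distrib)
  have sand: "(\<Sum>X\<leftarrow>gl_basis N. mtr N (mmul N P (mmul N (lins N X x) (mmul N M (mmul N (lins N X y) Q))))) = (if snd x = snd y then 0 else 2) * mtr N M * mtr N (mmul N P Q)" for P M Q x y
  proof -
    have "(\<Sum>X\<leftarrow>gl_basis N. mtr N (mmul N P (mmul N (lins N X x) (mmul N M (mmul N (lins N X y) Q)))))
      = (\<Sum>i<N. \<Sum>X\<leftarrow>gl_basis N. mmul N P (mmul N (lins N X x) (mmul N M (mmul N (lins N X y) Q))) (i,i)) / of_nat N"
      unfolding sum_list_swap[symmetric] mtr_def by (simp add: divide_inverse sum_list_mult_const del: mat_nth(1))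
    also have "(\<Sum>i<N. \<Sum>X\<leftarrow>gl_basis N. mmul N P (mmul N (lins N X x) (mmul N M (mmul N (lins N X y) Q))) (i,i))
      = (\<Sum>i<N. (if snd x = snd y then 0 else 2) * mtr N M * mmul N P Q (i,i))"
      by (intro sum.cong refl casimir_sandwich[OF casimir_gl_basis]) auto
    finally show ?thesis by (simp add: mtr_def[of N "mmul N P Q"] sum_distrib_left del: mat_nth(1))
  qed
  have "(\<Sum>X\<leftarrow>gl_basis N. mtr N (D2 N X A v)) =
    (\<Sum>p\<leftarrow>ins v. \<Sum>X\<leftarrow>gl_basis N. mtr N (mmul N (wev N A (fst (snd p))) (mmul N (lins N X (fst (snd (snd p)))) (mmul N (mid N) (mmul N (lins N X (fst (snd (snd p)))) (wev N A (snd (snd (snd p))))))))) +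
    (\<Sum>p\<leftarrow>pairs v. \<Sum>X\<leftarrow>gl_basis N. (2 * fst p) * mtr N (mmul N (wev N A (fst (snd p))) (mmul N (lins N X (fst (snd (snd p)))) (mmul N (wev N A (fst (snd (snd (snd p))))) (mmul N (lins N X (fst (snd (snd (snd (snd p)))))) (wev N A (snd (snd (snd (snd (snd p)))))))))))"
    unfolding D2_def tra mtr_msum sum_list_addf
    by (simp only: case_prod_unfold mtr_mscale mmul_mid_left[OF mats_closed(1)] sum_list_swap2[of _ _ "gl_basis N"])
  also have "\<dots> = (\<Sum>p\<leftarrow>ins v. 0) + (\<Sum>p\<leftarrow>pairs v. 2 * fst p * ((if snd (fst (snd (snd p))) = snd (fst (snd (snd (snd (snd p))))) then 0 else 2) * mtr N (wev N A (fst (snd (snd (snd p))))) * mtr N (wev N A (fst (snd p) @ snd (snd (snd (snd (snd p))))))))"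
    unfolding sum_list_const_mult sand wev_append by simp
  finally show ?thesis by (simp add: case_prod_unfold)
qed

lemma sum_gl_D2_le:
  assumes N: "N \<ge> 1" and A: "A \<in> GLm N" and l: "length v = 2 * d"
  shows "cmod (\<Sum>X\<leftarrow>gl_basis N. mtr N (D2 N X A v)) \<le> 16 * (real d)^2 * 4 ^ (d * d) * Tn N A d"
proof -
  have sl: "cmod (sum_list (map f xs)) \<le> real (length xs) * B" if "\<And>x. x \<in> set xs \<Longrightarrow> cmod (f x) \<le> B" for f :: "'z \<Rightarrow> complex" and xs B
    using that
  proof (induction xs)
    case (Cons x xs)
    have "cmod (f x + sum_list (map f xs)) \<le> cmod (f x) + cmod (sum_list (map f xs))" by (rule norm_triangle_ineq)
    also have "\<dots> \<le> B + real (length xs) * B" using Cons by (intro add_mono) auto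
    finally show ?case by (simp add: algebra_simps)
  qed simp
  \<comment> \<open>Each pair carries a factor at most 4, namely 2 from \<open>D2\<close> and 2 from
    the contraction; there are at most (2 d)^2 pairs, whence 16 d^2.\<close>
  let ?B = "4 * (4 ^ (d * d) * Tn N A d)"
  have "cmod (\<Sum>X\<leftarrow>gl_basis N. mtr N (D2 N X A v)) \<le> real (length (pairs v)) * ?B"
    unfolding sum_gl_D2
  proof (rule sl)
    fix p assume p: "p \<in> set (pairs v)"
    obtain c P x M y Q where pe: "p = (c,P,x,M,y,Q)" by (metis prod.exhaust)
    have L: "length P + length M + length Q = length v" "cmod c = 1" using pairs_length p pe by blast+
    have "cmod (mtr N (wev N A M)) * cmod (mtr N (wev N A (P @ Q))) \<le> 4 ^ (d * d) * Tn N A d"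
      by (rule mtr_pair_le[OF N A]) (use L l in simp)
    moreover have "cmod (case p of (c,P,x,M,y,Q) \<Rightarrow> 2 * c * ((if snd x = snd y then 0 else 2) * mtr N (wev N A M) * mtr N (wev N A (P @ Q))))
      \<le> 4 * (cmod (mtr N (wev N A M)) * cmod (mtr N (wev N A (P @ Q))))"
      using L by (simp add: pe norm_mult)
    ultimately show "cmod (case p of (c,P,x,M,y,Q) \<Rightarrow> 2 * c * ((if snd x = snd y then 0 else 2) * mtr N (wev N A M) * mtr N (wev N A (P @ Q)))) \<le> ?B"
      by linarith
  qed
  also have "\<dots> \<le> (real (length v ^ 2)) * ?B"
    using length_pairs[of v] by (intro mult_right_mono) (auto simp: of_nat_mono)
  also have "\<dots> = 16 * (real d)^2 * 4 ^ (d * d) * Tn N A d" by (simp add: l power_mult_distrib)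
  finally show ?thesis .
qed

text \<open>Holomorphic traces are harmonic: without adjoints no pair of opposite kind
  exists.\<close>

lemma sum_gl_D2_unstarred: "(\<And>x. x \<in> set v \<Longrightarrow> \<not> snd x) \<Longrightarrow> (\<Sum>X\<leftarrow>gl_basis N. mtr N (D2 N X A v)) = 0"
proof -
  assume u: "\<And>x. x \<in> set v \<Longrightarrow> \<not> snd x"
  have "(\<Sum>(c,P,x,M,y,Q)\<leftarrow>pairs v. 2 * c * ((if snd x = snd y then 0 else 2) * mtr N (wev N A M) * mtr N (wev N A (P @ Q)))) = (\<Sum>p\<leftarrow>pairs v. 0)"
  proof (intro arg_cong[where f = sum_list] map_cong refl, clarify)
    fix c P x sx M y sy Q assume m: "(c, P, (x,sx), M, (y,sy), Q) \<in> set (pairs v)"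
    have "\<not> snd (x,sx)" "\<not> snd (y,sy)" using pairs_length[OF m] u by blast+
    then show "2 * c * ((if snd (x,sx) = snd (y,sy) then 0 else 2) * mtr N (wev N A M) * mtr N (wev N A (P @ Q))) = 0" by simp
  qed
  then show ?thesis unfolding sum_gl_D2 by simp
qed

text \<open>A single insertion times its conjugate is a product of two traces, merged at the price
  2/N^2 into the squared norm of the rotated word Q P. The square of the length comes from
  Cauchy-Schwarz over the insertion points and from their number.\<close>

lemma sum_gl_D1_le:
  assumes A: "A \<in> GLm N"
  shows "(\<Sum>X\<leftarrow>gl_basis N. (cmod (mtr N (D1 N X A v)))^2) \<le> (2 / (real N)^2) * (real (length v))^2 * Tn N A (length v)"
proof -
  have tr: "mtr N (D1 N X A v) = (\<Sum>p\<leftarrow>ins v. fst p * mtr N (mmul N (wev N A (fst (snd p))) (mmul N (lins N X (fst (snd (snd p)))) (wev N A (snd (snd (snd p)))))))" for X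
    unfolding D1_def by (simp add: mtr_msum case_prod_unfold mtr_mscale)
  have cs: "(cmod (sum_list (map f xs)))^2 \<le> real (length xs) * sum_list (map (\<lambda>x. (cmod (f x))^2) xs)" for f :: "'z \<Rightarrow> complex" and xs
  proof -
    have "cmod (sum_list (map f xs)) \<le> (\<Sum>i<length xs. 1 * cmod (f (xs ! i)))"
      unfolding sum_list_sum_nth by (simp add: atLeast0LessThan) (rule norm_sum)
    then have "(cmod (sum_list (map f xs)))^2 \<le> (\<Sum>i<length xs. 1 * cmod (f (xs ! i)))^2" by (intro power_mono) auto
    also have "\<dots> \<le> (\<Sum>i<length xs. 1^2) * (\<Sum>i<length xs. (cmod (f (xs ! i)))^2)" by (rule Cauchy_Schwarz_ineq_sum)
    finally show ?thesis by (simp add: sum_list_sum_nth atLeast0LessThan)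
  qed
  let ?t = "\<lambda>X p. mtr N (mmul N (wev N A (fst (snd p))) (mmul N (lins N X (fst (snd (snd p)))) (wev N A (snd (snd (snd p))))))"
  have each: "(\<Sum>X\<leftarrow>gl_basis N. (cmod (?t X p))^2) \<le> 2 / (real N)^2 * Tn N A (length v)" if p: "p \<in> set (ins v)" for p
  proof -
    obtain c P y Q where pe: "p = (c,P,y,Q)" by (metis prod.exhaust)
    have L: "length P + length Q = length v" using ins_length p pe by blast
    let ?P = "wev N A P" let ?Q = "wev N A Q"
    have lm: "madj N (lins N X y) = lins N X (fst y, \<not> snd y)" if "X \<in> set (gl_basis N)" for X
      using gl_basis_mats[OF that] by (simp add: lins_def)
    have "complex_of_real (\<Sum>X\<leftarrow>gl_basis N. (cmod (?t X p))^2) = (\<Sum>X\<leftarrow>gl_basis N. complex_of_real ((cmod (?t X p))^2))"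
      by (rule of_real_sum_list)
    also have "\<dots> = (\<Sum>X\<leftarrow>gl_basis N. mtr N (mmul N ?P (mmul N (lins N X y) ?Q)) * mtr N (mmul N (madj N ?Q) (mmul N (lins N X (fst y, \<not> snd y)) (madj N ?P))))"
    proof (intro arg_cong[where f = sum_list] map_cong refl)
      fix X assume X: "X \<in> set (gl_basis N)"
      show "complex_of_real ((cmod (?t X p))^2) = mtr N (mmul N ?P (mmul N (lins N X y) ?Q)) * mtr N (mmul N (madj N ?Q) (mmul N (lins N X (fst y, \<not> snd y)) (madj N ?P)))"
        unfolding complex_norm_square cnj_mtr lm[OF X, symmetric] pe by (simp add: madj_mmul mmul_assoc)
    qed
    also have "\<dots> = 2 / (of_nat N)^2 * mtr N (mmul N ?P (mmul N (madj N ?P) (mmul N (madj N ?Q) ?Q)))"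
      using casimir_cross_mtr[OF casimir_gl_basis[of N y "(fst y, \<not> snd y)"]] by simp
    also have "mtr N (mmul N ?P (mmul N (madj N ?P) (mmul N (madj N ?Q) ?Q))) = mtr N (mmul N (mmul N ?P (mmul N (madj N ?P) (madj N ?Q))) ?Q)" by (simp add: mmul_assoc)
    also have "\<dots> = mtr N (mmul N ?Q (mmul N ?P (mmul N (madj N ?P) (madj N ?Q))))" by (rule mtr_mmul_commute)
    also have "\<dots> = mtr N (mmul N (wev N A (Q @ P)) (madj N (wev N A (Q @ P))))" by (simp add: wev_append madj_mmul mmul_assoc)
    also have "\<dots> = complex_of_real (nrm2 N (wev N A (Q @ P)))" by (rule mtr_mmul_madj)
    finally have "complex_of_real (\<Sum>X\<leftarrow>gl_basis N. (cmod (?t X p))^2) = complex_of_real (2 / (real N)^2 * nrm2 N (wev N A (Q @ P)))" by simp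
    then have "(\<Sum>X\<leftarrow>gl_basis N. (cmod (?t X p))^2) = 2 / (real N)^2 * nrm2 N (wev N A (Q @ P))" by (simp only: of_real_eq_iff)
    also have "\<dots> \<le> 2 / (real N)^2 * Tn N A (length (Q @ P))" by (intro mult_left_mono nrm2_le_Tn) simp
    finally show ?thesis using L by (simp add: add.commute)
  qed
  have "(\<Sum>X\<leftarrow>gl_basis N. (cmod (mtr N (D1 N X A v)))^2) \<le> (\<Sum>X\<leftarrow>gl_basis N. real (length v) * (\<Sum>p\<leftarrow>ins v. (cmod (?t X p))^2))"
  proof (rule sum_list_mono)
    fix X
    have "(cmod (mtr N (D1 N X A v)))^2 \<le> real (length (ins v)) * (\<Sum>p\<leftarrow>ins v. (cmod (fst p * ?t X p))^2)"
      unfolding tr by (rule cs)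
    also have "(\<Sum>p\<leftarrow>ins v. (cmod (fst p * ?t X p))^2) = (\<Sum>p\<leftarrow>ins v. (cmod (?t X p))^2)"
    proof (intro arg_cong[where f = sum_list] map_cong refl)
      fix p assume "p \<in> set (ins v)"
      then have "cmod (fst p) = 1" using ins_length by (metis prod.collapse)
      then show "(cmod (fst p * ?t X p))^2 = (cmod (?t X p))^2" by (simp add: norm_mult)
    qed
    finally show "(cmod (mtr N (D1 N X A v)))^2 \<le> real (length v) * (\<Sum>p\<leftarrow>ins v. (cmod (?t X p))^2)" by (simp add: length_ins)
  qed
  also have "\<dots> = real (length v) * (\<Sum>p\<leftarrow>ins v. \<Sum>X\<leftarrow>gl_basis N. (cmod (?t X p))^2)"
    unfolding sum_list_const_mult by (subst sum_list_swap2) (rule refl)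
  also have "\<dots> \<le> real (length v) * (\<Sum>p\<leftarrow>ins v. 2 / (real N)^2 * Tn N A (length v))"
    by (intro mult_left_mono sum_list_mono each) auto
  also have "\<dots> = (2 / (real N)^2) * (real (length v))^2 * Tn N A (length v)"
    by (simp add: sum_list_triv length_ins power2_eq_square)
  finally show ?thesis .
qed

section \<open>Lyapunov functions for the Brownian motion\<close>

text \<open>Polynomials in the entries of A, of its inverse and their conjugates: continuous on GL_N
  and closed under directional derivatives, as smoothness of the test functions demands.\<close>

inductive poly_fn :: "nat \<Rightarrow> (cmat \<Rightarrow> complex) \<Rightarrow> bool" for N where
  const: "poly_fn N (\<lambda>A. c)"
| entry: "i < N \<Longrightarrow> j < N \<Longrightarrow> poly_fn N (\<lambda>A. A (i,j))"
| inv_entry: "i < N \<Longrightarrow> j < N \<Longrightarrow> poly_fn N (\<lambda>A. minv N A (i,j))"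
| conj: "poly_fn N p \<Longrightarrow> poly_fn N (\<lambda>A. cnj (p A))"
| add: "poly_fn N p \<Longrightarrow> poly_fn N q \<Longrightarrow> poly_fn N (\<lambda>A. p A + q A)"
| mult: "poly_fn N p \<Longrightarrow> poly_fn N q \<Longrightarrow> poly_fn N (\<lambda>A. p A * q A)"

lemma poly_fn_sum: "(\<And>i. i \<in> I \<Longrightarrow> poly_fn N (p i)) \<Longrightarrow> poly_fn N (\<lambda>A. \<Sum>i\<in>I. p i A)"
  by (induction I rule: infinite_finite_induct) (auto intro: poly_fn.intros)

lemma poly_fn_cmult: "poly_fn N p \<Longrightarrow> poly_fn N (\<lambda>A. c * p A)"
  by (rule poly_fn.mult[OF poly_fn.const])

lemma poly_fn_tendsto:
  assumes "poly_fn N p" and e: "\<And>i j. i < N \<Longrightarrow> j < N \<Longrightarrow> ((\<lambda>s. \<gamma> s (i,j)) \<longlongrightarrow> A (i,j)) F"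
    and A: "A \<in> GLm N" and m: "\<And>s. \<gamma> s \<in> mats N"
  shows "((\<lambda>s. p (\<gamma> s)) \<longlongrightarrow> p A) F"
  using assms(1)
proof induction
  case (inv_entry i j)
  then show ?case using tendsto_GL(2)[OF e A m] by blast
qed (auto intro!: tendsto_intros e)

lemma of_real_has_vector_derivative: "(complex_of_real has_vector_derivative 1) (at x)"
  unfolding has_vector_derivative_def scaleR_conv_of_real by (auto intro!: derivative_eq_intros)

lemma poly_fn_deriv:
  assumes "poly_fn N p" and E: "E \<in> mats N"
  shows "\<exists>p'. poly_fn N p' \<and> (\<forall>A\<in>GLm N. ((\<lambda>s::real. p (madd N A (mscale N (complex_of_real s) E))) has_vector_derivative p' A) (at 0))"
  using assms(1)
proof induction
  case (const c)
  show ?case by (intro exI[of _ "\<lambda>A. 0"]) (auto intro: poly_fn.const)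
next
  case (entry i j)
  have "((\<lambda>s::real. A (i,j) + complex_of_real s * E (i,j)) has_vector_derivative 0 + 1 * E (i,j)) (at 0)" for A
    by (intro has_vector_derivative_add has_vector_derivative_const has_vector_derivative_mult_left of_real_has_vector_derivative)
  then show ?case using entry by (intro exI[of _ "\<lambda>A. E (i,j)"]) (auto intro: poly_fn.const)
next
  case (inv_entry i j)
  define p' where "p' A = (-1) * (\<Sum>k<N. (\<Sum>l<N. minv N A (i,l) * E (l,k)) * minv N A (k,j))" for A
  have "poly_fn N p'" unfolding p'_def
    using inv_entry by (intro poly_fn_cmult poly_fn_sum poly_fn.mult poly_fn.inv_entry poly_fn.const) auto
  moreover have "((\<lambda>s::real. minv N (madd N A (mscale N (complex_of_real s) E)) (i,j)) has_vector_derivative p' A) (at 0)" if A: "A \<in> GLm N" for A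
  proof -
    have "((\<lambda>s::real. minv N (madd N A (mscale N (complex_of_real s) E)) (i,j)) has_derivative
       (\<lambda>h. - mmul N (mmul N (minv N A) (mscale N (complex_of_real h) E)) (minv N A) (i,j))) (at 0)"
    proof (rule minv_has_derivative[OF _ _ A])
      show "madd N A (mscale N (complex_of_real 0) E) = A" by (rule mats_ext[where N = N]) (use minv_GL[OF A] in auto)
      fix i j assume ij: "i < N" "j < N"
      have "((\<lambda>s::real. A (i,j) + complex_of_real s * E (i,j)) has_vector_derivative 0 + 1 * E (i,j)) (at 0)"
        by (intro has_vector_derivative_add has_vector_derivative_const has_vector_derivative_mult_left of_real_has_vector_derivative)
      then show "((\<lambda>s::real. madd N A (mscale N (complex_of_real s) E) (i,j)) has_derivative (\<lambda>h. mscale N (complex_of_real h) E (i,j))) (at 0)"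
        using ij by (simp add: has_vector_derivative_def scaleR_conv_of_real)
    qed (use inv_entry in auto)
    moreover have "- mmul N (mmul N (minv N A) (mscale N (complex_of_real h) E)) (minv N A) (i,j) = h *\<^sub>R p' A" for h
    proof -
      have "mmul N (mmul N (minv N A) E) (minv N A) (i,j) = - p' A" using inv_entry by (simp add: p'_def)
      then show ?thesis using inv_entry by (simp add: scaleR_conv_of_real del: mat_nth(1))
    qed
    ultimately show ?thesis by (simp add: has_vector_derivative_def)
  qed
  ultimately show ?case by blast
next
  case (conj p)
  then obtain p' where p': "poly_fn N p'" "\<And>A. A \<in> GLm N \<Longrightarrow> ((\<lambda>s::real. p (madd N A (mscale N (complex_of_real s) E))) has_vector_derivative p' A) (at 0)" by blast
  show ?case
    by (intro exI[of _ "\<lambda>A. cnj (p' A)"] conjI ballI poly_fn.conj p'(1) bounded_linear.has_vector_derivative[OF bounded_linear_cnj] p'(2))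
next
  case (add p q)
  then obtain p' q' where p': "poly_fn N p'" "\<And>A. A \<in> GLm N \<Longrightarrow> ((\<lambda>s::real. p (madd N A (mscale N (complex_of_real s) E))) has_vector_derivative p' A) (at 0)"
    and q': "poly_fn N q'" "\<And>A. A \<in> GLm N \<Longrightarrow> ((\<lambda>s::real. q (madd N A (mscale N (complex_of_real s) E))) has_vector_derivative q' A) (at 0)" by blast
  show ?case
    by (intro exI[of _ "\<lambda>A. p' A + q' A"] conjI ballI poly_fn.add p'(1) q'(1) has_vector_derivative_add p'(2) q'(2))
next
  case (mult p q)
  then obtain p' q' where p': "poly_fn N p'" "\<And>A. A \<in> GLm N \<Longrightarrow> ((\<lambda>s::real. p (madd N A (mscale N (complex_of_real s) E))) has_vector_derivative p' A) (at 0)"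
    and q': "poly_fn N q'" "\<And>A. A \<in> GLm N \<Longrightarrow> ((\<lambda>s::real. q (madd N A (mscale N (complex_of_real s) E))) has_vector_derivative q' A) (at 0)" by blast
  show ?case
  proof (intro exI[of _ "\<lambda>A. p A * q' A + p' A * q A"] conjI ballI)
    show "poly_fn N (\<lambda>A. p A * q' A + p' A * q A)" by (intro poly_fn.add poly_fn.mult mult.hyps p'(1) q'(1))
    fix A assume A: "A \<in> GLm N"
    have "madd N A (mscale N (complex_of_real 0) E) = A" by (rule mats_ext[where N = N]) (use minv_GL[OF A] in auto)
    with has_vector_derivative_mult[OF p'(2)[OF A] q'(2)[OF A]]
    show "((\<lambda>s::real. p (madd N A (mscale N (complex_of_real s) E)) * q (madd N A (mscale N (complex_of_real s) E))) has_vector_derivative p A * q' A + p' A * q A) (at 0)"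
      by (simp only:)
  qed
qed

text \<open>Up to sign, \<open>hh 0\<close> is the profile of the test functions; all derivatives are combinations of the \<open>hh n\<close>.\<close>

definition hh :: "nat \<Rightarrow> real \<Rightarrow> real" where
  "hh n x = (if x > 0 then inverse x ^ n * exp (- inverse x) else 0)"

text \<open>At 0 both one-sided difference quotients tend to 0, because exp(-1/x) beats every power
  of 1/x. This makes all \<open>hh n\<close> smooth across the edge of their support.\<close>

lemma hh_DERIV: "(hh n has_real_derivative (hh (n + 2) x - real n * hh (n + 1) x)) (at x)"
proof -
  consider "x > 0" | "x < 0" | "x = 0" by linarith
  then show ?thesis
  proof cases
    case 1
    have "((\<lambda>x. inverse x ^ n * exp (- inverse x)) has_real_derivative (hh (n + 2) x - real n * hh (n + 1) x)) (at x)"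
    proof -
      have "((\<lambda>v. v ^ n * exp (- v)) has_real_derivative (real n * inverse x ^ (n - 1) - inverse x ^ n) * exp (- inverse x)) (at (inverse x))"
        by (auto intro!: derivative_eq_intros simp: algebra_simps)
      from DERIV_chain2[OF this DERIV_inverse[of x UNIV]] 1
      have "((\<lambda>x. inverse x ^ n * exp (- inverse x)) has_real_derivative
        (real n * inverse x ^ (n - 1) - inverse x ^ n) * exp (- inverse x) * - (inverse x ^ Suc (Suc 0))) (at x)" by simp
      moreover have "(real n * inverse x ^ (n - 1) - inverse x ^ n) * exp (- inverse x) * - (inverse x ^ Suc (Suc 0)) = hh (n + 2) x - real n * hh (n + 1) x"
        using 1 by (cases n) (simp_all add: hh_def algebra_simps del: of_nat_Suc power_inverse)
      ultimately show ?thesis by (simp only:)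
    qed
    moreover have "\<forall>\<^sub>F y in nhds x. hh n y = inverse y ^ n * exp (- inverse y)"
      using eventually_nhds_in_open[of "{0<..}" x] 1 by (auto simp: hh_def elim!: eventually_mono)
    ultimately show ?thesis using DERIV_cong_ev[OF refl _ refl, of "hh n" "\<lambda>y. inverse y ^ n * exp (- inverse y)" x] by blast
  next
    case 2
    have "\<forall>\<^sub>F y in nhds x. hh n y = 0"
      using eventually_nhds_in_open[of "{..<0}" x] 2 by (auto simp: hh_def elim!: eventually_mono)
    then show ?thesis using DERIV_cong_ev[OF refl _ refl, of "hh n" "\<lambda>y. 0" x 0] 2 by (simp add: hh_def)
  next
    case 3
    have "((\<lambda>u::real. u ^ (n + 1) / exp u) \<longlongrightarrow> 0) at_top" by (rule tendsto_power_div_exp_0)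
    from filterlim_compose[OF this filterlim_inverse_at_top_right]
    have "((\<lambda>y::real. inverse y ^ (n + 1) / exp (inverse y)) \<longlongrightarrow> 0) (at_right 0)" .
    then have r: "((\<lambda>y. hh n y / y) \<longlongrightarrow> 0) (at_right 0)"
      by (rule Lim_transform_eventually) (auto simp: hh_def eventually_at_filter exp_minus field_simps)
    have l: "((\<lambda>y. hh n y / y) \<longlongrightarrow> 0) (at_left 0)"
      by (rule tendsto_eventually) (auto simp: hh_def eventually_at_filter)
    have "((\<lambda>y. hh n y / y) \<longlongrightarrow> 0) (at 0)" using r l by (simp add: filterlim_split_at)
    then show ?thesis using 3 by (simp add: has_field_derivative_iff hh_def)
  qed
qed

lemma hh_isCont: "isCont (hh n) x"
  using hh_DERIV DERIV_isCont by blast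

lemma hh_nonneg: "hh n x \<ge> 0" by (simp add: hh_def)

lemma hh1_DERIV: "(hh 0 has_real_derivative hh 2 x) (at x)"
  using hh_DERIV[of 0 x] by (simp add: numeral_2_eq_2)

text \<open>Convexity of \<open>hh 0\<close> up to 1/2, its second derivative for x > 0 being x^-3
  exp(-1/x) (1/x - 2). This is the origin of the constant 1/2 in the truncations.\<close>

lemma hh2_mono:
  assumes "x \<le> y" and y: "y \<le> 1/2"
  shows "hh 2 x \<le> hh 2 y"
proof (rule DERIV_nonneg_imp_nondecreasing[OF assms(1)])
  fix z assume z: "x \<le> z" "z \<le> y"
  have "hh 4 z - 2 * hh 3 z \<ge> 0"
  proof (cases "z > 0")
    case True
    then have "inverse z \<ge> 2" using le_imp_inverse_le[of z "1/2"] z y True by simp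
    then have "inverse z ^ 3 * exp (- inverse z) * (inverse z - 2) \<ge> 0" using True by (intro mult_nonneg_nonneg) auto
    then show ?thesis using True by (simp add: hh_def algebra_simps eval_nat_numeral)
  qed (simp add: hh_def)
  then show "\<exists>d. (hh 2 has_real_derivative d) (at z) \<and> 0 \<le> d" using hh_DERIV[of 2 z] by (auto simp: numeral_eq_Suc)
qed

text \<open>Convexity places the secant slope between the tangent slopes at the two ends. The first
  inequality will control the generator, the second the initial value.\<close>

lemma hh_tangent:
  assumes "0 \<le> h"
  shows "h * hh 2 (1/2 - h) \<le> hh 0 (1/2) - hh 0 (1/2 - h)" "hh 0 (1/2) - hh 0 (1/2 - h) \<le> h * hh 2 (1/2)"
proof -
  have "\<exists>z. 1/2 - h \<le> z \<and> z \<le> 1/2 \<and> hh 0 (1/2) - hh 0 (1/2 - h) = h * hh 2 z"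
  proof (cases "h = 0")
    case False
    then have "1/2 - h < 1/2" using assms by simp
    from MVT2[OF this, of "hh 0" "hh 2"] hh1_DERIV obtain z where "1/2 - h < z" "z < 1/2" "hh 0 (1/2) - hh 0 (1/2 - h) = (1/2 - (1/2 - h)) * hh 2 z" by blast
    then show ?thesis by (intro exI[of _ z]) auto
  qed (auto intro!: exI[of _ "1/2"])
  then obtain z where z: "1/2 - h \<le> z" "z \<le> 1/2" "hh 0 (1/2) - hh 0 (1/2 - h) = h * hh 2 z" by blast
  show "h * hh 2 (1/2 - h) \<le> hh 0 (1/2) - hh 0 (1/2 - h)" unfolding z(3) using assms z hh2_mono[of "1/2 - h" z] by (intro mult_left_mono) auto
  show "hh 0 (1/2) - hh 0 (1/2 - h) \<le> h * hh 2 (1/2)" unfolding z(3) using assms z hh2_mono[of z "1/2"] by (intro mult_left_mono) auto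
qed

section \<open>Compact sublevel sets and smooth truncations\<close>

lemma closed_mats: "closed (mats N)"
proof -
  have "mats N = (\<Inter>p\<in>- sq N. {A. A p = undefined})" by (auto simp: mats_def PiE_def extensional_def)
  moreover have "closed {A :: cmat. A p = undefined}" for p
    by (intro closed_Collect_eq continuous_on_product_coordinates continuous_on_const)
  ultimately show ?thesis by (auto intro: closed_INT)
qed

lemma continuous_on_line: "continuous_on UNIV (\<lambda>s::real. madd N A (mscale N (complex_of_real s) E))"
proof (rule continuous_on_coordinatewise_then_product)
  fix p
  show "continuous_on UNIV (\<lambda>s. madd N A (mscale N (complex_of_real s) E) p)"
  proof (cases "p \<in> sq N")
    case True
    then obtain i j where "p = (i,j)" "i < N" "j < N" by (cases p) auto
    then show ?thesis by (auto intro!: continuous_intros)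
  qed (simp add: madd_def)
qed

text \<open>\<open>proper\<close> bounds the entries of A and of its inverse in terms of V, which
  makes the sublevel sets compact inside GL_N. The constant \<kappa> may depend on N: it does not
  occur in the resulting moment bound.\<close>

locale lyapunov =
  fixes N :: nat and q :: "cmat \<Rightarrow> complex" and \<kappa> :: real
  assumes q: "poly_fn N q"
    and proper: "\<And>A i j. A \<in> GLm N \<Longrightarrow> i < N \<Longrightarrow> j < N \<Longrightarrow> (cmod (A (i,j)))^2 \<le> \<kappa> * Re (q A) \<and> (cmod (minv N A (i,j)))^2 \<le> \<kappa> * Re (q A)"
    and nonneg: "\<And>A. A \<in> GLm N \<Longrightarrow> Re (q A) \<ge> 0" and \<kappa>: "\<kappa> > 0"
begin

definition V :: "cmat \<Rightarrow> real" where "V A = Re (q A)"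
definition K :: "real \<Rightarrow> cmat set" where "K R = {A \<in> GLm N. V A \<le> R}"

lemma K_entry:
  assumes "A \<in> K R" "i < N" "j < N"
  shows "cmod (A (i,j)) \<le> sqrt (\<kappa> * R)" "cmod (minv N A (i,j)) \<le> sqrt (\<kappa> * R)"
proof -
  have "\<kappa> * Re (q A) \<le> \<kappa> * R" using assms \<kappa> by (auto simp: K_def V_def)
  then have "(cmod (A (i,j)))^2 \<le> \<kappa> * R" "(cmod (minv N A (i,j)))^2 \<le> \<kappa> * R"
    using proper[of A i j] assms by (auto simp: K_def)
  then show "cmod (A (i,j)) \<le> sqrt (\<kappa> * R)" "cmod (minv N A (i,j)) \<le> sqrt (\<kappa> * R)" by (auto intro: real_le_rsqrt)
qed

text \<open>The inverses along the sequence stay bounded, so by the resolvent identity they form a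
  Cauchy sequence. Their limit inverts the limit matrix, which therefore remains in GL_N.\<close>

lemma closed_K: "closed (K R)"
  unfolding closed_sequential_limits
proof (intro allI impI, elim conjE)
  fix x l assume x: "\<forall>n. x n \<in> K R" and lim: "x \<longlonglongrightarrow> l"
  have xG: "x n \<in> GLm N" for n using x by (simp add: K_def)
  then have xm: "x n \<in> mats N" for n using minv_GL by blast
  have l: "l \<in> mats N" using closed_sequentially[OF closed_mats _ lim] xm by blast
  have le: "(\<lambda>n. x n p) \<longlonglongrightarrow> l p" for p
    using continuous_on_tendsto_compose[OF continuous_on_product_coordinates lim] by simp
  have diff: "minv N (x n) (i,j) - minv N (x m) (i,j) = (\<Sum>k<N. (\<Sum>a<N. minv N (x n) (i,a) * (x m (a,k) - x n (a,k))) * minv N (x m) (k,j))"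
    if ij: "i < N" "j < N" for n m i j
  proof -
    let ?B = "minv N (x n)" let ?C = "minv N (x m)"
    have "mmul N (mmul N ?B (madd N (x m) (mscale N (-1) (x n)))) ?C = madd N (mmul N ?B (mmul N (x m) ?C)) (mscale N (-1) (mmul N (mmul N ?B (x n)) ?C))"
      by (simp add: mmul_madd_right mmul_madd_left mmul_assoc)
    also have "\<dots> = madd N ?B (mscale N (-1) ?C)" using minv_GL[OF xG[of n]] minv_GL[OF xG[of m]] by simp
    finally have "mmul N (mmul N ?B (madd N (x m) (mscale N (-1) (x n)))) ?C (i,j) = ?B (i,j) - ?C (i,j)" using ij by simp
    then show ?thesis using ij by simp
  qed
  have cauchy: "Cauchy (\<lambda>n. minv N (x n) (i,j))" if ij: "i < N" "j < N" for i j
  proof (rule metric_CauchyI)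
    fix e :: real assume e: "e > 0"
    let ?c = "sqrt (\<kappa> * R) + 1"
    have "0 \<le> sqrt (\<kappa> * R)" using order_trans[OF norm_ge_zero K_entry(1)[of "x 0" R i j]] x ij by blast
    then have c: "?c > 0" by linarith
    \<comment> \<open>There are N^2 terms, each with two inverse entries bounded by c; the
      additional 2 makes the final inequality strict.\<close>
    define e' where "e' = e / (2 * (real N * (real N * (?c * ?c))))"
    have N0: "N > 0" using ij by auto
    have e': "e' > 0" using e c N0 by (simp add: e'_def)
    have "\<forall>p\<in>sq N. \<exists>M. \<forall>n\<ge>M. \<forall>m\<ge>M. cmod (x m p - x n p) < e'"
    proof
      fix p
      have "Cauchy (\<lambda>n. x n p)" using le[of p] LIMSEQ_imp_Cauchy by blast
      from metric_CauchyD[OF this e'] show "\<exists>M. \<forall>n\<ge>M. \<forall>m\<ge>M. cmod (x m p - x n p) < e'" by (auto simp: dist_norm)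
    qed
    then obtain M where M: "\<And>p n m. p \<in> sq N \<Longrightarrow> n \<ge> M p \<Longrightarrow> m \<ge> M p \<Longrightarrow> cmod (x m p - x n p) < e'" by metis
    define M0 where "M0 = (\<Sum>p\<in>sq N. M p)"
    have M0: "M p \<le> M0" if "p \<in> sq N" for p unfolding M0_def by (rule member_le_sum[OF that]) auto
    show "\<exists>M. \<forall>m\<ge>M. \<forall>n\<ge>M. dist (minv N (x m) (i,j)) (minv N (x n) (i,j)) < e"
    proof (intro exI[of _ M0] allI impI)
      fix n m assume nm: "M0 \<le> n" "M0 \<le> m"
      have "cmod (minv N (x n) (i,j) - minv N (x m) (i,j)) \<le> (\<Sum>k<N. (\<Sum>a<N. ?c * e') * ?c)"
        unfolding diff[OF ij]
      proof (rule sum_norm_le)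
        fix k assume k: "k \<in> {..<N}"
        have "cmod (\<Sum>a<N. minv N (x n) (i,a) * (x m (a,k) - x n (a,k))) \<le> (\<Sum>a<N. ?c * e')"
        proof (rule sum_norm_le)
          fix a assume a: "a \<in> {..<N}"
          have "cmod (x m (a,k) - x n (a,k)) \<le> e'" using M[of "(a,k)" n m] M0[of "(a,k)"] nm a k by force
          then show "cmod (minv N (x n) (i,a) * (x m (a,k) - x n (a,k))) \<le> ?c * e'"
            unfolding norm_mult using K_entry(2)[of "x n" R i a] x ij a c by (intro mult_mono) auto
        qed
        moreover have "cmod (minv N (x m) (k,j)) \<le> ?c" using K_entry(2)[of "x m" R k j] x ij k by auto
        ultimately show "cmod ((\<Sum>a<N. minv N (x n) (i,a) * (x m (a,k) - x n (a,k))) * minv N (x m) (k,j)) \<le> (\<Sum>a<N. ?c * e') * ?c"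
          unfolding norm_mult using c e' by (intro mult_mono) (auto intro!: sum_nonneg)
      qed
      also have "\<dots> = real N * (real N * (?c * ?c)) * e'" by (simp add: mult_ac)
      also have "\<dots> = e / 2" using c N0 by (simp add: e'_def)
      finally show "dist (minv N (x n) (i,j)) (minv N (x m) (i,j)) < e" using e by (simp add: dist_norm)
    qed
  qed
  define B where "B = restrict (\<lambda>p. lim (\<lambda>n. minv N (x n) p)) (sq N)"
  have B: "(\<lambda>n. minv N (x n) (i,j)) \<longlonglongrightarrow> B (i,j)" if "i < N" "j < N" for i j
    using cauchy[OF that] that by (simp add: B_def Cauchy_convergent_iff convergent_LIMSEQ_iff)
  have Bm: "B \<in> mats N" by (simp add: B_def mats_def)
  have "mmul N l B = mid N"
  proof (rule mats_ext[where N = N])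
    fix i j assume ij: "i < N" "j < N"
    have "(\<lambda>n. \<Sum>k<N. x n (i,k) * minv N (x n) (k,j)) \<longlonglongrightarrow> (\<Sum>k<N. l (i,k) * B (k,j))"
      by (intro tendsto_sum tendsto_mult le B) (use ij in auto)
    moreover have "(\<Sum>k<N. x n (i,k) * minv N (x n) (k,j)) = mid N (i,j)" for n
      using minv_GL(3)[OF xG[of n]] mat_nth(1)[OF ij, of "x n" "minv N (x n)"] by simp
    ultimately have "(\<lambda>n::nat. mid N (i,j)) \<longlonglongrightarrow> (\<Sum>k<N. l (i,k) * B (k,j))" by simp
    then show "mmul N l B (i,j) = mid N (i,j)" using ij LIMSEQ_unique[OF tendsto_const] by (metis mat_nth(1))
  qed auto
  then have lG: "l \<in> GLm N" using l Bm minv_unique(1) by blast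
  have "(\<lambda>n. q (x n)) \<longlonglongrightarrow> q l" by (rule poly_fn_tendsto[OF q _ lG xm]) (rule le)
  then have "(\<lambda>n. V (x n)) \<longlonglongrightarrow> V l" unfolding V_def by (rule tendsto_Re)
  then have "V l \<le> R" by (rule LIMSEQ_le_const2) (use x in \<open>auto simp: K_def\<close>)
  then show "l \<in> K R" using lG by (simp add: K_def)
qed

text \<open>Tychonoff over all index pairs: coordinates outside \<open>sq N\<close> are pinned to
  \<open>undefined\<close> and range over a singleton.\<close>

lemma compact_K: "compact (K R)"
proof -
  define S where "S p = (if p \<in> sq N then cball 0 (sqrt (\<kappa> * R)) else {undefined :: complex})" for p
  have "compactin (product_topology (\<lambda>p. euclidean) UNIV) (PiE UNIV S)"
    unfolding compactin_PiE by (auto simp: S_def)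
  then have c: "compact (PiE UNIV S)" by (simp add: euclidean_product_topology)
  have "K R \<subseteq> PiE UNIV S"
  proof
    fix A assume A: "A \<in> K R"
    then have Am: "A \<in> mats N" using minv_GL by (auto simp: K_def)
    have "A p \<in> S p" for p
    proof (cases "p \<in> sq N")
      case True
      then obtain i j where "p = (i,j)" "i < N" "j < N" by (cases p) auto
      then show ?thesis using K_entry(1)[OF A] by (simp add: S_def)
    next
      case False
      then show ?thesis using Am by (cases p) (auto simp: S_def mats_def PiE_def extensional_def)
    qed
    then show "A \<in> PiE UNIV S" by auto
  qed
  then show ?thesis using c closed_K compact_Int_closed[OF c closed_K[of R]] by (simp add: Int_absorb1)
qed


text \<open>A class that contains the truncations and is closed under directional derivatives;
  extension by 0 to singular matrices makes its members functions on all of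
  \<open>mats N\<close>.\<close>

inductive tf :: "real \<Rightarrow> (cmat \<Rightarrow> real) \<Rightarrow> bool" for b where
  base: "poly_fn N p \<Longrightarrow> (\<And>A. A \<in> GLm N \<Longrightarrow> F A = hh n (1/2 - b * V A) * Re (p A)) \<Longrightarrow> (\<And>A. A \<in> mats N \<Longrightarrow> A \<notin> GLm N \<Longrightarrow> F A = 0) \<Longrightarrow> tf b F"
| add: "tf b F \<Longrightarrow> tf b G \<Longrightarrow> (\<And>A. A \<in> mats N \<Longrightarrow> H A = F A + G A) \<Longrightarrow> tf b H"

lemma tf_cong:
  assumes "tf b F" "\<And>A. A \<in> mats N \<Longrightarrow> G A = F A"
  shows "tf b G"
  using assms(1)
proof cases
  case (base p n)
  show ?thesis by (rule tf.base[OF base(1), of _ n]) (use base assms(2) minv_GL(1) in auto)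
next
  case (add F' G')
  show ?thesis by (rule tf.add[OF add(1,2)]) (use add assms(2) in auto)
qed

lemma tf_support:
  assumes "tf b F" and b: "b > 0"
  shows "A \<in> mats N \<Longrightarrow> A \<notin> K (1 / (2 * b)) \<Longrightarrow> F A = 0"
  using assms(1)
proof induction
  case (base p F n)
  show ?case
  proof (cases "A \<in> GLm N")
    case True
    then have "V A > 1 / (2 * b)" using base by (simp add: K_def)
    then have "b * V A > 1 / 2" using b by (simp add: field_simps)
    then show ?thesis using base.hyps(2)[OF True] by (simp add: hh_def)
  qed (use base in auto)
qed auto

lemma tf_continuous:
  assumes "tf b F" and b: "b > 0"
  shows "continuous_on (mats N) F"
  using assms(1)
proof induction
  case (base p F n)
  show ?case unfolding continuous_on_def
  proof
    fix A assume A: "A \<in> mats N"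
    show "(F \<longlongrightarrow> F A) (at A within mats N)"
    proof (cases "A \<in> GLm N")
      case False
      \<comment> \<open>A singular matrix lies in the open complement of a closed sublevel set, and
        F vanishes on that complement.\<close>
      have ev: "\<forall>\<^sub>F B in at A within mats N. F B = F A"
        unfolding eventually_at_topological
      proof (intro exI[of _ "- K (1 / (2 * b))"] conjI ballI impI)
        show "open (- K (1 / (2 * b)))" using closed_K by (rule open_Compl)
        show "A \<in> - K (1 / (2 * b))" using False by (simp add: K_def)
        fix B assume "B \<in> - K (1 / (2 * b))" "B \<in> mats N"
        then have "F B = 0" using tf_support[OF tf.base[OF base] b] by simp
        then show "F B = F A" using base.hyps(3)[OF A False] by simp
      qed
      then show ?thesis by (rule tendsto_eventually)
    next
      case True
      define \<gamma> where "\<gamma> B = (if B \<in> mats N then B else A)" for B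
      have ev: "\<forall>\<^sub>F B in at A within mats N. B \<in> mats N" by (simp add: eventually_at_filter)
      have m: "\<gamma> B \<in> mats N" for B using A by (simp add: \<gamma>_def)
      have e: "((\<lambda>B. \<gamma> B p) \<longlongrightarrow> A p) (at A within mats N)" for p
      proof (rule Lim_transform_eventually)
        have "continuous_on (mats N) (\<lambda>B::cmat. B p)" by (rule continuous_on_subset[OF continuous_on_product_coordinates subset_UNIV])
        then show "((\<lambda>B. B p) \<longlongrightarrow> A p) (at A within mats N)" unfolding continuous_on_def using A by (rule bspec)
        show "\<forall>\<^sub>F B in at A within mats N. B p = \<gamma> B p" using ev by eventually_elim (simp add: \<gamma>_def)
      qed
      have "((\<lambda>B. hh n (1/2 - b * V (\<gamma> B)) * Re (p (\<gamma> B))) \<longlongrightarrow> hh n (1/2 - b * V A) * Re (p A)) (at A within mats N)"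
        unfolding V_def
        by (intro tendsto_mult tendsto_Re poly_fn_tendsto[OF base.hyps(1) e True m] isCont_tendsto_compose[OF hh_isCont]
            tendsto_diff tendsto_const poly_fn_tendsto[OF q e True m])
      then show ?thesis unfolding base.hyps(2)[OF True]
      proof (rule Lim_transform_eventually)
        show "\<forall>\<^sub>F B in at A within mats N. hh n (1/2 - b * V (\<gamma> B)) * Re (p (\<gamma> B)) = F B"
          using ev tendsto_GL(1)[OF e True m] by eventually_elim (simp add: \<gamma>_def base.hyps(2))
      qed
    qed
  qed
next
  case (add F G H)
  have "continuous_on (mats N) (\<lambda>A. F A + G A)" by (intro continuous_on_add add.IH)
  then show ?case using add.hyps(3) by (simp cong: continuous_on_cong)
qed

lemma tf_deriv:
  assumes "tf b F" and b: "b > 0" and E: "E \<in> mats N"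
  shows "\<exists>F'. tf b F' \<and> (\<forall>A\<in>mats N. ((\<lambda>s::real. F (madd N A (mscale N (complex_of_real s) E))) has_real_derivative F' A) (at 0))"
  using assms(1)
proof induction
  case (base p F n)
  obtain p' where p': "poly_fn N p'" "\<And>A. A \<in> GLm N \<Longrightarrow> ((\<lambda>s::real. p (madd N A (mscale N (complex_of_real s) E))) has_vector_derivative p' A) (at 0)"
    using poly_fn_deriv[OF base.hyps(1) E] by blast
  obtain q' where q': "poly_fn N q'" "\<And>A. A \<in> GLm N \<Longrightarrow> ((\<lambda>s::real. q (madd N A (mscale N (complex_of_real s) E))) has_vector_derivative q' A) (at 0)"
    using poly_fn_deriv[OF q E] by blast
  \<comment> \<open>A real-valued polynomial function equal to the real part of q', so that Re (v p)
    = Re q' * Re p and the derivative again has the form required by \<open>tf\<close>.\<close>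
  define v where "v A = (q' A + cnj (q' A)) * (1/2)" for A
  have v: "poly_fn N v" unfolding v_def by (intro poly_fn.intros q')
  have v_Re: "Re (v A) = Re (q' A)" and v_Im: "Im (v A) = 0" for A by (simp_all add: v_def)
  define F1 where "F1 A = (if A \<in> GLm N then hh (n+2) (1/2 - b * V A) * Re (of_real (- b) * (v A * p A)) else 0)" for A
  define F2 where "F2 A = (if A \<in> GLm N then hh (n+1) (1/2 - b * V A) * Re (of_real (real n * b) * (v A * p A)) else 0)" for A
  define F3 where "F3 A = (if A \<in> GLm N then hh n (1/2 - b * V A) * Re (p' A) else 0)" for A
  have tf1: "tf b F1" by (rule tf.base[where p = "\<lambda>A. of_real (- b) * (v A * p A)" and n = "n + 2"]) (auto simp del: of_real_minus simp: F1_def intro!: poly_fn_cmult poly_fn.mult v base.hyps(1))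
  have tf2: "tf b F2" by (rule tf.base[where p = "\<lambda>A. of_real (real n * b) * (v A * p A)" and n = "n + 1"]) (auto simp del: of_real_mult simp: F2_def intro!: poly_fn_cmult poly_fn.mult v base.hyps(1))
  have tf3: "tf b F3" by (rule tf.base[where p = p' and n = n]) (auto simp: F3_def p')
  have tf12: "tf b (\<lambda>A. F1 A + F2 A)" by (rule tf.add[OF tf1 tf2]) simp
  have tf: "tf b (\<lambda>A. F1 A + F2 A + F3 A)" by (rule tf.add[OF tf12 tf3]) simp
  have "((\<lambda>s::real. F (madd N A (mscale N (complex_of_real s) E))) has_real_derivative F1 A + F2 A + F3 A) (at 0)" if A: "A \<in> mats N" for A
  proof -
    let ?l = "\<lambda>s::real. madd N A (mscale N (complex_of_real s) E)"
    have l0: "?l 0 = A" by (rule mats_ext[where N = N]) (use A in auto)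
    have cl: "isCont ?l 0" using continuous_on_line[of N A E] by (simp add: continuous_on_eq_continuous_at)
    have "(?l \<longlongrightarrow> ?l 0) (nhds 0)"
      using cl unfolding isCont_def by (rule tendsto_at_iff_tendsto_nhds[THEN iffD1])
    then have ct: "(?l \<longlongrightarrow> A) (nhds 0)" by (simp only: l0)
    show ?thesis
    proof (cases "A \<in> GLm N")
      case False
      have "\<forall>\<^sub>F s in nhds 0. ?l s \<in> - K (1 / (2 * b))"
        by (rule topological_tendstoD[OF ct open_Compl[OF closed_K]]) (use False in \<open>simp add: K_def\<close>)
      then have "\<forall>\<^sub>F s in nhds 0. F (?l s) = 0"
        by eventually_elim (use tf_support[OF tf.base[OF base] b] in auto)
      then have "((\<lambda>s. F (?l s)) has_real_derivative 0) (at 0)"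
        using DERIV_cong_ev[OF refl _ refl, of "\<lambda>s. F (?l s)" "\<lambda>s. 0" 0 0] by simp
      then show ?thesis using False by (simp add: F1_def F2_def F3_def)
    next
      case True
      have Vd: "((\<lambda>s. V (?l s)) has_real_derivative Re (q' A)) (at 0)"
        unfolding V_def has_real_derivative_iff_has_vector_derivative by (rule bounded_linear.has_vector_derivative[OF bounded_linear_Re q'(2)[OF True]])
      have pd: "((\<lambda>s. Re (p (?l s))) has_real_derivative Re (p' A)) (at 0)"
        unfolding has_real_derivative_iff_has_vector_derivative by (rule bounded_linear.has_vector_derivative[OF bounded_linear_Re p'(2)[OF True]])
      have yd: "((\<lambda>s. 1/2 - b * V (?l s)) has_real_derivative (- b * Re (q' A))) (at 0)"
        using DERIV_diff[OF DERIV_const[of "1/2"] DERIV_cmult[OF Vd, of b]] by simp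
      have "((\<lambda>s. hh n (1/2 - b * V (?l s))) has_real_derivative (hh (n+2) (1/2 - b * V A) - real n * hh (n+1) (1/2 - b * V A)) * (- b * Re (q' A))) (at 0)"
        using DERIV_chain2[OF hh_DERIV yd] unfolding l0 .
      from DERIV_mult[OF this pd]
      have "((\<lambda>s. hh n (1/2 - b * V (?l s)) * Re (p (?l s))) has_real_derivative
         (hh (n+2) (1/2 - b * V A) - real n * hh (n+1) (1/2 - b * V A)) * (- b * Re (q' A)) * Re (p A) + Re (p' A) * hh n (1/2 - b * V A)) (at 0)"
        unfolding l0 .
      also have "(hh (n+2) (1/2 - b * V A) - real n * hh (n+1) (1/2 - b * V A)) * (- b * Re (q' A)) * Re (p A) + Re (p' A) * hh n (1/2 - b * V A) = F1 A + F2 A + F3 A"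
        using True by (simp add: F1_def F2_def F3_def v_Re v_Im algebra_simps)
      finally have D: "((\<lambda>s. hh n (1/2 - b * V (?l s)) * Re (p (?l s))) has_real_derivative F1 A + F2 A + F3 A) (at 0)" .
      have "\<forall>\<^sub>F s in nhds 0. ?l s \<in> GLm N"
      proof (rule tendsto_GL(1)[OF _ True])
        fix i j assume "i < N" "j < N"
        show "((\<lambda>s. ?l s (i,j)) \<longlongrightarrow> A (i,j)) (nhds 0)"
          using continuous_on_tendsto_compose[OF continuous_on_product_coordinates ct] by simp
      qed simp
      then have "\<forall>\<^sub>F s in nhds 0. F (?l s) = hh n (1/2 - b * V (?l s)) * Re (p (?l s))" by eventually_elim (rule base.hyps(2))
      then show ?thesis using D DERIV_cong_ev[OF refl _ refl, of "\<lambda>s. F (?l s)" "\<lambda>s. hh n (1/2 - b * V (?l s)) * Re (p (?l s))" 0] by blast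
    qed
  qed
  then show ?case using tf by blast
next
  case (add F G H)
  then obtain F' G' where F': "tf b F'" "\<And>A. A \<in> mats N \<Longrightarrow> ((\<lambda>s::real. F (madd N A (mscale N (complex_of_real s) E))) has_real_derivative F' A) (at 0)"
    and G': "tf b G'" "\<And>A. A \<in> mats N \<Longrightarrow> ((\<lambda>s::real. G (madd N A (mscale N (complex_of_real s) E))) has_real_derivative G' A) (at 0)" by blast
  have "tf b (\<lambda>A. F' A + G' A)" by (rule tf.add[OF F'(1) G'(1)]) simp
  moreover have "((\<lambda>s::real. H (madd N A (mscale N (complex_of_real s) E))) has_real_derivative F' A + G' A) (at 0)" if "A \<in> mats N" for A
    using DERIV_add[OF F'(2)[OF that] G'(2)[OF that]] add.hyps(3) by simp
  ultimately show ?case by blast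
qed

lemma tf_smooth:
  assumes F: "tf b F" and b: "b > 0"
  shows "smooth_mats N F"
proof -
  have it: "tf b (iter_dd N Es F)" if "set Es \<subseteq> mats N" for Es
    using that
  proof (induction Es)
    case (Cons E Es)
    then have E: "E \<in> mats N" and t: "tf b (iter_dd N Es F)" by auto
    obtain F' where F': "tf b F'" "\<And>A. A \<in> mats N \<Longrightarrow> ((\<lambda>s::real. iter_dd N Es F (madd N A (mscale N (complex_of_real s) E))) has_real_derivative F' A) (at 0)"
      using tf_deriv[OF t b E] by blast
    show ?case
      by (rule tf_cong[OF F'(1)]) (simp add: dirder_def, rule vector_derivative_at, use F'(2) in \<open>simp add: has_real_derivative_iff_has_vector_derivative\<close>)
  qed (simp add: F)
  show ?thesis unfolding smooth_mats_def
  proof (intro allI impI conjI ballI)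
    fix Es assume Es: "set Es \<subseteq> mats N"
    show "continuous_on (mats N) (iter_dd N Es F)" by (rule tf_continuous[OF it[OF Es] b])
    fix E A assume E: "E \<in> mats N" and A: "A \<in> mats N"
    obtain F' where "((\<lambda>s::real. iter_dd N Es F (madd N A (mscale N (complex_of_real s) E))) has_real_derivative F') (at 0)"
      using tf_deriv[OF it[OF Es] b E] A by blast
    then show "(\<lambda>s::real. iter_dd N Es F (madd N A (mscale N (complex_of_real s) E))) differentiable (at 0)"
      unfolding has_field_derivative_def by (rule differentiableI)
  qed
qed

end

section \<open>Measurability, and growth of expectations under the forward equation\<close>

lemma measurable_id_mats: "(\<lambda>A. A) \<in> borel_measurable (mat_space N)"
proof -
  have sp: "space (mat_space N) = mats N" by (simp add: mat_space_def space_PiM mats_def)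
  have "(\<lambda>A. A) \<in> measurable (mat_space N) (PiM UNIV (\<lambda>_. borel :: complex measure))"
  proof (rule measurable_PiM_single')
    fix p :: "nat \<times> nat"
    show "(\<lambda>A. A p) \<in> borel_measurable (mat_space N)"
    proof (cases "p \<in> sq N")
      case True
      then show ?thesis unfolding mat_space_def by (rule measurable_component_singleton)
    next
      case False
      then have "A p = undefined" if "A \<in> space (mat_space N)" for A
        using that unfolding sp by (cases p) (auto simp: mats_def PiE_def extensional_def)
      then show ?thesis using measurable_cong[of "mat_space N" "\<lambda>A. A p" "\<lambda>_. undefined" borel] by simp
    qed
  qed auto
  then show ?thesis using measurable_cong_sets[OF refl sets_PiM_equal_borel] by blast
qed

lemma borel_measurable_mats:
  fixes F :: "cmat \<Rightarrow> real"
  assumes "continuous_on (mats N) F"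
  shows "F \<in> borel_measurable (mat_space N)"
proof -
  have sp: "space (mat_space N) = mats N" by (simp add: mat_space_def space_PiM mats_def)
  have "(\<lambda>A. indicator (mats N) A *\<^sub>R F A) \<in> borel_measurable borel"
    by (rule borel_measurable_continuous_on_indicator[OF borel_closed[OF closed_mats] assms])
  from measurable_compose[OF measurable_id_mats this]
  show ?thesis by (rule measurable_cong[THEN iffD1, rotated]) (simp add: sp)
qed

lemma vdiff_compose:
  fixes g :: "cmat \<Rightarrow> real"
  assumes X: "X \<in> mats N" and h: "\<And>x. (h has_real_derivative h' x) (at x)" and g: "vdiff N X g g'"
  shows "vdiff N X (\<lambda>A. h (g A)) (\<lambda>A. h' (g A) * g' A)"
  unfolding vdiff_def has_real_derivative_iff_has_vector_derivative[symmetric]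
proof
  fix A assume A: "A \<in> GLm N"
  have "((\<lambda>s. g (mexpc N X A s)) has_real_derivative g' A) (at 0)"
    using vdiffD[OF g A] unfolding has_real_derivative_iff_has_vector_derivative .
  from DERIV_chain2[OF h this]
  show "((\<lambda>s. h (g (mexpc N X A s))) has_real_derivative h' (g A) * g' A) (at 0)"
    unfolding mexpc_0[OF X minv_GL(1)[OF A]] .
qed

context lyapunov
begin

definition cut :: "real \<Rightarrow> cmat \<Rightarrow> real" where
  "cut b A = (if A \<in> GLm N then hh 0 (1/2 - b * V A) else 0)"

lemma tf_cut: "tf b (cut b)"
  by (rule tf.base[OF poly_fn.const[of N 1], of _ 0]) (simp_all add: cut_def)

lemma testGL_cut:
  assumes b: "b > 0"
  shows "testGL N (cut b)"
  unfolding testGL_def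
proof (intro conjI exI[of _ "K (1 / (2 * b))"] ballI)
  show "smooth_mats N (cut b)" by (rule tf_smooth[OF tf_cut b])
  show "compact (K (1 / (2 * b)))" by (rule compact_K)
  show "K (1 / (2 * b)) \<subseteq> GLm N" by (auto simp: K_def)
  show "cut b A = 0" if "A \<in> mats N - K (1 / (2 * b))" for A by (rule tf_support[OF tf_cut b]) (use that in auto)
qed

lemma hh0_le: "hh 0 x \<le> exp (-2)" if "x \<le> 1/2"
proof (cases "x > 0")
  case True
  then have "inverse x \<ge> 2" using le_imp_inverse_le[of x "1/2"] that by simp
  then show ?thesis by (simp add: hh_def)
qed (simp add: hh_def)

lemma hh0_half: "hh 0 (1/2) = exp (-2)" by (simp add: hh_def)

lemma cut_bounds:
  assumes "b > 0"
  shows "0 \<le> cut b A" "cut b A \<le> exp (-2)"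
  using hh0_le[of "1/2 - b * V A"] assms nonneg[of A] by (auto simp: cut_def hh_nonneg V_def)

text \<open>Chain rule with y = 1/2 - b V: the term with the second derivative of
  \<open>hh 0\<close> is nonnegative by convexity and is dropped. The first-order term is at least
  -c b V times hh 2 y, and the tangent inequality replaces this by the truncated quantity itself, so
  that a Gronwall argument closes at fixed b.\<close>

lemma lapGL_cut:
  assumes b: "b > 0" and A: "A \<in> GLm N"
    and jets: "\<And>X. X \<in> set (gl_basis N) \<Longrightarrow> vdiff2 N X V (V1 X) (V2 X)"
    and LV: "(\<Sum>X\<leftarrow>gl_basis N. V2 X A) / 4 \<le> c * V A" and c: "c \<ge> 0"
  shows "lapGL N (cut b) A / 4 \<ge> - c * (exp (-2) - cut b A)"
proof -
  define y where "y A = 1/2 - b * V A" for A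
  have j: "vdiff2 N X (cut b) (\<lambda>A. hh 2 (y A) * (- b * V1 X A))
      (\<lambda>A. ((hh 4 (y A) - 2 * hh 3 (y A)) * (- b * V1 X A)) * (- b * V1 X A) + hh 2 (y A) * (- b * V2 X A))"
    if X: "X \<in> set (gl_basis N)" for X
  proof -
    note Xm = gl_basis_mats[OF X]
    have v: "vdiff N X V (V1 X)" "vdiff N X (V1 X) (V2 X)" using jets[OF X] by (auto simp: vdiff2_def)
    have y: "vdiff N X y (\<lambda>A. - b * V1 X A)"
      using vdiff_add[OF vdiff_const[of N X "1/2"] vdiff_cmult[OF v(1), of "-b"]] unfolding y_def by simp
    have v': "vdiff N X (\<lambda>A. - b * V1 X A) (\<lambda>A. - b * V2 X A)" by (rule vdiff_cmult[OF v(2)])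
    have 1: "vdiff N X (cut b) (\<lambda>A. hh 2 (y A) * (- b * V1 X A))"
      by (rule vdiff_cong[OF Xm vdiff_compose[OF Xm hh1_DERIV y]]) (simp_all add: cut_def y_def)
    have h2: "(hh 2 has_real_derivative hh 4 x - 2 * hh 3 x) (at x)" for x
      using hh_DERIV[of 2 x] by (simp add: eval_nat_numeral)
    show ?thesis unfolding vdiff2_def using 1 vdiff_mult[OF Xm vdiff_compose[OF Xm h2 y] v'] by (simp only: conj_absorb)
  qed
  have yA: "y A \<le> 1/2" using b nonneg[OF A] by (simp add: y_def V_def)
  have pos: "hh 4 z - 2 * hh 3 z \<ge> 0" if "z \<le> 1/2" for z
  proof (cases "z > 0")
    case True
    then have "inverse z \<ge> 2" using le_imp_inverse_le[of z "1/2"] that by simp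
    then have "inverse z ^ 3 * exp (- inverse z) * (inverse z - 2) \<ge> 0" using True by (intro mult_nonneg_nonneg) auto
    then show ?thesis using True by (simp add: hh_def algebra_simps eval_nat_numeral)
  qed (simp add: hh_def)
  have "lapGL N (cut b) A = (\<Sum>X\<leftarrow>gl_basis N. ((hh 4 (y A) - 2 * hh 3 (y A)) * (- b * V1 X A)) * (- b * V1 X A) + hh 2 (y A) * (- b * V2 X A))"
    unfolding lapGL_def by (rule lap_vdiff2[OF gl_basis_mats j A])
  also have "\<dots> \<ge> (\<Sum>X\<leftarrow>gl_basis N. hh 2 (y A) * (- b * V2 X A))"
  proof (rule sum_list_mono)
    fix X
    have "0 \<le> (hh 4 (y A) - 2 * hh 3 (y A)) * (- b * V1 X A)\<^sup>2" using pos[OF yA] by (intro mult_nonneg_nonneg) auto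
    then show "hh 2 (y A) * (- b * V2 X A) \<le> ((hh 4 (y A) - 2 * hh 3 (y A)) * (- b * V1 X A)) * (- b * V1 X A) + hh 2 (y A) * (- b * V2 X A)"
      by (simp add: power2_eq_square mult_ac)
  qed
  also have "(\<Sum>X\<leftarrow>gl_basis N. hh 2 (y A) * (- b * V2 X A)) = - (b * hh 2 (y A)) * (\<Sum>X\<leftarrow>gl_basis N. V2 X A)"
    unfolding sum_list_const_mult[symmetric] by (simp add: mult_ac)
  also have "\<dots> \<ge> - (b * hh 2 (y A)) * (4 * c * V A)"
    using LV b by (intro mult_left_mono_neg) (auto simp: hh_nonneg)
  also have "- (b * hh 2 (y A)) * (4 * c * V A) = - (4 * c) * (b * V A * hh 2 (1/2 - b * V A))" by (simp add: y_def)
  also have "\<dots> \<ge> - (4 * c) * (exp (-2) - hh 0 (1/2 - b * V A))"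
    using c hh_tangent(1)[of "b * V A"] b nonneg[OF A] by (intro mult_left_mono_neg) (auto simp: hh0_half V_def)
  finally have "- (4 * c) * (exp (-2) - hh 0 (1/2 - b * V A)) \<le> lapGL N (cut b) A" .
  moreover have "cut b A = hh 0 (1/2 - b * V A)" using A by (simp add: cut_def)
  ultimately show ?thesis by simp
qed

text \<open>Gronwall for the expectation G s of exp(-2) - \<open>cut b\<close>, then division by b
  and Fatou's lemma as b tends to 0. The normalization hh 2 (1/2), the derivative of the profile at
  1/2, makes the quotients converge to V.\<close>

theorem lyapunov_bound:
  assumes jets: "\<And>X. X \<in> set (gl_basis N) \<Longrightarrow> vdiff2 N X V (V1 X) (V2 X)"
    and LV: "\<And>A. A \<in> GLm N \<Longrightarrow> (\<Sum>X\<leftarrow>gl_basis N. V2 X A) / 4 \<le> c * V A" and c: "c \<ge> 0"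
    and t: "t > 0" and law: "GL_BM_law N t \<nu>"
  shows "(\<integral>\<^sup>+A. ennreal (V A) \<partial>\<nu>) \<le> ennreal (exp (c * t) * V (mid N))"
proof -
  from law[unfolded GL_BM_law_def] obtain \<mu> where m: "(\<forall>s\<ge>0. prob_space (\<mu> s) \<and> sets (\<mu> s) = sets (mat_space N) \<and> emeasure (\<mu> s) (GLm N) = 1) \<and>
     \<mu> 0 = return (mat_space N) (mid N) \<and> \<mu> t = \<nu> \<and>
     (\<forall>f. testGL N f \<longrightarrow>
        continuous_on {0..} (\<lambda>s. \<integral>A. f A \<partial>\<mu> s) \<and>
        (\<forall>s>0. ((\<lambda>r. \<integral>A. f A \<partial>\<mu> r) has_real_derivative (\<integral>A. lapGL N f A / 4 \<partial>\<mu> s)) (at s)))" by (rule exE)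
  then have \<mu>: "\<And>s. s \<ge> 0 \<Longrightarrow> prob_space (\<mu> s)" "\<And>s. s \<ge> 0 \<Longrightarrow> sets (\<mu> s) = sets (mat_space N)"
      "\<And>s. s \<ge> 0 \<Longrightarrow> emeasure (\<mu> s) (GLm N) = 1"
    and \<mu>0: "\<mu> 0 = return (mat_space N) (mid N)" and \<mu>t: "\<mu> t = \<nu>" by simp_all
  have ev: "\<And>f. testGL N f \<Longrightarrow> continuous_on {0..} (\<lambda>s. \<integral>A. f A \<partial>\<mu> s)"
       "\<And>f s. testGL N f \<Longrightarrow> s > 0 \<Longrightarrow> ((\<lambda>r. \<integral>A. f A \<partial>\<mu> r) has_real_derivative (\<integral>A. lapGL N f A / 4 \<partial>\<mu> s)) (at s)"
    using m by simp_all
  have AE: "AE A in \<mu> s. A \<in> GLm N" if "s \<ge> 0" for s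
  proof -
    interpret prob_space "\<mu> s" by (rule \<mu>(1)[OF that])
    have "GLm N \<in> sets (\<mu> s)" using \<mu>(3)[OF that] emeasure_notin_sets[of "GLm N" "\<mu> s"] by force
    moreover have "measure (\<mu> s) (GLm N) = 1" using \<mu>(3)[OF that] by (simp add: measure_def)
    ultimately show ?thesis using prob_eq_1 by blast
  qed
  have meas: "cut b \<in> borel_measurable (\<mu> s)" if "b > 0" "s \<ge> 0" for b s
    using borel_measurable_mats[OF tf_continuous[OF tf_cut that(1)]] measurable_cong_sets[OF \<mu>(2)[OF that(2)] refl] by blast
  have int: "integrable (\<mu> s) (cut b)" if "b > 0" "s \<ge> 0" for b s
  proof -
    interpret prob_space "\<mu> s" by (rule \<mu>(1)[OF that(2)])
    show ?thesis by (rule integrable_const_bound[of _ "exp (-2)", OF _ meas[OF that]]) (use cut_bounds[OF that(1)] in auto)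
  qed
  have main: "(\<integral>A. exp (-2) - cut b A \<partial>\<nu>) \<le> exp (c * t) * (b * V (mid N) * hh 2 (1/2))" if b: "b > 0" for b
  proof -
    define G where "G s = exp (-2) - (\<integral>A. cut b A \<partial>\<mu> s)" for s
    have Gs: "G s = (\<integral>A. exp (-2) - cut b A \<partial>\<mu> s)" if "s \<ge> 0" for s
    proof -
      interpret prob_space "\<mu> s" by (rule \<mu>(1)[OF that])
      show ?thesis using int[OF b that] by (simp add: G_def prob_space)
    qed
    have G0: "G s \<ge> 0" if "s \<ge> 0" for s
      unfolding Gs[OF that] using cut_bounds[OF b] by (intro integral_nonneg_AE) auto
    have low: "(\<integral>A. lapGL N (cut b) A / 4 \<partial>\<mu> s) \<ge> - c * G s" if s: "s > 0" for s
    \<comment> \<open>A non-integrable function has integral 0 by convention, and the lower bound is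
      nonpositive, so the inequality holds in that case as well.\<close>
    proof (cases "integrable (\<mu> s) (\<lambda>A. lapGL N (cut b) A / 4)")
      case True
      interpret prob_space "\<mu> s" using \<mu>(1) s by simp
      have "- c * G s = (\<integral>A. - c * (exp (-2) - cut b A) \<partial>\<mu> s)" using Gs s by simp
      also have "\<dots> \<le> (\<integral>A. lapGL N (cut b) A / 4 \<partial>\<mu> s)"
      proof (rule integral_mono_AE)
        show "integrable (\<mu> s) (\<lambda>A. - c * (exp (-2) - cut b A))" using int[OF b, of s] s by (intro integrable_mult_right integrable_diff integrable_const) auto
        have "AE A in \<mu> s. A \<in> GLm N" using AE s by simp
        then show "AE A in \<mu> s. - c * (exp (-2) - cut b A) \<le> lapGL N (cut b) A / 4"
          by eventually_elim (rule lapGL_cut[OF b _ jets LV c])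
      qed (rule True)
      finally show ?thesis .
    next
      case False
      then have "(\<integral>A. lapGL N (cut b) A / 4 \<partial>\<mu> s) = 0" by (rule not_integrable_integral_eq)
      then show ?thesis using c G0[of s] s by simp
    qed
    \<comment> \<open>exp(-c s) G s is nonincreasing. At s = 0 only continuity of the expectations
      is given, hence the monotonicity rule with derivatives on the open interval.\<close>
    have "exp (- c * t) * G t \<le> exp (- c * 0) * G 0"
    proof (rule DERIV_nonpos_imp_decreasing_open[OF less_imp_le[OF t]])
      fix s assume s: "0 < s" "s < t"
      have "(G has_real_derivative 0 - (\<integral>A. lapGL N (cut b) A / 4 \<partial>\<mu> s)) (at s)"
        unfolding G_def by (intro DERIV_diff DERIV_const ev(2)[OF testGL_cut[OF b] s(1)])
      moreover have "((\<lambda>s. exp (- c * s)) has_real_derivative exp (- c * s) * (- c)) (at s)"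
        by (auto intro!: derivative_eq_intros)
      ultimately have "((\<lambda>s. exp (- c * s) * G s) has_real_derivative exp (- c * s) * (- c) * G s + (0 - (\<integral>A. lapGL N (cut b) A / 4 \<partial>\<mu> s)) * exp (- c * s)) (at s)"
        by (rule DERIV_mult[rotated])
      moreover have "exp (- c * s) * (- c) * G s + (0 - (\<integral>A. lapGL N (cut b) A / 4 \<partial>\<mu> s)) * exp (- c * s)
         = exp (- c * s) * (- c * G s - (\<integral>A. lapGL N (cut b) A / 4 \<partial>\<mu> s))" by (simp add: algebra_simps)
      moreover have "\<dots> \<le> 0" using low[OF s(1)] by (intro mult_nonneg_nonpos) auto
      ultimately show "\<exists>y. ((\<lambda>s. exp (- c * s) * G s) has_real_derivative y) (at s) \<and> y \<le> 0" by metis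
    next
      have "continuous_on {0..t} G" unfolding G_def
        by (intro continuous_on_diff continuous_on_const continuous_on_subset[OF ev(1)[OF testGL_cut[OF b]]]) auto
      then show "continuous_on {0..t} (\<lambda>s. exp (- c * s) * G s)" by (intro continuous_intros)
    qed
    then have "exp (c * t) * (exp (- c * t) * G t) \<le> exp (c * t) * (exp (- c * 0) * G 0)" by (rule mult_left_mono) simp
    then have "exp (c * t) * (exp (- c * t) * G t) \<le> exp (c * t) * G 0" by (simp only: mult_zero_right exp_zero mult_1_left)
    moreover have "exp (c * t) * (exp (- c * t) * G t) = G t" by (simp add: mult.assoc[symmetric] exp_add[symmetric])
    ultimately have "G t \<le> exp (c * t) * G 0" by (simp only:)
    also have "G 0 \<le> b * V (mid N) * hh 2 (1/2)"
    proof -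
      have "(\<integral>A. cut b A \<partial>\<mu> 0) = cut b (mid N)"
        unfolding \<mu>0 by (rule integral_return) (auto simp: mat_space_def space_PiM mid_def intro!: borel_measurable_mats[OF tf_continuous[OF tf_cut b], unfolded mat_space_def])
      then show ?thesis using hh_tangent(2)[of "b * V (mid N)"] b nonneg[OF mid_GLm(1)] by (simp add: G_def cut_def mid_GLm hh0_half V_def)
    qed
    finally show ?thesis using Gs[of t] t \<mu>t by simp
  qed
  define b where "b n = inverse (real (Suc n))" for n
  have b: "b n > 0" for n by (simp add: b_def)
  define h where "h n A = (exp (-2) - cut (b n) A) / (b n * hh 2 (1/2))" for n A
  have H: "hh 2 (1/2) > 0" by (simp add: hh_def)
  have lim: "(\<lambda>n. h n A) \<longlonglongrightarrow> V A" if A: "A \<in> GLm N" for A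
  proof -
    have "((\<lambda>b. 1/2 - b * V A) has_real_derivative - V A) (at 0)" by (auto intro!: derivative_eq_intros)
    from DERIV_chain2[OF hh1_DERIV this]
    have "((\<lambda>b. hh 0 (1/2 - b * V A)) has_real_derivative hh 2 (1/2) * - V A) (at 0)" by simp
    then have "((\<lambda>b. (hh 0 (1/2 - b * V A) - hh 0 (1/2)) / b) \<longlongrightarrow> hh 2 (1/2) * - V A) (at 0)"
      by (simp add: has_field_derivative_iff)
    moreover have "filterlim b (at 0) sequentially"
      unfolding filterlim_at using LIMSEQ_inverse_real_of_nat b less_imp_neq[OF b] by (auto simp: b_def[abs_def])
    ultimately have "(\<lambda>n. (hh 0 (1/2 - b n * V A) - hh 0 (1/2)) / b n) \<longlonglongrightarrow> hh 2 (1/2) * - V A"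
      by (rule filterlim_compose)
    from tendsto_divide[OF tendsto_minus[OF this] tendsto_const[of "hh 2 (1/2)"]]
    have "(\<lambda>n. - ((hh 0 (1/2 - b n * V A) - hh 0 (1/2)) / b n) / hh 2 (1/2)) \<longlonglongrightarrow> V A" using H by simp
    moreover have "- ((hh 0 (1/2 - b n * V A) - hh 0 (1/2)) / b n) / hh 2 (1/2) = h n A" for n
      using A by (simp add: h_def cut_def hh0_half[symmetric] minus_divide_left)
    ultimately show ?thesis by simp
  qed
  have AEt: "AE A in \<nu>. A \<in> GLm N" by (rule AE[OF less_imp_le[OF t], unfolded \<mu>t])
  have hn: "(\<integral>\<^sup>+A. ennreal (h n A) \<partial>\<nu>) \<le> ennreal (exp (c * t) * V (mid N))" for n
  proof -
    interpret prob_space \<nu> using \<mu>(1)[of t] t \<mu>t by simp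
    have i: "integrable \<nu> (cut (b n))" using int[OF b, of t] t \<mu>t by simp
    have "(\<integral>\<^sup>+A. ennreal (h n A) \<partial>\<nu>) = ennreal (\<integral>A. h n A \<partial>\<nu>)"
      using i cut_bounds[OF b] b[of n] H by (intro nn_integral_eq_integral) (auto simp: h_def)
    also have "(\<integral>A. h n A \<partial>\<nu>) = (\<integral>A. exp (-2) - cut (b n) A \<partial>\<nu>) / (b n * hh 2 (1/2))" by (simp add: h_def)
    also have "\<dots> \<le> exp (c * t) * (b n * V (mid N) * hh 2 (1/2)) / (b n * hh 2 (1/2))"
      using main[OF b] b[of n] H by (intro divide_right_mono) auto
    also have "\<dots> = exp (c * t) * V (mid N)" using b[of n] H by simp
    finally show ?thesis by (simp add: ennreal_leI)
  qed
  have "(\<integral>\<^sup>+A. ennreal (V A) \<partial>\<nu>) = (\<integral>\<^sup>+A. liminf (\<lambda>n. ennreal (h n A)) \<partial>\<nu>)"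
  proof (rule nn_integral_cong_AE)
    show "AE A in \<nu>. ennreal (V A) = liminf (\<lambda>n. ennreal (h n A))"
      using AEt by eventually_elim (rule lim_imp_Liminf[OF _ tendsto_ennrealI[OF lim], symmetric], simp_all)
  qed
  also have "\<dots> \<le> liminf (\<lambda>n. \<integral>\<^sup>+A. ennreal (h n A) \<partial>\<nu>)"
  proof (rule nn_integral_liminf)
    fix n
    have "cut (b n) \<in> borel_measurable \<nu>" using meas[OF b, of t] t \<mu>t by simp
    then show "(\<lambda>A. ennreal (h n A)) \<in> borel_measurable \<nu>" unfolding h_def by simp
  qed
  also have "\<dots> \<le> liminf (\<lambda>n. ennreal (exp (c * t) * V (mid N)))"
    by (intro Liminf_mono always_eventually allI hn)
  also have "\<dots> = ennreal (exp (c * t) * V (mid N))" by (simp add: Liminf_const)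
  finally show ?thesis .
qed

end

section \<open>Moments of words, uniformly in N\<close>

lemma poly_fn_lev: "i < N \<Longrightarrow> j < N \<Longrightarrow> poly_fn N (\<lambda>A. lev N A x (i,j))"
  by (cases "fst x"; cases "snd x") (auto simp: lev_def intro: poly_fn.intros)

lemma poly_fn_wev: "i < N \<Longrightarrow> j < N \<Longrightarrow> poly_fn N (\<lambda>A. wev N A w (i,j))"
proof (induction w arbitrary: i j)
  case Nil
  then show ?case using poly_fn.const[of N "mid N (i,j)"] by simp
next
  case (Cons x w)
  have "poly_fn N (\<lambda>A. \<Sum>k<N. lev N A x (i,k) * wev N A w (k,j))"
    by (intro poly_fn_sum poly_fn.mult poly_fn_lev Cons) (use Cons.prems in auto)
  then show ?case using Cons.prems by simp
qed

lemma poly_fn_mtr: "poly_fn N (\<lambda>A. mtr N (wev N A w))"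
proof -
  have "poly_fn N (\<lambda>A. (1 / of_nat N) * (\<Sum>i<N. wev N A w (i,i)))"
    by (intro poly_fn_cmult poly_fn_sum poly_fn_wev) auto
  then show ?thesis by (simp add: mtr_def)
qed

text \<open>A polynomial function with first and second derivatives in all basis directions, kept
  complex-valued so that products and conjugates can be formed; real parts are taken at the
  end.\<close>

definition cjet :: "nat \<Rightarrow> (cmat \<Rightarrow> complex) \<Rightarrow> (cmat \<Rightarrow> cmat \<Rightarrow> complex) \<Rightarrow> (cmat \<Rightarrow> cmat \<Rightarrow> complex) \<Rightarrow> bool" where
  "cjet N g g1 g2 \<longleftrightarrow> poly_fn N g \<and> (\<forall>X\<in>set (gl_basis N). vdiff2 N X g (g1 X) (g2 X))"

lemma cjet_mtr: "cjet N (\<lambda>A. mtr N (wev N A w)) (\<lambda>X A. mtr N (D1 N X A w)) (\<lambda>X A. mtr N (D2 N X A w))"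
  unfolding cjet_def using poly_fn_mtr vdiff2_mtr gl_basis_mats by blast

lemma cjet_add: "cjet N f f1 f2 \<Longrightarrow> cjet N g g1 g2 \<Longrightarrow> cjet N (\<lambda>A. f A + g A) (\<lambda>X A. f1 X A + g1 X A) (\<lambda>X A. f2 X A + g2 X A)"
  by (simp add: cjet_def poly_fn.add vdiff2_add)

lemma cjet_const: "cjet N (\<lambda>A. c) (\<lambda>X A. 0) (\<lambda>X A. 0)"
  by (simp add: cjet_def poly_fn.const vdiff2_const)

lemma cjet_sum: "(\<And>i. i \<in> I \<Longrightarrow> cjet N (f i) (f1 i) (f2 i)) \<Longrightarrow>
  cjet N (\<lambda>A. \<Sum>i\<in>I. f i A) (\<lambda>X A. \<Sum>i\<in>I. f1 i X A) (\<lambda>X A. \<Sum>i\<in>I. f2 i X A)"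
  by (simp add: cjet_def poly_fn_sum vdiff2_sum)

lemma cjet_mult: "cjet N f f1 f2 \<Longrightarrow> cjet N g g1 g2 \<Longrightarrow> cjet N (\<lambda>A. f A * g A) (\<lambda>X A. f1 X A * g A + f A * g1 X A)
   (\<lambda>X A. f2 X A * g A + 2 * (f1 X A * g1 X A) + f A * g2 X A)"
  by (simp add: cjet_def poly_fn.mult vdiff2_mult gl_basis_mats)

lemma cjet_cnj: "cjet N f f1 f2 \<Longrightarrow> cjet N (\<lambda>A. cnj (f A)) (\<lambda>X A. cnj (f1 X A)) (\<lambda>X A. cnj (f2 X A))"
  by (simp add: cjet_def poly_fn.conj vdiff2_bounded_linear[OF bounded_linear_cnj])

lemma cjet_cmult: "cjet N f f1 f2 \<Longrightarrow> cjet N (\<lambda>A. c * f A) (\<lambda>X A. c * f1 X A) (\<lambda>X A. c * f2 X A)"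
  by (simp add: cjet_def poly_fn_cmult vdiff2_bounded_linear[OF bounded_linear_mult_right])

lemma Re_sum_list: "Re (\<Sum>x\<leftarrow>xs. f x) = (\<Sum>x\<leftarrow>xs. Re (f x))"
  by (induction xs) auto

lemma cjet_lyapunov:
  assumes qj: "cjet N q q1 q2"
    and "\<And>A i j. A \<in> GLm N \<Longrightarrow> i < N \<Longrightarrow> j < N \<Longrightarrow> (cmod (A (i,j)))^2 \<le> \<kappa> * Re (q A) \<and> (cmod (minv N A (i,j)))^2 \<le> \<kappa> * Re (q A)"
    and "\<And>A. A \<in> GLm N \<Longrightarrow> Re (q A) \<ge> 0" and "\<kappa> > 0"
    and LV: "\<And>A. A \<in> GLm N \<Longrightarrow> Re (\<Sum>X\<leftarrow>gl_basis N. q2 X A) \<le> 4 * c * Re (q A)" and c: "c \<ge> 0"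
    and t: "t > 0" and law: "GL_BM_law N t \<nu>"
  shows "(\<integral>\<^sup>+A. ennreal (Re (q A)) \<partial>\<nu>) \<le> ennreal (exp (c * t) * Re (q (mid N)))"
proof -
  interpret lyapunov N q \<kappa> using assms(1-4) by unfold_locales (auto simp: cjet_def)
  have "vdiff2 N X V (\<lambda>A. Re (q1 X A)) (\<lambda>A. Re (q2 X A))" if "X \<in> set (gl_basis N)" for X
    unfolding V_def by (rule vdiff2_bounded_linear[OF bounded_linear_Re]) (use qj that in \<open>auto simp: cjet_def\<close>)
  then have "(\<integral>\<^sup>+A. ennreal (V A) \<partial>\<nu>) \<le> ennreal (exp (c * t) * V (mid N))"
  proof (rule lyapunov_bound[OF _ _ c t law])
    show "(\<Sum>X\<leftarrow>gl_basis N. Re (q2 X A)) / 4 \<le> c * V A" if "A \<in> GLm N" for A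
      using LV[OF that] by (simp add: Re_sum_list V_def)
  qed
  then show ?thesis by (simp only: V_def)
qed

lemma sum_list_sum_commute: "(\<Sum>X\<leftarrow>xs. \<Sum>i\<in>I. f i X) = (\<Sum>i\<in>I. \<Sum>X\<leftarrow>xs. f i X)" for f :: "'i \<Rightarrow> 'x \<Rightarrow> 'a::comm_monoid_add"
  by (induction xs) (auto simp: sum.distrib)

text \<open>\<open>Tn\<close> as traces of words followed by their adjoint words, the form to which
  the derivative formulas for words apply; the two agree on GL_N.\<close>

definition qT :: "nat \<Rightarrow> nat \<Rightarrow> cmat \<Rightarrow> complex" where "qT N n A = (\<Sum>w\<in>Wn n. mtr N (wev N A (w @ sw w)))"
definition qT1 :: "nat \<Rightarrow> nat \<Rightarrow> cmat \<Rightarrow> cmat \<Rightarrow> complex" where "qT1 N n X A = (\<Sum>w\<in>Wn n. mtr N (D1 N X A (w @ sw w)))"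
definition qT2 :: "nat \<Rightarrow> nat \<Rightarrow> cmat \<Rightarrow> cmat \<Rightarrow> complex" where "qT2 N n X A = (\<Sum>w\<in>Wn n. mtr N (D2 N X A (w @ sw w)))"

lemma cjet_qT: "cjet N (qT N n) (qT1 N n) (qT2 N n)"
  unfolding qT_def[abs_def] qT1_def[abs_def] qT2_def[abs_def] by (rule cjet_sum) (rule cjet_mtr)

lemma qT_eq: "A \<in> GLm N \<Longrightarrow> qT N n A = of_real (Tn N A n)"
  by (simp add: qT_def Tn_def wev_append wev_sw mtr_mmul_madj)

lemma GL_BM_law_AE:
  assumes law: "GL_BM_law N t \<nu>" and t: "t \<ge> 0"
  shows "AE A in \<nu>. A \<in> GLm N"
proof -
  from law[unfolded GL_BM_law_def] t have p: "prob_space \<nu>" and e: "emeasure \<nu> (GLm N) = 1" by auto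
  interpret prob_space \<nu> by (rule p)
  have "GLm N \<in> sets \<nu>" using e emeasure_notin_sets[of "GLm N" \<nu>] by force
  moreover have "measure \<nu> (GLm N) = 1" using e by (simp add: measure_def)
  ultimately show ?thesis using prob_eq_1 by blast
qed

lemma card_Wn: "card (Wn n) = 4 ^ n"
proof -
  have "card (UNIV :: letter set) = 4" unfolding UNIV_Times_UNIV[symmetric] card_cartesian_product by simp
  then show ?thesis using card_lists_length_eq[OF finite, of "UNIV :: letter set" n] unfolding Wn_def by (simp only: subset_UNIV simp_thms)
qed

text \<open>\<open>aT\<close>: there are 4^n words, each with the bound of
  \<open>sum_gl_D2_le\<close>. \<open>bT\<close>: one 4^n comes from Cauchy-Schwarz over the words,
  one from their number, and the rest is the gradient bound for words of length 2 n.\<close>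

definition aT :: "nat \<Rightarrow> real" where "aT n = 4 ^ n * (16 * (real n)^2 * 4 ^ (n * n))"
definition bT :: "nat \<Rightarrow> real" where "bT n = 4 ^ n * 4 ^ n * (2 * (2 * real n)^2)"

lemma aT_nonneg [simp]: "aT n \<ge> 0" and bT_nonneg [simp]: "bT n \<ge> 0" by (simp_all add: aT_def bT_def)

lemma qT2_le:
  assumes N: "N \<ge> 1" and A: "A \<in> GLm N"
  shows "cmod (\<Sum>X\<leftarrow>gl_basis N. qT2 N n X A) \<le> aT n * Tn N A n"
proof -
  have "(\<Sum>X\<leftarrow>gl_basis N. qT2 N n X A) = (\<Sum>w\<in>Wn n. \<Sum>X\<leftarrow>gl_basis N. mtr N (D2 N X A (w @ sw w)))"
    unfolding qT2_def by (rule sum_list_sum_commute)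
  also have "cmod \<dots> \<le> (\<Sum>w\<in>Wn n. 16 * (real n)^2 * 4 ^ (n * n) * Tn N A n)"
    by (rule sum_norm_le, rule sum_gl_D2_le[OF N A]) (simp add: Wn_def)
  also have "\<dots> = aT n * Tn N A n" by (simp add: card_Wn aT_def)
  finally show ?thesis .
qed

lemma qT1_le:
  assumes A: "A \<in> GLm N"
  shows "(\<Sum>X\<leftarrow>gl_basis N. (cmod (qT1 N n X A))^2) \<le> bT n / (real N)^2 * Tn N A (2 * n)"
proof -
  have "(cmod (qT1 N n X A))^2 \<le> 4 ^ n * (\<Sum>w\<in>Wn n. (cmod (mtr N (D1 N X A (w @ sw w))))^2)" for X
  proof -
    have "cmod (qT1 N n X A) \<le> (\<Sum>w\<in>Wn n. cmod (mtr N (D1 N X A (w @ sw w))) * 1)"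
      unfolding qT1_def using norm_sum by simp
    then have "(cmod (qT1 N n X A))^2 \<le> (\<Sum>w\<in>Wn n. cmod (mtr N (D1 N X A (w @ sw w))) * 1)^2" by (rule power_mono) simp
    also have "\<dots> \<le> (\<Sum>w\<in>Wn n. (cmod (mtr N (D1 N X A (w @ sw w))))^2) * (\<Sum>w\<in>Wn n. 1^2)"
      by (rule Cauchy_Schwarz_ineq_sum)
    also have "\<dots> = 4 ^ n * (\<Sum>w\<in>Wn n. (cmod (mtr N (D1 N X A (w @ sw w))))^2)" by (simp add: card_Wn)
    finally show ?thesis .
  qed
  then have "(\<Sum>X\<leftarrow>gl_basis N. (cmod (qT1 N n X A))^2) \<le> (\<Sum>X\<leftarrow>gl_basis N. 4 ^ n * (\<Sum>w\<in>Wn n. (cmod (mtr N (D1 N X A (w @ sw w))))^2))"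
    by (rule sum_list_mono)
  also have "\<dots> = 4 ^ n * (\<Sum>w\<in>Wn n. \<Sum>X\<leftarrow>gl_basis N. (cmod (mtr N (D1 N X A (w @ sw w))))^2)"
    unfolding sum_list_const_mult by (simp only: sum_list_sum_commute)
  also have "\<dots> \<le> 4 ^ n * (\<Sum>w\<in>Wn n. (2 / (real N)^2) * (2 * real n)^2 * Tn N A (2 * n))"
  proof (intro mult_left_mono sum_mono)
    fix w assume "w \<in> Wn n"
    then have "length (w @ sw w) = 2 * n" by (simp add: Wn_def)
    then show "(\<Sum>X\<leftarrow>gl_basis N. (cmod (mtr N (D1 N X A (w @ sw w))))^2) \<le> (2 / (real N)^2) * (2 * real n)^2 * Tn N A (2 * n)"
      using sum_gl_D1_le[OF A, of "w @ sw w"] by simp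
  qed simp
  also have "\<dots> = bT n / (real N)^2 * Tn N A (2 * n)" by (simp add: card_Wn bT_def)
  finally show ?thesis .
qed

text \<open>T_0 = 1 makes the sum dominate constants, and for D >= 1 the summand T_1 dominates the
  entries of A and of its inverse, which makes the sum proper.\<close>

definition VT :: "nat \<Rightarrow> nat \<Rightarrow> cmat \<Rightarrow> real" where "VT N D A = (\<Sum>n\<le>D. Tn N A n)"

lemma VT_nonneg [simp]: "VT N D A \<ge> 0" by (simp add: VT_def sum_nonneg)

lemma Tn_le_VT: "n \<le> D \<Longrightarrow> Tn N A n \<le> VT N D A"
  unfolding VT_def by (rule member_le_sum) auto

lemma VT_proper:
  assumes N: "N \<ge> 1" and A: "A \<in> GLm N" and ij: "i < N" "j < N" and D: "D \<ge> 1"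
  shows "(cmod (A (i,j)))^2 \<le> real N * VT N D A" "(cmod (minv N A (i,j)))^2 \<le> real N * VT N D A"
proof -
  have e: "(cmod (M (i,j)))^2 \<le> real N * nrm2 N M" for M
  proof -
    have "(cmod (M (i,j)))^2 \<le> (\<Sum>p\<in>sq N. (cmod (M p))^2)"
      by (rule member_le_sum[of "(i,j)" "sq N" "\<lambda>p. (cmod (M p))^2"]) (use ij in \<open>auto simp: sq_def\<close>)
    then show ?thesis using N by (simp add: nrm2_sq)
  qed
  have w: "real N * nrm2 N (wev N A [x]) \<le> real N * VT N D A" for x
    using nrm2_le_Tn[of N A "[x]"] Tn_le_VT[of 1 D N A] D by (intro mult_left_mono) auto
  have "wev N A [(True,False)] = A" "wev N A [(False,False)] = minv N A" using minv_GL[OF A] by (simp_all add: lev_def)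
  then show "(cmod (A (i,j)))^2 \<le> real N * VT N D A" "(cmod (minv N A (i,j)))^2 \<le> real N * VT N D A"
    using order_trans[OF e[of A] w[of "(True,False)", unfolded \<open>wev N A [(True,False)] = A\<close>]]
      order_trans[OF e[of "minv N A"] w[of "(False,False)", unfolded \<open>wev N A [(False,False)] = minv N A\<close>]] by auto
qed

definition qV :: "nat \<Rightarrow> nat \<Rightarrow> cmat \<Rightarrow> complex" where "qV N D A = (\<Sum>n\<le>D. qT N n A)"
definition qV1 :: "nat \<Rightarrow> nat \<Rightarrow> cmat \<Rightarrow> cmat \<Rightarrow> complex" where "qV1 N D X A = (\<Sum>n\<le>D. qT1 N n X A)"
definition qV2 :: "nat \<Rightarrow> nat \<Rightarrow> cmat \<Rightarrow> cmat \<Rightarrow> complex" where "qV2 N D X A = (\<Sum>n\<le>D. qT2 N n X A)"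

lemma cjet_qV: "cjet N (qV N D) (qV1 N D) (qV2 N D)"
  unfolding qV_def[abs_def] qV1_def[abs_def] qV2_def[abs_def] by (rule cjet_sum) (rule cjet_qT)

lemma qV_eq: "A \<in> GLm N \<Longrightarrow> qV N D A = of_real (VT N D A)"
  by (simp add: qV_def VT_def qT_eq)

definition aV :: "nat \<Rightarrow> real" where "aV D = (\<Sum>n\<le>D. aT n)"

lemma aV_nonneg [simp]: "aV D \<ge> 0" by (simp add: aV_def sum_nonneg)

lemma qV2_le:
  assumes "N \<ge> 1" "A \<in> GLm N"
  shows "cmod (\<Sum>X\<leftarrow>gl_basis N. qV2 N D X A) \<le> aV D * VT N D A"
proof -
  have "(\<Sum>X\<leftarrow>gl_basis N. qV2 N D X A) = (\<Sum>n\<le>D. \<Sum>X\<leftarrow>gl_basis N. qT2 N n X A)"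
    unfolding qV2_def by (rule sum_list_sum_commute)
  also have "cmod \<dots> \<le> (\<Sum>n\<le>D. aV D * Tn N A n)"
  proof (rule sum_norm_le)
    fix n assume "n \<in> {..D}"
    then have "aT n \<le> aV D" unfolding aV_def by (intro member_le_sum) auto
    then show "cmod (\<Sum>X\<leftarrow>gl_basis N. qT2 N n X A) \<le> aV D * Tn N A n"
      using order_trans[OF qT2_le[OF assms, of n] mult_right_mono] by simp
  qed
  finally show ?thesis by (simp add: VT_def sum_distrib_left)
qed

lemma lev_mid: "lev N (mid N) x = mid N"
proof -
  have "minv N (mid N) = mid N" by (rule mid_GLm(2))
  then show ?thesis by (auto simp: lev_def Let_def madj_mid)
qed

lemma wev_mid: "wev N (mid N) w = mid N"
  by (induction w) (auto simp: lev_mid)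

lemma VT_mid: "N \<ge> 1 \<Longrightarrow> VT N D (mid N) = (\<Sum>n\<le>D. 4 ^ n)"
  by (simp add: VT_def Tn_def wev_mid nrm2_mid card_Wn)

text \<open>Both the growth rate aV D / 4 and the value at the identity, which counts the words of
  length at most D, are free of N.\<close>

theorem VT_moment:
  assumes t: "t > 0" and D: "D \<ge> 1"
  shows "\<exists>C\<ge>0. \<forall>N\<ge>1. \<forall>\<nu>. GL_BM_law N t \<nu> \<longrightarrow> (\<integral>\<^sup>+A. ennreal (Re (qV N D A)) \<partial>\<nu>) \<le> ennreal C"
proof (intro exI[of _ "exp (aV D / 4 * t) * (\<Sum>n\<le>D. 4 ^ n)"] conjI allI impI)
  fix N :: nat and \<nu> assume N: "N \<ge> 1" and law: "GL_BM_law N t \<nu>"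
  have "(\<integral>\<^sup>+A. ennreal (Re (qV N D A)) \<partial>\<nu>) \<le> ennreal (exp (aV D / 4 * t) * Re (qV N D (mid N)))"
  proof (rule cjet_lyapunov[OF cjet_qV _ _ _ _ _ t law])
    fix A assume A: "A \<in> GLm N"
    show "Re (qV N D A) \<ge> 0" by (simp add: qV_eq[OF A])
    show "Re (\<Sum>X\<leftarrow>gl_basis N. qV2 N D X A) \<le> 4 * (aV D / 4) * Re (qV N D A)"
      using order_trans[OF complex_Re_le_cmod qV2_le[OF N A]] by (simp add: qV_eq[OF A])
    fix i j assume "i < N" "j < N"
    then show "(cmod (A (i,j)))^2 \<le> real N * Re (qV N D A) \<and> (cmod (minv N A (i,j)))^2 \<le> real N * Re (qV N D A)"
      using VT_proper[OF N A _ _ D] by (simp add: qV_eq[OF A])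
  qed (use N in auto)
  then show "(\<integral>\<^sup>+A. ennreal (Re (qV N D A)) \<partial>\<nu>) \<le> ennreal (exp (aV D / 4 * t) * (\<Sum>n\<le>D. 4 ^ n))"
    using VT_mid[OF N] by (simp add: qV_eq[OF mid_GLm(1)])
qed (auto intro!: mult_nonneg_nonneg sum_nonneg)

section \<open>Deviation of the traces of powers from 1\<close>

definition trdev :: "nat \<Rightarrow> bool \<Rightarrow> nat \<Rightarrow> cmat \<Rightarrow> complex" where
  "trdev N x k A = mtr N (wev N A (em (replicate k x))) + (-1)"

definition trdev1 :: "nat \<Rightarrow> bool \<Rightarrow> nat \<Rightarrow> cmat \<Rightarrow> cmat \<Rightarrow> complex" where
  "trdev1 N x k X A = mtr N (D1 N X A (em (replicate k x))) + 0"

definition trdev2 :: "nat \<Rightarrow> bool \<Rightarrow> nat \<Rightarrow> cmat \<Rightarrow> cmat \<Rightarrow> complex" where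
  "trdev2 N x k X A = mtr N (D2 N X A (em (replicate k x))) + 0"

lemma cjet_trdev: "cjet N (trdev N x k) (trdev1 N x k) (trdev2 N x k)"
  unfolding trdev_def[abs_def] trdev1_def[abs_def] trdev2_def[abs_def] by (rule cjet_add[OF cjet_mtr cjet_const])

lemma trdev_mid: "N \<ge> 1 \<Longrightarrow> trdev N x k (mid N) = 0"
  by (simp add: trdev_def wev_mid)

lemma sum_trdev2: "(\<Sum>X\<leftarrow>gl_basis N. trdev2 N x k X A) = 0"
  unfolding trdev2_def using sum_gl_D2_unstarred[of "em (replicate k x)"] by (auto simp: em_def)

lemma sum_trdev1:
  assumes "A \<in> GLm N"
  shows "(\<Sum>X\<leftarrow>gl_basis N. (cmod (trdev1 N x k X A))^2) \<le> 2 * (real k)^2 / (real N)^2 * Tn N A k"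
  using sum_gl_D1_le[OF assms, of "em (replicate k x)"] by (simp add: trdev1_def)

lemma trdev_sq_le:
  assumes "N \<ge> 1"
  shows "(cmod (trdev N x k A))^2 \<le> 2 * Tn N A k + 2"
proof -
  let ?m = "mtr N (wev N A (em (replicate k x)))"
  have "(cmod ?m)^2 \<le> Tn N A k * Tn N A 0" by (rule mtr_word_le') simp
  then have m: "(cmod ?m)^2 \<le> Tn N A k" by (simp add: Tn_0[OF assms])
  have "(cmod (trdev N x k A))^2 \<le> (cmod ?m + 1)^2"
    unfolding trdev_def using norm_triangle_ineq[of ?m "-1"] by (intro power_mono) auto
  also have "\<dots> \<le> 2 * (cmod ?m)^2 + 2" using sum_squares_bound[of "cmod ?m" 1] by (simp add: power2_sum)
  finally show ?thesis using m by simp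
qed

lemma mult_le_half_squares: "a * (b * c) \<le> (b^2 + (a * c)^2) / 2" for a b c :: real
  using sum_squares_bound[of b "a * c"] by (simp add: mult_ac)

text \<open>The Laplacian annihilates \<open>trdev\<close>, so only its gradient, of square \<open>O(1/N\<^sup>2)\<close>, feeds its growth.\<close>

theorem trdev_moment:
  assumes t: "t > 0"
  shows "\<exists>C\<ge>0. \<forall>N\<ge>1. \<forall>\<nu>. GL_BM_law N t \<nu> \<longrightarrow>
    (\<integral>\<^sup>+A. ennreal (Re (trdev N x k A * cnj (trdev N x k A) * qT N d A)) \<partial>\<nu>) \<le> ennreal (C / (real N)^2)"
proof -
  \<comment> \<open>T_k T_d, T_k T_{2 d} and T_{2 d} all have to be dominated by
    \<open>VT N D\<close>, and the final 1 secures D >= 1.\<close>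
  define D where "D = 2 * d + k + 1"
  define k1 where "k1 = 2 * (real k)^2"
  define c where "c = aV D + aT d + 4 * k1 * 4 ^ (k * d) + 2 * k1 + 2 * bT d * (2 * 4 ^ (k * (2 * d)) + 2)"
  have k1: "k1 \<ge> 0" by (simp add: k1_def)
  have c: "c \<ge> 0" unfolding c_def using k1 by simp
  show ?thesis
  proof (intro exI[of _ "exp (c / 4 * t) * (\<Sum>n\<le>D. 4 ^ n)"] conjI allI impI)
    fix N :: nat and \<nu> assume N: "N \<ge> 1" and law: "GL_BM_law N t \<nu>"
    define e :: complex where "e = of_real (1 / (real N)^2)"
    define f where "f = trdev N x k"
    define f1 where "f1 = trdev1 N x k"
    define f2 where "f2 = trdev2 N x k"
    define g where "g A = f A * cnj (f A)" for A
    define g1 where "g1 X A = f1 X A * cnj (f A) + f A * cnj (f1 X A)" for X A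
    define g2 where "g2 X A = f2 X A * cnj (f A) + 2 * (f1 X A * cnj (f1 X A)) + f A * cnj (f2 X A)" for X A
    \<comment> \<open>The term \<open>e * qV\<close> absorbs the gradient contributions, which are
      of size V/N^2 without a factor |f|^2, and makes q proper. At the identity, where f = 0, it
      alone remains and is of order 1/N^2.\<close>
    define q where "q A = e * qV N D A + g A * qT N d A" for A
    define q1 where "q1 X A = e * qV1 N D X A + (g1 X A * qT N d A + g A * qT1 N d X A)" for X A
    define q2 where "q2 X A = e * qV2 N D X A + (g2 X A * qT N d A + 2 * (g1 X A * qT1 N d X A) + g A * qT2 N d X A)" for X A
    have "cjet N g g1 g2" unfolding g_def[abs_def] g1_def[abs_def] g2_def[abs_def] f_def f1_def f2_def
      by (rule cjet_mult[OF cjet_trdev cjet_cnj[OF cjet_trdev]])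
    then have qj: "cjet N q q1 q2" unfolding q_def[abs_def] q1_def[abs_def] q2_def[abs_def]
      by (rule cjet_add[OF cjet_cmult[OF cjet_qV] cjet_mult[OF _ cjet_qT]])
    have g: "g A = of_real ((cmod (f A))^2)" for A by (simp add: g_def complex_norm_square[symmetric])
    have gT: "Re (g A * qT N d A) = (cmod (f A))^2 * Tn N A d" if A: "A \<in> GLm N" for A
      by (simp add: g qT_eq[OF A] flip: of_real_mult of_real_power)
    have Req: "Re (q A) = VT N D A / (real N)^2 + (cmod (f A))^2 * Tn N A d" if A: "A \<in> GLm N" for A
      unfolding q_def plus_complex.sel gT[OF A] by (simp add: qV_eq[OF A] e_def flip: of_real_mult of_real_power)
    have main: "(\<integral>\<^sup>+A. ennreal (Re (q A)) \<partial>\<nu>) \<le> ennreal (exp (c / 4 * t) * Re (q (mid N)))"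
    proof (rule cjet_lyapunov[OF qj _ _ _ _ _ t law])
      fix A assume A: "A \<in> GLm N"
      show "Re (q A) \<ge> 0" by (simp add: Req[OF A])
      show "Re (\<Sum>X\<leftarrow>gl_basis N. q2 X A) \<le> 4 * (c / 4) * Re (q A)"
      proof -
        define F where "F = cmod (f A)"
        define V where "V = VT N D A"
        define n where "n = 1 / (real N)^2"
        have n: "n \<ge> 0" by (simp add: n_def)
        have V: "V \<ge> 0" by (simp add: V_def)
        let ?S = "\<lambda>h. (\<Sum>X\<leftarrow>gl_basis N. h X)"
        have sq1: "?S (\<lambda>X. (cmod (f1 X A))^2) \<le> k1 * n * Tn N A k"
          using sum_trdev1[OF A, of x k] by (simp add: f1_def k1_def n_def)
        have sq2: "?S (\<lambda>X. (cmod (qT1 N d X A))^2) \<le> bT d * n * Tn N A (2 * d)"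
          using qT1_le[OF A, of d] by (simp add: n_def)
        have F2: "F^2 \<le> 2 * Tn N A k + 2" unfolding F_def f_def by (rule trdev_sq_le[OF N])
        have T: "Tn N A m \<le> V" if "m \<le> D" for m unfolding V_def by (rule Tn_le_VT[OF that])
        have e1: "cmod (?S (\<lambda>X. e * qV2 N D X A)) \<le> n * (aV D * V)"
          unfolding sum_list_const_mult norm_mult V_def
          by (rule mult_mono) (use qV2_le[OF N A, of D] in \<open>simp_all add: e_def n_def norm_divide norm_power\<close>)
        have "?S (\<lambda>X. g2 X A) = ?S (\<lambda>X. cnj (f A) * f2 X A) + ?S (\<lambda>X. 2 * of_real ((cmod (f1 X A))^2)) + ?S (\<lambda>X. f A * cnj (f2 X A))"
          unfolding g2_def sum_list_addf complex_norm_square by (simp add: mult.commute)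
        also have "?S (\<lambda>X. cnj (f A) * f2 X A) = 0" unfolding sum_list_const_mult f2_def sum_trdev2 by simp
        also have "?S (\<lambda>X. f A * cnj (f2 X A)) = f A * cnj (?S (\<lambda>X. f2 X A))"
        proof -
          have "(\<Sum>X\<leftarrow>xs. f A * cnj (f2 X A)) = f A * cnj (\<Sum>X\<leftarrow>xs. f2 X A)" for xs
            by (induction xs) (auto simp: algebra_simps)
          then show ?thesis .
        qed
        also have "\<dots> = 0" unfolding f2_def sum_trdev2 by simp
        finally have "?S (\<lambda>X. g2 X A) = 2 * of_real (?S (\<lambda>X. (cmod (f1 X A))^2))"
          by (simp add: sum_list_const_mult of_real_sum_list)
        then have e2: "cmod (?S (\<lambda>X. g2 X A * qT N d A)) \<le> n * (2 * k1 * 4 ^ (k * d) * V)"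
        proof -
          have S0: "0 \<le> ?S (\<lambda>X. (cmod (f1 X A))^2)" by (rule sum_list_nonneg) auto
          assume "?S (\<lambda>X. g2 X A) = 2 * of_real (?S (\<lambda>X. (cmod (f1 X A))^2))"
          then have "cmod (?S (\<lambda>X. g2 X A * qT N d A)) = 2 * ?S (\<lambda>X. (cmod (f1 X A))^2) * Tn N A d"
            using S0 by (simp add: sum_list_mult_const norm_mult qT_eq[OF A])
          also have "\<dots> \<le> 2 * (k1 * n * Tn N A k) * Tn N A d" by (intro mult_right_mono mult_left_mono sq1) auto
          also have "\<dots> = 2 * k1 * n * (Tn N A k * Tn N A d)" by simp
          also have "\<dots> \<le> 2 * k1 * n * (4 ^ (k * d) * V)"
            by (intro mult_left_mono order_trans[OF Tn_mult_le[OF N A]] T) (use k1 n in \<open>auto simp: D_def\<close>)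
          finally show ?thesis by (simp add: mult_ac)
        qed
        \<comment> \<open>The mixed term pairs the gradients of |f|^2 and of T_d. The
          arithmetic-geometric inequality separates them, leaving |f|^2 on the gradient of T_d,
          where |f|^2 <= 2 T_k + 2.\<close>
        have "cmod (?S (\<lambda>X. 2 * (g1 X A * qT1 N d X A))) \<le> ?S (\<lambda>X. 2 * ((cmod (f1 X A))^2 + F^2 * (cmod (qT1 N d X A))^2))"
        proof -
          have "cmod (2 * (g1 X A * qT1 N d X A)) \<le> 2 * ((cmod (f1 X A))^2 + F^2 * (cmod (qT1 N d X A))^2)" for X
          proof -
            have "cmod (g1 X A) \<le> 2 * (F * cmod (f1 X A))"
              unfolding g1_def by (rule order_trans[OF norm_triangle_ineq]) (simp add: norm_mult F_def)
            then have "cmod (g1 X A) * cmod (qT1 N d X A) \<le> 2 * (F * cmod (f1 X A)) * cmod (qT1 N d X A)"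
              by (rule mult_right_mono) simp
            then have "cmod (2 * (g1 X A * qT1 N d X A)) \<le> 2 * (2 * (F * cmod (f1 X A)) * cmod (qT1 N d X A))"
              by (simp only: norm_mult norm_numeral)
            also have "\<dots> = 4 * (F * (cmod (f1 X A) * cmod (qT1 N d X A)))" by simp
            also have "\<dots> \<le> 4 * (((cmod (f1 X A))^2 + (F * cmod (qT1 N d X A))^2) / 2)"
              by (intro mult_left_mono mult_le_half_squares) simp
            finally show ?thesis by (simp add: power_mult_distrib)
          qed
          then have "?S (\<lambda>X. cmod (2 * (g1 X A * qT1 N d X A))) \<le> ?S (\<lambda>X. 2 * ((cmod (f1 X A))^2 + F^2 * (cmod (qT1 N d X A))^2))"
            by (rule sum_list_mono)
          moreover have "cmod (sum_list (map h xs)) \<le> sum_list (map (\<lambda>X. cmod (h X)) xs)" for h :: "cmat \<Rightarrow> complex" and xs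
            by (induction xs) (auto intro: order_trans[OF norm_triangle_ineq])
          ultimately show ?thesis by (rule order_trans[rotated])
        qed
        also have "\<dots> = 2 * (?S (\<lambda>X. (cmod (f1 X A))^2) + F^2 * ?S (\<lambda>X. (cmod (qT1 N d X A))^2))"
          unfolding sum_list_const_mult sum_list_addf ..
        also have "\<dots> \<le> 2 * (k1 * n * Tn N A k + (2 * Tn N A k + 2) * (bT d * n * Tn N A (2 * d)))"
          by (intro mult_left_mono add_mono mult_mono sq1 sq2 F2) (auto intro!: sum_list_nonneg)
        also have "\<dots> = n * (2 * k1 * Tn N A k + 2 * bT d * (2 * (Tn N A k * Tn N A (2 * d)) + 2 * Tn N A (2 * d)))"
          by (simp add: algebra_simps)
        also have "\<dots> \<le> n * (2 * k1 * V + 2 * bT d * (2 * (4 ^ (k * (2 * d)) * V) + 2 * V))"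
          by (intro mult_left_mono add_mono order_trans[OF Tn_mult_le[OF N A]] T) (use k1 n in \<open>auto simp: D_def\<close>)
        finally have e3: "cmod (?S (\<lambda>X. 2 * (g1 X A * qT1 N d X A))) \<le> n * (2 * k1 * V + 2 * bT d * (2 * (4 ^ (k * (2 * d)) * V) + 2 * V))" .
        have e4: "cmod (?S (\<lambda>X. g A * qT2 N d X A)) \<le> F^2 * (aT d * Tn N A d)"
          unfolding sum_list_const_mult norm_mult
          by (rule mult_mono) (use qT2_le[OF N A, of d] in \<open>simp_all add: g F_def norm_power\<close>)
        have "?S (\<lambda>X. q2 X A) = ?S (\<lambda>X. e * qV2 N D X A) + (?S (\<lambda>X. g2 X A * qT N d A) + ?S (\<lambda>X. 2 * (g1 X A * qT1 N d X A)) + ?S (\<lambda>X. g A * qT2 N d X A))"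
          unfolding q2_def sum_list_addf ..
        then have "Re (?S (\<lambda>X. q2 X A)) \<le> n * (aV D * V) + (n * (2 * k1 * 4 ^ (k * d) * V) + n * (2 * k1 * V + 2 * bT d * (2 * (4 ^ (k * (2 * d)) * V) + 2 * V)) + F^2 * (aT d * Tn N A d))"
          using complex_Re_le_cmod[of "?S (\<lambda>X. e * qV2 N D X A)"] complex_Re_le_cmod[of "?S (\<lambda>X. g2 X A * qT N d A)"]
            complex_Re_le_cmod[of "?S (\<lambda>X. 2 * (g1 X A * qT1 N d X A))"] complex_Re_le_cmod[of "?S (\<lambda>X. g A * qT2 N d X A)"]
            e1 e2 e3 e4 by (simp only: plus_complex.sel)
        also have "\<dots> = (aV D + 2 * k1 * 4 ^ (k * d) + 2 * k1 + 2 * bT d * (2 * 4 ^ (k * (2 * d)) + 2)) * (n * V) + aT d * (F^2 * Tn N A d)"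
          by (simp add: algebra_simps)
        also have "\<dots> \<le> c * (n * V) + c * (F^2 * Tn N A d)"
          by (intro add_mono mult_right_mono) (use k1 n V in \<open>auto simp: c_def\<close>)
        also have "\<dots> = 4 * (c / 4) * Re (q A)" unfolding Req[OF A] by (simp add: n_def V_def F_def algebra_simps)
        finally show ?thesis .
      qed
      fix i j assume ij: "i < N" "j < N"
      have D: "D \<ge> 1" by (simp add: D_def)
      \<comment> \<open>VT <= N^2 Re q, and passing from the normalized norm to a single entry costs
        one more N; this constant serves properness only.\<close>
      have "real N * VT N D A = (real N)^3 * (VT N D A / (real N)^2)" using N by (simp add: power_def numeral_3_eq_3 numeral_2_eq_2)
      also have "\<dots> \<le> (real N)^3 * Re (q A)" unfolding Req[OF A] by (intro mult_left_mono) auto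
      finally show "(cmod (A (i,j)))^2 \<le> (real N)^3 * Re (q A) \<and> (cmod (minv N A (i,j)))^2 \<le> (real N)^3 * Re (q A)"
        using VT_proper[OF N A ij D] by linarith
    qed (use N c in auto)
    have "(\<integral>\<^sup>+A. ennreal (Re (f A * cnj (f A) * qT N d A)) \<partial>\<nu>) \<le> (\<integral>\<^sup>+A. ennreal (Re (q A)) \<partial>\<nu>)"
    proof (rule nn_integral_mono_AE)
      have "AE A in \<nu>. A \<in> GLm N" by (rule GL_BM_law_AE[OF law]) (use t in simp)
      then show "AE A in \<nu>. ennreal (Re (f A * cnj (f A) * qT N d A)) \<le> ennreal (Re (q A))"
      proof eventually_elim
        case (elim A)
        show ?case unfolding Req[OF elim] using gT[OF elim] by (intro ennreal_leI) (simp add: g_def)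
      qed
    qed
    also note main
    also have "Re (q (mid N)) = (\<Sum>n\<le>D. 4 ^ n) / (real N)^2"
      unfolding Req[OF mid_GLm(1)] by (simp add: f_def trdev_mid[OF N] VT_mid[OF N])
    finally show "(\<integral>\<^sup>+A. ennreal (Re (trdev N x k A * cnj (trdev N x k A) * qT N d A)) \<partial>\<nu>) \<le> ennreal (exp (c / 4 * t) * (\<Sum>n\<le>D. 4 ^ n) / (real N)^2)"
      unfolding f_def by simp
  qed (auto intro!: mult_nonneg_nonneg sum_nonneg)
qed

section \<open>The inverse series\<close>

text \<open>Differentiability in the parameter s, coefficient by coefficient, so that series
  identities can be differentiated formally.\<close>

definition fps_ode :: "(complex \<Rightarrow> complex fps) \<Rightarrow> (complex \<Rightarrow> complex fps) \<Rightarrow> bool" where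
  "fps_ode f f' \<longleftrightarrow> (\<forall>s n. ((\<lambda>s. fps_nth (f s) n) has_field_derivative fps_nth (f' s) n) (at s))"

lemma fps_ode_const: "fps_ode (\<lambda>s. c) (\<lambda>s. 0)" by (simp add: fps_ode_def)

lemma fps_ode_mult:
  assumes "fps_ode f f'" "fps_ode g g'"
  shows "fps_ode (\<lambda>s. f s * g s) (\<lambda>s. f' s * g s + f s * g' s)"
  unfolding fps_ode_def
proof (intro allI)
  fix s n
  have "((\<lambda>s. \<Sum>i=0..n. fps_nth (f s) i * fps_nth (g s) (n - i)) has_field_derivative
    (\<Sum>i=0..n. fps_nth (f' s) i * fps_nth (g s) (n - i) + fps_nth (g' s) (n - i) * fps_nth (f s) i)) (at s)"
    using assms by (intro DERIV_sum DERIV_mult) (auto simp: fps_ode_def)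
  then show "((\<lambda>s. fps_nth (f s * g s) n) has_field_derivative fps_nth (f' s * g s + f s * g' s) n) (at s)"
    by (simp add: fps_mult_nth sum.distrib mult.commute)
qed

lemma fps_ode_power:
  assumes "fps_ode f f'"
  shows "fps_ode (\<lambda>s. f s ^ k) (\<lambda>s. of_nat k * f s ^ (k - 1) * f' s)"
proof (induction k)
  case 0 then show ?case using fps_ode_const[of 1] by simp
next
  case (Suc k)
  have "(\<lambda>s. f' s * f s ^ k + f s * (of_nat k * f s ^ (k - 1) * f' s)) = (\<lambda>s. of_nat (Suc k) * f s ^ (Suc k - 1) * f' s)"
    by (rule ext, cases k) (simp_all add: algebra_simps)
  then show ?case using fps_ode_mult[OF assms Suc] by simp
qed

definition segal_A :: "complex fps" where "segal_A = (1 + fps_X) / (1 - fps_X)"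

text \<open>The series of \<open>z exp(s(1+z)/(1-z))\<close>; the constant term \<open>s\<close> of the exponent is split off because
  composition of formal power series requires a vanishing constant term.\<close>
definition hser :: "complex \<Rightarrow> complex fps" where
  "hser s = fps_const (exp s) * fps_X * (fps_exp s oo (segal_A - 1))"

lemma segal_A_alt: "segal_A = 1 + 2 * (fps_X / (1 - fps_X))" "segal_A - 1 = 2 * (fps_X / (1 - fps_X))" "fps_nth segal_A 0 = 1"
proof -
  have nz: "(1 - fps_X :: complex fps) \<noteq> 0" "fps_nth (1 - fps_X :: complex fps) 0 \<noteq> 0" by (auto dest: arg_cong[where f = "\<lambda>f. fps_nth f 0"])
  have d: "a / (1 - fps_X) * (1 - fps_X) = a" for a :: "complex fps"
    using nz(2) by (simp add: fps_divide_unit mult.assoc inverse_mult_eq_1)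
  have "segal_A * (1 - fps_X) = (1 + 2 * (fps_X / (1 - fps_X))) * (1 - fps_X)"
    unfolding segal_A_def distrib_right mult.assoc d by (simp add: algebra_simps)
  then show a: "segal_A = 1 + 2 * (fps_X / (1 - fps_X))" using nz by simp
  show "segal_A - 1 = 2 * (fps_X / (1 - fps_X))" unfolding a by (rule add_diff_cancel_left')
  show "fps_nth segal_A 0 = 1" unfolding a using nz by (simp add: fps_divide_unit)
qed

lemma fps_ode_exp_compose:
  assumes B0: "fps_nth B 0 = 0"
  shows "fps_ode (\<lambda>s. fps_exp s oo B) (\<lambda>s. B * (fps_exp s oo B))"
  unfolding fps_ode_def
proof (intro allI)
  fix s n
  have "((\<lambda>s. \<Sum>i=0..n. s ^ i / fact i * fps_nth (B ^ i) n) has_field_derivative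
     (\<Sum>i=0..n. of_nat i * s ^ (i - 1) / fact i * fps_nth (B ^ i) n)) (at s)"
    by (intro DERIV_sum) (auto intro!: derivative_eq_intros)
  also have "(\<Sum>i=0..n. of_nat i * s ^ (i - 1) / fact i * fps_nth (B ^ i) n) = fps_nth (B * (fps_exp s oo B)) n"
  proof -
    have "B * (fps_exp s oo B) = (fps_X * fps_exp s) oo B" using B0 by (simp add: fps_compose_mult_distrib)
    then have "fps_nth (B * (fps_exp s oo B)) n = (\<Sum>i=0..n. fps_nth (fps_X * fps_exp s) i * fps_nth (B ^ i) n)"
      by (simp add: fps_compose_nth)
    also have "\<dots> = (\<Sum>i=0..n. of_nat i * s ^ (i - 1) / fact i * fps_nth (B ^ i) n)"
    proof (intro sum.cong refl)
      fix i
      show "fps_nth (fps_X * fps_exp s) i * fps_nth (B ^ i) n = of_nat i * s ^ (i - 1) / fact i * fps_nth (B ^ i) n"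
        by (cases i) (simp_all add: field_simps del: of_nat_Suc)
    qed
    finally show ?thesis by simp
  qed
  finally show "((\<lambda>s. fps_nth (fps_exp s oo B) n) has_field_derivative fps_nth (B * (fps_exp s oo B)) n) (at s)"
    by (simp add: fps_compose_nth)
qed

lemma fps_ode_hser: "fps_ode hser (\<lambda>s. segal_A * hser s)"
proof -
  have 0: "fps_nth (segal_A - 1) 0 = 0" using segal_A_alt(3) by simp
  have e: "fps_ode (\<lambda>s. fps_const (exp s)) (\<lambda>s. fps_const (exp s))"
    unfolding fps_ode_def by (auto intro!: derivative_eq_intros)
  have "fps_ode hser (\<lambda>s. (fps_const (exp s) * fps_X + fps_const (exp s) * 0) * (fps_exp s oo (segal_A - 1))
      + fps_const (exp s) * fps_X * ((segal_A - 1) * (fps_exp s oo (segal_A - 1))))"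
    unfolding hser_def by (intro fps_ode_mult e fps_ode_const fps_ode_exp_compose 0)
  moreover have "(fps_const (exp s) * fps_X + fps_const (exp s) * 0) * (fps_exp s oo (segal_A - 1))
      + fps_const (exp s) * fps_X * ((segal_A - 1) * (fps_exp s oo (segal_A - 1))) = segal_A * hser s" for s
    by (simp add: hser_def algebra_simps)
  ultimately show ?thesis by simp
qed

lemma hser_nth: "fps_nth (hser s) 0 = 0" "fps_nth (hser s) (Suc 0) = exp s"
  by (simp_all add: hser_def fps_mult_nth_1 mult.assoc)

lemma hser_0: "hser 0 = fps_X"
  by (simp add: hser_def)

definition qser :: "complex \<Rightarrow> complex fps" where "qser s = fps_inv (hser s)"

lemma qser_compose: "qser s oo hser s = fps_X" "hser s oo qser s = fps_X" "fps_nth (qser s) 0 = 0"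
proof -
  have h: "fps_nth (hser s) 0 = 0" "fps_nth (hser s) 1 \<noteq> 0" by (simp_all add: hser_nth)
  show "qser s oo hser s = fps_X" "hser s oo qser s = fps_X"
    unfolding qser_def using fps_inv[OF h] fps_inv_right[OF h] by auto
  show "fps_nth (qser s) 0 = 0" by (simp add: qser_def fps_inv_def)
qed

lemma qser_0: "qser 0 = fps_X"
  using qser_compose(1)[of 0] by (simp add: hser_0)

text \<open>Coefficients of the inverse series are rational in those of \<open>hser s\<close>, whence differentiability.\<close>
lemma qser_differentiable: "(\<lambda>s. fps_nth (qser s) n) field_differentiable (at s)"
proof (induction n rule: less_induct)
  case (less n)
  have hp: "(\<lambda>s. fps_nth (hser s ^ i) n) field_differentiable (at s)" for i n
    using fps_ode_power[OF fps_ode_hser, of i] by (auto simp: fps_ode_def field_differentiable_def)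
  have eq: "fps_nth (qser s) n = (fps_nth fps_X n - (\<Sum>i<n. fps_nth (qser s) i * fps_nth (hser s ^ i) n)) / exp s ^ n" for s
  proof -
    have "fps_nth fps_X n = (\<Sum>i=0..n. fps_nth (qser s) i * fps_nth (hser s ^ i) n)"
      using qser_compose(1)[of s] fps_compose_nth[of "qser s" "hser s" n] by simp
    also have "\<dots> = (\<Sum>i<n. fps_nth (qser s) i * fps_nth (hser s ^ i) n) + fps_nth (qser s) n * fps_nth (hser s ^ n) n"
      by (simp add: atLeast0AtMost lessThan_Suc_atMost[symmetric])
    also have "fps_nth (hser s ^ n) n = exp s ^ n" using startsby_zero_power_nth_same[of "hser s" n] hser_nth by simp
    finally show ?thesis by simp
  qed
  have "(\<lambda>s. (fps_nth fps_X n - (\<Sum>i<n. fps_nth (qser s) i * fps_nth (hser s ^ i) n)) / exp s ^ n) field_differentiable (at s)"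
    by (intro field_differentiable_divide field_differentiable_diff field_differentiable_const field_differentiable_sum
        field_differentiable_mult hp less field_differentiable_power field_differentiable_within_exp) auto
  then show ?case using eq by simp
qed

text \<open>Chosen because \<open>segal_A\<close> = 1 + 2 X/(1 - X) composed with the inverse series
  is 1 + 2 \<open>mser\<close>. Its coefficients add up those of all positive powers of
  \<open>qser\<close>.\<close>

definition mser :: "complex \<Rightarrow> complex fps" where "mser s = (fps_X / (1 - fps_X)) oo qser s"

text \<open>Write q = \<open>qser s\<close>, h = \<open>hser s\<close>, A = \<open>segal_A\<close>.
  Differentiating q o h = X in s gives q' o h + (q_z o h) A h = 0; composing with q on the right
  turns A o q into 1 + 2 \<open>mser s\<close> and h o q into X.\<close>

lemma fps_ode_qser: "fps_ode qser (\<lambda>s. - (fps_X * fps_deriv (qser s) * (1 + 2 * mser s)))"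
proof -
  define q' where "q' s = Abs_fps (\<lambda>n. deriv (\<lambda>s. fps_nth (qser s) n) s)" for s
  have q': "fps_ode qser q'"
    unfolding fps_ode_def q'_def using qser_differentiable by (auto intro!: field_differentiable_derivI simp: DERIV_deriv_iff_field_differentiable)
  have "q' s = - (fps_X * fps_deriv (qser s) * (1 + 2 * mser s))" for s
  proof -
    have 0: "fps_nth (hser s) 0 = 0" "fps_nth (qser s) 0 = 0" by (simp_all add: hser_nth qser_compose)
    have "fps_nth ((q' s oo hser s) + (fps_deriv (qser s) oo hser s) * (segal_A * hser s)) n = 0" for n
    proof -
      have d: "((\<lambda>s. \<Sum>i=0..n. fps_nth (qser s) i * fps_nth (hser s ^ i) n) has_field_derivative
        (\<Sum>i=0..n. fps_nth (q' s) i * fps_nth (hser s ^ i) n + fps_nth (of_nat i * hser s ^ (i - 1) * (segal_A * hser s)) n * fps_nth (qser s) i)) (at s)"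
        using q' fps_ode_power[OF fps_ode_hser] by (intro DERIV_sum DERIV_mult) (auto simp: fps_ode_def)
      have "(\<lambda>s. \<Sum>i=0..n. fps_nth (qser s) i * fps_nth (hser s ^ i) n) = (\<lambda>s. fps_nth fps_X n)"
      proof (rule ext)
        fix u show "(\<Sum>i=0..n. fps_nth (qser u) i * fps_nth (hser u ^ i) n) = fps_nth fps_X n"
          using fps_compose_nth[of "qser u" "hser u" n] qser_compose(1)[of u] by (simp only:)
      qed
      from d[unfolded this] have z: "(\<Sum>i=0..n. fps_nth (q' s) i * fps_nth (hser s ^ i) n + fps_nth (of_nat i * hser s ^ (i - 1) * (segal_A * hser s)) n * fps_nth (qser s) i) = 0"
        using DERIV_unique[OF _ DERIV_const] by blast
      have "(fps_deriv (qser s) oo hser s) * (segal_A * hser s) = ((fps_X * fps_deriv (qser s)) oo hser s) * segal_A"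
        using 0 by (simp add: fps_compose_mult_distrib mult_ac)
      also have "fps_nth \<dots> n = (\<Sum>k=0..n. (\<Sum>i=0..k. fps_nth (fps_X * fps_deriv (qser s)) i * fps_nth (hser s ^ i) k) * fps_nth segal_A (n - k))"
        by (simp add: fps_mult_nth fps_compose_nth)
      \<comment> \<open>Powers of \<open>hser s\<close> beyond the k-th have no coefficient of order
        k, so the inner range may be enlarged to a fixed one and the sums exchanged.\<close>
      also have "\<dots> = (\<Sum>k=0..n. (\<Sum>i=0..n. fps_nth (fps_X * fps_deriv (qser s)) i * fps_nth (hser s ^ i) k) * fps_nth segal_A (n - k))"
      proof (rule sum.cong[OF refl])
        fix k assume k: "k \<in> {0..n}"
        have "(\<Sum>i=0..k. fps_nth (fps_X * fps_deriv (qser s)) i * fps_nth (hser s ^ i) k) = (\<Sum>i=0..n. fps_nth (fps_X * fps_deriv (qser s)) i * fps_nth (hser s ^ i) k)"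
          by (rule sum.mono_neutral_left) (use k startsby_zero_power_prefix[OF 0(1)] in auto)
        then show "(\<Sum>i=0..k. fps_nth (fps_X * fps_deriv (qser s)) i * fps_nth (hser s ^ i) k) * fps_nth segal_A (n - k) =
          (\<Sum>i=0..n. fps_nth (fps_X * fps_deriv (qser s)) i * fps_nth (hser s ^ i) k) * fps_nth segal_A (n - k)"
          by (simp only:)
      qed
      also have "\<dots> = (\<Sum>i=0..n. fps_nth (fps_X * fps_deriv (qser s)) i * fps_nth (hser s ^ i * segal_A) n)"
        by (simp add: fps_mult_nth sum_distrib_left sum_distrib_right mult.assoc) (rule sum.swap)
      also have "\<dots> = (\<Sum>i=0..n. fps_nth (of_nat i * hser s ^ (i - 1) * (segal_A * hser s)) n * fps_nth (qser s) i)"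
      proof (intro sum.cong refl)
        fix i
        show "fps_nth (fps_X * fps_deriv (qser s)) i * fps_nth (hser s ^ i * segal_A) n = fps_nth (of_nat i * hser s ^ (i - 1) * (segal_A * hser s)) n * fps_nth (qser s) i"
        proof (cases i)
          case (Suc k)
          have c: "of_nat i * hser s ^ (i - 1) * (segal_A * hser s) = fps_const (of_nat i) * (hser s ^ i * segal_A)"
            unfolding fps_of_nat Suc by (simp add: mult_ac del: of_nat_Suc)
          have x: "fps_nth (fps_X * fps_deriv (qser s)) i = of_nat i * fps_nth (qser s) i" by (simp add: Suc)
          show ?thesis unfolding c x fps_mult_left_const_nth by (simp only: mult_ac)
        qed simp
      qed
      finally show ?thesis using z by (simp add: fps_compose_nth sum.distrib)
    qed
    then have e: "(q' s oo hser s) + (fps_deriv (qser s) oo hser s) * (segal_A * hser s) = 0" by (intro fps_ext) simp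
    have "((q' s oo hser s) + (fps_deriv (qser s) oo hser s) * (segal_A * hser s)) oo qser s = 0" unfolding e by simp
    then have "((q' s oo hser s) oo qser s) + ((fps_deriv (qser s) oo hser s) oo qser s) * ((segal_A oo qser s) * (hser s oo qser s)) = 0"
      using 0 by (simp add: fps_compose_add_distrib fps_compose_mult_distrib)
    then have "q' s + fps_deriv (qser s) * ((segal_A oo qser s) * fps_X) = 0"
      using 0 by (simp add: fps_compose_assoc[symmetric] qser_compose)
    moreover have "segal_A oo qser s = 1 + 2 * mser s"
      unfolding segal_A_alt(1) mser_def using 0
      by (simp only: fps_compose_add_distrib fps_compose_mult_distrib fps_compose_1) (simp add: numeral_fps_const)
    ultimately show ?thesis by (simp add: algebra_simps eq_neg_iff_add_eq_0)
  qed
  then have "q' = (\<lambda>s. - (fps_X * fps_deriv (qser s) * (1 + 2 * mser s)))" by (rule ext)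
  then show ?thesis using q' by (simp only:)
qed

text \<open>\<open>dcoef n j (t/2)\<close> will be the coefficient of X^j in the transform of X^n.
  For n >= 1, \<open>mcoef n\<close> is the value of that polynomial at 1; it solves the moment
  equations of free unitary Brownian motion at time 2 s, with value 1 at s = 0.\<close>

definition dcoef :: "nat \<Rightarrow> nat \<Rightarrow> complex \<Rightarrow> complex" where "dcoef n j s = fps_nth (qser s ^ j) n"
definition mcoef :: "nat \<Rightarrow> complex \<Rightarrow> complex" where "mcoef n s = (\<Sum>j=1..n. dcoef n j s)"

lemma mcoef_nth: "fps_nth (mser s) n = mcoef n s"
proof -
  have g: "fps_nth (fps_X / (1 - fps_X) :: complex fps) i = (if i = 0 then 0 else 1)" for i
    by (simp add: fps_divide_unit fps_inverse_gp'[symmetric] fps_X_mult_nth  flip: fps_inverse_gp)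
  have "fps_nth (mser s) n = (\<Sum>i=0..n. (if i = 0 then 0 else 1) * fps_nth (qser s ^ i) n)"
    unfolding mser_def fps_compose_nth g ..
  also have "\<dots> = (\<Sum>i=1..n. fps_nth (qser s ^ i) n)" by (simp add: sum.atLeast_Suc_atMost)
  finally show ?thesis by (simp add: mcoef_def dcoef_def)
qed

text \<open>The coefficient of order n in the equation for the j-th power of \<open>qser\<close>;
  the operator z d/dz multiplies coefficients by their index, which yields the factors n and n -
  k.\<close>

theorem dcoef_ode: "(dcoef n j has_field_derivative (- of_nat n * dcoef n j s - 2 * (\<Sum>k=1..n. of_nat (n - k) * mcoef k s * dcoef (n - k) j s))) (at s)"
proof -
  have "fps_ode (\<lambda>s. qser s ^ j) (\<lambda>s. of_nat j * qser s ^ (j - 1) * (- (fps_X * fps_deriv (qser s) * (1 + 2 * mser s))))"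
    by (rule fps_ode_power[OF fps_ode_qser])
  then have d: "(dcoef n j has_field_derivative fps_nth (of_nat j * qser s ^ (j - 1) * (- (fps_X * fps_deriv (qser s) * (1 + 2 * mser s)))) n) (at s)"
    unfolding fps_ode_def dcoef_def[abs_def] by blast
  have e: "of_nat j * qser s ^ (j - 1) * (- (fps_X * fps_deriv (qser s) * (1 + 2 * mser s)))
     = - (fps_X * fps_deriv (qser s ^ j)) - 2 * (mser s * (fps_X * fps_deriv (qser s ^ j)))"
    by (simp add: fps_deriv_power fps_of_nat algebra_simps)
  have x: "fps_nth (fps_X * fps_deriv (qser s ^ j)) i = of_nat i * dcoef i j s" for i
    by (cases i) (simp_all add: dcoef_def)
  have m: "fps_nth (2 * (mser s * (fps_X * fps_deriv (qser s ^ j)))) n = 2 * (\<Sum>k=1..n. of_nat (n - k) * mcoef k s * dcoef (n - k) j s)"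
  proof -
    have "fps_nth (mser s * (fps_X * fps_deriv (qser s ^ j))) n = (\<Sum>k=0..n. mcoef k s * (of_nat (n - k) * dcoef (n - k) j s))"
      unfolding fps_mult_nth[of "mser s"] x mcoef_nth ..
    also have "\<dots> = (\<Sum>k=1..n. of_nat (n - k) * mcoef k s * dcoef (n - k) j s)"
      by (simp add: sum.atLeast_Suc_atMost mcoef_def mult_ac)
    finally show ?thesis by (simp add: numeral_fps_const)
  qed
  have "fps_nth (of_nat j * qser s ^ (j - 1) * (- (fps_X * fps_deriv (qser s) * (1 + 2 * mser s)))) n
    = - of_nat n * dcoef n j s - 2 * (\<Sum>k=1..n. of_nat (n - k) * mcoef k s * dcoef (n - k) j s)"
    unfolding e fps_sub_nth fps_neg_nth x m by simp
  with d show ?thesis by (simp only:)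
qed

theorem mcoef_ode: "(mcoef n has_field_derivative (- of_nat n * mcoef n s - 2 * (\<Sum>k=1..n. of_nat (n - k) * mcoef k s * mcoef (n - k) s))) (at s)"
proof -
  have z: "dcoef i j s = 0" if "i < j" for i j s
    unfolding dcoef_def using startsby_zero_power_prefix[OF qser_compose(3)[of s]] that by blast
  \<comment> \<open>The j-th power of \<open>qser\<close> starts at order j, so the range of j can
    be taken up to n for all i <= n, and the sums over j and k can be exchanged.\<close>
  have m: "mcoef i s = (\<Sum>j=1..n. dcoef i j s)" if "i \<le> n" for i s
    unfolding mcoef_def by (rule sum.mono_neutral_left) (use that z in auto)
  have "(mcoef n has_field_derivative (\<Sum>j=1..n. - of_nat n * dcoef n j s - 2 * (\<Sum>k=1..n. of_nat (n - k) * mcoef k s * dcoef (n - k) j s))) (at s)"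
  proof -
    have "mcoef n = (\<lambda>s. \<Sum>j=1..n. dcoef n j s)" by (rule ext) (rule mcoef_def)
    then show ?thesis by (simp only:) (intro DERIV_sum dcoef_ode)
  qed
  moreover have "(\<Sum>j=1..n. \<Sum>k=1..n. of_nat (n - k) * mcoef k s * dcoef (n - k) j s) = (\<Sum>k=1..n. of_nat (n - k) * mcoef k s * mcoef (n - k) s)"
    by (subst sum.swap) (simp add: m sum_distrib_left)
  moreover have "(\<Sum>j=1..n. - of_nat n * dcoef n j s - 2 * (\<Sum>k=1..n. of_nat (n - k) * mcoef k s * dcoef (n - k) j s))
    = - of_nat n * mcoef n s - 2 * (\<Sum>j=1..n. \<Sum>k=1..n. of_nat (n - k) * mcoef k s * dcoef (n - k) j s)"
    by (simp only: sum_subtractf sum_distrib_left mcoef_def[of n])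
  ultimately show ?thesis by (simp only:)
qed

lemma dcoef_0: "dcoef n j 0 = (if n = j then 1 else 0)"
  by (simp add: dcoef_def qser_0 fps_X_power_nth)

lemma mcoef_0: "n \<ge> 1 \<Longrightarrow> mcoef n 0 = 1"
  by (simp add: mcoef_def dcoef_0 cong: if_cong)

text \<open>The coefficient matrices of the powers of a series and of the powers of its
  compositional inverse are triangular and inverse to each other.\<close>

lemma hser_dcoef: "(\<Sum>k\<le>n. fps_nth (hser s ^ k) n * dcoef k j s) = (if n = j then 1 else 0)"
proof -
  have "(qser s ^ j) oo hser s = fps_X ^ j" using qser_compose(1)[of s] hser_nth by (simp add: fps_compose_power[symmetric])
  then have "fps_nth ((qser s ^ j) oo hser s) n = (if n = j then 1 else 0)" by (simp add: fps_X_power_nth)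
  then show ?thesis by (simp add: fps_compose_nth dcoef_def atLeast0AtMost mult.commute)
qed

section \<open>The free Segal--Bargmann transform\<close>

lemma hser_expansion: "(\<lambda>z. z * exp (s * (1 + z) / (1 - z))) has_fps_expansion hser s"
proof -
  define B where "B = (2::complex fps) * (fps_X / (1 - fps_X))"
  have nz: "fps_nth (1 - fps_X :: complex fps) 0 \<noteq> 0" by simp
  have b: "(\<lambda>z::complex. 2 * (z * inverse (1 - z))) has_fps_expansion 2 * (fps_X * inverse (1 - fps_X))"
    by (intro fps_expansion_intros) auto
  have B: "B = 2 * (fps_X * inverse (1 - fps_X))" unfolding B_def using nz by (simp add: fps_divide_unit)
  have "((\<lambda>w. exp (s * w)) \<circ> (\<lambda>z. 2 * (z * inverse (1 - z)))) has_fps_expansion (fps_exp s oo B)"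
    unfolding B by (rule has_fps_expansion_compose[OF has_fps_expansion_exp b]) simp
  then have "(\<lambda>z. exp s * z * exp (s * (2 * (z * inverse (1 - z))))) has_fps_expansion hser s"
    unfolding hser_def segal_A_alt(2) B_def[symmetric] o_def by (intro fps_expansion_intros)
  then show ?thesis
  proof (rule has_fps_expansion_cong[THEN iffD1, OF _ refl, rotated])
   show "\<forall>\<^sub>F z in nhds 0. exp s * z * exp (s * (2 * (z * inverse (1 - z)))) = z * exp (s * (1 + z) / (1 - z))"
  proof -
    have "\<forall>\<^sub>F z in nhds 0. z \<in> - {1::complex}" by (rule eventually_nhds_in_open) auto
    then show ?thesis
    proof eventually_elim
      case (elim z)
      then have "1 - z \<noteq> 0" by auto
      then have "s + s * (2 * (z * inverse (1 - z))) = s * (1 + z) / (1 - z)" by (simp add: field_simps)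
      then have "exp s * exp (s * (2 * (z * inverse (1 - z)))) = exp (s * (1 + z) / (1 - z))" by (simp add: exp_add[symmetric])
      then show ?case by (simp add: mult_ac)
    qed
  qed
  qed
qed

definition Pp :: "real \<Rightarrow> nat \<Rightarrow> complex poly" where
  "Pp t n = (\<Sum>k\<le>n. monom (fps_nth (hser (of_real (t/2)) ^ k) n) k)"

text \<open>Expand the geometric series 1/(1 - h x) in powers of h. Since h vanishes at 0, its k-th
  power contributes to order n only for k <= n, and the coefficient is a polynomial in x.\<close>

lemma Pfun_eq: "Pfun t n x = poly (Pp t n) x"
proof -
  define s :: complex where "s = of_real (t/2)"
  let ?h = "\<lambda>z. z * exp (s * (1 + z) / (1 - z))"
  have "(\<lambda>z. inverse (1 - ?h z * x)) has_fps_expansion inverse (1 - hser s * fps_const x)"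
    by (intro fps_expansion_intros hser_expansion) (simp add: hser_nth)
  then have "fps_nth (inverse (1 - hser s * fps_const x)) n = (deriv ^^ n) (\<lambda>z. inverse (1 - ?h z * x)) 0 / fact n"
    by (rule fps_nth_fps_expansion)
  then have "Pfun t n x = fps_nth (inverse (1 - hser s * fps_const x)) n"
    unfolding Pfun_def s_def inverse_eq_divide of_nat_fact by (rule sym)
  also have "inverse (1 - hser s * fps_const x) = inverse (1 - fps_X) oo (hser s * fps_const x)"
    by (subst fps_inverse_compose) (simp_all add: hser_nth fps_compose_sub_distrib)
  also have "inverse (1 - fps_X :: complex fps) = Abs_fps (\<lambda>n. 1)"
    unfolding fps_inverse_gp'[symmetric] by (rule fps_inverse_idempotent) simp
  also have "fps_nth (Abs_fps (\<lambda>n. 1) oo (hser s * fps_const x)) n = (\<Sum>k=0..n. fps_nth ((hser s * fps_const x) ^ k) n)"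
    by (simp add: fps_compose_nth)
  also have "\<dots> = (\<Sum>k\<le>n. fps_nth (hser s ^ k) n * x ^ k)"
    by (simp add: power_mult_distrib fps_const_power atLeast0AtMost)
  finally show ?thesis by (simp add: Pp_def s_def poly_sum poly_monom)
qed

lemma Pt_eq: "Pt t n = Pp t n"
  unfolding Pt_def
proof (rule the_equality)
  fix p :: "complex poly" assume "\<forall>x. poly p x = Pfun t n x"
  then have "poly p = poly (Pp t n)" unfolding Pfun_eq by (intro ext) simp
  then show "p = Pp t n" by (simp add: poly_eq_poly_eq_iff)
qed (simp add: Pfun_eq)

lemma coeff_Pp: "coeff (Pp t n) k = (if k \<le> n then fps_nth (hser (of_real (t/2)) ^ k) n else 0)"
  by (simp add: Pp_def coeff_sum if_distrib cong: if_cong)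

lemma lead_Pp: "coeff (Pp t n) n \<noteq> 0"
  using startsby_zero_power_nth_same[of "hser (of_real (t/2))" n] by (simp add: coeff_Pp hser_nth)

section \<open>The transform \<open>Gt\<close> in coefficients, for both letters at once\<close>

definition sgnpow :: "bool \<Rightarrow> nat \<Rightarrow> int" where "sgnpow x n = (if x then int n else - int n)"

definition lpx :: "bool \<Rightarrow> complex poly \<Rightarrow> lpoly" where "lpx x p = (if x then lp_X p else lp_Xinv p)"

lemma lookup_lsmult: "lkp (lsmult c P) k = c * lkp P k"
  by (simp add: lsmult_def map.rep_eq when_def)

lemma lookup_lpx: "lkp (lpx x p) k = (if (if x then 0 \<le> k else k \<le> 0) then coeff p (nat (abs k)) else 0)"
proof -
  have "finite {k::int. (if 0 \<le> k then coeff p (nat k) else 0) \<noteq> 0}"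
    by (rule finite_subset[of _ "int ` {..degree p}"]) (auto split: if_splits dest!: le_degree intro!: image_eqI[of _ int "nat _"])
  moreover have "finite {k::int. (if k \<le> 0 then coeff p (nat (- k)) else 0) \<noteq> 0}"
    by (rule finite_subset[of _ "(\<lambda>n. - int n) ` {..degree p}"]) (auto split: if_splits dest!: le_degree intro!: image_eqI[of _ "\<lambda>n. - int n" "nat _"])
  ultimately show ?thesis by (simp add: lpx_def lp_X_def lp_Xinv_def lookup_Abs_poly_mapping)
qed

lemma sgnpow_cases: obtains x n where "k = sgnpow x n"
proof (cases "k \<ge> 0")
  case True then show ?thesis using that[of True "nat k"] by (simp add: sgnpow_def)
next
  case False then show ?thesis using that[of False "nat (- k)"] by (simp add: sgnpow_def)
qed

lemma lpx_Pp: "lpx x (Pp t n) = (\<Sum>k\<le>n. Poly_Mapping.single (sgnpow x k) (coeff (Pp t n) k))"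
proof (rule poly_mapping_eqI)
  fix l
  obtain y m where l: "l = sgnpow y m" by (rule sgnpow_cases)
  show "lkp (lpx x (Pp t n)) l = lkp (\<Sum>k\<le>n. Poly_Mapping.single (sgnpow x k) (coeff (Pp t n) k)) l"
  proof (cases "if x then 0 \<le> l else l \<le> 0")
    case True
    have "(sgnpow x k = l) = (k = nat \<bar>l\<bar>)" for k using True by (auto simp: sgnpow_def split: if_splits)
    then have "(\<Sum>k\<le>n. lkp (Poly_Mapping.single (sgnpow x k) (coeff (Pp t n) k)) l) = (\<Sum>k\<le>n. if k = nat \<bar>l\<bar> then coeff (Pp t n) k else 0)"
      by (simp add: lookup_single when_def)
    also have "\<dots> = coeff (Pp t n) (nat \<bar>l\<bar>)" by (simp add: coeff_Pp)
    finally show ?thesis using True by (simp add: lookup_lpx lookup_sum)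
  next
    case False
    then have "sgnpow x k \<noteq> l" for k by (auto simp: sgnpow_def split: if_splits)
    then show ?thesis using False by (simp add: lookup_lpx lookup_sum lookup_single)
  qed
qed

definition gsym :: "real \<Rightarrow> int \<Rightarrow> lpoly" where
  "gsym t k = (\<Sum>j\<le>nat \<bar>k\<bar>. Poly_Mapping.single (sgnpow (0 \<le> k) j) (dcoef (nat \<bar>k\<bar>) j (of_real (t/2))))"

definition GtL :: "real \<Rightarrow> lpoly \<Rightarrow> lpoly" where
  "GtL t P = (\<Sum>k\<in>kys P. lsmult (lkp P k) (gsym t k))"

lemma lsmult_simps: "lsmult 0 P = 0" "lsmult (a + b) P = lsmult a P + lsmult b P" "lsmult (a * b) P = lsmult a (lsmult b P)"
  "lsmult a (P + Q) = lsmult a P + lsmult a Q" "lsmult 1 P = P" "lsmult a 0 = 0" "lsmult c (Poly_Mapping.single k a) = Poly_Mapping.single k (c * a)"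
  by (rule poly_mapping_eqI, simp add: lookup_lsmult lookup_add lookup_single when_def algebra_simps)+

lemma lsmult_sum: "lsmult c (\<Sum>i\<in>I. f i) = (\<Sum>i\<in>I. lsmult c (f i))"
  by (induction I rule: infinite_finite_induct) (auto simp: lsmult_simps)

lemma GtL_superset: "finite B \<Longrightarrow> kys P \<subseteq> B \<Longrightarrow> GtL t P = (\<Sum>k\<in>B. lsmult (lkp P k) (gsym t k))"
  unfolding GtL_def by (rule sum.mono_neutral_left) (auto simp: in_keys_iff lsmult_simps)

lemma GtL_add: "GtL t (P + Q) = GtL t P + GtL t Q"
proof -
  let ?B = "kys P \<union> kys Q"
  have "GtL t (P + Q) = (\<Sum>k\<in>?B. lsmult (lkp (P + Q) k) (gsym t k))"
    by (rule GtL_superset) (use Poly_Mapping.keys_add[of P Q] in auto)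
  also have "\<dots> = (\<Sum>k\<in>?B. lsmult (lkp P k) (gsym t k)) + (\<Sum>k\<in>?B. lsmult (lkp Q k) (gsym t k))"
    by (simp add: lookup_add lsmult_simps sum.distrib)
  also have "\<dots> = GtL t P + GtL t Q" using GtL_superset[of ?B P t] GtL_superset[of ?B Q t] by simp
  finally show ?thesis .
qed

lemma GtL_lsmult: "GtL t (lsmult c P) = lsmult c (GtL t P)"
proof -
  have "GtL t (lsmult c P) = (\<Sum>k\<in>kys P. lsmult (lkp (lsmult c P) k) (gsym t k))"
    by (rule GtL_superset) (auto simp: in_keys_iff lookup_lsmult)
  then show ?thesis by (simp add: lookup_lsmult lsmult_simps GtL_def lsmult_sum)
qed

lemma gsym_sgnpow: "gsym t (sgnpow x n) = (\<Sum>j\<le>n. Poly_Mapping.single (sgnpow x j) (dcoef n j (of_real (t/2))))"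
  by (cases "n = 0") (auto simp: gsym_def sgnpow_def)

lemma GtL_single: "GtL t (Poly_Mapping.single k c) = lsmult c (gsym t k)"
  using GtL_superset[of "{k}" "Poly_Mapping.single k c" t] by simp

lemma GtL_sum: "GtL t (\<Sum>i\<in>I. f i) = (\<Sum>i\<in>I. GtL t (f i))"
  by (induction I rule: infinite_finite_induct) (auto simp: GtL_add, simp_all add: GtL_def)

lemma dcoef_gt: "i < j \<Longrightarrow> dcoef i j s = 0"
  unfolding dcoef_def using startsby_zero_power_prefix[OF qser_compose(3)[of s]] by blast

lemma single_sum: "(\<Sum>i\<in>I. Poly_Mapping.single k (f i)) = Poly_Mapping.single k (\<Sum>i\<in>I. f i)"
  by (induction I rule: infinite_finite_induct) (auto simp: single_add)

text \<open>P_n collects coefficients of powers of \<open>hser\<close>, \<open>gsym\<close> those of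
  powers of \<open>qser\<close>; the double sum is the product of the two inverse triangular
  matrices.\<close>

lemma GtL_Pp: "GtL t (lpx x (Pp t n)) = Poly_Mapping.single (sgnpow x n) 1"
proof -
  let ?d = "\<lambda>k j. dcoef k j (of_real (t/2))"
  have "GtL t (lpx x (Pp t n)) = (\<Sum>k\<le>n. \<Sum>j\<le>k. Poly_Mapping.single (sgnpow x j) (coeff (Pp t n) k * ?d k j))"
    by (simp add: lpx_Pp GtL_sum GtL_single gsym_sgnpow lsmult_sum lsmult_simps)
  also have "\<dots> = (\<Sum>k\<le>n. \<Sum>j\<le>n. Poly_Mapping.single (sgnpow x j) (coeff (Pp t n) k * ?d k j))"
    by (intro sum.cong[OF refl] sum.mono_neutral_left) (auto simp: dcoef_gt)
  also have "\<dots> = (\<Sum>j\<le>n. \<Sum>k\<le>n. Poly_Mapping.single (sgnpow x j) (coeff (Pp t n) k * ?d k j))" by (rule sum.swap)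
  also have "\<dots> = (\<Sum>j\<le>n. Poly_Mapping.single (sgnpow x j) (if n = j then 1 else 0))"
  proof (unfold single_sum, rule sum.cong[OF refl], rule arg_cong[where f = "Poly_Mapping.single _"])
    fix j
    have "(\<Sum>k\<le>n. coeff (Pp t n) k * ?d k j) = (\<Sum>k\<le>n. fps_nth (hser (of_real (t/2)) ^ k) n * ?d k j)"
      by (rule sum.cong) (simp_all add: coeff_Pp)
    then show "(\<Sum>k\<le>n. coeff (Pp t n) k * ?d k j) = (if n = j then 1 else 0)" by (simp only: hser_dcoef)
  qed
  also have "\<dots> = (\<Sum>j\<le>n. if n = j then Poly_Mapping.single (sgnpow x j) 1 else 0)" by (intro sum.cong) auto
  also have "\<dots> = Poly_Mapping.single (sgnpow x n) 1" by simp
  finally show ?thesis .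
qed

text \<open>P_n has degree exactly n, so a triangular recursion recovers the monomials of either
  letter from the P_n, and the values on the P_n determine a linear map. The conditions for the two
  letters agree at n = 0.\<close>

theorem Gt_eq: "Gt t = GtL t"
  unfolding Gt_def Pt_eq
proof (rule the_equality)
  have "lp_X p = lpx True p" "lp_Xinv p = lpx False p" for p by (simp_all add: lpx_def)
  then show "(\<forall>p q. GtL t (p + q) = GtL t p + GtL t q) \<and> (\<forall>c p. GtL t (lsmult c p) = lsmult c (GtL t p)) \<and>
     (\<forall>n. GtL t (lp_X (Pp t n)) = Poly_Mapping.single (int n) 1) \<and> (\<forall>n. GtL t (lp_Xinv (Pp t n)) = Poly_Mapping.single (- int n) 1)"
    by (simp add: GtL_add GtL_lsmult GtL_Pp sgnpow_def)
next
  fix L :: "lpoly \<Rightarrow> lpoly"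
  assume "(\<forall>p q. L (p + q) = L p + L q) \<and> (\<forall>c p. L (lsmult c p) = lsmult c (L p)) \<and>
     (\<forall>n. L (lp_X (Pp t n)) = Poly_Mapping.single (int n) 1) \<and> (\<forall>n. L (lp_Xinv (Pp t n)) = Poly_Mapping.single (- int n) 1)"
  then have La: "L (p + q) = L p + L q" and Lc: "L (lsmult c p) = lsmult c (L p)"
    and Lx: "L (lpx x (Pp t n)) = Poly_Mapping.single (sgnpow x n) 1" for p q c x n by (auto simp: lpx_def sgnpow_def)
  have L0: "L 0 = 0" using Lc[of 0 0] by (simp add: lsmult_simps)
  have Ls: "L (\<Sum>i\<in>I. f i) = (\<Sum>i\<in>I. L (f i))" for I :: "'z set" and f
    by (induction I rule: infinite_finite_induct) (auto simp: La L0)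
  have sg: "L (Poly_Mapping.single (sgnpow x n) c) = GtL t (Poly_Mapping.single (sgnpow x n) c)" for x n c
  proof (induction n arbitrary: c rule: less_induct)
    case (less n)
    define a where "a = coeff (Pp t n) n"
    have a: "a \<noteq> 0" using lead_Pp by (simp add: a_def)
    have split: "lpx x (Pp t n) = (\<Sum>k<n. Poly_Mapping.single (sgnpow x k) (coeff (Pp t n) k)) + Poly_Mapping.single (sgnpow x n) a"
      unfolding lpx_Pp a_def by (simp add: lessThan_Suc_atMost[symmetric])
    have eq: "L (\<Sum>k<n. Poly_Mapping.single (sgnpow x k) (coeff (Pp t n) k)) = GtL t (\<Sum>k<n. Poly_Mapping.single (sgnpow x k) (coeff (Pp t n) k))"
      unfolding Ls GtL_sum by (intro sum.cong refl less) auto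
    have "L (lpx x (Pp t n)) = GtL t (lpx x (Pp t n))" unfolding Lx GtL_Pp ..
    then have e: "L (Poly_Mapping.single (sgnpow x n) a) = GtL t (Poly_Mapping.single (sgnpow x n) a)"
      unfolding split La GtL_add eq by (rule add_left_imp_eq)
    have c: "Poly_Mapping.single (sgnpow x n) c = lsmult (c / a) (Poly_Mapping.single (sgnpow x n) a)" using a by (simp add: lsmult_simps)
    show ?case unfolding c Lc GtL_lsmult e ..
  qed
  show "L = GtL t"
  proof
    fix P :: lpoly
    have P: "P = (\<Sum>k\<in>kys P. Poly_Mapping.single k (lkp P k))"
      by (rule poly_mapping_eqI) (auto simp: lookup_sum lookup_single when_def in_keys_iff)
    have "L (\<Sum>k\<in>kys P. Poly_Mapping.single k (lkp P k)) = GtL t (\<Sum>k\<in>kys P. Poly_Mapping.single k (lkp P k))"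
      unfolding Ls GtL_sum
    proof (intro sum.cong refl)
      fix k
      obtain x n where "k = sgnpow x n" by (rule sgnpow_cases)
      then show "L (Poly_Mapping.single k (lkp P k)) = GtL t (Poly_Mapping.single k (lkp P k))" using sg by simp
    qed
    then show "L P = GtL t P" using P by simp
  qed
qed

section \<open>\<open>DeltaU\<close> on symbols in a single letter\<close>

lemma sum_offdiag:
  fixes f :: "nat \<Rightarrow> complex"
  shows "(\<Sum>(i,j)\<in>{(i,j). i < j \<and> j < n}. f (j - i)) = (\<Sum>k=1..n. of_nat (n - k) * f k)"
proof (induction n)
  case (Suc n)
  have s: "{(i,j). i < j \<and> j < Suc n} = {(i,j). i < j \<and> j < n} \<union> (\<lambda>i. (i,n)) ` {..<n}" by auto
  have fin: "finite {(i,j). i < j \<and> j < n}" by (rule finite_subset[of _ "{..<n} \<times> {..<n}"]) auto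
  have "(\<Sum>(i,j)\<in>{(i,j). i < j \<and> j < Suc n}. f (j - i)) = (\<Sum>(i,j)\<in>{(i,j). i < j \<and> j < n}. f (j - i)) + (\<Sum>(i,j)\<in>(\<lambda>i. (i,n)) ` {..<n}. f (j - i))"
    unfolding s by (rule sum.union_disjoint) (use fin in auto)
  also have "(\<Sum>(i,j)\<in>(\<lambda>i. (i,n)) ` {..<n}. f (j - i)) = (\<Sum>i<n. f (n - i))"
    by (subst sum.reindex) (auto simp: inj_on_def)
  also have "\<dots> = (\<Sum>k=1..n. f k)"
    by (rule sum.reindex_bij_witness[of _ "\<lambda>k. n - k" "\<lambda>i. n - i"]) auto
  also have "(\<Sum>(i,j)\<in>{(i,j). i < j \<and> j < n}. f (j - i)) + (\<Sum>k=1..n. f k) = (\<Sum>k=1..n. of_nat (Suc n - k) * f k)"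
    unfolding Suc.IH sum.distrib[symmetric] by (intro sum.cong refl) (simp add: Suc_diff_le algebra_simps)
  finally show ?case by simp
qed simp

lemma replicate_of_subset: "set w \<subseteq> {x} \<Longrightarrow> w = replicate (length w) x"
  by (simp add: replicate_eqI subset_iff)

lemma set_lft: "set (lft x) \<subseteq> {x}" and set_rgt: "set (rgt x) \<subseteq> {x}"
  by (cases x; simp add: lft_def rgt_def)+

text \<open>In a one-letter word a pair at distance k cuts out a subword of length k, whichever
  letter it is, and n - k pairs have that distance. Signs square to 1, so X and its inverse obey the
  same formula.\<close>

lemma lin_DeltaU_word_replicate:
  "lin h (DeltaU_word (replicate n x)) = - of_nat n * h (replicate n x, {#})
     - 2 * (\<Sum>k=1..n. of_nat (n - k) * h (replicate (n - k) x, trm (replicate k x)))"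
proof -
  let ?w = "replicate n x"
  let ?I = "{(i,j). i < j \<and> j < length ?w}"
  have e: "take i ?w @ lft (?w ! i) @ rgt (?w ! j) @ drop (Suc j) ?w = replicate (n - (j - i)) x"
    "rgt (?w ! i) @ take (j - Suc i) (drop (Suc i) ?w) @ lft (?w ! j) = replicate (j - i) x" if "i < j" "j < n" for i j
  proof -
    have lr: "set (lft (?w ! k)) \<subseteq> {x}" "set (rgt (?w ! k)) \<subseteq> {x}" if "k < n" for k
      unfolding List.nth_replicate[OF that] by (rule set_lft set_rgt)+
    have s: "set (take i ?w @ lft (?w ! i) @ rgt (?w ! j) @ drop (Suc j) ?w) \<subseteq> {x}"
       "set (rgt (?w ! i) @ take (j - Suc i) (drop (Suc i) ?w) @ lft (?w ! j)) \<subseteq> {x}"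
      using lr[of i] lr[of j] that by (simp_all add: set_replicate_conv_if)
    have l: "length (take i ?w @ lft (?w ! i) @ rgt (?w ! j) @ drop (Suc j) ?w) = n - (j - i)"
      "length (rgt (?w ! i) @ take (j - Suc i) (drop (Suc i) ?w) @ lft (?w ! j)) = j - i"
      using that by (cases x; simp add: lft_def rgt_def)+
    show "take i ?w @ lft (?w ! i) @ rgt (?w ! j) @ drop (Suc j) ?w = replicate (n - (j - i)) x"
      by (rule replicate_of_subset[OF s(1), unfolded l])
    show "rgt (?w ! i) @ take (j - Suc i) (drop (Suc i) ?w) @ lft (?w ! j) = replicate (j - i) x"
      by (rule replicate_of_subset[OF s(2), unfolded l])
  qed
  have "lin h (DeltaU_word ?w) = - of_nat n * h (?w, {#}) + (\<Sum>(i,j)\<in>?I. - 2 * h (replicate (n - (j - i)) x, trm (replicate (j - i) x)))"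
    unfolding DeltaU_word_def lin_add lin_sum
  proof (intro arg_cong2[where f = "(+)"] sum.cong refl)
    fix p assume p: "p \<in> ?I"
    obtain i j where ij: "p = (i,j)" by fastforce
    have eps: "- 2 * eps (?w ! i) * eps (?w ! j) = - 2" using p ij by (simp add: eps_def)
    have l: "i < j" "j < n" using p ij by auto
    show "lin h (case p of (i, j) \<Rightarrow> Poly_Mapping.single
          (take i ?w @ lft (?w ! i) @ rgt (?w ! j) @ drop (Suc j) ?w,
           trm (rgt (?w ! i) @ take (j - Suc i) (drop (Suc i) ?w) @ lft (?w ! j)))
          (- 2 * eps (?w ! i) * eps (?w ! j))) = (case p of (i,j) \<Rightarrow> - 2 * h (replicate (n - (j - i)) x, trm (replicate (j - i) x)))"
      unfolding ij prod.case lin_single e[OF l] eps ..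
  qed simp
  also have "(\<Sum>(i,j)\<in>?I. - 2 * h (replicate (n - (j - i)) x, trm (replicate (j - i) x))) =
     (\<Sum>k=1..n. of_nat (n - k) * (- 2 * h (replicate (n - k) x, trm (replicate k x))))"
    using sum_offdiag[of "\<lambda>k. - 2 * h (replicate (n - k) x, trm (replicate k x))" n] by (simp only: length_replicate)
  finally show ?thesis by (simp add: sum_distrib_left sum_negf mult_ac)
qed

lemma lin_DeltaU_sym_split: "lin h (DeltaU_sym (w,S)) = lin (\<lambda>b. h (case b of (v,T) \<Rightarrow> (v, T + S))) (DeltaU_word w)
   + (\<Sum>M\<in>#S. lin (\<lambda>b. h (case b of (v,T) \<Rightarrow> (w, (S - {#M#}) + T + trm v))) (DeltaU_word M))"
  unfolding DeltaU_sym_def prod.case lin_add lin_sum_mset lin_tmapkeys ..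

definition mM :: "complex \<Rightarrow> word multiset \<Rightarrow> complex" where
  "mM s S = prod_mset (image_mset (\<lambda>M. mcoef (length M) s) S)"

lemma mM_simps [simp]: "mM s {#} = 1" "mM s (add_mset M S) = mcoef (length M) s * mM s S" "mM s (S + T) = mM s S * mM s T"
  by (simp_all add: mM_def)

lemma mM_trm: "w \<noteq> [] \<Longrightarrow> mM s (trm w) = mcoef (length w) s"
  by (simp add: trm_def)

definition mder :: "nat \<Rightarrow> complex \<Rightarrow> complex" where
  "mder n s = - of_nat n * mcoef n s - 2 * (\<Sum>k=1..n. of_nat (n - k) * mcoef k s * mcoef (n - k) s)"

lemma mM_deriv: "((\<lambda>s. mM s S) has_field_derivative (\<Sum>M\<in>#S. mder (length M) s * mM s (S - {#M#}))) (at s)"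
proof (induction S)
  case (add M S)
  have "((\<lambda>s. mcoef (length M) s * mM s S) has_field_derivative
     mder (length M) s * mM s S + (\<Sum>M\<in>#S. mder (length M) s * mM s (S - {#M#})) * mcoef (length M) s) (at s)"
    by (rule DERIV_mult[OF _ add]) (use mcoef_ode[of "length M" s] in \<open>simp add: mder_def\<close>)
  moreover have "(\<Sum>M'\<in>#S. mder (length M') s * mM s (S - {#M'#})) * mcoef (length M) s = (\<Sum>M'\<in>#S. mder (length M') s * mM s (add_mset M S - {#M'#}))"
    unfolding sum_mset_distrib_right
  proof (intro arg_cong[where f = sum_mset] image_mset_cong)
    fix M' assume "M' \<in># S"
    then have "add_mset M S - {#M'#} = add_mset M (S - {#M'#})" by simp
    then show "mder (length M') s * mM s (S - {#M'#}) * mcoef (length M) s = mder (length M') s * mM s (add_mset M S - {#M'#})"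
      by (simp only: mM_simps) (simp only: mult_ac)
  qed
  ultimately show ?case by simp
qed simp

text \<open>\<open>e x j\<close> is an arbitrary value for the j-th power of the letter x, and w is
  read as a power of its first letter. For the empty word only j = 0 contributes, with an
  unspecified letter; in the application \<open>e x 0\<close> is the same for both letters.\<close>

definition RW :: "(bool \<Rightarrow> nat \<Rightarrow> complex) \<Rightarrow> nat \<Rightarrow> complex \<Rightarrow> word \<Rightarrow> complex" where
  "RW e D s w = (\<Sum>j\<le>D. dcoef (length w) j s * e (hd w) j)"

text \<open>For symbols of degree at most D, the value at s = 0 sets every trace to 1 and the word
  to \<open>e\<close>; with growing s the functional moves dually to exp(s
  \<open>DeltaU\<close>).\<close>

definition RR :: "(bool \<Rightarrow> nat \<Rightarrow> complex) \<Rightarrow> nat \<Rightarrow> complex \<Rightarrow> tsym \<Rightarrow> complex" where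
  "RR e D s b = RW e D s (fst b) * mM s (snd b)"

lemma RW_deriv: "((\<lambda>s. RW e D s (replicate n x)) has_field_derivative
   (- of_nat n * RW e D s (replicate n x) - 2 * (\<Sum>k=1..n. of_nat (n - k) * (mcoef k s * RW e D s (replicate (n - k) x))))) (at s)"
proof -
  let ?a = "e (hd (replicate n x))"
  have "((\<lambda>s. \<Sum>j\<le>D. dcoef n j s * ?a j) has_field_derivative
    (\<Sum>j\<le>D. (- of_nat n * dcoef n j s - 2 * (\<Sum>k=1..n. of_nat (n - k) * mcoef k s * dcoef (n - k) j s)) * ?a j)) (at s)"
    by (intro DERIV_sum DERIV_cmult_right dcoef_ode)
  moreover have "(\<Sum>j\<le>D. (- of_nat n * dcoef n j s - 2 * (\<Sum>k=1..n. of_nat (n - k) * mcoef k s * dcoef (n - k) j s)) * ?a j)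
     = - of_nat n * RW e D s (replicate n x) - 2 * (\<Sum>j\<le>D. \<Sum>k=1..n. of_nat (n - k) * (mcoef k s * (dcoef (n - k) j s * ?a j)))"
    by (simp add: RW_def sum_subtractf sum_distrib_left sum_distrib_right left_diff_distrib mult.assoc sum_negf)
  moreover have "(\<Sum>j\<le>D. \<Sum>k=1..n. of_nat (n - k) * (mcoef k s * (dcoef (n - k) j s * ?a j))) = (\<Sum>k=1..n. of_nat (n - k) * (mcoef k s * RW e D s (replicate (n - k) x)))"
  proof (subst sum.swap, intro sum.cong refl)
    fix k assume k: "k \<in> {1..n}"
    show "(\<Sum>j\<le>D. of_nat (n - k) * (mcoef k s * (dcoef (n - k) j s * ?a j))) = of_nat (n - k) * (mcoef k s * RW e D s (replicate (n - k) x))"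
    proof (cases "k = n")
      case False
      then have "hd (replicate (n - k) x) = hd (replicate n x)" using k by simp
      then show ?thesis by (simp add: RW_def sum_distrib_left)
    qed simp
  qed
  ultimately show ?thesis by (simp add: RW_def)
qed

definition pureB :: "nat \<Rightarrow> tsym set" where
  "pureB d = {b \<in> Bd d. \<exists>x. set (fst b) \<subseteq> {x} \<and> (\<forall>M\<in>#snd b. set M \<subseteq> {x})}"

text \<open>On symbols in a single letter, the derivation \<open>DeltaU_sym\<close> reproduces the differential
  equations of the coefficients of the inverse series.\<close>

lemma RR_deriv:
  assumes "b \<in> pureB d"
  shows "((\<lambda>s. RR e D s b) has_field_derivative lin (RR e D s) (DeltaU_sym b)) (at s)"
proof -
  obtain w S where b: "b = (w,S)" by fastforce
  obtain x where x: "set w \<subseteq> {x}" "\<And>M. M \<in># S \<Longrightarrow> set M \<subseteq> {x}" using assms by (auto simp: pureB_def b)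
  define n where "n = length w"
  have w: "w = replicate n x" unfolding n_def by (rule replicate_of_subset[OF x(1)])
  have nz: "replicate k x \<noteq> []" if "k \<ge> 1" for k using that by (cases k) auto
  have 1: "lin (\<lambda>b. RR e D s (case b of (v,T) \<Rightarrow> (v, T + S))) (DeltaU_word w) =
     (- of_nat n * RW e D s (replicate n x) - 2 * (\<Sum>k=1..n. of_nat (n - k) * (mcoef k s * RW e D s (replicate (n - k) x)))) * mM s S"
  proof -
    have "lin (\<lambda>b. RR e D s (case b of (v,T) \<Rightarrow> (v, T + S))) (DeltaU_word w) = - of_nat n * (RW e D s (replicate n x) * (1 * mM s S))
      - 2 * (\<Sum>k=1..n. of_nat (n - k) * (RW e D s (replicate (n - k) x) * (mM s (trm (replicate k x)) * mM s S)))"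
      unfolding w lin_DeltaU_word_replicate RR_def prod.case fst_conv snd_conv mM_simps ..
    also have "(\<Sum>k=1..n. of_nat (n - k) * (RW e D s (replicate (n - k) x) * (mM s (trm (replicate k x)) * mM s S)))
      = (\<Sum>k=1..n. of_nat (n - k) * (mcoef k s * RW e D s (replicate (n - k) x))) * mM s S"
      unfolding sum_distrib_right by (intro sum.cong refl) (simp add: mM_trm[OF nz] mult_ac)
    finally show ?thesis by (simp only: left_diff_distrib mult.assoc mult_1_left)
  qed
  have 2: "lin (\<lambda>b. RR e D s (case b of (v,T) \<Rightarrow> (w, (S - {#M#}) + T + trm v))) (DeltaU_word M) = RW e D s w * (mder (length M) s * mM s (S - {#M#}))"
    if M: "M \<in># S" for M
  proof -
    define l where "l = length M"
    have Ml: "M = replicate l x" unfolding l_def by (rule replicate_of_subset[OF x(2)[OF M]])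
    let ?R = "mM s (S - {#M#})"
    have a: "- of_nat l * (RW e D s w * (?R * 1 * mM s (trm (replicate l x)))) = RW e D s w * (- of_nat l * mcoef l s * ?R)"
      by (cases "l = 0") (simp_all add: mM_trm[OF nz])
    have b: "of_nat (l - k) * (RW e D s w * (?R * mM s (trm (replicate k x)) * mM s (trm (replicate (l - k) x)))) =
      RW e D s w * (of_nat (l - k) * mcoef k s * mcoef (l - k) s * ?R)" if "k \<in> {1..l}" for k
    proof (cases "k = l")
      case False
      then have "l - k \<ge> 1" "k \<ge> 1" using that by auto
      then have "mM s (trm (replicate (l - k) x)) = mcoef (l - k) s" "mM s (trm (replicate k x)) = mcoef k s"
        using mM_trm[OF nz] by simp_all
      then show ?thesis by simp
    qed simp
    have "lin (\<lambda>b. RR e D s (case b of (v,T) \<Rightarrow> (w, (S - {#M#}) + T + trm v))) (DeltaU_word (replicate l x)) =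
       RW e D s w * (- of_nat l * mcoef l s * ?R) - 2 * (\<Sum>k=1..l. RW e D s w * (of_nat (l - k) * mcoef k s * mcoef (l - k) s * ?R))"
      unfolding lin_DeltaU_word_replicate RR_def prod.case fst_conv snd_conv mM_simps a
      by (intro arg_cong2[where f = "(-)"] refl arg_cong2[where f = "(*)"] sum.cong b)
    also have "\<dots> = RW e D s w * (mder l s * ?R)"
    proof -
      define Q where "Q = (\<Sum>k=1..l. of_nat (l - k) * mcoef k s * mcoef (l - k) s)"
      have "(\<Sum>k=1..l. RW e D s w * (of_nat (l - k) * mcoef k s * mcoef (l - k) s * ?R)) = RW e D s w * (Q * ?R)"
        unfolding Q_def by (simp only: sum_distrib_left sum_distrib_right)
      then show ?thesis unfolding mder_def Q_def[symmetric] by (simp add: algebra_simps)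
    qed
    finally show ?thesis by (simp only: Ml[symmetric] l_def[symmetric])
  qed
  have "lin (RR e D s) (DeltaU_sym b) =
     (- of_nat n * RW e D s (replicate n x) - 2 * (\<Sum>k=1..n. of_nat (n - k) * (mcoef k s * RW e D s (replicate (n - k) x)))) * mM s S
     + (\<Sum>M\<in>#S. mder (length M) s * mM s (S - {#M#})) * RW e D s w"
    unfolding b lin_DeltaU_sym_split 1 sum_mset_distrib_right
    by (intro arg_cong2[where f = "(+)"] refl arg_cong[where f = sum_mset] image_mset_cong) (simp only: 2 mult.commute)
  moreover have "((\<lambda>s. RW e D s w * mM s S) has_field_derivative
     (- of_nat n * RW e D s (replicate n x) - 2 * (\<Sum>k=1..n. of_nat (n - k) * (mcoef k s * RW e D s (replicate (n - k) x)))) * mM s S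
     + (\<Sum>M\<in>#S. mder (length M) s * mM s (S - {#M#})) * RW e D s w) (at s)"
    by (rule DERIV_mult[OF _ mM_deriv]) (unfold w, rule RW_deriv)
  ultimately show ?thesis by (simp add: RR_def b)
qed

lemma DeltaU_word_letters:
  assumes "b \<in> kys (DeltaU_word w)"
  shows "set (fst b) \<subseteq> set w \<and> (\<forall>M\<in>#snd b. set M \<subseteq> set w)"
proof -
  let ?I = "{(i,j). i < j \<and> j < length w}"
  let ?f = "\<lambda>(i,j). Poly_Mapping.single
          (take i w @ lft (w ! i) @ rgt (w ! j) @ drop (Suc j) w,
           trm (rgt (w ! i) @ take (j - Suc i) (drop (Suc i) w) @ lft (w ! j)))
          (- 2 * eps (w ! i) * eps (w ! j))"
  have "b \<in> kys (Poly_Mapping.single (w, {#} :: word multiset) (- of_nat (length w) :: complex)) \<or> b \<in> kys (sum ?f ?I)"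
    using subsetD[OF Poly_Mapping.keys_add assms[unfolded DeltaU_word_def]] by (simp only: Un_iff)
  then show ?thesis
  proof
    assume "b \<in> kys (Poly_Mapping.single (w, {#} :: word multiset) (- of_nat (length w) :: complex))"
    then have "b = (w, {#})" by (simp split: if_splits)
    then show ?thesis by simp
  next
    assume "b \<in> kys (sum ?f ?I)"
    then obtain i j where ij: "i < j" "j < length w" and b: "b \<in> kys (?f (i,j))"
      using Poly_Mapping.keys_sum[of ?f ?I] by blast
    then have b': "b = (take i w @ lft (w ! i) @ rgt (w ! j) @ drop (Suc j) w,
           trm (rgt (w ! i) @ take (j - Suc i) (drop (Suc i) w) @ lft (w ! j)))" by (simp split: if_splits)
    have lr: "set (lft (w ! k)) \<subseteq> set w" "set (rgt (w ! k)) \<subseteq> set w" if "k < length w" for k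
      by (rule subset_trans[OF set_lft], simp only: insert_subset empty_subsetI nth_mem[OF that] simp_thms)
         (rule subset_trans[OF set_rgt], simp only: insert_subset empty_subsetI nth_mem[OF that] simp_thms)
    have a: "set (take i w @ lft (w ! i) @ rgt (w ! j) @ drop (Suc j) w) \<subseteq> set w"
      using lr(1)[of i] lr(2)[of j] ij set_take_subset[of i w] set_drop_subset[of "Suc j" w] by simp
    have "set (take (j - Suc i) (drop (Suc i) w)) \<subseteq> set w" using set_take_subset set_drop_subset by (rule subset_trans)
    then have c: "set (rgt (w ! i) @ take (j - Suc i) (drop (Suc i) w) @ lft (w ! j)) \<subseteq> set w"
      using lr(2)[of i] lr(1)[of j] ij by simp
    have t: "\<forall>M\<in>#trm u. set M \<subseteq> set w" if "set u \<subseteq> set w" for u using that by (simp add: trm_def)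
    show ?thesis unfolding b' fst_conv snd_conv using a t[OF c] by (rule conjI)
  qed
qed

lemma DeltaU_sym_pure:
  assumes b: "b \<in> pureB d" and b': "b' \<in> kys (DeltaU_sym b)"
  shows "b' \<in> pureB d"
proof -
  obtain w S where wS: "b = (w,S)" by fastforce
  obtain x where x: "set w \<subseteq> {x}" "\<And>M. M \<in># S \<Longrightarrow> set M \<subseteq> {x}" using b by (auto simp: pureB_def wS)
  have B: "b' \<in> Bd d" by (rule DeltaU_sym_keys[OF _ b']) (use b in \<open>simp add: pureB_def\<close>)
  have "b' \<in> kys (tmapkeys (\<lambda>(w, T). (w, T + S)) (DeltaU_word w)) \<or>
     b' \<in> kys (sum_mset (image_mset (\<lambda>Mj. tmapkeys (\<lambda>(v, T). (w, (S - {#Mj#}) + T + trm v)) (DeltaU_word Mj)) S))"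
    using subsetD[OF Poly_Mapping.keys_add b'[unfolded DeltaU_sym_def wS prod.case]] by (simp only: Un_iff)
  then have "set (fst b') \<subseteq> {x} \<and> (\<forall>M\<in>#snd b'. set M \<subseteq> {x})"
  proof
    assume "b' \<in> kys (tmapkeys (\<lambda>(w, T). (w, T + S)) (DeltaU_word w))"
    from tmapkeys_keys[OF this] obtain v T where v: "(v,T) \<in> kys (DeltaU_word w)" "b' = (v, T + S)" by auto
    have "set v \<subseteq> {x}" "\<And>M. M \<in># T \<Longrightarrow> set M \<subseteq> {x}" using DeltaU_word_letters[OF v(1)] x(1) by auto
    then show ?thesis unfolding v(2) fst_conv snd_conv set_mset_union using x(2) by blast
  next
    assume "b' \<in> kys (sum_mset (image_mset (\<lambda>Mj. tmapkeys (\<lambda>(v, T). (w, (S - {#Mj#}) + T + trm v)) (DeltaU_word Mj)) S))"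
    from keys_sum_mset[OF this] obtain M where M: "M \<in># S" "b' \<in> kys (tmapkeys (\<lambda>(v, T). (w, (S - {#M#}) + T + trm v)) (DeltaU_word M))" by blast
    from tmapkeys_keys[OF this(2)] obtain v T where v: "(v,T) \<in> kys (DeltaU_word M)" "b' = (w, (S - {#M#}) + T + trm v)" by auto
    have t: "M' = v" if "M' \<in># trm v" for M' using that by (simp add: trm_def split: if_splits)
    have l: "set v \<subseteq> {x}" "\<And>M. M \<in># T \<Longrightarrow> set M \<subseteq> {x}" using DeltaU_word_letters[OF v(1)] x(2)[OF M(1)] by auto
    have "set M' \<subseteq> {x}" if "M' \<in># S - {#M#} + T + trm v" for M'
    proof -
      from that consider "M' \<in># S" | "M' \<in># T" | "M' \<in># trm v" unfolding union_iff by (blast dest: in_diffD)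
      then show ?thesis
      proof cases
        case 3
        show ?thesis using l(1) unfolding t[OF 3] .
      qed (rule x(2) l(2), assumption)+
    qed
    then show ?thesis unfolding v(2) fst_conv snd_conv using x(1) by blast
  qed
  then show ?thesis using B by (auto simp: pureB_def)
qed

lemma kit_pure:
  assumes "\<And>b. b \<notin> pureB d \<Longrightarrow> c b = 0" "b \<notin> pureB d"
  shows "kit dker (Bd d) c b = 0"
  unfolding kit_def
proof (rule sum.neutral, intro ballI)
  fix b'
  have "b' \<notin> pureB d \<or> dker b' b = 0" using DeltaU_sym_pure[of b' d b] assms(2) by (auto simp: dker_def in_keys_iff)
  then show "c b' * dker b' b = 0" using assms(1)[of b'] by auto
qed

lemma kit_pow_pure:
  assumes "\<And>b. b \<notin> pureB d \<Longrightarrow> c b = 0"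
  shows "b \<notin> pureB d \<Longrightarrow> (kit dker (Bd d) ^^ m) c b = 0"
  by (induction m arbitrary: b) (simp_all add: assms kit_pure)

definition FF :: "nat \<Rightarrow> (bool \<Rightarrow> nat \<Rightarrow> complex) \<Rightarrow> nat \<Rightarrow> (tsym \<Rightarrow> complex) \<Rightarrow> complex \<Rightarrow> complex" where
  "FF d e D c s = (\<Sum>b\<in>Bd d. c b * RR e D s b)"

lemma FF_deriv:
  assumes c: "\<And>b. b \<notin> pureB d \<Longrightarrow> c b = 0"
  shows "(FF d e D c has_field_derivative FF d e D (kit dker (Bd d) c) s) (at s)"
proof -
  have t: "((\<lambda>s. c b * RR e D s b) has_field_derivative c b * (\<Sum>b'\<in>Bd d. dker b b' * RR e D s b')) (at s)" if b: "b \<in> Bd d" for b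
  proof (cases "b \<in> pureB d")
    case True
    have "lin (RR e D s) (DeltaU_sym b) = (\<Sum>b'\<in>Bd d. dker b b' * RR e D s b')"
      unfolding dker_def by (rule lin_superset) (use DeltaU_sym_keys[OF b] in auto)
    then show ?thesis using DERIV_cmult[OF RR_deriv[OF True], of "c b" e D s] by simp
  qed (simp add: c)
  have "(FF d e D c has_field_derivative (\<Sum>b\<in>Bd d. c b * (\<Sum>b'\<in>Bd d. dker b b' * RR e D s b'))) (at s)"
    unfolding FF_def[abs_def] by (intro DERIV_sum t)
  moreover have "(\<Sum>b\<in>Bd d. c b * (\<Sum>b'\<in>Bd d. dker b b' * RR e D s b')) = FF d e D (kit dker (Bd d) c) s"
    unfolding FF_def kit_def sum_distrib_left sum_distrib_right by (subst sum.swap) (simp add: mult.assoc)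
  ultimately show ?thesis by simp
qed

lemma FF_higher_deriv:
  assumes c: "\<And>b. b \<notin> pureB d \<Longrightarrow> c b = 0"
  shows "(deriv ^^ m) (FF d e D c) = FF d e D ((kit dker (Bd d) ^^ m) c)"
proof (induction m)
  case (Suc m)
  have "deriv (FF d e D ((kit dker (Bd d) ^^ m) c)) = FF d e D (kit dker (Bd d) ((kit dker (Bd d) ^^ m) c))"
    by (rule ext, rule DERIV_imp_deriv, rule FF_deriv, rule kit_pow_pure[of d c, OF c])
  then show ?case using Suc by simp
qed simp

text \<open>The pairing of c with \<open>RR\<close> is entire in s, and its m-th derivative is the
  pairing with the m-th iterate of the kernel on c. Taylor expansion at 0, where all traces count as
  1, is the exponential series with traces set to 1.\<close>

theorem pure_kexp:
  assumes c: "\<And>b. b \<notin> pureB d \<Longrightarrow> c b = 0" and D: "d \<le> D"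
  shows "(\<Sum>b\<in>Bd d. c b * RR e D s b) = (\<Sum>b\<in>Bd d. kexp s dker (Bd d) c b * e (hd (fst b)) (length (fst b)))"
proof -
  let ?k = "\<lambda>m. (kit dker (Bd d) ^^ m) c"
  have "FF d e D c holomorphic_on ball 0 (cmod s + 1)"
    unfolding holomorphic_on_def field_differentiable_def using has_field_derivative_at_within[OF FF_deriv[of d c, OF c]] by blast
  then have "(\<lambda>m. (deriv ^^ m) (FF d e D c) 0 / fact m * (s - 0) ^ m) sums FF d e D c s"
    by (rule holomorphic_power_series) simp
  moreover have "(deriv ^^ m) (FF d e D c) 0 / fact m * (s - 0) ^ m = (\<Sum>b\<in>Bd d. s ^ m / fact m * ?k m b * RR e D 0 b)" for m
  proof -
    have "(deriv ^^ m) (FF d e D c) = FF d e D (?k m)" by (rule FF_higher_deriv) (rule c)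
    then have "(deriv ^^ m) (FF d e D c) 0 = (\<Sum>b\<in>Bd d. ?k m b * RR e D 0 b)" by (simp only: FF_def)
    then show ?thesis by (simp add: sum_distrib_left sum_divide_distrib mult_ac)
  qed
  ultimately have s1: "(\<lambda>m. \<Sum>b\<in>Bd d. s ^ m / fact m * ?k m b * RR e D 0 b) sums FF d e D c s" by (simp only:)
  have s2: "(\<lambda>m. \<Sum>b\<in>Bd d. s ^ m / fact m * ?k m b * RR e D 0 b) sums (\<Sum>b\<in>Bd d. kexp s dker (Bd d) c b * RR e D 0 b)"
    unfolding kexp_def by (intro sums_sum sums_mult2 summable_sums kexp_summable finite_Bd)
  have r: "RR e D 0 b = e (hd (fst b)) (length (fst b))" if b: "b \<in> Bd d" for b
  proof -
    have l: "length (fst b) \<le> D" using b D by (simp add: Bd_def tdeg_def)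
    have ne: "[] \<notin># snd b" using b by (simp add: Bd_def)
    then have "mM 0 (snd b) = 1"
    proof (induction "snd b" arbitrary: b)
      case (add M S)
      then have "mM 0 S = 1" using add.hyps(1)[of "([],S)"] by (simp flip: add.hyps(2))
      moreover have "length M \<ge> 1" using add.prems by (cases M) (auto simp flip: add.hyps(2))
      ultimately show ?case by (simp add: mcoef_0 flip: add.hyps(2))
    qed (metis mM_simps(1))
    moreover have "RW e D 0 (fst b) = (\<Sum>j\<le>D. if length (fst b) = j then e (hd (fst b)) j else 0)"
      unfolding RW_def dcoef_0 by (intro sum.cong) auto
    ultimately show ?thesis using l by (simp add: RR_def)
  qed
  have "FF d e D c s = (\<Sum>b\<in>Bd d. kexp s dker (Bd d) c b * RR e D 0 b)" by (rule sums_unique2[OF s1 s2])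
  then show ?thesis using r by (simp add: FF_def cong: sum.cong)
qed

section \<open>The limit theorem\<close>

definition wd :: "int \<Rightarrow> word" where "wd k = replicate (nat \<bar>k\<bar>) (0 \<le> k)"

definition tp :: "lpoly \<Rightarrow> tpoly" where
  "tp P = (\<Sum>k\<in>kys P. Poly_Mapping.single (wd k, {#}) (lkp P k))"

lemma lin_tp: "lin h (tp P) = (\<Sum>k\<in>kys P. lkp P k * h (wd k, {#}))"
  by (simp add: tp_def lin_sum)

lemma weval_replicate: "weval N (replicate j x) A = mpow N (if x then A else minv N A) j"
  by (induction j) (auto simp: weval_def mpow_def)

lemma mzpow_sgnpow: "mzpow N A (sgnpow x j) = weval N (replicate j x) A"
proof (cases "j = 0")
  case True
  then show ?thesis by (simp add: mzpow_def sgnpow_def mpow_def weval_def)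
next
  case False
  then show ?thesis by (simp add: mzpow_def sgnpow_def weval_replicate)
qed

lemma mzpow_wd: "mzpow N A k = weval N (wd k) A"
  using mzpow_sgnpow[of N A "0 \<le> k" "nat \<bar>k\<bar>"] by (simp add: wd_def sgnpow_def split: if_splits)

lemma leval_tp: "leval N P = teval N (tp P)"
proof
  fix A
  show "leval N P A = teval N (tp P) A"
  proof (rule mats_ext[where N = N])
    fix i j assume ij: "i < N" "j < N"
    show "leval N P A (i,j) = teval N (tp P) A (i,j)"
      unfolding teval_lin[OF ij] lin_tp using ij by (simp add: leval_def mzpow_wd symeval_nth)
  qed (auto simp: leval_def teval_def mats_def)
qed

lemma wd_pure: "nat \<bar>k\<bar> \<le> d \<Longrightarrow> (wd k, {#}) \<in> pureB d"
  by (auto simp: pureB_def Bd_def tdeg_def wd_def intro!: exI[of _ "0 \<le> k"])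

lemma lookup_tp_pure:
  assumes "\<And>k. k \<in> kys P \<Longrightarrow> nat \<bar>k\<bar> \<le> d" "b \<notin> pureB d"
  shows "lkp (tp P) b = 0"
  unfolding lookup_lin lin_tp
proof (rule sum.neutral, intro ballI)
  fix k assume "k \<in> kys P"
  then have "(wd k, {#}) \<noteq> b" using wd_pure[OF assms(1)] assms(2) by blast
  then show "lkp P k * (if (wd k, {#}) = b then 1 else 0) = 0" by simp
qed

lemma keys_tp:
  assumes "\<And>k. k \<in> kys P \<Longrightarrow> nat \<bar>k\<bar> \<le> d"
  shows "kys (tp P) \<subseteq> Bd d"
proof
  fix b assume "b \<in> kys (tp P)"
  then have "b \<in> pureB d" using lookup_tp_pure[of P d b, OF assms] by (auto simp: in_keys_iff)
  then show "b \<in> Bd d" by (simp add: pureB_def)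
qed

lemma lookup_gsym:
  "lkp (gsym t k) l = (\<Sum>j\<le>nat \<bar>k\<bar>. if sgnpow (0 \<le> k) j = l then dcoef (nat \<bar>k\<bar>) j (of_real (t/2)) else 0)"
  by (simp only: gsym_def lookup_sum lookup_single when_def)

text \<open>\<open>pure_kexp\<close> at s = t/2, with \<open>e x j\<close> a matrix entry of the
  j-th power: the transform of P is exp(t/2 \<open>DeltaU\<close>) P with every trace factor
  replaced by 1.\<close>

theorem leval_Gt:
  assumes d: "\<And>k. k \<in> kys P \<Longrightarrow> nat \<bar>k\<bar> \<le> d" and ij: "i < N" "i' < N"
  shows "leval N (Gt t P) A (i,i') = (\<Sum>b\<in>Bd d. lkp (expDeltaU t (tp P)) b * weval N (fst b) A (i,i'))"
proof -
  define s :: complex where "s = of_real (t/2)"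
  define e where "e x j = weval N (replicate j x) A (i,i')" for x j
  let ?c = "lkp (tp P)"
  have c: "?c b = 0" if "b \<notin> pureB d" for b by (rule lookup_tp_pure[OF d that])
  let ?I = "{- int d..int d}"
  have look: "lkp (GtL t P) l = (\<Sum>k\<in>kys P. lkp P k * lkp (gsym t k) l)" for l
    by (simp add: GtL_def lookup_sum lookup_lsmult)
  have sub: "kys (GtL t P) \<subseteq> ?I"
  proof
    fix l assume "l \<in> kys (GtL t P)"
    then have "(\<Sum>k\<in>kys P. lkp P k * lkp (gsym t k) l) \<noteq> 0" by (simp add: in_keys_iff look)
    then obtain k where k: "k \<in> kys P" "lkp (gsym t k) l \<noteq> 0"
      using sum.neutral[of "kys P" "\<lambda>k. lkp P k * lkp (gsym t k) l"] by force
    obtain j where j: "j \<in> {..nat \<bar>k\<bar>}" "(if sgnpow (0 \<le> k) j = l then dcoef (nat \<bar>k\<bar>) j (of_real (t/2)) else 0) \<noteq> 0"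
      by (rule sum.not_neutral_contains_not_neutral[OF k(2)[unfolded lookup_gsym]])
    then have "j \<le> nat \<bar>k\<bar>" "sgnpow (0 \<le> k) j = l" by (simp, meson)
    then show "l \<in> ?I" using d[OF k(1)] by (auto simp: sgnpow_def split: if_splits)
  qed
  have "leval N (Gt t P) A (i,i') = (\<Sum>l\<in>kys (GtL t P). lkp (GtL t P) l * mzpow N A l (i,i'))"
    using ij by (simp add: leval_def Gt_eq sq_def)
  also have "\<dots> = (\<Sum>l\<in>?I. lkp (GtL t P) l * mzpow N A l (i,i'))"
    by (rule sum.mono_neutral_left) (use sub in \<open>auto simp: in_keys_iff\<close>)
  also have "\<dots> = (\<Sum>k\<in>kys P. lkp P k * (\<Sum>l\<in>?I. lkp (gsym t k) l * mzpow N A l (i,i')))"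
    unfolding look sum_distrib_left sum_distrib_right by (subst sum.swap) (simp only: mult.assoc)
  also have "\<dots> = (\<Sum>k\<in>kys P. lkp P k * RR e d s (wd k, {#}))"
  proof (intro sum.cong refl arg_cong2[where f = "(*)"])
    fix k assume k: "k \<in> kys P"
    define n where "n = nat \<bar>k\<bar>"
    have n: "n \<le> d" using d[OF k] by (simp add: n_def)
    have "(\<Sum>l\<in>?I. lkp (gsym t k) l * mzpow N A l (i,i'))
       = (\<Sum>l\<in>?I. \<Sum>j\<le>n. if sgnpow (0 \<le> k) j = l then dcoef n j s * mzpow N A l (i,i') else 0)"
      unfolding lookup_gsym n_def s_def sum_distrib_right by (intro sum.cong refl) simp
    also have "\<dots> = (\<Sum>j\<le>n. \<Sum>l\<in>?I. if sgnpow (0 \<le> k) j = l then dcoef n j s * mzpow N A l (i,i') else 0)" by (rule sum.swap)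
    also have "\<dots> = (\<Sum>j\<le>n. dcoef n j s * e (0 \<le> k) j)"
    proof (intro sum.cong refl)
      fix j assume "j \<in> {..n}"
      then have "sgnpow (0 \<le> k) j \<in> ?I" using n by (auto simp: sgnpow_def)
      then show "(\<Sum>l\<in>?I. if sgnpow (0 \<le> k) j = l then dcoef n j s * mzpow N A l (i,i') else 0) = dcoef n j s * e (0 \<le> k) j"
        by (simp add: mzpow_sgnpow e_def)
    qed
    also have "\<dots> = (\<Sum>j\<le>d. dcoef n j s * e (0 \<le> k) j)"
      by (rule sum.mono_neutral_left) (use n dcoef_gt in auto)
    also have "\<dots> = RR e d s (wd k, {#})"
    \<comment> \<open>At k = 0 the letter \<open>0 \<le> k\<close> and the one read off by
      \<open>hd []\<close> may differ; only the zeroth power is involved, which is the identity for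
      both.\<close>
    proof (cases "n = 0")
      case True
      have z: "dcoef 0 j s * e x j = dcoef 0 j s * e y j" for x y j
        using dcoef_gt[of 0 j s] by (cases "j = 0") (simp_all add: e_def)
      show ?thesis using True by (simp add: RR_def RW_def wd_def n_def) (intro sum.cong refl z)
    next
      case False
      then have "hd (wd k) = (0 \<le> k)" by (simp add: wd_def n_def)
      then show ?thesis by (simp add: RR_def RW_def) (simp add: wd_def n_def)
    qed
    finally show "(\<Sum>l\<in>?I. lkp (gsym t k) l * mzpow N A l (i,i')) = RR e d s (wd k, {#})" .
  qed
  also have "\<dots> = (\<Sum>b\<in>Bd d. ?c b * RR e d s b)"
    unfolding lin_tp[symmetric] by (rule lin_superset[OF finite_Bd keys_tp[OF d]])
  also have "\<dots> = (\<Sum>b\<in>Bd d. kexp s dker (Bd d) ?c b * e (hd (fst b)) (length (fst b)))"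
    by (rule pure_kexp[OF c order_refl])
  also have "\<dots> = (\<Sum>b\<in>Bd d. lkp (expDeltaU t (tp P)) b * weval N (fst b) A (i,i'))"
  proof (intro sum.cong refl)
    fix b assume b: "b \<in> Bd d"
    have l: "lkp (expDeltaU t (tp P)) b = kexp s dker (Bd d) ?c b"
      using lookup_expDeltaU[OF keys_tp[OF d], where t = t and b = b] b by (simp only: s_def if_True)
    show "kexp s dker (Bd d) ?c b * e (hd (fst b)) (length (fst b)) = lkp (expDeltaU t (tp P)) b * weval N (fst b) A (i,i')"
    proof (cases "b \<in> pureB d")
      case True
      then obtain x where x: "set (fst b) \<subseteq> {x}" by (auto simp: pureB_def)
      have "replicate (length (fst b)) (hd (fst b)) = fst b"
        using replicate_of_subset[OF x] by (cases "fst b") auto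
      then show ?thesis unfolding l e_def by simp
    next
      case False
      then show ?thesis unfolding l using kit_pow_pure[of d ?c b, OF c] by (simp add: kexp_def)
    qed
  qed
  finally show ?thesis .
qed

lemma expDeltaU_tp_pure:
  assumes d: "\<And>k. k \<in> kys P \<Longrightarrow> nat \<bar>k\<bar> \<le> d" and b: "b \<notin> pureB d"
  shows "lkp (expDeltaU t (tp P)) b = 0"
proof -
  have "(kit dker (Bd d) ^^ m) (lkp (tp P)) b = 0" for m
    by (rule kit_pow_pure[OF lookup_tp_pure[OF d] b])
  then show ?thesis using lookup_expDeltaU[OF keys_tp[OF d], where t = t and b = b] by (simp add: kexp_def)
qed

text \<open>GL_N is a countable union of compact sublevel sets of a proper function. Integrands cut
  off outside GL_N are thereby measurable.\<close>

lemma GLm_borel: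
  assumes N: "N \<ge> 1"
  shows "GLm N \<in> sets borel"
proof -
  interpret lyapunov N "qV N 1" "real N"
  proof
    show "poly_fn N (qV N 1)" using cjet_qV by (simp add: cjet_def)
    fix A assume A: "A \<in> GLm N"
    show "Re (qV N 1 A) \<ge> 0" by (simp add: qV_eq[OF A])
    fix i j assume "i < N" "j < N"
    then show "(cmod (A (i,j)))^2 \<le> real N * Re (qV N 1 A) \<and> (cmod (minv N A (i,j)))^2 \<le> real N * Re (qV N 1 A)"
      using VT_proper[OF N A] by (simp add: qV_eq[OF A])
  qed (use N in simp)
  have "GLm N = (\<Union>n. K (real n))"
  proof
    show "GLm N \<subseteq> (\<Union>n. K (real n))"
    proof
      fix A assume A: "A \<in> GLm N"
      obtain n where "V A \<le> real n" using real_arch_simple by blast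
      then have "A \<in> K (real n)" unfolding K_def using A by blast
      then show "A \<in> (\<Union>n. K (real n))" by blast
    qed
    show "(\<Union>n. K (real n)) \<subseteq> GLm N" unfolding K_def by blast
  qed
  moreover have "range (\<lambda>n. K (real n)) \<subseteq> sets borel" using borel_closed[OF closed_K] by blast
  then have "(\<Union>n. K (real n)) \<in> sets borel" by (rule sets.countable_UN)
  ultimately show ?thesis by simp
qed

lemma poly_fn_measurable:
  assumes N: "N \<ge> 1" and p: "poly_fn N p"
  shows "(\<lambda>A. indicator (GLm N) A *\<^sub>R Re (p A)) \<in> borel_measurable (mat_space N)"
proof -
  have "continuous_on (GLm N) (\<lambda>A. Re (p A))"
    unfolding continuous_on_def
  proof
    fix A assume A: "A \<in> GLm N"
    define \<gamma> where "\<gamma> B = (if B \<in> GLm N then B else A)" for B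
    have ev: "\<forall>\<^sub>F B in at A within GLm N. B \<in> GLm N" by (simp add: eventually_at_filter)
    have m: "\<gamma> B \<in> mats N" for B using A minv_GL(1) by (auto simp: \<gamma>_def)
    have e: "((\<lambda>B. \<gamma> B p) \<longlongrightarrow> A p) (at A within GLm N)" for p
    proof (rule Lim_transform_eventually)
      have "continuous_on (GLm N) (\<lambda>B::cmat. B p)" by (rule continuous_on_subset[OF continuous_on_product_coordinates subset_UNIV])
      then show "((\<lambda>B. B p) \<longlongrightarrow> A p) (at A within GLm N)" unfolding continuous_on_def using A by (rule bspec)
      show "\<forall>\<^sub>F B in at A within GLm N. B p = \<gamma> B p" using ev by eventually_elim (simp add: \<gamma>_def)
    qed
    have "((\<lambda>B. Re (p (\<gamma> B))) \<longlongrightarrow> Re (p A)) (at A within GLm N)"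
      by (intro tendsto_Re poly_fn_tendsto[OF p e A m])
    then show "((\<lambda>B. Re (p B)) \<longlongrightarrow> Re (p A)) (at A within GLm N)"
    proof (rule Lim_transform_eventually)
      show "\<forall>\<^sub>F B in at A within GLm N. Re (p (\<gamma> B)) = Re (p B)" using ev by eventually_elim (simp add: \<gamma>_def)
    qed
  qed
  then have "(\<lambda>A. indicator (GLm N) A *\<^sub>R Re (p A)) \<in> borel_measurable borel"
    by (rule borel_measurable_continuous_on_indicator[OF GLm_borel[OF N]])
  from measurable_compose[OF measurable_id_mats this] show ?thesis .
qed

section \<open>Integration of pointwise bounds against the law of G_t\<close>

lemma GL_BM_law_sets: "GL_BM_law N t \<nu> \<Longrightarrow> t \<ge> 0 \<Longrightarrow> sets \<nu> = sets (mat_space N)"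
  unfolding GL_BM_law_def by auto

text \<open>Additivity of the nonnegative integral asks for measurable summands. They are obtained
  by cutting the polynomial functions off outside GL_N, where the law has no mass.\<close>

lemma nn_integral_poly_bound:
  assumes N: "N \<ge> 1" and law: "GL_BM_law N t \<nu>" and t: "t > 0" and I: "finite I"
    and p: "\<And>i. i \<in> I \<Longrightarrow> poly_fn N (p i)"
    and c: "\<And>i. i \<in> I \<Longrightarrow> (\<integral>\<^sup>+A. ennreal (Re (p i A)) \<partial>\<nu>) \<le> ennreal (c i)"
    and nn: "\<And>i. i \<in> I \<Longrightarrow> c i \<ge> 0" "\<And>i. i \<in> I \<Longrightarrow> a i \<ge> 0" "\<And>i A. i \<in> I \<Longrightarrow> A \<in> GLm N \<Longrightarrow> Re (p i A) \<ge> 0"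
    and g: "\<And>A. A \<in> GLm N \<Longrightarrow> g A \<le> (\<Sum>i\<in>I. a i * Re (p i A))"
  shows "(\<integral>\<^sup>+A. ennreal (g A) \<partial>\<nu>) \<le> ennreal (\<Sum>i\<in>I. a i * c i)"
proof -
  define h where "h i A = ennreal (indicator (GLm N) A *\<^sub>R Re (p i A))" for i A
  have AE: "AE A in \<nu>. A \<in> GLm N" by (rule GL_BM_law_AE[OF law]) (use t in simp)
  have m: "h i \<in> borel_measurable \<nu>" if "i \<in> I" for i
    using poly_fn_measurable[OF N p[OF that]] measurable_cong_sets[OF GL_BM_law_sets[OF law] refl] t
    unfolding h_def by (intro measurable_compose[OF _ measurable_ennreal]) auto
  have "(\<integral>\<^sup>+A. ennreal (g A) \<partial>\<nu>) \<le> (\<integral>\<^sup>+A. (\<Sum>i\<in>I. ennreal (a i) * h i A) \<partial>\<nu>)"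
  proof (rule nn_integral_mono_AE)
    show "AE A in \<nu>. ennreal (g A) \<le> (\<Sum>i\<in>I. ennreal (a i) * h i A)"
      using AE
    proof eventually_elim
      case (elim A)
      have "(\<Sum>i\<in>I. ennreal (a i) * h i A) = (\<Sum>i\<in>I. ennreal (a i * Re (p i A)))"
        by (intro sum.cong refl) (use elim nn in \<open>simp add: h_def ennreal_mult\<close>)
      also have "\<dots> = ennreal (\<Sum>i\<in>I. a i * Re (p i A))"
        by (rule sum_ennreal) (use elim nn in auto)
      finally show ?case using g[OF elim] by (simp add: ennreal_leI)
    qed
  qed
  also have "\<dots> = (\<Sum>i\<in>I. \<integral>\<^sup>+A. ennreal (a i) * h i A \<partial>\<nu>)"
    by (rule nn_integral_sum) (use m in auto)
  also have "\<dots> = (\<Sum>i\<in>I. ennreal (a i) * (\<integral>\<^sup>+A. h i A \<partial>\<nu>))"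
    by (intro sum.cong refl nn_integral_cmult m)
  also have "\<dots> \<le> (\<Sum>i\<in>I. ennreal (a i) * ennreal (c i))"
  proof (intro sum_mono mult_left_mono)
    fix i assume i: "i \<in> I"
    have "(\<integral>\<^sup>+A. h i A \<partial>\<nu>) = (\<integral>\<^sup>+A. ennreal (Re (p i A)) \<partial>\<nu>)"
      by (rule nn_integral_cong_AE) (use AE in \<open>eventually_elim, simp add: h_def\<close>)
    then show "(\<integral>\<^sup>+A. h i A \<partial>\<nu>) \<le> ennreal (c i)" using c[OF i] by simp
  qed simp
  also have "\<dots> = (\<Sum>i\<in>I. ennreal (a i * c i))" by (intro sum.cong refl) (use nn in \<open>simp add: ennreal_mult\<close>)
  also have "\<dots> = ennreal (\<Sum>i\<in>I. a i * c i)" by (rule sum_ennreal) (use nn in auto)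
  finally show ?thesis .
qed

text \<open>One quantity for all squared deviations of traces of powers from 1, for A and its
  inverse, together with the weights T_n that may multiply them; its expectation is
  O(1/N^2).\<close>

definition WT :: "nat \<Rightarrow> nat \<Rightarrow> cmat \<Rightarrow> real" where
  "WT N D A = (\<Sum>(x,k,n)\<in>UNIV \<times> {..D} \<times> {..D}. (cmod (trdev N x k A))^2 * Tn N A n)"

lemma WT_nonneg [simp]: "WT N D A \<ge> 0"
  unfolding WT_def by (intro sum_nonneg) auto

lemma trdev_le_WT: "k \<le> D \<Longrightarrow> n \<le> D \<Longrightarrow> (cmod (trdev N x k A))^2 * Tn N A n \<le> WT N D A"
  unfolding WT_def using member_le_sum[of "(x,k,n)" "UNIV \<times> {..D} \<times> {..D}" "\<lambda>(x,k,n). (cmod (trdev N x k A))^2 * Tn N A n"]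
  by auto

text \<open>Reduces both parts of the theorem to pointwise bounds on GL_N. The coefficient a of
  \<open>VT\<close> has to carry its own 1/N^2, whereas \<open>WT\<close> brings one along.\<close>

lemma combined_moment:
  assumes t: "t > 0" and D: "D \<ge> 1"
  shows "\<exists>K\<ge>0. \<forall>N\<ge>1. \<forall>\<nu> g a b. GL_BM_law N t \<nu> \<longrightarrow> a \<ge> 0 \<longrightarrow> b \<ge> 0 \<longrightarrow>
    (\<forall>A\<in>GLm N. g A \<le> a * VT N D A + b * WT N D A) \<longrightarrow> (\<integral>\<^sup>+A. ennreal (g A) \<partial>\<nu>) \<le> ennreal (K * (a + b / (real N)^2))"
proof -
  obtain C where C: "C \<ge> 0" "\<And>N \<nu>. N \<ge> 1 \<Longrightarrow> GL_BM_law N t \<nu> \<Longrightarrow> (\<integral>\<^sup>+A. ennreal (Re (qV N D A)) \<partial>\<nu>) \<le> ennreal C"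
    using VT_moment[OF t D] by blast
  define Q where "Q x k n C \<longleftrightarrow> C \<ge> 0 \<and> (\<forall>N\<ge>1. \<forall>\<nu>. GL_BM_law N t \<nu> \<longrightarrow>
    (\<integral>\<^sup>+A. ennreal (Re (trdev N x k A * cnj (trdev N x k A) * qT N n A)) \<partial>\<nu>) \<le> ennreal (C / (real N)^2))" for x k n C
  \<comment> \<open>Each triple (x,k,n) has its own constant, fixed before N; the finitely many that
    occur are added up.\<close>
  define E where "E x k n = (SOME C. Q x k n C)" for x k n
  have QE: "Q x k n (E x k n)" for x k n
    unfolding E_def using trdev_moment[OF t] by (intro someI_ex[of "Q x k n"]) (simp add: Q_def)
  define J where "J = (UNIV :: bool set) \<times> {..D} \<times> {..D}"
  have J: "finite J" by (simp add: J_def)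
  define I where "I = insert None (Some ` J)"
  define S where "S = (\<Sum>(x,k,n)\<in>J. E x k n)"
  have E0: "E x k n \<ge> 0" for x k n using QE by (simp add: Q_def)
  have S: "S \<ge> 0" unfolding S_def by (intro sum_nonneg) (auto simp: E0)
  have split: "(\<Sum>i\<in>I. f i) = f None + (\<Sum>j\<in>J. f (Some j))" for f :: "_ \<Rightarrow> real"
    unfolding I_def using J by (subst sum.insert) (auto simp: sum.reindex)
  show ?thesis
  proof (intro exI[of _ "C + S"] conjI allI impI)
    fix N :: nat and \<nu> and g :: "cmat \<Rightarrow> real" and a b :: real
    assume N: "N \<ge> 1" and law: "GL_BM_law N t \<nu>" and ab: "a \<ge> 0" "b \<ge> 0"
      and g: "\<forall>A\<in>GLm N. g A \<le> a * VT N D A + b * WT N D A"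
    define p where "p i = (case i of None \<Rightarrow> qV N D | Some (x,k,n) \<Rightarrow> (\<lambda>A. trdev N x k A * cnj (trdev N x k A) * qT N n A))" for i
    define c where "c i = (case i of None \<Rightarrow> C | Some (x,k,n) \<Rightarrow> E x k n / (real N)^2)" for i
    define w where "w i = (case i of None \<Rightarrow> a | Some j \<Rightarrow> b)" for i :: "(bool \<times> nat \<times> nat) option"
    have pT: "Re (trdev N x k A * cnj (trdev N x k A) * qT N n A) = (cmod (trdev N x k A))^2 * Tn N A n" if "A \<in> GLm N" for x k n A
      unfolding qT_eq[OF that] complex_norm_square[symmetric] by (simp flip: of_real_mult of_real_power)
    have "(\<integral>\<^sup>+A. ennreal (g A) \<partial>\<nu>) \<le> ennreal (\<Sum>i\<in>I. w i * c i)"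
    proof (rule nn_integral_poly_bound[OF N law t, where p = p])
      show "finite I" using J by (simp add: I_def)
      fix i
      show "poly_fn N (p i)"
        using cjet_qV[of N D] cjet_mult[OF cjet_mult[OF cjet_trdev cjet_cnj[OF cjet_trdev]] cjet_qT]
        by (auto simp: p_def cjet_def split: option.split)
      show "(\<integral>\<^sup>+A. ennreal (Re (p i A)) \<partial>\<nu>) \<le> ennreal (c i)"
        using C(2)[OF N law] QE N law by (auto simp: p_def c_def Q_def split: option.split)
      show "c i \<ge> 0" using C(1) E0 by (auto simp: c_def split: option.split)
      show "w i \<ge> 0" using ab by (auto simp: w_def split: option.split)
      show "Re (p i A) \<ge> 0" if "A \<in> GLm N" for A
        using pT[OF that] qV_eq[OF that] by (cases i) (auto simp: p_def simp del: times_complex.sel)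
    next
      fix A assume A: "A \<in> GLm N"
      have "(\<Sum>i\<in>I. w i * Re (p i A)) = a * VT N D A + (\<Sum>j\<in>J. b * (case j of (x,k,n) \<Rightarrow> (cmod (trdev N x k A))^2 * Tn N A n))"
        unfolding split using pT[OF A] qV_eq[OF A] by (auto simp: p_def w_def simp del: times_complex.sel intro!: sum.cong)
      also have "\<dots> = a * VT N D A + b * WT N D A" unfolding sum_distrib_left[symmetric] WT_def J_def ..
      finally show "g A \<le> (\<Sum>i\<in>I. w i * Re (p i A))" using g A by simp
    qed
    also have "(\<Sum>i\<in>I. w i * c i) = a * C + b * (S / (real N)^2)"
      unfolding split S_def sum_divide_distrib sum_distrib_left by (auto simp: w_def c_def intro!: sum.cong)
    also have "\<dots> \<le> (C + S) * (a + b / (real N)^2)"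
    proof -
      define r where "r = b / (real N)^2"
      have "b * (S / (real N)^2) = r * S" by (simp add: r_def)
      moreover have "0 \<le> S * a + C * r" using S C(1) ab by (simp add: r_def)
      ultimately show ?thesis unfolding r_def[symmetric] by (simp add: algebra_simps)
    qed
    finally show "(\<integral>\<^sup>+A. ennreal (g A) \<partial>\<nu>) \<le> ennreal ((C + S) * (a + b / (real N)^2))" by (simp add: ennreal_leI)
  qed (use C S in simp)
qed

text \<open>Traces are absorbed into the weight one at a time: |tr M|^2 is at most T at the length
  of M, and the product of this with T_n is bounded by T at the sum of the indices, up to a
  constant. The weight index n is therefore arbitrary in the induction.\<close>

lemma pS_bound: "\<exists>C\<ge>0. \<forall>N\<ge>1. \<forall>A\<in>GLm N. (cmod (pS N S A))^2 * Tn N A n \<le> C * Tn N A (n + sum_mset (image_mset length S))"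
proof (induction S arbitrary: n)
  case empty
  show ?case by (intro exI[of _ 1]) simp
next
  case (add M S)
  obtain C where C: "C \<ge> 0" "\<And>N A. N \<ge> 1 \<Longrightarrow> A \<in> GLm N \<Longrightarrow> (cmod (pS N S A))^2 * Tn N A (length M + n) \<le> C * Tn N A (length M + n + sum_mset (image_mset length S))"
    using add[of "length M + n"] by blast
  show ?case
  proof (intro exI[of _ "4 ^ (length M * n) * C"] conjI allI impI ballI)
    fix N :: nat and A assume N: "N \<ge> 1" and A: "A \<in> GLm N"
    have m: "(cmod (mtr N (weval N M A)))^2 \<le> Tn N A (length M)"
      using mtr_word_le'[of "em M" "length M" 0 N A] by (simp add: wev_em Tn_0[OF N])
    have "(cmod (pS N (add_mset M S) A))^2 * Tn N A n \<le> (Tn N A (length M) * Tn N A n) * (cmod (pS N S A))^2"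
      using mult_right_mono[OF m, of "Tn N A n * (cmod (pS N S A))^2"] by (simp add: norm_mult power_mult_distrib mult_ac)
    also have "\<dots> \<le> (4 ^ (length M * n) * Tn N A (length M + n)) * (cmod (pS N S A))^2"
      by (intro mult_right_mono Tn_mult_le[OF N A]) simp
    also have "\<dots> \<le> 4 ^ (length M * n) * (C * Tn N A (length M + n + sum_mset (image_mset length S)))"
      using C(2)[OF N A] by (simp add: mult_ac)
    finally show "(cmod (pS N (add_mset M S) A))^2 * Tn N A n \<le> 4 ^ (length M * n) * C * Tn N A (n + sum_mset (image_mset length (add_mset M S)))"
      by (simp add: ac_simps)
  qed (use C in simp)
qed

text \<open>Telescoping, m p - 1 = m (p - 1) + (m - 1): the first term falls under the induction
  hypothesis with the weight index raised by the length of M, the second is a summand of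
  \<open>WT\<close>.\<close>

lemma pS_dev_bound:
  assumes "\<And>M. M \<in># S \<Longrightarrow> set M \<subseteq> {x}" "n + sum_mset (image_mset length S) \<le> D"
  shows "\<exists>C\<ge>0. \<forall>N\<ge>1. \<forall>A\<in>GLm N. (cmod (pS N S A - 1))^2 * Tn N A n \<le> C * WT N D A"
  using assms
proof (induction S arbitrary: n)
  case empty
  show ?case by (intro exI[of _ 0]) simp
next
  case (add M S)
  have "length M + n + sum_mset (image_mset length S) \<le> D" "\<And>M. M \<in># S \<Longrightarrow> set M \<subseteq> {x}" using add.prems by auto
  from add.IH[OF this(2,1)]
  obtain C where C: "C \<ge> 0" "\<And>N A. N \<ge> 1 \<Longrightarrow> A \<in> GLm N \<Longrightarrow> (cmod (pS N S A - 1))^2 * Tn N A (length M + n) \<le> C * WT N D A"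
    by blast
  have M: "M = replicate (length M) x" by (rule replicate_of_subset) (use add.prems in simp)
  show ?case
  proof (intro exI[of _ "2 * (4 ^ (length M * n) * C) + 2"] conjI allI impI ballI)
    fix N :: nat and A assume N: "N \<ge> 1" and A: "A \<in> GLm N"
    let ?m = "mtr N (weval N M A)"
    have m: "(cmod ?m)^2 \<le> Tn N A (length M)"
      using mtr_word_le'[of "em M" "length M" 0 N A] by (simp add: wev_em Tn_0[OF N])
    have f: "?m - 1 = trdev N x (length M) A" unfolding trdev_def by (simp add: wev_em M[symmetric])
    have "(cmod (pS N (add_mset M S) A - 1))^2 \<le> 2 * ((cmod ?m)^2 * (cmod (pS N S A - 1))^2) + 2 * (cmod (?m - 1))^2"
    proof -
      have "pS N (add_mset M S) A - 1 = ?m * (pS N S A - 1) + (?m - 1)" by (simp add: algebra_simps)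
      then have "cmod (pS N (add_mset M S) A - 1) \<le> cmod ?m * cmod (pS N S A - 1) + cmod (?m - 1)"
        by (metis norm_mult norm_triangle_ineq)
      then have "(cmod (pS N (add_mset M S) A - 1))^2 \<le> (cmod ?m * cmod (pS N S A - 1) + cmod (?m - 1))^2" by (rule power_mono) simp
      also have "\<dots> \<le> 2 * (cmod ?m * cmod (pS N S A - 1))^2 + 2 * (cmod (?m - 1))^2"
        using sum_squares_bound[of "cmod ?m * cmod (pS N S A - 1)" "cmod (?m - 1)"] by (simp add: power2_sum)
      finally show ?thesis by (simp add: power_mult_distrib)
    qed
    then have "(cmod (pS N (add_mset M S) A - 1))^2 * Tn N A n \<le> (2 * ((cmod ?m)^2 * (cmod (pS N S A - 1))^2) + 2 * (cmod (?m - 1))^2) * Tn N A n"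
      by (rule mult_right_mono) simp
    also have "\<dots> = 2 * (((cmod ?m)^2 * Tn N A n) * (cmod (pS N S A - 1))^2) + 2 * ((cmod (?m - 1))^2 * Tn N A n)"
      by (simp add: algebra_simps)
    also have "\<dots> \<le> 2 * ((4 ^ (length M * n) * Tn N A (length M + n)) * (cmod (pS N S A - 1))^2) + 2 * WT N D A"
    proof (intro add_mono mult_left_mono mult_right_mono)
      show "(cmod ?m)^2 * Tn N A n \<le> 4 ^ (length M * n) * Tn N A (length M + n)"
        using order_trans[OF mult_right_mono[OF m Tn_nonneg] Tn_mult_le[OF N A]] .
      show "(cmod (?m - 1))^2 * Tn N A n \<le> WT N D A" unfolding f by (rule trdev_le_WT) (use add.prems in auto)
    qed auto
    also have "\<dots> = 2 * (4 ^ (length M * n) * ((cmod (pS N S A - 1))^2 * Tn N A (length M + n))) + 2 * WT N D A" by simp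
    also have "\<dots> \<le> 2 * (4 ^ (length M * n) * (C * WT N D A)) + 2 * WT N D A"
      by (intro add_mono mult_left_mono C(2)[OF N A]) auto
    finally show "(cmod (pS N (add_mset M S) A - 1))^2 * Tn N A n \<le> (2 * (4 ^ (length M * n) * C) + 2) * WT N D A"
      by (simp add: algebra_simps)
  qed (use C in simp)
qed

section \<open>The two error terms\<close>

lemma nrm2_cong: "(\<And>i j. i < N \<Longrightarrow> j < N \<Longrightarrow> M (i,j) = M' (i,j)) \<Longrightarrow> nrm2 N M = nrm2 N M'"
  by (simp add: nrm2_def)

lemma nrm2_lincomb:
  assumes "finite B"
  shows "nrm2 N (\<lambda>p. \<Sum>b\<in>B. z b * F b p) \<le> real (card B) * (\<Sum>b\<in>B. (cmod (z b))^2 * nrm2 N (F b))"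
proof -
  have "(cmod (\<Sum>b\<in>B. z b * F b p))^2 \<le> real (card B) * (\<Sum>b\<in>B. (cmod (z b))^2 * (cmod (F b p))^2)" for p
  proof -
    have "cmod (\<Sum>b\<in>B. z b * F b p) \<le> (\<Sum>b\<in>B. cmod (z b * F b p) * 1)" using norm_sum by simp
    then have "(cmod (\<Sum>b\<in>B. z b * F b p))^2 \<le> (\<Sum>b\<in>B. cmod (z b * F b p) * 1)^2" by (rule power_mono) simp
    also have "\<dots> \<le> (\<Sum>b\<in>B. (cmod (z b * F b p))^2) * (\<Sum>b\<in>B. 1^2)" by (rule Cauchy_Schwarz_ineq_sum)
    finally show ?thesis by (simp add: norm_mult power_mult_distrib mult.commute)
  qed
  then have "nrm2 N (\<lambda>p. \<Sum>b\<in>B. z b * F b p) \<le> (\<Sum>p\<in>sq N. real (card B) * (\<Sum>b\<in>B. (cmod (z b))^2 * (cmod (F b p))^2)) / real N"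
    unfolding nrm2_sq by (intro divide_right_mono sum_mono) auto
  also have "\<dots> = real (card B) * (\<Sum>b\<in>B. (cmod (z b))^2 * nrm2 N (F b))"
    unfolding nrm2_sq sum_distrib_left[symmetric] sum.swap[of _ B "sq N"]
    by (simp add: sum_distrib_left sum_divide_distrib)
  finally show ?thesis .
qed

lemma nrm2_add_le: "nrm2 N (\<lambda>p. M p + M' p) \<le> 2 * nrm2 N M + 2 * nrm2 N M'"
proof -
  have "(cmod (u + v))^2 \<le> 2 * (cmod u)^2 + 2 * (cmod v)^2" for u v :: complex
  proof -
    have "(cmod (u + v))^2 \<le> (cmod u + cmod v)^2" by (rule power_mono[OF norm_triangle_ineq]) simp
    also have "\<dots> \<le> 2 * (cmod u)^2 + 2 * (cmod v)^2" using sum_squares_bound[of "cmod u" "cmod v"] by (simp add: power2_sum)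
    finally show ?thesis .
  qed
  then have "nrm2 N (\<lambda>p. M p + M' p) \<le> (\<Sum>p\<in>sq N. 2 * (cmod (M p))^2 + 2 * (cmod (M' p))^2) / real N"
    unfolding nrm2_sq by (intro divide_right_mono sum_mono) auto
  then show ?thesis by (simp add: nrm2_sq sum.distrib sum_distrib_left add_divide_distrib)
qed

lemma nrm2_scale: "nrm2 N (\<lambda>p. c * M p) = (cmod c)^2 * nrm2 N M"
  by (simp add: nrm2_sq norm_mult power_mult_distrib sum_distrib_left)

text \<open>\<open>Suc d\<close> in place of d, so that the sum contains T_1 even for d = 0, as the
  moment bounds require.\<close>

lemma nrm2_symeval_le:
  "\<exists>C\<ge>0. \<forall>b\<in>Bd d. \<forall>N\<ge>1. \<forall>A\<in>GLm N. nrm2 N (symeval N b A) \<le> C * VT N (Suc d) A"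
proof -
  have "\<exists>C\<ge>0. \<forall>N\<ge>1. \<forall>A\<in>GLm N. nrm2 N (symeval N b A) \<le> C * VT N (Suc d) A" if b: "b \<in> Bd d" for b
  proof -
    obtain C where C: "C \<ge> 0" "\<And>N A. N \<ge> 1 \<Longrightarrow> A \<in> GLm N \<Longrightarrow> (cmod (pS N (snd b) A))^2 * Tn N A (length (fst b)) \<le> C * Tn N A (tdeg b)"
      using pS_bound[of "snd b" "length (fst b)"] unfolding tdeg_def by blast
    have "nrm2 N (symeval N b A) \<le> C * VT N (Suc d) A" if N: "N \<ge> 1" and A: "A \<in> GLm N" for N A
    proof -
      have "nrm2 N (symeval N b A) = nrm2 N (\<lambda>p. pS N (snd b) A * weval N (fst b) A p)"
        by (rule nrm2_cong) (rule symeval_nth')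
      also have "\<dots> = (cmod (pS N (snd b) A))^2 * nrm2 N (wev N A (em (fst b)))" by (simp add: nrm2_scale wev_em)
      also have "\<dots> \<le> (cmod (pS N (snd b) A))^2 * Tn N A (length (fst b))"
        using nrm2_le_Tn[of N A "em (fst b)"] by (intro mult_left_mono) auto
      also have "\<dots> \<le> C * Tn N A (tdeg b)" by (rule C(2)[OF N A])
      also have "\<dots> \<le> C * VT N (Suc d) A" using C(1) b by (intro mult_left_mono Tn_le_VT) (auto simp: Bd_def)
      finally show ?thesis .
    qed
    then show ?thesis using C(1) by blast
  qed
  then have "\<forall>b. \<exists>C. b \<in> Bd d \<longrightarrow> C \<ge> 0 \<and> (\<forall>N\<ge>1. \<forall>A\<in>GLm N. nrm2 N (symeval N b A) \<le> C * VT N (Suc d) A)" by blast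
  from choice[OF this] obtain C where C: "\<And>b. b \<in> Bd d \<Longrightarrow> C b \<ge> 0"
    "\<And>b N A. b \<in> Bd d \<Longrightarrow> N \<ge> 1 \<Longrightarrow> A \<in> GLm N \<Longrightarrow> nrm2 N (symeval N b A) \<le> C b * VT N (Suc d) A" by blast
  show ?thesis
  proof (intro exI[of _ "\<Sum>b\<in>Bd d. C b"] conjI ballI allI impI)
    show "(\<Sum>b\<in>Bd d. C b) \<ge> 0" by (intro sum_nonneg C(1))
    fix b N A assume b: "b \<in> Bd d" and N: "(1::nat) \<le> N" and A: "A \<in> GLm N"
    have "C b \<le> (\<Sum>b\<in>Bd d. C b)" using b C(1) by (intro member_le_sum) auto
    then show "nrm2 N (symeval N b A) \<le> (\<Sum>b\<in>Bd d. C b) * VT N (Suc d) A"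
      using order_trans[OF C(2)[OF b N A] mult_right_mono] by simp
  qed
qed

lemma hall_error:
  assumes P: "kys P \<subseteq> Bd d"
  shows "\<exists>C\<ge>0. \<forall>N\<ge>1. \<forall>A\<in>GLm N. nrm2 N (\<lambda>p. hallM N t (teval N P) A p - teval N (expDeltaU t P) A p) \<le> C / (real N)^2 * VT N (Suc d) A"
proof -
  from hallM_teval_diff[OF P, of t] obtain C where C0: "C \<ge> 0 \<and> (\<forall>N\<ge>1. \<exists>\<delta>. (\<forall>b\<in>Bd d. cmod (\<delta> b) \<le> C/(real N)^2) \<and>
     (\<forall>A\<in>GLm N. \<forall>i<N. \<forall>j<N. hallM N t (teval N P) A (i,j) - teval N (expDeltaU t P) A (i,j) = (\<Sum>b\<in>Bd d. \<delta> b * symeval N b A (i,j))))"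
    by (rule exE)
  note C = C0[THEN conjunct1] and Cd = C0[THEN conjunct2, rule_format]
  obtain E where E: "E \<ge> 0" "\<And>b N A. b \<in> Bd d \<Longrightarrow> N \<ge> 1 \<Longrightarrow> A \<in> GLm N \<Longrightarrow> nrm2 N (symeval N b A) \<le> E * VT N (Suc d) A"
    using nrm2_symeval_le[of d] by blast
  let ?c = "real (card (Bd d))"
  show ?thesis
  proof (intro exI[of _ "?c * (?c * (C^2 * E))"] conjI allI impI ballI)
    fix N :: nat and A assume N: "N \<ge> 1" and A: "A \<in> GLm N"
    from Cd[OF N] obtain \<delta> where \<delta>0: "(\<forall>b\<in>Bd d. cmod (\<delta> b) \<le> C/(real N)^2) \<and>
     (\<forall>A\<in>GLm N. \<forall>i<N. \<forall>j<N. hallM N t (teval N P) A (i,j) - teval N (expDeltaU t P) A (i,j) = (\<Sum>b\<in>Bd d. \<delta> b * symeval N b A (i,j)))" by (rule exE)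
    note \<delta> = \<delta>0[THEN conjunct1, rule_format] \<delta>0[THEN conjunct2, rule_format, OF A]
    have N1: "(real N)^2 \<ge> 1" using N by simp
    have "nrm2 N (\<lambda>p. hallM N t (teval N P) A p - teval N (expDeltaU t P) A p) = nrm2 N (\<lambda>p. \<Sum>b\<in>Bd d. \<delta> b * symeval N b A p)"
      by (rule nrm2_cong) (rule \<delta>(2))
    also have "\<dots> \<le> ?c * (\<Sum>b\<in>Bd d. (cmod (\<delta> b))^2 * nrm2 N (symeval N b A))" by (rule nrm2_lincomb) simp
    also have "\<dots> \<le> ?c * (\<Sum>b\<in>Bd d. C^2 / (real N)^2 * (E * VT N (Suc d) A))"
    proof (intro mult_left_mono sum_mono mult_mono)
      fix b assume b: "b \<in> Bd d"
      have "(cmod (\<delta> b))^2 \<le> (C / (real N)^2)^2" by (rule power_mono[OF \<delta>(1)[OF b]]) simp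
      also have "\<dots> = C^2 / (real N)^2 / (real N)^2" by (simp add: power_divide power2_eq_square)
      \<comment> \<open>The squared coefficients are even of order 1/N^4; only 1/N^2 is
        kept.\<close>
      also have "\<dots> \<le> C^2 / (real N)^2 / 1" using N1 N by (intro divide_left_mono) auto
      finally show "(cmod (\<delta> b))^2 \<le> C^2 / (real N)^2" by simp
      show "nrm2 N (symeval N b A) \<le> E * VT N (Suc d) A" by (rule E(2)[OF b N A])
    qed auto
    finally show "nrm2 N (\<lambda>p. hallM N t (teval N P) A p - teval N (expDeltaU t P) A p) \<le> ?c * (?c * (C^2 * E)) / (real N)^2 * VT N (Suc d) A"
      by (simp add: mult_ac)
  qed (use C E in simp)
qed

lemma l2dist_nrm2: "l2dist N \<nu> F H = (\<integral>\<^sup>+A. ennreal (nrm2 N (\<lambda>p. F A p - H A p)) \<partial>\<nu>)"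
  by (simp add: l2dist_def nrm2_def)

text \<open>Both expressions have the same coefficients, and a symbol differs from its word by the
  scalar \<open>pS N (snd b) A - 1\<close> alone. No power of N appears yet; it arises on
  integrating \<open>WT\<close>.\<close>

lemma trace_error:
  assumes d: "\<And>k. k \<in> kys P \<Longrightarrow> nat \<bar>k\<bar> \<le> d"
  shows "\<exists>C\<ge>0. \<forall>N\<ge>1. \<forall>A\<in>GLm N. nrm2 N (\<lambda>p. teval N (expDeltaU t (tp P)) A p - leval N (Gt t P) A p) \<le> C * WT N (Suc d) A"
proof -
  let ?E = "lkp (expDeltaU t (tp P))"
  let ?c = "real (card (Bd d))"
  have keys: "kys (expDeltaU t (tp P)) \<subseteq> Bd d"
    using expDeltaU_tp_pure[of P d, OF d] by (auto simp: in_keys_iff pureB_def)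
  have "\<exists>C\<ge>0. \<forall>N\<ge>1. \<forall>A\<in>GLm N. (cmod (?E b * (pS N (snd b) A - 1)))^2 * Tn N A (length (fst b)) \<le> C * WT N (Suc d) A" if b: "b \<in> Bd d" for b
  proof (cases "b \<in> pureB d")
    case True
    then obtain x where x: "\<And>M. M \<in># snd b \<Longrightarrow> set M \<subseteq> {x}" by (auto simp: pureB_def)
    have "length (fst b) + sum_mset (image_mset length (snd b)) \<le> Suc d" using b by (simp add: Bd_def tdeg_def)
    from pS_dev_bound[OF x this] obtain C where C: "C \<ge> 0"
      "\<And>N A. N \<ge> 1 \<Longrightarrow> A \<in> GLm N \<Longrightarrow> (cmod (pS N (snd b) A - 1))^2 * Tn N A (length (fst b)) \<le> C * WT N (Suc d) A" by blast
    show ?thesis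
    proof (intro exI[of _ "(cmod (?E b))^2 * C"] conjI allI impI ballI)
      fix N :: nat and A assume "N \<ge> 1" "A \<in> GLm N"
      from mult_left_mono[OF C(2)[OF this], of "(cmod (?E b))^2"]
      show "(cmod (?E b * (pS N (snd b) A - 1)))^2 * Tn N A (length (fst b)) \<le> (cmod (?E b))^2 * C * WT N (Suc d) A"
        by (simp add: norm_mult power_mult_distrib mult_ac)
    qed (use C in simp)
  next
    case False
    then have "?E b = 0" using expDeltaU_tp_pure[where P = P and d = d and b = b and t = t, OF d] by blast
    then show ?thesis by (intro exI[of _ 0]) simp
  qed
  then have "\<forall>b. \<exists>C. b \<in> Bd d \<longrightarrow> C \<ge> 0 \<and> (\<forall>N\<ge>1. \<forall>A\<in>GLm N. (cmod (?E b * (pS N (snd b) A - 1)))^2 * Tn N A (length (fst b)) \<le> C * WT N (Suc d) A)" by blast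
  from choice[OF this] obtain C where C: "\<And>b. b \<in> Bd d \<Longrightarrow> C b \<ge> 0"
    "\<And>b N A. b \<in> Bd d \<Longrightarrow> N \<ge> 1 \<Longrightarrow> A \<in> GLm N \<Longrightarrow> (cmod (?E b * (pS N (snd b) A - 1)))^2 * Tn N A (length (fst b)) \<le> C b * WT N (Suc d) A" by blast
  show ?thesis
  proof (intro exI[of _ "?c * (\<Sum>b\<in>Bd d. C b)"] conjI allI impI ballI)
    show "?c * (\<Sum>b\<in>Bd d. C b) \<ge> 0" by (intro mult_nonneg_nonneg sum_nonneg C(1)) auto
    fix N :: nat and A assume N: "N \<ge> 1" and A: "A \<in> GLm N"
    have "nrm2 N (\<lambda>p. teval N (expDeltaU t (tp P)) A p - leval N (Gt t P) A p)
      = nrm2 N (\<lambda>p. \<Sum>b\<in>Bd d. (?E b * (pS N (snd b) A - 1)) * weval N (fst b) A p)"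
    proof (rule nrm2_cong)
      fix i j assume ij: "i < N" "j < N"
      have "teval N (expDeltaU t (tp P)) A (i,j) = (\<Sum>b\<in>Bd d. ?E b * symeval N b A (i,j))"
        unfolding teval_lin[OF ij] by (rule lin_superset[OF finite_Bd keys])
      moreover have g: "leval N (Gt t P) A (i,j) = (\<Sum>b\<in>Bd d. ?E b * weval N (fst b) A (i,j))"
        by (rule leval_Gt[OF d ij])
      ultimately show "teval N (expDeltaU t (tp P)) A (i,j) - leval N (Gt t P) A (i,j) = (\<Sum>b\<in>Bd d. (?E b * (pS N (snd b) A - 1)) * weval N (fst b) A (i,j))"
        by (simp only: sum_subtractf[symmetric], intro sum.cong refl) (simp add: symeval_nth'[OF ij] algebra_simps)
    qed
    also have "\<dots> \<le> ?c * (\<Sum>b\<in>Bd d. (cmod (?E b * (pS N (snd b) A - 1)))^2 * nrm2 N (weval N (fst b) A))"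
      by (rule nrm2_lincomb) simp
    also have "\<dots> \<le> ?c * (\<Sum>b\<in>Bd d. C b * WT N (Suc d) A)"
    proof (intro mult_left_mono sum_mono)
      fix b assume b: "b \<in> Bd d"
      have "nrm2 N (weval N (fst b) A) \<le> Tn N A (length (fst b))" using nrm2_le_Tn[of N A "em (fst b)"] by (simp add: wev_em)
      then show "(cmod (?E b * (pS N (snd b) A - 1)))^2 * nrm2 N (weval N (fst b) A) \<le> C b * WT N (Suc d) A"
        using order_trans[OF mult_left_mono C(2)[OF b N A]] by simp
    qed simp
    finally show "nrm2 N (\<lambda>p. teval N (expDeltaU t (tp P)) A p - leval N (Gt t P) A p) \<le> ?c * (\<Sum>b\<in>Bd d. C b) * WT N (Suc d) A"
      by (simp add: sum_distrib_right mult.assoc)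
  qed
qed

theorem theorem4p7:
  fixes t :: real and \<nu> :: "nat \<Rightarrow> cmat measure"
  assumes "t > 0"
    and "\<And>N. N \<ge> 1 \<Longrightarrow> GL_BM_law N t (\<nu> N)"
  shows "(\<forall>P :: lpoly. \<exists>C :: real. \<forall>\<^sub>F N in sequentially.
            l2dist N (\<nu> N) (hallM N t (leval N P)) (leval N (Gt t P))
              \<le> ennreal (C / (real N)^2))
       \<and> (\<forall>P :: tpoly. valid_tpoly P \<longrightarrow> (\<exists>C :: real. \<forall>\<^sub>F N in sequentially.
            l2dist N (\<nu> N) (hallM N t (teval N P)) (teval N (expDeltaU t P))
              \<le> ennreal (C / (real N)^2)))"
proof (intro conjI allI impI)
  fix P :: lpoly
  define d where "d = (\<Sum>k\<in>kys P. nat \<bar>k\<bar>)"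
  have d: "nat \<bar>k\<bar> \<le> d" if "k \<in> kys P" for k unfolding d_def by (rule member_le_sum) (use that in auto)
  from hall_error[where t = t and P = "tp P" and d = d, OF keys_tp[OF d]] obtain C where C0: "C \<ge> 0 \<and> (\<forall>N\<ge>1. \<forall>A\<in>GLm N.
      nrm2 N (\<lambda>p. hallM N t (teval N (tp P)) A p - teval N (expDeltaU t (tp P)) A p) \<le> C / (real N)^2 * VT N (Suc d) A)"
    by (rule exE)
  note C = C0[THEN conjunct1] C0[THEN conjunct2, rule_format]
  from trace_error[where P = P and d = d and t = t, OF d] obtain E where E0: "E \<ge> 0 \<and> (\<forall>N\<ge>1. \<forall>A\<in>GLm N.
      nrm2 N (\<lambda>p. teval N (expDeltaU t (tp P)) A p - leval N (Gt t P) A p) \<le> E * WT N (Suc d) A)"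
    by (rule exE)
  note E = E0[THEN conjunct1] E0[THEN conjunct2, rule_format]
  have "\<exists>K\<ge>0. \<forall>N\<ge>1. \<forall>\<nu> g a b. GL_BM_law N t \<nu> \<longrightarrow> a \<ge> 0 \<longrightarrow> b \<ge> 0 \<longrightarrow>
    (\<forall>A\<in>GLm N. g A \<le> a * VT N (Suc d) A + b * WT N (Suc d) A) \<longrightarrow> (\<integral>\<^sup>+A. ennreal (g A) \<partial>\<nu>) \<le> ennreal (K * (a + b / (real N)^2))"
    by (rule combined_moment[OF assms(1)]) simp
  then obtain K where K0: "K \<ge> 0 \<and> (\<forall>N\<ge>1. \<forall>\<nu> g a b. GL_BM_law N t \<nu> \<longrightarrow> a \<ge> 0 \<longrightarrow> b \<ge> 0 \<longrightarrow>
    (\<forall>A\<in>GLm N. g A \<le> a * VT N (Suc d) A + b * WT N (Suc d) A) \<longrightarrow> (\<integral>\<^sup>+A. ennreal (g A) \<partial>\<nu>) \<le> ennreal (K * (a + b / (real N)^2)))"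
    by (rule exE)
  note K = K0[THEN conjunct2, rule_format]
  show "\<exists>C. \<forall>\<^sub>F N in sequentially. l2dist N (\<nu> N) (hallM N t (leval N P)) (leval N (Gt t P)) \<le> ennreal (C / (real N)^2)"
  proof (intro exI[of _ "K * (2 * C + 2 * E)"] eventually_sequentiallyI[of 1])
    fix N :: nat assume N: "1 \<le> N"
    \<comment> \<open>The two coefficients are 2 C / N^2, from the perturbed exponential, and 2 E,
      from replacing traces by 1; the factors 2 come from splitting the squared norm of a
      sum.\<close>
    have "l2dist N (\<nu> N) (hallM N t (leval N P)) (leval N (Gt t P)) \<le> ennreal (K * (2 * C / (real N)^2 + 2 * E / (real N)^2))"
      unfolding l2dist_nrm2
    proof (rule K[OF N assms(2)[OF N]])
      fix A assume A: "A \<in> GLm N"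
      have "nrm2 N (\<lambda>p. hallM N t (leval N P) A p - leval N (Gt t P) A p)
        = nrm2 N (\<lambda>p. (hallM N t (teval N (tp P)) A p - teval N (expDeltaU t (tp P)) A p) + (teval N (expDeltaU t (tp P)) A p - leval N (Gt t P) A p))"
        by (simp add: leval_tp[of N P])
      also have "\<dots> \<le> 2 * nrm2 N (\<lambda>p. hallM N t (teval N (tp P)) A p - teval N (expDeltaU t (tp P)) A p) + 2 * nrm2 N (\<lambda>p. teval N (expDeltaU t (tp P)) A p - leval N (Gt t P) A p)"
        by (rule nrm2_add_le)
      also have "\<dots> \<le> 2 * (C / (real N)^2 * VT N (Suc d) A) + 2 * (E * WT N (Suc d) A)"
        by (intro add_mono mult_left_mono C(2)[OF N A] E(2)[OF N A]) auto
      finally show "nrm2 N (\<lambda>p. hallM N t (leval N P) A p - leval N (Gt t P) A p) \<le> 2 * C / (real N)^2 * VT N (Suc d) A + 2 * E * WT N (Suc d) A"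
        by simp
    qed (use C E in auto)
    then show "l2dist N (\<nu> N) (hallM N t (leval N P)) (leval N (Gt t P)) \<le> ennreal (K * (2 * C + 2 * E) / (real N)^2)"
      by (simp add: add_divide_distrib[symmetric])
  qed
next
  fix P assume "valid_tpoly P"
  then obtain d where d: "kys P \<subseteq> Bd d" using tpoly_Bd by blast
  from hall_error[where t = t and P = P and d = d, OF d] obtain C where C0: "C \<ge> 0 \<and> (\<forall>N\<ge>1. \<forall>A\<in>GLm N.
      nrm2 N (\<lambda>p. hallM N t (teval N P) A p - teval N (expDeltaU t P) A p) \<le> C / (real N)^2 * VT N (Suc d) A)"
    by (rule exE)
  note C = C0[THEN conjunct1] C0[THEN conjunct2, rule_format]
  have "\<exists>K\<ge>0. \<forall>N\<ge>1. \<forall>\<nu> g a b. GL_BM_law N t \<nu> \<longrightarrow> a \<ge> 0 \<longrightarrow> b \<ge> 0 \<longrightarrow>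
    (\<forall>A\<in>GLm N. g A \<le> a * VT N (Suc d) A + b * WT N (Suc d) A) \<longrightarrow> (\<integral>\<^sup>+A. ennreal (g A) \<partial>\<nu>) \<le> ennreal (K * (a + b / (real N)^2))"
    by (rule combined_moment[OF assms(1)]) simp
  then obtain K where K0: "K \<ge> 0 \<and> (\<forall>N\<ge>1. \<forall>\<nu> g a b. GL_BM_law N t \<nu> \<longrightarrow> a \<ge> 0 \<longrightarrow> b \<ge> 0 \<longrightarrow>
    (\<forall>A\<in>GLm N. g A \<le> a * VT N (Suc d) A + b * WT N (Suc d) A) \<longrightarrow> (\<integral>\<^sup>+A. ennreal (g A) \<partial>\<nu>) \<le> ennreal (K * (a + b / (real N)^2)))"
    by (rule exE)
  note K = K0[THEN conjunct2, rule_format]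
  show "\<exists>C. \<forall>\<^sub>F N in sequentially. l2dist N (\<nu> N) (hallM N t (teval N P)) (teval N (expDeltaU t P)) \<le> ennreal (C / (real N)^2)"
  proof (intro exI[of _ "K * C"] eventually_sequentiallyI[of 1])
    fix N :: nat assume N: "1 \<le> N"
    \<comment> \<open>No trace is replaced by its limit here, so \<open>WT\<close> enters with
      coefficient 0.\<close>
    have "l2dist N (\<nu> N) (hallM N t (teval N P)) (teval N (expDeltaU t P)) \<le> ennreal (K * (C / (real N)^2 + 0 / (real N)^2))"
      unfolding l2dist_nrm2 by (rule K[OF N assms(2)[OF N]]) (use C C(2)[OF N] in auto)
    then show "l2dist N (\<nu> N) (hallM N t (teval N P)) (teval N (expDeltaU t P)) \<le> ennreal (K * C / (real N)^2)" by simp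
  qed
qed

end
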